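(* Let $n\ge 2$, let $\mathbb{S}^n_+$ be the open upper unit hemisphere with pole $p$, and let $\mathcal{C}\subset\mathbb{S}^n_+$ be an open convex cone with vertex at $p$ such that $\partial\mathcal{C}\setminus\{p\}$ is smooth. Let $\Omega$ be an admissible interior domain in $\mathcal{C}$, with $\Gamma_0=\partial\Omega\setminus\partial\mathcal{C}$ and $\Gamma_1=\partial\Omega\setminus\overline{\Gamma_0}$. Let $r(x)=\operatorname{dist}(p,x)$. Suppose there exists $u\in C^2(\overline{\Omega})$ satisfying $$\Delta u=-n\cos r \ \text{ in } \Omega,\qquad u=0,\ \ \frac{\partial u}{\partial\nu}=c \ \text{ on } \Gamma_0,\qquad \frac{\partial u}{\partial\nu}=0 \ \text{ on } \Gamma_1\setminus\{p\},$$ where $c$ is a constant and $\nu$ is the outward unit normal to $\Gamma_0\cup\Gamma_1\setminus\{p\}$. Then $\Omega=\mathcal{C}\cap B_R(p)$, where $B_R(p)$ is the geodesic ball in $\mathbb{S}^n_+$ of radius $R$ centered at the vertex $p$, and $u(x)=\cos r(x)-\cos R$, where $R=\sin^{-1}(-c)$.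
   Context: $\Delta$ denotes the Laplace–Beltrami operator. The space $\mathbb{S}^n_+$ is written as the warped product $[0,\pi/2)\times\mathbb{S}^{n-1}$ with metric $g=dr^2+\sin^2 r\, g_{\mathbb{S}^{n-1}}$, where $r$ is the geodesic distance from the pole $p$. For a domain $\omega\subset\mathbb{S}^{n-1}$, the cone with vertex $p$ is $\mathcal{C}=\{tx: x\in\omega,\ t\in I\}$ (in polar coordinates $(t,x)$ about $p$, with $I=[0,\pi/2)$); it is called convex when $\omega$ is convex in $\mathbb{S}^{n-1}$ (a $C^2$ domain is convex if the normal curvature of its boundary with respect to the inward normal is nonnegative). A connected bounded open set $\Omega\subset\mathcal{C}$ is an admissible interior domain if: $p\in\partial\Omega$; $\Gamma_0:=\partial\Omega\setminus\partial\mathcal{C}\neq\emptyset$ is an $(n-1)$-dimensional smooth manifold; $\Gamma_1:=\partial\Omega\setminus\overline{\Gamma_0}\neq\emptyset$ and $\partial\Gamma_0=\partial\Gamma_1\subset\partial\mathcal{C}\setminus\{p\}$ is an $(n-2)$-dimensional smooth manifold; and $\mathcal{H}^{n-1}(\Gamma_i)>0$ for $i=0,1$, where $\mathcal{H}^{n-1}$ is $(n-1)$-dimensional Hausdorff measure. *)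

theory Defs
  imports "HOL-Analysis.Analysis"
begin

text \<open>Ambient model: the unit sphere S^n in a Euclidean space 'a of dimension n+1.
  The pole p is a unit vector; the open upper hemisphere is {x. |x|=1, x.p > 0}.\<close>

fun Ck :: "nat \<Rightarrow> ('a::euclidean_space \<Rightarrow> 'b::euclidean_space) \<Rightarrow> 'a set \<Rightarrow> bool" where
  "Ck 0 f U = continuous_on U f"
| "Ck (Suc k) f U = (f differentiable_on U \<and>
      (\<forall>v. Ck k (\<lambda>x. frechet_derivative f (at x) v) U))"

definition smooth_on :: "('a::euclidean_space \<Rightarrow> 'b::euclidean_space) \<Rightarrow> 'a set \<Rightarrow> bool" where
  "smooth_on f U \<longleftrightarrow> (\<forall>k. Ck k f U)"

definition smooth_submanifold :: "nat \<Rightarrow> 'a::euclidean_space set \<Rightarrow> bool" where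
  "smooth_submanifold k M \<longleftrightarrow>
     (\<forall>x\<in>M. \<exists>U V (\<phi>::'a \<Rightarrow> 'a) (\<psi>::'a \<Rightarrow> 'a) L.
        open U \<and> x \<in> U \<and> open V \<and> \<phi> ` U = V \<and> \<psi> ` V = U \<and>
        (\<forall>y\<in>U. \<psi> (\<phi> y) = y) \<and> (\<forall>z\<in>V. \<phi> (\<psi> z) = z) \<and>
        smooth_on \<phi> U \<and> smooth_on \<psi> V \<and>
        subspace L \<and> dim L = k \<and> \<phi> ` (M \<inter> U) = V \<inter> L)"

section \<open>Hausdorff measure (up to the normalising constant, irrelevant for positivity)\<close>

definition hausdorff_content :: "real \<Rightarrow> real \<Rightarrow> 'a::metric_space set \<Rightarrow> ennreal" where
  "hausdorff_content s \<delta> A =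
     (INF U \<in> {U :: nat \<Rightarrow> 'a set. A \<subseteq> (\<Union>i. U i) \<and> (\<forall>i. bounded (U i) \<and> diameter (U i) \<le> \<delta>)}.
        (\<Sum>i. ennreal (diameter (U i) powr s)))"

definition hausdorff_measure :: "real \<Rightarrow> 'a::metric_space set \<Rightarrow> ennreal" where
  "hausdorff_measure s A = (SUP \<delta> \<in> {0<..}. hausdorff_content s \<delta> A)"

definition hemi :: "'a::euclidean_space \<Rightarrow> 'a set" where
  "hemi p = {x. norm x = 1 \<and> x \<bullet> p > 0}"

definition equator :: "'a::euclidean_space \<Rightarrow> 'a set" where
  "equator p = {y. norm y = 1 \<and> y \<bullet> p = 0}"

definition geod :: "'a::euclidean_space \<Rightarrow> 'a \<Rightarrow> real \<Rightarrow> 'a" where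
  "geod x e t = cos t *\<^sub>R x + sin t *\<^sub>R e"

definition gdist :: "'a::euclidean_space \<Rightarrow> 'a \<Rightarrow> real" where
  "gdist p x = arccos (p \<bullet> x)"

definition geoball :: "'a::euclidean_space \<Rightarrow> real \<Rightarrow> 'a set" where
  "geoball p R = {x \<in> hemi p. gdist p x < R}"

text \<open>Cone with vertex p over omega (a subset of the equator sphere S^{n-1}); open cone, vertex excluded.\<close>
definition cone_over :: "'a::euclidean_space \<Rightarrow> 'a set \<Rightarrow> 'a set" where
  "cone_over p \<omega> = {geod p y t | y t. y \<in> \<omega> \<and> 0 < t \<and> t < pi / 2}"

text \<open>Boundary of a relatively open subset of a closed set (sphere, hemisphere closure, ...).\<close>
definition rbdry :: "'a::euclidean_space set \<Rightarrow> 'a set" where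
  "rbdry A = closure A - A"

definition cone_bdry :: "'a::euclidean_space \<Rightarrow> 'a set \<Rightarrow> 'a set" where
  "cone_bdry p C = (closure C \<inter> hemi p) - C"

definition tangent_vecs :: "'a::euclidean_space set \<Rightarrow> 'a \<Rightarrow> 'a set" where
  "tangent_vecs M x = {v. \<exists>\<gamma> \<epsilon>. \<epsilon> > 0 \<and> \<gamma> 0 = x \<and> (\<forall>t\<in>{-\<epsilon><..<\<epsilon>}. \<gamma> t \<in> M) \<and>
                             (\<gamma> has_vector_derivative v) (at 0)}"

definition outward_normal :: "'a::euclidean_space set \<Rightarrow> 'a \<Rightarrow> 'a \<Rightarrow> bool" where
  "outward_normal \<Omega> x \<nu> \<longleftrightarrow> norm \<nu> = 1 \<and> \<nu> \<bullet> x = 0 \<and>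
     (\<forall>v\<in>tangent_vecs (rbdry \<Omega>) x. \<nu> \<bullet> v = 0) \<and>
     (\<exists>\<epsilon>>0. \<forall>t\<in>{0<..<\<epsilon>}. geod x \<nu> (-t) \<in> \<Omega> \<and> geod x \<nu> t \<notin> closure \<Omega>)"

definition inward_normal_eq :: "'a::euclidean_space \<Rightarrow> 'a set \<Rightarrow> 'a \<Rightarrow> 'a \<Rightarrow> bool" where
  "inward_normal_eq p \<omega> x N \<longleftrightarrow> norm N = 1 \<and> N \<bullet> x = 0 \<and> N \<bullet> p = 0 \<and>
     (\<forall>v\<in>tangent_vecs (rbdry \<omega>) x. N \<bullet> v = 0) \<and>
     (\<exists>\<epsilon>>0. \<forall>t\<in>{0<..<\<epsilon>}. geod x N t \<in> \<omega>)"

text \<open>Convexity of a (C^2) domain omega in S^{n-1}: the normal curvature of its boundary with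
  respect to the inward normal is nonnegative, i.e. every C^2 curve in the boundary through x
  has acceleration with nonnegative component along the inward normal.\<close>
definition sph_convex :: "'a::euclidean_space \<Rightarrow> 'a set \<Rightarrow> bool" where
  "sph_convex p \<omega> \<longleftrightarrow>
     (\<forall>x\<in>rbdry \<omega>. \<forall>N. inward_normal_eq p \<omega> x N \<longrightarrow>
        (\<forall>(\<gamma>::real \<Rightarrow> 'a) \<epsilon>. \<epsilon> > 0 \<and> \<gamma> 0 = x \<and> (\<forall>t\<in>{-\<epsilon><..<\<epsilon>}. \<gamma> t \<in> rbdry \<omega>) \<and>
             Ck 2 \<gamma> {-\<epsilon><..<\<epsilon>} \<longrightarrow>
           vector_derivative (\<lambda>s. vector_derivative \<gamma> (at s)) (at 0) \<bullet> N \<ge> 0))"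

definition sphere_tangent_onb :: "'a::euclidean_space \<Rightarrow> 'a set \<Rightarrow> bool" where
  "sphere_tangent_onb x B \<longleftrightarrow> finite B \<and> card B = DIM('a) - 1 \<and>
     (\<forall>e\<in>B. norm e = 1 \<and> e \<bullet> x = 0) \<and> pairwise orthogonal B"

text \<open>Laplace-Beltrami operator on the unit sphere: sum of second derivatives along the
  great circles in the directions of an orthonormal tangent frame.\<close>
definition laplace_beltrami :: "('a::euclidean_space \<Rightarrow> real) \<Rightarrow> 'a \<Rightarrow> real" where
  "laplace_beltrami u x =
     (\<Sum>e\<in>(SOME B. sphere_tangent_onb x B). deriv (deriv (\<lambda>t. u (geod x e t))) 0)"

definition Gamma0 :: "'a::euclidean_space \<Rightarrow> 'a set \<Rightarrow> 'a set \<Rightarrow> 'a set" where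
  "Gamma0 p C \<Omega> = rbdry \<Omega> - cone_bdry p C"

definition Gamma1 :: "'a::euclidean_space \<Rightarrow> 'a set \<Rightarrow> 'a set \<Rightarrow> 'a set" where
  "Gamma1 p C \<Omega> = rbdry \<Omega> - closure (Gamma0 p C \<Omega>)"

definition admissible :: "'a::euclidean_space \<Rightarrow> 'a set \<Rightarrow> 'a set \<Rightarrow> bool" where
  "admissible p C \<Omega> \<longleftrightarrow>
     openin (top_of_set (sphere 0 1)) \<Omega> \<and> connected \<Omega> \<and> \<Omega> \<noteq> {} \<and> \<Omega> \<subseteq> C \<and>
     closure \<Omega> \<subseteq> hemi p \<and>
     p \<in> rbdry \<Omega> \<and>
     Gamma0 p C \<Omega> \<noteq> {} \<and> smooth_submanifold (DIM('a) - 2) (Gamma0 p C \<Omega>) \<and>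
     Gamma1 p C \<Omega> \<noteq> {} \<and>
     rbdry (Gamma0 p C \<Omega>) = rbdry (Gamma1 p C \<Omega>) \<and>
     rbdry (Gamma0 p C \<Omega>) \<subseteq> cone_bdry p C - {p} \<and>
     smooth_submanifold (DIM('a) - 3) (rbdry (Gamma0 p C \<Omega>)) \<and>
     hausdorff_measure (real (DIM('a) - 2)) (Gamma0 p C \<Omega>) > 0 \<and>
     hausdorff_measure (real (DIM('a) - 2)) (Gamma1 p C \<Omega>) > 0"

end

theory Submission
  imports Defs
begin

text \<open>Let \<open>V = cos r\<close> and let \<open>n = DIM('a) - 1\<close>. Extended homogeneously of degree zero to a cone in the
  ambient space, \<open>w = u - V\<close> is harmonic. The function \<open>F = (|x|^2 |\<nabla>u|^2 + 2 u V - u^2 - c^2) / 2\<close>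
  vanishes together with \<open>u\<close> on the free boundary \<open>\<Gamma>0\<close>, and the field
  \<open>Y = u (|x|^2 \<nabla>^2w \<nabla>w + |\<nabla>w|^2 x) - F \<nabla>w\<close> is tangent to the spheres about the origin and has
  divergence \<open>u (|x|^2 |\<nabla>^2w|^2 + (n - 2) |\<nabla>w|^2) \<ge> 0\<close>. The flux of \<open>Y\<close> through \<open>\<Gamma>0\<close> is zero, and
  through the lateral boundary the Neumann condition and convexity give it a sign. Hence the divergence
  vanishes, so \<open>\<nabla>w = 0\<close> and \<open>u = cos r - const\<close>. Positivity of \<open>u\<close> follows from the same flux
  inequality applied to \<open>-\<nabla>u\<close>.

  No regularity of the domain is available where \<open>\<Gamma>0\<close> meets the cone or at the vertex. The former set is
  cut away by a step function of \<open>(u^2 + F^2) / \<delta>\<close>, whose gradient paired with \<open>Y\<close> stays bounded as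
  \<open>\<delta> \<longlongrightarrow> 0\<close>; the line over the vertex has codimension at least two and zero capacity.\<close>

section \<open>Functions of class C1 and C2\<close>

text \<open>The choice of \<open>F\<close> is dictated by the model. If \<open>u = V - a\<close> and
  \<open>c^2 = 1 - a^2\<close>, then \<open>|x|^2 |\<nabla>u|^2 = 1 - V^2\<close> and
  \<open>2 u V - u^2 = V^2 - a^2\<close>, so \<open>F\<close> vanishes identically. In general its
  tangential gradient is that of \<open>|x|^2 \<nabla>^2w \<nabla>u - u \<nabla>w\<close>, which
  involves only derivatives of \<open>w\<close>. The proof is shaped by missing regularity. Since
  \<open>u\<close> is only C2, \<open>Y\<close> is merely continuous and its divergence exists only
  weakly: difference quotients of a divergence-free gradient field replace the third derivatives of
  a Bochner formula. No surface measure is used either. A boundary flux is the volume integral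
  \<open>J\<close> of a test function against the weak divergence, and its sign comes from cut-offs
  in thin strips along the boundary, combined by a partition of unity. Lifting to the ambient space
  trades the sphere for Lebesgue measure and the Laplace-Beltrami operator for the trace of a
  Hessian. The price is an unbounded conical domain; a radial cut-off repairs this at no cost,
  because its gradient is orthogonal to \<open>Y\<close>.\<close>

definition C1 :: "('a::real_normed_vector \<Rightarrow> 'b::real_normed_vector) \<Rightarrow> 'a set \<Rightarrow> bool" where
  "C1 f W \<longleftrightarrow> (\<exists>f'. (\<forall>x\<in>W. (f has_derivative blinfun_apply (f' x)) (at x)) \<and> continuous_on W f')"

text \<open>Derivatives take values in bounded linear maps, so second order regularity is C1 of the
  derivative, and the product and chain rules reduce to the bilinear case. The predicate
  \<open>Ck\<close> of the hypotheses speaks of directional derivatives; \<open>Ck_2_imp_C2\<close>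
  and \<open>C2_imp_Ck_2\<close> translate.\<close>

definition C2 :: "('a::real_normed_vector \<Rightarrow> 'b::real_normed_vector) \<Rightarrow> 'a set \<Rightarrow> bool" where
  "C2 f W \<longleftrightarrow> (\<exists>f'. (\<forall>x\<in>W. (f has_derivative blinfun_apply (f' x)) (at x)) \<and> C1 f' W)"

lemma C1I: "(\<And>x. x \<in> W \<Longrightarrow> (f has_derivative blinfun_apply (f' x)) (at x)) \<Longrightarrow> continuous_on W f' \<Longrightarrow> C1 f W"
  unfolding C1_def by (rule exI[of _ f']) simp

lemma C1E:
  assumes "C1 f W"
  obtains f' where "\<And>x. x \<in> W \<Longrightarrow> (f has_derivative blinfun_apply (f' x)) (at x)" "continuous_on W f'"
  using assms unfolding C1_def by blast

lemma C2I: "(\<And>x. x \<in> W \<Longrightarrow> (f has_derivative blinfun_apply (f' x)) (at x)) \<Longrightarrow> C1 f' W \<Longrightarrow> C2 f W"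
  unfolding C2_def by (rule exI[of _ f']) simp

lemma C2E:
  assumes "C2 f W"
  obtains f' where "\<And>x. x \<in> W \<Longrightarrow> (f has_derivative blinfun_apply (f' x)) (at x)" "C1 f' W"
  using assms unfolding C2_def by blast

lemma C1_continuous_on:
  assumes "C1 f W" shows "continuous_on W f"
proof -
  from assms obtain f' where f': "\<And>x. x \<in> W \<Longrightarrow> (f has_derivative blinfun_apply (f' x)) (at x)"
    by (rule C1E) blast
  then show ?thesis
    by (intro continuous_at_imp_continuous_on ballI) (rule has_derivative_continuous[OF f'])
qed

lemma C2_imp_C1:
  assumes "C2 f W" shows "C1 f W"
proof -
  from assms obtain f' where "\<And>x. x \<in> W \<Longrightarrow> (f has_derivative blinfun_apply (f' x)) (at x)" "C1 f' W"
    by (rule C2E) blast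
  then show ?thesis by (intro C1I[of W f f'] C1_continuous_on[of f' W])
qed

lemma C2_continuous_on: "C2 f W \<Longrightarrow> continuous_on W f"
  by (simp add: C1_continuous_on C2_imp_C1)

lemma C1_subset: "C1 f W \<Longrightarrow> V \<subseteq> W \<Longrightarrow> C1 f V"
  unfolding C1_def using continuous_on_subset by blast

lemma C2_subset: "C2 f W \<Longrightarrow> V \<subseteq> W \<Longrightarrow> C2 f V"
  unfolding C2_def using C1_subset by blast

lemma C1_const [simp]: "C1 (\<lambda>x. c) W"
  by (rule C1I[where f'="\<lambda>x. 0"]) (auto simp: zero_blinfun.rep_eq)

lemma C2_const [simp]: "C2 (\<lambda>x. c) W"
  by (rule C2I[where f'="\<lambda>x. 0"]) (auto simp: zero_blinfun.rep_eq)

lemma C1_linear: "bounded_linear f \<Longrightarrow> C1 f W"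
  by (rule C1I[where f'="\<lambda>x. Blinfun f"])
     (auto simp: bounded_linear_Blinfun_apply bounded_linear_imp_has_derivative)

lemma C2_linear: "bounded_linear f \<Longrightarrow> C2 f W"
  by (rule C2I[where f'="\<lambda>x. Blinfun f"])
     (auto simp: bounded_linear_Blinfun_apply bounded_linear_imp_has_derivative)

lemma C1_compose:
  assumes g: "C1 g V" and f: "C1 f W" and sub: "f ` W \<subseteq> V"
  shows "C1 (\<lambda>x. g (f x)) W"
proof -
  from g obtain g' where g': "\<And>x. x \<in> V \<Longrightarrow> (g has_derivative blinfun_apply (g' x)) (at x)" "continuous_on V g'"
    by (rule C1E) blast
  from f obtain f' where f': "\<And>x. x \<in> W \<Longrightarrow> (f has_derivative blinfun_apply (f' x)) (at x)" "continuous_on W f'"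
    by (rule C1E) blast
  show ?thesis
  proof (rule C1I[where f'="\<lambda>x. g' (f x) o\<^sub>L f' x"])
    fix x assume x: "x \<in> W"
    have "((g \<circ> f) has_derivative (blinfun_apply (g' (f x)) \<circ> blinfun_apply (f' x))) (at x)"
      using x sub by (intro diff_chain_at f' g') auto
    then show "((\<lambda>x. g (f x)) has_derivative blinfun_apply (g' (f x) o\<^sub>L f' x)) (at x)"
      by (simp add: o_def blinfun_compose.rep_eq)
  next
    show "continuous_on W (\<lambda>x. g' (f x) o\<^sub>L f' x)"
      using sub by (intro bounded_bilinear.continuous_on[OF bounded_bilinear_blinfun_compose]
          continuous_on_compose2[OF g'(2)] f' C1_continuous_on[OF f])
  qed
qed

lemma C1_bilinear:
  assumes b: "bounded_bilinear b" and f: "C1 f W" and g: "C1 g W"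
  shows "C1 (\<lambda>x. b (f x) (g x)) W"
proof -
  interpret bounded_bilinear b by fact
  from g obtain g' where g': "\<And>x. x \<in> W \<Longrightarrow> (g has_derivative blinfun_apply (g' x)) (at x)" "continuous_on W g'"
    by (rule C1E) blast
  from f obtain f' where f': "\<And>x. x \<in> W \<Longrightarrow> (f has_derivative blinfun_apply (f' x)) (at x)" "continuous_on W f'"
    by (rule C1E) blast
  show ?thesis
  proof (rule C1I[where f'="\<lambda>x. (prod_right (f x) o\<^sub>L g' x) + (prod_left (g x) o\<^sub>L f' x)"])
    fix x assume x: "x \<in> W"
    show "((\<lambda>x. b (f x) (g x)) has_derivative blinfun_apply ((prod_right (f x) o\<^sub>L g' x) + (prod_left (g x) o\<^sub>L f' x))) (at x)"
      using FDERIV[OF f'(1)[OF x] g'(1)[OF x]]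
      by (simp add: plus_blinfun.rep_eq blinfun_compose.rep_eq prod_right.rep_eq prod_left.rep_eq o_def)
  next
    show "continuous_on W (\<lambda>x. (prod_right (f x) o\<^sub>L g' x) + (prod_left (g x) o\<^sub>L f' x))"
      by (intro continuous_on_add bounded_bilinear.continuous_on[OF bounded_bilinear_blinfun_compose]
          bounded_linear.continuous_on[OF bounded_linear_prod_right]
          bounded_linear.continuous_on[OF bounded_linear_prod_left] f' g' C1_continuous_on[OF f] C1_continuous_on[OF g])
  qed
qed

lemma C1_linear_compose: "bounded_linear l \<Longrightarrow> C1 f W \<Longrightarrow> C1 (\<lambda>x. l (f x)) W"
  using C1_compose[OF C1_linear, of l f W UNIV] by simp

lemma C1_add:
  assumes f: "C1 f W" and g: "C1 g W"
  shows "C1 (\<lambda>x. f x + g x) W"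
proof -
  from g obtain g' where g': "\<And>x. x \<in> W \<Longrightarrow> (g has_derivative blinfun_apply (g' x)) (at x)" "continuous_on W g'"
    by (rule C1E) blast
  from f obtain f' where f': "\<And>x. x \<in> W \<Longrightarrow> (f has_derivative blinfun_apply (f' x)) (at x)" "continuous_on W f'"
    by (rule C1E) blast
  show ?thesis
    by (rule C1I[where f'="\<lambda>x. f' x + g' x"])
      (auto simp: plus_blinfun.rep_eq intro!: has_derivative_add f' g' continuous_on_add)
qed

lemma C2_linear_compose:
  assumes l: "bounded_linear l" and f: "C2 f W" shows "C2 (\<lambda>x. l (f x)) W"
proof -
  from f obtain f' where f': "\<And>x. x \<in> W \<Longrightarrow> (f has_derivative blinfun_apply (f' x)) (at x)" "C1 f' W"
    by (rule C2E) blast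
  show ?thesis
  proof (rule C2I[where f'="\<lambda>x. Blinfun l o\<^sub>L f' x"])
    fix x assume x: "x \<in> W"
    show "((\<lambda>x. l (f x)) has_derivative blinfun_apply (Blinfun l o\<^sub>L f' x)) (at x)"
      using bounded_linear.has_derivative[OF l f'(1)[OF x]] l
      by (simp add: blinfun_compose.rep_eq bounded_linear_Blinfun_apply o_def)
  qed (intro C1_bilinear[OF bounded_bilinear_blinfun_compose] f' C1_const)
qed

lemma C2_compose:
  assumes g: "C2 g V" and f: "C2 f W" and sub: "f ` W \<subseteq> V"
  shows "C2 (\<lambda>x. g (f x)) W"
proof -
  from g obtain g' where g': "\<And>x. x \<in> V \<Longrightarrow> (g has_derivative blinfun_apply (g' x)) (at x)" "C1 g' V"
    by (rule C2E) blast
  from f obtain f' where f': "\<And>x. x \<in> W \<Longrightarrow> (f has_derivative blinfun_apply (f' x)) (at x)" "C1 f' W"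
    by (rule C2E) blast
  show ?thesis
  proof (rule C2I[where f'="\<lambda>x. g' (f x) o\<^sub>L f' x"])
    fix x assume x: "x \<in> W"
    have "((g \<circ> f) has_derivative (blinfun_apply (g' (f x)) \<circ> blinfun_apply (f' x))) (at x)"
      using x sub by (intro diff_chain_at f' g') auto
    then show "((\<lambda>x. g (f x)) has_derivative blinfun_apply (g' (f x) o\<^sub>L f' x)) (at x)"
      by (simp add: o_def blinfun_compose.rep_eq)
  next
    show "C1 (\<lambda>x. g' (f x) o\<^sub>L f' x) W"
      by (intro C1_bilinear[OF bounded_bilinear_blinfun_compose] f' C1_compose[OF g'(2) _ sub] C2_imp_C1[OF f])
  qed
qed

lemma C2_add:
  assumes f: "C2 f W" and g: "C2 g W"
  shows "C2 (\<lambda>x. f x + g x) W"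
proof -
  from g obtain g' where g': "\<And>x. x \<in> W \<Longrightarrow> (g has_derivative blinfun_apply (g' x)) (at x)" "C1 g' W"
    by (rule C2E) blast
  from f obtain f' where f': "\<And>x. x \<in> W \<Longrightarrow> (f has_derivative blinfun_apply (f' x)) (at x)" "C1 f' W"
    by (rule C2E) blast
  show ?thesis
    by (rule C2I[where f'="\<lambda>x. f' x + g' x"])
      (auto simp: plus_blinfun.rep_eq intro!: has_derivative_add f' g' C1_add)
qed

lemma C2_bilinear:
  assumes b: "bounded_bilinear b" and f: "C2 f W" and g: "C2 g W"
  shows "C2 (\<lambda>x. b (f x) (g x)) W"
proof -
  interpret bounded_bilinear b by fact
  from g obtain g' where g': "\<And>x. x \<in> W \<Longrightarrow> (g has_derivative blinfun_apply (g' x)) (at x)" "C1 g' W"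
    by (rule C2E) blast
  from f obtain f' where f': "\<And>x. x \<in> W \<Longrightarrow> (f has_derivative blinfun_apply (f' x)) (at x)" "C1 f' W"
    by (rule C2E) blast
  show ?thesis
  proof (rule C2I[where f'="\<lambda>x. (prod_right (f x) o\<^sub>L g' x) + (prod_left (g x) o\<^sub>L f' x)"])
    fix x assume x: "x \<in> W"
    show "((\<lambda>x. b (f x) (g x)) has_derivative blinfun_apply ((prod_right (f x) o\<^sub>L g' x) + (prod_left (g x) o\<^sub>L f' x))) (at x)"
      using FDERIV[OF f'(1)[OF x] g'(1)[OF x]]
      by (simp add: plus_blinfun.rep_eq blinfun_compose.rep_eq prod_right.rep_eq prod_left.rep_eq o_def)
  next
    show "C1 (\<lambda>x. (prod_right (f x) o\<^sub>L g' x) + (prod_left (g x) o\<^sub>L f' x)) W"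
      by (intro C1_add C1_bilinear[OF bounded_bilinear_blinfun_compose]
          C1_linear_compose[OF bounded_linear_prod_right]
          C1_linear_compose[OF bounded_linear_prod_left] f' g' C2_imp_C1[OF f] C2_imp_C1[OF g])
  qed
qed

lemma C2_cong:
  assumes "C2 f W" "open W" "\<And>x. x \<in> W \<Longrightarrow> f x = g x" shows "C2 g W"
proof -
  from assms(1) obtain f' where "\<And>x. x \<in> W \<Longrightarrow> (f has_derivative blinfun_apply (f' x)) (at x)" "C1 f' W"
    by (rule C2E) blast
  then show ?thesis
    using assms(2,3) by (intro C2I[of W g f']) (auto intro: has_derivative_transform_within_open)
qed

lemma C1_real:
  fixes f :: "real \<Rightarrow> real"
  assumes "\<And>x. x \<in> W \<Longrightarrow> (f has_real_derivative f' x) (at x)" "continuous_on W f'"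
  shows "C1 f W"
proof (rule C1I[where f'="\<lambda>x. blinfun_scaleR_left (f' x)"])
  fix x assume "x \<in> W"
  then have "(f has_derivative (\<lambda>h. h *\<^sub>R f' x)) (at x)"
    using assms(1)[of x] by (simp add: has_field_derivative_def mult_commute_abs)
  then show "(f has_derivative blinfun_apply (blinfun_scaleR_left (f' x))) (at x)"
    by simp
qed (intro bounded_linear.continuous_on[OF bounded_linear_blinfun_scaleR_left] assms)

lemma C2_real:
  fixes f :: "real \<Rightarrow> real"
  assumes "\<And>x. x \<in> W \<Longrightarrow> (f has_real_derivative f' x) (at x)"
    and "\<And>x. x \<in> W \<Longrightarrow> (f' has_real_derivative f'' x) (at x)" "continuous_on W f''"
  shows "C2 f W"
proof (rule C2I[where f'="\<lambda>x. blinfun_scaleR_left (f' x)"])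
  fix x assume "x \<in> W"
  then have "(f has_derivative (\<lambda>h. h *\<^sub>R f' x)) (at x)"
    using assms(1)[of x] by (simp add: has_field_derivative_def mult_commute_abs)
  then show "(f has_derivative blinfun_apply (blinfun_scaleR_left (f' x))) (at x)"
    by simp
qed (intro C1_linear_compose[OF bounded_linear_blinfun_scaleR_left] C1_real[OF assms(2,3)])

lemma C2_inner: "C2 f W \<Longrightarrow> C2 g W \<Longrightarrow> C2 (\<lambda>x. f x \<bullet> g x) W"
  by (rule C2_bilinear[OF bounded_bilinear_inner])

lemma C2_scaleR: "C2 f W \<Longrightarrow> C2 g W \<Longrightarrow> C2 (\<lambda>x. f x *\<^sub>R g x) W"
  by (rule C2_bilinear[OF bounded_bilinear_scaleR])

lemma C2_ident: "C2 (\<lambda>x. x) W"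
  by (rule C2_linear[OF bounded_linear_ident])

text \<open>Through \<open>(x \<bullet> x) powr (-1/2)\<close> only a power on the positive reals
  has to be differentiated by hand.\<close>

lemma C2_inverse_norm:
  "C2 (\<lambda>x::'a::real_inner. inverse (norm x)) (- {0})"
proof -
  have 1: "C2 (\<lambda>t::real. t powr (-1/2)) {0<..}"
    by (rule C2_real[where f'="\<lambda>t. (-1/2) * t powr (-3/2)" and f''="\<lambda>t. (3/4) * t powr (-5/2)"])
      (auto intro!: derivative_eq_intros continuous_intros)
  have 2: "C2 (\<lambda>x::'a. x \<bullet> x) (-{0})"
    by (intro C2_inner C2_ident)
  have "C2 (\<lambda>x::'a. (x \<bullet> x) powr (-1/2)) (- {0})"
    by (rule C2_compose[OF 1 2]) auto
  moreover have "(x \<bullet> x) powr (-1/2) = inverse (norm x)" if "x \<in> -{0}" for x :: 'a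
  proof -
    have "x \<bullet> x > 0" using that by simp
    then have "(x \<bullet> x) powr (-1/2) = inverse (sqrt (x \<bullet> x))"
      by (simp add: powr_minus powr_half_sqrt)
    then show ?thesis by (simp add: norm_eq_sqrt_inner)
  qed
  ultimately show ?thesis
    using C2_cong[of "\<lambda>x::'a. (x \<bullet> x) powr (-1/2)" "- {0}" "\<lambda>x. inverse (norm x)"] by (simp add: open_Compl)
qed

lemma C2_sgn: "C2 (sgn :: 'a::real_inner \<Rightarrow> 'a) (- {0})"
  unfolding sgn_div_norm[abs_def] by (intro C2_scaleR C2_inverse_norm C2_ident)

text \<open>Both iterated derivatives are limits of the same second difference quotient, whence their symmetry.\<close>

lemma second_difference_quotient:
  fixes f :: "'a::real_normed_vector \<Rightarrow> real"
  assumes f': "\<And>x. x \<in> W \<Longrightarrow> (f has_derivative blinfun_apply (f' x)) (at x)"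
    and f'': "\<And>x. x \<in> W \<Longrightarrow> (f' has_derivative blinfun_apply (f'' x)) (at x)"
    and W: "convex W" "x \<in> W" "x + h \<in> W" "x + k \<in> W" "x + h + k \<in> W"
  shows "\<exists>s\<in>{0..1}. \<exists>t\<in>{0..1}. f (x + h + k) - f (x + h) - f (x + k) + f x
      = blinfun_apply (blinfun_apply (f'' (x + s *\<^sub>R h + t *\<^sub>R k)) k) h"
proof -
  have inW: "x + s *\<^sub>R h + t *\<^sub>R k \<in> W" if "s \<in> {0..1}" "t \<in> {0..1}" for s t
  proof -
    have a: "x + s *\<^sub>R h \<in> W" using convexD[OF W(1) W(2) W(3), of "1-s" s] that
      by (simp add: algebra_simps)
    have b: "x + k + s *\<^sub>R h \<in> W" using convexD[OF W(1) W(4) W(5), of "1-s" s] that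
      by (simp add: algebra_simps)
    show ?thesis using convexD[OF W(1) a b, of "1-t" t] that
      by (simp add: algebra_simps)
  qed
  \<comment> \<open>Two mean value theorems: \<open>F\<close> moves in direction \<open>h\<close>
    with the shift by \<open>k\<close> built in, then \<open>K\<close> moves in direction
    \<open>k\<close>. The order decides which mixed derivative appears.\<close>
  define F where "F = (\<lambda>s. f (x + s *\<^sub>R h + k) - f (x + s *\<^sub>R h))"
  have F: "(F has_real_derivative (f' (x + s *\<^sub>R h + k) h - f' (x + s *\<^sub>R h) h)) (at s)"
    if "s \<in> {0..1}" for s
  proof -
    have 1: "((\<lambda>s. f (x + s *\<^sub>R h + k)) has_derivative (\<lambda>r. f' (x + s *\<^sub>R h + k) (r *\<^sub>R h))) (at s)"
      by (rule has_derivative_compose[OF _ f'])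
        (use inW[of s 1] that in \<open>auto intro!: derivative_eq_intros\<close>)
    have 2: "((\<lambda>s. f (x + s *\<^sub>R h)) has_derivative (\<lambda>r. f' (x + s *\<^sub>R h) (r *\<^sub>R h))) (at s)"
      by (rule has_derivative_compose[OF _ f'])
        (use inW[of s 0] that in \<open>auto intro!: derivative_eq_intros\<close>)
    show ?thesis
      unfolding F_def
      by (rule has_derivative_imp_has_field_derivative[OF has_derivative_diff[OF 1 2]])
        (simp add: blinfun.scaleR_right algebra_simps)
  qed
  obtain s where s: "0 < s" "s < 1" "F 1 - F 0 = f' (x + s *\<^sub>R h + k) h - f' (x + s *\<^sub>R h) h"
    using MVT2[of 0 1 F "\<lambda>s. f' (x + s *\<^sub>R h + k) h - f' (x + s *\<^sub>R h) h"] F by auto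
  define K where "K = (\<lambda>t. f' (x + s *\<^sub>R h + t *\<^sub>R k) h)"
  have K: "(K has_real_derivative (f'' (x + s *\<^sub>R h + t *\<^sub>R k) k h)) (at t)" if "t \<in> {0..1}" for t
  proof -
    have 1: "((\<lambda>t. f' (x + s *\<^sub>R h + t *\<^sub>R k)) has_derivative (\<lambda>r. f'' (x + s *\<^sub>R h + t *\<^sub>R k) (r *\<^sub>R k))) (at t)"
      by (rule has_derivative_compose[OF _ f''])
        (use inW[of s t] that s in \<open>auto intro!: derivative_eq_intros\<close>)
    show ?thesis
      unfolding K_def
      by (rule has_derivative_imp_has_field_derivative[OF bounded_linear.has_derivative[OF blinfun.bounded_linear_left 1, of h]])
        (simp add: blinfun.scaleR_right blinfun.scaleR_left)
  qed
  obtain t where t: "0 < t" "t < 1" "K 1 - K 0 = f'' (x + s *\<^sub>R h + t *\<^sub>R k) k h"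
    using MVT2[of 0 1 K "\<lambda>t. f'' (x + s *\<^sub>R h + t *\<^sub>R k) k h"] K by auto
  have "f (x + h + k) - f (x + h) - f (x + k) + f x = F 1 - F 0"
    by (simp add: F_def)
  also have "\<dots> = K 1 - K 0" using s by (simp add: K_def)
  finally show ?thesis using s t by (intro bexI[of _ s] bexI[of _ t]) auto
qed

lemma second_derivative_symmetric:
  fixes f :: "'a::real_normed_vector \<Rightarrow> real"
  assumes W: "open W" "x \<in> W"
    and f': "\<And>x. x \<in> W \<Longrightarrow> (f has_derivative blinfun_apply (f' x)) (at x)"
    and f'': "\<And>x. x \<in> W \<Longrightarrow> (f' has_derivative blinfun_apply (f'' x)) (at x)"
    and cont: "continuous_on W f''"
  shows "f'' x h k = f'' x k h"
proof (rule ccontr)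
  assume ne: "\<not> ?thesis"
  define e where "e = \<bar>f'' x h k - f'' x k h\<bar> / 2"
  have e: "e > 0" using ne by (simp add: e_def)
  have c1: "isCont (\<lambda>y. f'' y h k) x" "isCont (\<lambda>y. f'' y k h) x"
    using cont W by (auto intro!: continuous_intros simp: continuous_on_eq_continuous_at)
  obtain r where r: "r > 0" "ball x r \<subseteq> W" using W openE by blast
  obtain d1 where d1: "d1 > 0" "\<And>y. dist y x < d1 \<Longrightarrow> \<bar>f'' y h k - f'' x h k\<bar> < e"
    using c1(1) e unfolding continuous_at_eps_delta dist_real_def by blast
  obtain d2 where d2: "d2 > 0" "\<And>y. dist y x < d2 \<Longrightarrow> \<bar>f'' y k h - f'' x k h\<bar> < e"
    using c1(2) e unfolding continuous_at_eps_delta dist_real_def by blast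
  define d where "d = min r (min d1 d2)"
  have d: "d > 0" using r d1 d2 by (simp add: d_def)
  \<comment> \<open>The factor \<open>a\<close> shrinks the parallelogram spanned by
    \<open>h\<close> and \<open>k\<close> into the ball where both mixed derivatives vary by less
    than \<open>e\<close>.\<close>
  define a where "a = d / (2 * (norm h + norm k + 1))"
  have a: "a > 0" using d by (simp add: a_def add_nonneg_pos)
  have small: "norm (s *\<^sub>R (a *\<^sub>R h) + t *\<^sub>R (a *\<^sub>R k)) < d" if "s \<in> {0..1}" "t \<in> {0..1}" for s t
  proof -
    have "norm (s *\<^sub>R (a *\<^sub>R h) + t *\<^sub>R (a *\<^sub>R k)) \<le> s * (a * norm h) + t * (a * norm k)"
      using that a norm_triangle_ineq[of "s *\<^sub>R (a *\<^sub>R h)" "t *\<^sub>R (a *\<^sub>R k)"] by simp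
    also have "\<dots> \<le> 1 * (a * norm h) + 1 * (a * norm k)"
      using that a by (intro add_mono mult_right_mono) auto
    also have "\<dots> = a * (norm h + norm k)" by (simp add: algebra_simps)
    also have "\<dots> < d"
    proof -
      have "a * (norm h + norm k) = d * ((norm h + norm k) / (2 * (norm h + norm k + 1)))"
        by (simp add: a_def)
      also have "\<dots> < d * 1"
      proof (intro mult_strict_left_mono d)
        define q where "q = norm h + norm k"
        have "q \<ge> 0" by (simp add: q_def)
        then show "(norm h + norm k) / (2 * (norm h + norm k + 1)) < 1"
          unfolding q_def[symmetric] by (simp add: field_simps)
      qed
      finally show ?thesis by simp
    qed
    finally show ?thesis .
  qed
  have mem: "x + s *\<^sub>R (a *\<^sub>R h) + t *\<^sub>R (a *\<^sub>R k) \<in> ball x d" if "s \<in> {0..1}" "t \<in> {0..1}" for s t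
    using small[OF that] by (simp add: dist_norm add.assoc norm_minus_commute add.commute)
  have sub: "ball x d \<subseteq> W" using r by (auto simp: d_def)
  have m: "x \<in> ball x d" "x + a *\<^sub>R h \<in> ball x d" "x + a *\<^sub>R k \<in> ball x d" "x + a *\<^sub>R h + a *\<^sub>R k \<in> ball x d" "x + a *\<^sub>R k + a *\<^sub>R h \<in> ball x d"
    using mem[of 0 0] mem[of 1 0] mem[of 0 1] mem[of 1 1] by (auto simp: algebra_simps)
  obtain s t where st: "s \<in> {0..1}" "t \<in> {0..1}" 
    "f (x + a *\<^sub>R h + a *\<^sub>R k) - f (x + a *\<^sub>R h) - f (x + a *\<^sub>R k) + f x
      = f'' (x + s *\<^sub>R (a *\<^sub>R h) + t *\<^sub>R (a *\<^sub>R k)) (a *\<^sub>R k) (a *\<^sub>R h)"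
    using second_difference_quotient[OF f'[OF subsetD[OF sub]] f''[OF subsetD[OF sub]] convex_ball m(1,2,3,4)] by auto
  obtain s' t' where st': "s' \<in> {0..1}" "t' \<in> {0..1}" 
    "f (x + a *\<^sub>R k + a *\<^sub>R h) - f (x + a *\<^sub>R k) - f (x + a *\<^sub>R h) + f x
      = f'' (x + s' *\<^sub>R (a *\<^sub>R k) + t' *\<^sub>R (a *\<^sub>R h)) (a *\<^sub>R h) (a *\<^sub>R k)"
    using second_difference_quotient[OF f'[OF subsetD[OF sub]] f''[OF subsetD[OF sub]] convex_ball m(1,3,2,5)] by auto
  define y where "y = x + s *\<^sub>R (a *\<^sub>R h) + t *\<^sub>R (a *\<^sub>R k)"
  define y' where "y' = x + t' *\<^sub>R (a *\<^sub>R h) + s' *\<^sub>R (a *\<^sub>R k)"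
  have yy: "y \<in> ball x d" "y' \<in> ball x d" using mem st st' by (auto simp: y_def y'_def)
  have y'eq: "x + s' *\<^sub>R (a *\<^sub>R k) + t' *\<^sub>R (a *\<^sub>R h) = y'" by (simp add: y'_def algebra_simps)
  \<comment> \<open>The second difference is symmetric in \<open>h\<close> and \<open>k\<close>, so
    the two mixed derivatives agree, each at its own intermediate point.\<close>
  have "f'' y (a *\<^sub>R k) (a *\<^sub>R h) = f'' y' (a *\<^sub>R h) (a *\<^sub>R k)"
    using st(3) st'(3) unfolding y'eq y_def[symmetric] by (simp add: algebra_simps)
  then have "f'' y k h = f'' y' h k"
    using a by (simp add: blinfun.scaleR_right blinfun.scaleR_left)
  moreover have "\<bar>f'' y k h - f'' x k h\<bar> < e" "\<bar>f'' y' h k - f'' x h k\<bar> < e"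
    using yy d1 d2 by (auto simp: d_def dist_commute)
  ultimately have "\<bar>f'' x h k - f'' x k h\<bar> < 2 * e" by arith
  then show False by (simp add: e_def)
qed

section \<open>Test functions and the divergence theorem\<close>

text \<open>The gradient is recorded as a vector field and not as a functional, because it is paired
  with other fields under integrals.\<close>

definition C1g :: "('a::euclidean_space \<Rightarrow> real) \<Rightarrow> ('a \<Rightarrow> 'a) \<Rightarrow> 'a set \<Rightarrow> bool" where
  "C1g f g W \<longleftrightarrow> (\<forall>x\<in>W. (f has_derivative (\<lambda>h. g x \<bullet> h)) (at x)) \<and> continuous_on W g"

text \<open>\<open>K\<close> is any compact set off which the function vanishes, not the exact
  support. The same pair can therefore be used again with a smaller \<open>K\<close> as soon as more
  vanishing is known.\<close>

definition test_fun :: "('a::euclidean_space \<Rightarrow> real) \<Rightarrow> ('a \<Rightarrow> 'a) \<Rightarrow> 'a set \<Rightarrow> bool" where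
  "test_fun \<psi> g K \<longleftrightarrow> C1g \<psi> g UNIV \<and> compact K \<and> (\<forall>x. x \<notin> K \<longrightarrow> \<psi> x = 0 \<and> g x = 0)"

lemma C1gI: "(\<And>x. x \<in> W \<Longrightarrow> (f has_derivative (\<lambda>h. g x \<bullet> h)) (at x)) \<Longrightarrow> continuous_on W g \<Longrightarrow> C1g f g W"
  by (simp add: C1g_def)

lemma C1g_deriv: "C1g f g W \<Longrightarrow> x \<in> W \<Longrightarrow> (f has_derivative (\<lambda>h. g x \<bullet> h)) (at x)"
  by (simp add: C1g_def)

lemma C1g_cont_grad: "C1g f g W \<Longrightarrow> continuous_on W g"
  by (simp add: C1g_def)

lemma C1g_cont: "C1g f g W \<Longrightarrow> continuous_on W f"
  by (intro continuous_at_imp_continuous_on ballI) (rule has_derivative_continuous[OF C1g_deriv])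

lemma C1g_subset: "C1g f g W \<Longrightarrow> V \<subseteq> W \<Longrightarrow> C1g f g V"
  by (auto simp: C1g_def intro: continuous_on_subset)

lemma C1g_const: "C1g (\<lambda>x. c) (\<lambda>x. 0) W"
  by (simp add: C1g_def)

lemma C1g_add:
  assumes "C1g f g W" "C1g f' g' W" shows "C1g (\<lambda>x. f x + f' x) (\<lambda>x. g x + g' x) W"
  using assms by (auto simp: C1g_def inner_add_left intro!: has_derivative_add continuous_on_add)

lemma C1g_mult:
  assumes "C1g f g W" "C1g f' g' W"
  shows "C1g (\<lambda>x. f x * f' x) (\<lambda>x. f x *\<^sub>R g' x + f' x *\<^sub>R g x) W"
proof (rule C1gI)
  fix x assume "x \<in> W"
  then show "((\<lambda>x. f x * f' x) has_derivative (\<lambda>h. (f x *\<^sub>R g' x + f' x *\<^sub>R g x) \<bullet> h)) (at x)"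
    using has_derivative_mult[OF C1g_deriv[OF assms(1)] C1g_deriv[OF assms(2)], of x]
    by (simp add: inner_add_left mult.commute)
qed (intro continuous_intros C1g_cont[OF assms(1)] C1g_cont[OF assms(2)] C1g_cont_grad[OF assms(1)] C1g_cont_grad[OF assms(2)])

lemma C1g_cmult: "C1g f g W \<Longrightarrow> C1g (\<lambda>x. c * f x) (\<lambda>x. c *\<^sub>R g x) W"
  using C1g_mult[OF C1g_const, of f g W c] by simp

lemma C1g_diff:
  assumes "C1g f g W" "C1g f' g' W" shows "C1g (\<lambda>x. f x - f' x) (\<lambda>x. g x - g' x) W"
  using C1g_add[OF assms(1) C1g_cmult[OF assms(2), of "-1"]] by simp

lemma C1g_compose:
  assumes f: "C1g f g W" and th: "\<And>t. t \<in> f ` W \<Longrightarrow> (\<theta> has_real_derivative \<theta>' t) (at t)" and c: "continuous_on (f ` W) \<theta>'"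
  shows "C1g (\<lambda>x. \<theta> (f x)) (\<lambda>x. \<theta>' (f x) *\<^sub>R g x) W"
proof (rule C1gI)
  fix x assume x: "x \<in> W"
  have 1: "(\<theta> has_derivative (*) (\<theta>' (f x))) (at (f x))" using th[of "f x"] x by (simp add: has_field_derivative_def)
  show "((\<lambda>x. \<theta> (f x)) has_derivative (\<lambda>h. (\<theta>' (f x) *\<^sub>R g x) \<bullet> h)) (at x)"
    using has_derivative_compose[OF C1g_deriv[OF f x] 1] by simp
qed (intro continuous_intros continuous_on_compose2[OF c] C1g_cont[OF f] C1g_cont_grad[OF f]; simp)

lemma C1g_transform:
  assumes "C1g f g W" "open W" "\<And>x. x \<in> W \<Longrightarrow> f x = f' x" "\<And>x. x \<in> W \<Longrightarrow> g x = g' x"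
  shows "C1g f' g' W"
proof (rule C1gI)
  fix x assume x: "x \<in> W"
  show "(f' has_derivative (\<lambda>h. g' x \<bullet> h)) (at x)"
    using has_derivative_transform_within_open[OF C1g_deriv[OF assms(1) x] assms(2) x] assms(3,4) x by simp
next
  show "continuous_on W g'"
    using continuous_on_cong[of W W g g'] C1g_cont_grad[OF assms(1)] assms(4) by simp
qed

text \<open>Off the compact set the function is locally zero, and uniqueness of the derivative makes
  the gradient vanish there.\<close>

lemma test_funI:
  assumes "C1g \<psi> g UNIV" "compact K" "\<And>x. x \<notin> K \<Longrightarrow> \<psi> x = 0"
  shows "test_fun \<psi> g K"
proof -
  have "g x = 0" if x: "x \<notin> K" for x
  proof -
    have o: "open (-K)" using assms(2) by (simp add: compact_imp_closed open_Compl)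
    have "((\<lambda>x. 0::real) has_derivative (\<lambda>h. g x \<bullet> h)) (at x)"
      using has_derivative_transform_within_open[OF C1g_deriv[OF assms(1), of x] o, of "\<lambda>x. 0"] assms(3) x by simp
    moreover have "((\<lambda>x::'a. 0::real) has_derivative (\<lambda>h. 0)) (at x)" by simp
    ultimately have "(\<lambda>h. g x \<bullet> h) = (\<lambda>h. 0)" by (rule has_derivative_unique)
    then have "g x \<bullet> g x = 0" by (rule fun_cong)
    then show ?thesis by simp
  qed
  then show ?thesis using assms by (simp add: test_fun_def)
qed

lemma test_funD:
  assumes "test_fun \<psi> g K"
  shows "C1g \<psi> g UNIV" "compact K" "x \<notin> K \<Longrightarrow> \<psi> x = 0" "x \<notin> K \<Longrightarrow> g x = 0"
    "continuous_on S \<psi>" "continuous_on S g"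
  using assms continuous_on_subset[OF C1g_cont[of \<psi> g UNIV], of S] continuous_on_subset[OF C1g_cont_grad[of \<psi> g UNIV], of S]
  by (auto simp: test_fun_def)

text \<open>Nothing is asked of \<open>f\<close> away from \<open>K\<close>: the open sets
  \<open>W\<close> and \<open>- K\<close> cover the space, and on the second one the product is
  zero.\<close>

lemma test_fun_mult:
  assumes t: "test_fun \<psi> g K" and K: "K \<subseteq> W" "open W" and f: "C1g f gf W"
  shows "test_fun (\<lambda>x. \<psi> x * f x) (\<lambda>x. \<psi> x *\<^sub>R gf x + f x *\<^sub>R g x) K"
proof -
  note [simp] = test_funD(3,4)[OF t]
  have o: "open (-K)" using test_funD(2)[OF t] by (simp add: compact_imp_closed open_Compl)
  have 1: "C1g (\<lambda>x. \<psi> x * f x) (\<lambda>x. \<psi> x *\<^sub>R gf x + f x *\<^sub>R g x) W"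
    by (rule C1g_mult[OF C1g_subset[OF test_funD(1)[OF t]] f]) simp
  have 2: "C1g (\<lambda>x. \<psi> x * f x) (\<lambda>x. \<psi> x *\<^sub>R gf x + f x *\<^sub>R g x) (-K)"
    by (rule C1g_transform[OF C1g_const[of 0] o]) auto
  have U: "UNIV = W \<union> -K" using K by auto
  have "continuous_on (W \<union> -K) (\<lambda>x. \<psi> x *\<^sub>R gf x + f x *\<^sub>R g x)"
    using 1 2 K(2) o by (intro continuous_on_open_Un) (auto simp: C1g_def)
  moreover have "((\<lambda>x. \<psi> x * f x) has_derivative (\<lambda>h. (\<psi> x *\<^sub>R gf x + f x *\<^sub>R g x) \<bullet> h)) (at x)" for x
    using C1g_deriv[OF 1, of x] C1g_deriv[OF 2, of x] U by blast
  ultimately have "C1g (\<lambda>x. \<psi> x * f x) (\<lambda>x. \<psi> x *\<^sub>R gf x + f x *\<^sub>R g x) UNIV"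
    using U[symmetric] unfolding C1g_def by simp
  then show ?thesis using test_funD(2)[OF t] by (simp add: test_fun_def)
qed

lemma compact_support_integrable:
  fixes f :: "'a::euclidean_space \<Rightarrow> real"
  assumes "compact K" "continuous_on K f" "\<And>x. x \<notin> K \<Longrightarrow> f x = 0"
  shows "integrable lborel f"
proof -
  have "(\<lambda>x. indicator K x *\<^sub>R f x) = f" using assms(3) by (intro ext) (auto simp: indicator_def)
  then show ?thesis using borel_integrable_compact[OF assms(1,2)] by simp
qed

lemma lborel_integral_translate:
  fixes f :: "'a::euclidean_space \<Rightarrow> real"
  assumes "f \<in> borel_measurable borel"
  shows "(\<integral>x. f (c + x) \<partial>lborel) = (\<integral>x. f x \<partial>lborel)"
proof -
  have "(\<integral>x. f x \<partial>lborel) = (\<integral>x. f x \<partial>(distr lborel borel ((+) c)))"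
    by (simp add: lborel_distr_plus)
  also have "\<dots> = (\<integral>x. f (c + x) \<partial>lborel)"
    using assms by (intro integral_distr) auto
  finally show ?thesis by simp
qed

lemma lborel_integrable_translate:
  fixes f :: "'a::euclidean_space \<Rightarrow> real"
  assumes "integrable lborel f"
  shows "integrable lborel (\<lambda>x. f (c + x))"
proof -
  have "integrable (distr lborel borel ((+) c)) f" using assms by (simp add: lborel_distr_plus)
  then show ?thesis using assms by (subst (asm) integrable_distr_eq) auto
qed

lemma test_fun_bounded:
  assumes t: "test_fun \<psi> g K"
  obtains B where "B > 0" "\<And>x. norm (g x) \<le> B" "\<And>x. \<bar>\<psi> x\<bar> \<le> B"
proof -
  have "bounded (g ` K)" "bounded (\<psi> ` K)"
    using compact_continuous_image[OF test_funD(6)[OF t] test_funD(2)[OF t]]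
      compact_continuous_image[OF test_funD(5)[OF t] test_funD(2)[OF t]] by (auto intro: compact_imp_bounded)
  then obtain B1 B2 where B: "B1 > 0" "\<forall>x\<in>K. norm (g x) \<le> B1" "B2 > 0" "\<forall>x\<in>K. norm (\<psi> x) \<le> B2"
    unfolding bounded_pos by auto
  show ?thesis
  proof (rule that[of "max B1 B2"])
    fix x show "norm (g x) \<le> max B1 B2" "\<bar>\<psi> x\<bar> \<le> max B1 B2"
      using B test_funD(3,4)[OF t, of x] by (cases "x \<in> K"; fastforce)+
  qed (use B in auto)
qed

lemma C1g_increment_bound:
  assumes "C1g f g S" "convex S" "x \<in> S" "y \<in> S" "\<And>z. z \<in> S \<Longrightarrow> norm (g z) \<le> B"
  shows "\<bar>f y - f x\<bar> \<le> B * norm (y - x)"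
proof -
  have "norm (f y - f x) \<le> B * norm (y - x)"
  proof (rule differentiable_bound[OF assms(2) _ _ assms(4,3)])
    fix z assume z: "z \<in> S"
    show "(f has_derivative (\<lambda>h. g z \<bullet> h)) (at z within S)"
      using C1g_deriv[OF assms(1) z] by (rule has_derivative_at_withinI)
    show "onorm (\<lambda>h. g z \<bullet> h) \<le> B"
      using assms(5)[OF z] by (intro onorm_le)
        (metis Cauchy_Schwarz_ineq2 mult_right_mono norm_ge_zero order_trans real_norm_def)
  qed
  then show ?thesis by simp
qed

lemma has_derivative_directional_limit:
  fixes f :: "'a::real_normed_vector \<Rightarrow> 'b::real_normed_vector"
  assumes "(f has_derivative f') (at x)" "s \<longlonglongrightarrow> 0" "\<And>n. s n \<noteq> 0"
  shows "(\<lambda>n. (f (x + s n *\<^sub>R e) - f x) /\<^sub>R s n) \<longlonglongrightarrow> f' e"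
proof -
  have "((\<lambda>t. f (x + t *\<^sub>R e)) has_derivative (\<lambda>t. f' (t *\<^sub>R e))) (at 0)"
    by (rule has_derivative_compose[where f="\<lambda>t. x + t *\<^sub>R e" and g=f]) (use assms(1) in \<open>auto intro!: derivative_eq_intros\<close>)
  then have "((\<lambda>t. f (x + t *\<^sub>R e)) has_vector_derivative f' e) (at 0)"
    using has_derivative_bounded_linear[OF assms(1)]
    by (simp add: has_vector_derivative_def linear_cmul bounded_linear.linear)
  then have "((\<lambda>t. (f (x + t *\<^sub>R e) - f x - t *\<^sub>R f' e) /\<^sub>R \<bar>t\<bar>) \<longlongrightarrow> 0) (at 0)"
    by (simp add: has_vector_derivative_def has_derivative_def)
  then have "((\<lambda>t. norm ((f (x + t *\<^sub>R e) - f x - t *\<^sub>R f' e) /\<^sub>R \<bar>t\<bar>)) \<longlongrightarrow> 0) (at 0)"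
    by (rule tendsto_norm_zero)
  then have "((\<lambda>t. norm ((f (x + t *\<^sub>R e) - f x) /\<^sub>R t - f' e)) \<longlongrightarrow> 0) (at 0)"
  proof (rule Lim_transform_eventually)
    show "\<forall>\<^sub>F t in at 0. norm ((f (x + t *\<^sub>R e) - f x - t *\<^sub>R f' e) /\<^sub>R \<bar>t\<bar>) = norm ((f (x + t *\<^sub>R e) - f x) /\<^sub>R t - f' e)"
    proof (rule eventually_at_filter[THEN iffD2], rule always_eventually, intro allI impI)
      fix t :: real assume "t \<noteq> 0"
      then have "(f (x + t *\<^sub>R e) - f x) /\<^sub>R t - f' e = (f (x + t *\<^sub>R e) - f x - t *\<^sub>R f' e) /\<^sub>R t"
        by (simp add: scaleR_diff_right)
      then show "norm ((f (x + t *\<^sub>R e) - f x - t *\<^sub>R f' e) /\<^sub>R \<bar>t\<bar>) = norm ((f (x + t *\<^sub>R e) - f x) /\<^sub>R t - f' e)"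
        by simp
    qed
  qed
  then have "((\<lambda>t. (f (x + t *\<^sub>R e) - f x) /\<^sub>R t - f' e) \<longlongrightarrow> 0) (at 0)"
    by (simp only: tendsto_norm_zero_iff)
  then have "((\<lambda>t. (f (x + t *\<^sub>R e) - f x) /\<^sub>R t) \<longlongrightarrow> f' e) (at 0)"
    by (rule LIM_zero_cancel)
  then show ?thesis
    using assms(2,3) by (auto simp: tendsto_at_iff_sequentially o_def)
qed

text \<open>Lebesgue measure is translation invariant, so each difference quotient of
  \<open>\<psi>\<close> integrates to zero; the bound on the gradient dominates the passage to the
  derivative.\<close>

lemma integral_test_fun_directional:
  assumes t: "test_fun \<psi> g K"
  shows "(\<integral>x. g x \<bullet> e \<partial>lborel) = 0"
proof -
  obtain B where B: "B > 0" "\<And>x. norm (g x) \<le> B" by (rule test_fun_bounded[OF t]) blast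
  obtain R where R: "R > 0" "K \<subseteq> cball 0 R"
    using compact_imp_bounded[OF test_funD(2)[OF t]] unfolding bounded_pos by (auto simp: subset_iff)
  define s where "s = (\<lambda>n. inverse (real (Suc n)))"
  have s0: "s \<longlonglongrightarrow> 0" unfolding s_def by (rule LIMSEQ_inverse_real_of_nat)
  have s1: "s n > 0" "s n \<le> 1" for n by (auto simp: s_def divide_simps)
  have s2: "s n \<noteq> 0" for n using s1(1)[of n] by simp
  have int\<psi>: "integrable lborel \<psi>"
    using compact_support_integrable[OF test_funD(2)[OF t] test_funD(5)[OF t] test_funD(3)[OF t]] .
  \<comment> \<open>The shifts are no longer than \<open>e\<close>, so all difference quotients live
    in one ball.\<close>
  define w where "w = (\<lambda>x::'a. indicator (cball 0 (R + norm e)) x *\<^sub>R (B * norm e))"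
  have "(\<lambda>n. \<integral>x. (\<psi> (x + s n *\<^sub>R e) - \<psi> x) /\<^sub>R s n \<partial>lborel) \<longlonglongrightarrow> (\<integral>x. g x \<bullet> e \<partial>lborel)"
  proof (rule integral_dominated_convergence[where w=w])
    show "(\<lambda>x. g x \<bullet> e) \<in> borel_measurable lborel"
      using test_funD(6)[OF t, of UNIV] by (simp add: borel_measurable_continuous_onI continuous_on_inner)
    show "(\<lambda>x. (\<psi> (x + s n *\<^sub>R e) - \<psi> x) /\<^sub>R s n) \<in> borel_measurable lborel" for n
    proof -
      have "continuous_on UNIV (\<lambda>x. (\<psi> (x + s n *\<^sub>R e) - \<psi> x) /\<^sub>R s n)"
        by (intro continuous_intros continuous_on_compose2[OF test_funD(5)[OF t, of UNIV]] test_funD(5)[OF t]) auto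
      then show ?thesis by (simp add: borel_measurable_continuous_onI)
    qed
    show "integrable lborel w"
      unfolding w_def by (intro borel_integrable_compact) auto
    show "AE x in lborel. (\<lambda>n. (\<psi> (x + s n *\<^sub>R e) - \<psi> x) /\<^sub>R s n) \<longlonglongrightarrow> g x \<bullet> e"
      by (intro AE_I2 has_derivative_directional_limit[OF C1g_deriv[OF test_funD(1)[OF t]] s0 s2]) simp
    show "AE x in lborel. norm ((\<psi> (x + s n *\<^sub>R e) - \<psi> x) /\<^sub>R s n) \<le> w x" for n
    proof (rule AE_I2)
      fix x :: 'a
      have a: "\<bar>\<psi> (x + s n *\<^sub>R e) - \<psi> x\<bar> \<le> B * (s n * norm e)"
        using C1g_increment_bound[OF test_funD(1)[OF t] convex_UNIV, of x "x + s n *\<^sub>R e" B] B s1[of n] by simp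
      show "norm ((\<psi> (x + s n *\<^sub>R e) - \<psi> x) /\<^sub>R s n) \<le> w x"
      proof (cases "x \<in> cball 0 (R + norm e)")
        case True
        have "norm ((\<psi> (x + s n *\<^sub>R e) - \<psi> x) /\<^sub>R s n) = \<bar>\<psi> (x + s n *\<^sub>R e) - \<psi> x\<bar> / s n"
          using s1(1)[of n] by (simp add: divide_inverse_commute abs_mult)
        also have "\<dots> \<le> B * norm e"
          using a s1(1)[of n] by (simp add: pos_divide_le_eq mult.assoc mult.left_commute mult.commute)
        finally show ?thesis using True by (simp add: w_def)
      next
        case False
        then have nx: "norm x > R + norm e" by simp
        have "norm (x + s n *\<^sub>R e) \<ge> norm x - s n * norm e"
          using norm_triangle_ineq4[of "x + s n *\<^sub>R e" "s n *\<^sub>R e"] s1[of n] by simp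
        moreover have "s n * norm e \<le> norm e" using s1[of n] by (simp add: mult_left_le_one_le)
        ultimately have "norm (x + s n *\<^sub>R e) > R" "norm x > R" using nx norm_ge_zero[of e] by linarith+
        then have "x + s n *\<^sub>R e \<notin> K" "x \<notin> K" using R by auto
        then show ?thesis using test_funD(3)[OF t] B(1) by (simp add: w_def)
      qed
    qed
  qed
  moreover have "(\<integral>x. (\<psi> (x + s n *\<^sub>R e) - \<psi> x) /\<^sub>R s n \<partial>lborel) = 0" for n
  proof -
    have i: "integrable lborel (\<lambda>x. \<psi> (x + s n *\<^sub>R e))"
      using lborel_integrable_translate[OF int\<psi>, of "s n *\<^sub>R e"] by (simp add: add.commute)
    have "(\<integral>x. \<psi> (x + s n *\<^sub>R e) \<partial>lborel) = (\<integral>x. \<psi> x \<partial>lborel)"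
      using lborel_integral_translate[of \<psi> "s n *\<^sub>R e"] int\<psi> by (simp add: add.commute borel_measurable_integrable)
    then show ?thesis using i int\<psi> by simp
  qed
  ultimately have "(\<lambda>n. 0) \<longlonglongrightarrow> (\<integral>x. g x \<bullet> e \<partial>lborel)" by (simp only:)
  then show ?thesis by (rule LIMSEQ_unique[OF tendsto_const, symmetric])
qed

lemma inner_field_C1g:
  fixes v :: "'a::euclidean_space \<Rightarrow> 'a"
  assumes "\<And>x. x \<in> W \<Longrightarrow> (v has_derivative blinfun_apply (H x)) (at x)" "continuous_on W H"
  shows "C1g (\<lambda>x. v x \<bullet> i) (\<lambda>x. \<Sum>k\<in>Basis. (H x k \<bullet> i) *\<^sub>R k) W"
proof (rule C1gI)
  fix x assume x: "x \<in> W"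
  have "(\<Sum>k\<in>Basis. (H x k \<bullet> i) *\<^sub>R k) \<bullet> h = H x h \<bullet> i" for h
  proof -
    have "H x h = H x (\<Sum>k\<in>Basis. (h \<bullet> k) *\<^sub>R k)" by (simp add: euclidean_representation)
    also have "\<dots> = (\<Sum>k\<in>Basis. (h \<bullet> k) *\<^sub>R H x k)" by (simp add: blinfun.sum_right blinfun.scaleR_right)
    finally show ?thesis by (simp add: inner_sum_left inner_sum_right inner_commute mult.commute)
  qed
  then show "((\<lambda>x. v x \<bullet> i) has_derivative (\<lambda>h. (\<Sum>k\<in>Basis. (H x k \<bullet> i) *\<^sub>R k) \<bullet> h)) (at x)"
    using has_derivative_inner_left[OF assms(1)[OF x], of i] by simp
qed (intro continuous_intros assms)

text \<open>Each component of \<open>v\<close> times \<open>\<phi>\<close> is again a test function,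
  and its derivative in the matching basis direction integrates to zero.\<close>

theorem integral_divergence:
  fixes v :: "'a::euclidean_space \<Rightarrow> 'a"
  assumes t: "test_fun \<phi> g K" and K: "K \<subseteq> W" "open W"
    and v: "\<And>x. x \<in> W \<Longrightarrow> (v has_derivative blinfun_apply (H x)) (at x)" "continuous_on W H"
  shows "(\<integral>x. g x \<bullet> v x + \<phi> x * (\<Sum>i\<in>Basis. H x i \<bullet> i) \<partial>lborel) = 0"
proof -
  have cv: "continuous_on W v"
    by (intro continuous_at_imp_continuous_on ballI) (rule has_derivative_continuous[OF v(1)])
  have t': "test_fun (\<lambda>x. \<phi> x * (v x \<bullet> i)) (\<lambda>x. \<phi> x *\<^sub>R (\<Sum>k\<in>Basis. (H x k \<bullet> i) *\<^sub>R k) + (v x \<bullet> i) *\<^sub>R g x) K" for i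
    by (rule test_fun_mult[OF t K inner_field_C1g[OF v]])
  have "0 = (\<Sum>i\<in>Basis. \<integral>x. (\<phi> x *\<^sub>R (\<Sum>k\<in>Basis. (H x k \<bullet> i) *\<^sub>R k) + (v x \<bullet> i) *\<^sub>R g x) \<bullet> i \<partial>lborel)"
    using integral_test_fun_directional[OF t'] by simp
  also have "\<dots> = (\<integral>x. (\<Sum>i\<in>Basis. (\<phi> x *\<^sub>R (\<Sum>k\<in>Basis. (H x k \<bullet> i) *\<^sub>R k) + (v x \<bullet> i) *\<^sub>R g x) \<bullet> i) \<partial>lborel)"
  proof (rule Bochner_Integration.integral_sum[symmetric])
    fix i :: 'a
    show "integrable lborel (\<lambda>x. (\<phi> x *\<^sub>R (\<Sum>k\<in>Basis. (H x k \<bullet> i) *\<^sub>R k) + (v x \<bullet> i) *\<^sub>R g x) \<bullet> i)"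
      by (rule compact_support_integrable[OF test_funD(2)[OF t]])
        (use test_funD(4)[OF t'] in \<open>auto intro!: continuous_intros test_funD[OF t'] simp: \<close>)
  qed
  also have "\<dots> = (\<integral>x. g x \<bullet> v x + \<phi> x * (\<Sum>i\<in>Basis. H x i \<bullet> i) \<partial>lborel)"
  proof (rule Bochner_Integration.integral_cong[OF refl])
    fix x
    have "(\<phi> x *\<^sub>R (\<Sum>k\<in>Basis. (H x k \<bullet> i) *\<^sub>R k) + (v x \<bullet> i) *\<^sub>R g x) \<bullet> i
        = \<phi> x * (H x i \<bullet> i) + (g x \<bullet> i) * (v x \<bullet> i)" if "i \<in> Basis" for i
      using that by (simp add: inner_add_left inner_sum_left inner_Basis if_distrib cong: if_cong)
    then show "(\<Sum>i\<in>Basis. (\<phi> x *\<^sub>R (\<Sum>k\<in>Basis. (H x k \<bullet> i) *\<^sub>R k) + (v x \<bullet> i) *\<^sub>R g x) \<bullet> i) = g x \<bullet> v x + \<phi> x * (\<Sum>i\<in>Basis. H x i \<bullet> i)"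
      by (simp add: sum.distrib sum_distrib_left euclidean_inner[of "g x" "v x"] del: sum.cong)
  qed
  finally show ?thesis by simp
qed

text \<open>The derivative of \<open>v\<close> in direction \<open>e\<close> is only continuous, yet
  it is divergence-free in the weak sense: translates of \<open>v\<close> are divergence-free, hence
  so are the difference quotients, and these converge to it. Applied to a harmonic gradient, this
  stands in for third derivatives.\<close>

theorem integral_derivative_divergence_free:
  fixes v :: "'a::euclidean_space \<Rightarrow> 'a"
  assumes t: "test_fun \<phi> g K" and K: "K \<subseteq> W" "open W"
    and v: "\<And>x. x \<in> W \<Longrightarrow> (v has_derivative blinfun_apply (H x)) (at x)" "continuous_on W H"
    and tr: "\<And>x. x \<in> W \<Longrightarrow> (\<Sum>i\<in>Basis. H x i \<bullet> i) = 0"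
  shows "(\<integral>x. g x \<bullet> H x e \<partial>lborel) = 0"
proof -
  have cv: "continuous_on W v"
    by (intro continuous_at_imp_continuous_on ballI) (rule has_derivative_continuous[OF v(1)])
  note cK = test_funD(2)[OF t]
  obtain r where r: "r > 0" "(\<Union>x\<in>K. cball x r) \<subseteq> W"
    using compact_subset_open_imp_cball_epsilon_subset[OF cK K(2,1)] .
  \<comment> \<open>The closed \<open>r\<close>-neighbourhood of \<open>K\<close> contains every
    segment from a point of \<open>K\<close> to its translate, and \<open>H\<close> is bounded on it
    by compactness.\<close>
  define K' where "K' = {x + y | x y. x \<in> K \<and> y \<in> cball 0 r}"
  have cK': "compact K'" unfolding K'_def by (intro compact_sums cK compact_cball)
  have K'W: "K' \<subseteq> W"
  proof
    fix z assume "z \<in> K'"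
    then obtain x y where "x \<in> K" "norm y \<le> r" "z = x + y" by (auto simp: K'_def)
    then have "z \<in> cball x r" by (simp add: dist_norm)
    then show "z \<in> W" using r(2) \<open>x \<in> K\<close> by blast
  qed
  have K'1: "cball x r \<subseteq> K'" if "x \<in> K" for x
  proof
    fix z assume "z \<in> cball x r"
    then have "z = x + (z - x)" "z - x \<in> cball 0 r" by (auto simp: dist_norm norm_minus_commute)
    then show "z \<in> K'" using that unfolding K'_def by blast
  qed
  define d where "d = r / (norm e + 1)"
  have d: "d > 0" using r by (simp add: d_def add_nonneg_pos)
  have de: "\<bar>\<tau>\<bar> * norm e \<le> r" if "\<bar>\<tau>\<bar> \<le> d" for \<tau>
  proof -
    have "\<bar>\<tau>\<bar> * norm e \<le> d * (norm e + 1)" using that d by (intro mult_mono) auto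
    also have "\<dots> = r"
    proof -
      have "norm e + 1 \<noteq> 0" using norm_ge_zero[of e] by linarith
      then show ?thesis by (simp add: d_def)
    qed
    finally show ?thesis .
  qed
  \<comment> \<open>The translation is moved from \<open>v\<close> to the test function, whose
    shifted support stays in \<open>W\<close>, where the trace vanishes.\<close>
  have shift0: "(\<integral>x. g x \<bullet> v (x + \<tau> *\<^sub>R e) \<partial>lborel) = 0" if \<tau>: "\<bar>\<tau>\<bar> \<le> d" for \<tau>
  proof -
    define a where "a = \<tau> *\<^sub>R e"
    have na: "norm a \<le> r" using de[OF \<tau>] by (simp add: a_def)
    have "C1g (\<lambda>x. \<phi> (x - a)) (\<lambda>x. g (x - a)) UNIV"
    proof (rule C1gI)
      fix x show "((\<lambda>x. \<phi> (x - a)) has_derivative (\<lambda>h. g (x - a) \<bullet> h)) (at x)"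
        by (rule has_derivative_compose[where f="\<lambda>x. x - a"]) (use C1g_deriv[OF test_funD(1)[OF t]] in \<open>auto intro!: derivative_eq_intros\<close>)
    qed (intro continuous_on_compose2[OF test_funD(6)[OF t, of UNIV]] continuous_intros; simp)
    moreover have "compact ((+) a ` K)" using cK by (rule compact_translation)
    moreover have "\<phi> (x - a) = 0" if "x \<notin> (+) a ` K" for x
      using that by (intro test_funD(3)[OF t]) (metis add.commute diff_add_cancel imageI)
    ultimately have ts: "test_fun (\<lambda>x. \<phi> (x - a)) (\<lambda>x. g (x - a)) ((+) a ` K)" by (rule test_funI)
    have sub: "(+) a ` K \<subseteq> W"
    proof
      fix z assume "z \<in> (+) a ` K"
      then obtain x where "x \<in> K" "z = a + x" by auto
      then have "z \<in> cball x r" using na by (simp add: dist_norm)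
      then show "z \<in> W" using r(2) \<open>x \<in> K\<close> by blast
    qed
    have z: "(\<integral>x. g (x - a) \<bullet> v x \<partial>lborel) = 0"
    proof -
      have "(\<integral>x. g (x - a) \<bullet> v x + \<phi> (x - a) * (\<Sum>i\<in>Basis. H x i \<bullet> i) \<partial>lborel) = 0"
        by (rule integral_divergence[OF ts sub K(2) v])
      moreover have "\<phi> (x - a) * (\<Sum>i\<in>Basis. H x i \<bullet> i) = 0" for x
        using tr[of x] test_funD(3)[OF ts, of x] sub by (cases "x \<in> W") auto
      ultimately show ?thesis by simp
    qed
    have m: "(\<lambda>x. g (x - a) \<bullet> v x) \<in> borel_measurable borel"
    proof -
      have "integrable lborel (\<lambda>x. g (x - a) \<bullet> v x)"
        by (rule compact_support_integrable[OF test_funD(2)[OF ts]])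
          (use test_funD(4)[OF ts] in \<open>auto intro!: continuous_intros test_funD(6)[OF ts] continuous_on_subset[OF cv sub]\<close>)
      then show ?thesis by (simp add: borel_measurable_integrable)
    qed
    show ?thesis using lborel_integral_translate[OF m, of a] z by (simp add: a_def add.commute)
  qed
  have cH: "compact (H ` K')" by (intro compact_continuous_image continuous_on_subset[OF v(2) K'W] cK')
  obtain M where M: "M > 0" "\<And>x. x \<in> K' \<Longrightarrow> norm (H x) \<le> M"
    using compact_imp_bounded[OF cH] unfolding bounded_pos by auto
  obtain B where B: "B > 0" "\<And>x. norm (g x) \<le> B" by (rule test_fun_bounded[OF t]) blast
  define s where "s = (\<lambda>n. d * inverse (real (Suc n)))"
  have s0: "s \<longlonglongrightarrow> 0" unfolding s_def by (intro tendsto_mult_right_zero LIMSEQ_inverse_real_of_nat)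
  have s1: "s n > 0" "s n \<le> d" for n using d by (auto simp: s_def divide_simps)
  have s2: "s n \<noteq> 0" for n using s1(1)[of n] by simp
  define w where "w = (\<lambda>x::'a. indicator K x *\<^sub>R (B * (M * norm e)))"
  have xK': "x + \<tau> *\<^sub>R e \<in> K'" if "x \<in> K" "\<bar>\<tau>\<bar> \<le> d" for x \<tau>
    using K'1[OF that(1)] de[OF that(2)] by (auto simp: subset_iff dist_norm)
  have int: "integrable lborel (\<lambda>x. g x \<bullet> v (x + \<tau> *\<^sub>R e))" if "\<bar>\<tau>\<bar> \<le> d" for \<tau>
    by (rule compact_support_integrable[OF cK])
      (use test_funD(4)[OF t] xK' that in \<open>auto intro!: continuous_intros test_funD(6)[OF t] continuous_on_compose2[OF continuous_on_subset[OF cv K'W]]\<close>)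
  have q: "(\<lambda>n. \<integral>x. g x \<bullet> ((v (x + s n *\<^sub>R e) - v x) /\<^sub>R s n) \<partial>lborel) \<longlonglongrightarrow> (\<integral>x. g x \<bullet> H x e \<partial>lborel)"
  proof (rule integral_dominated_convergence[where w=w])
    have "integrable lborel (\<lambda>x. g x \<bullet> H x e)"
      by (rule compact_support_integrable[OF cK])
        (use test_funD(4)[OF t] in \<open>auto intro!: continuous_intros test_funD(6)[OF t] continuous_on_subset[OF v(2) K(1)]\<close>)
    then show "(\<lambda>x. g x \<bullet> H x e) \<in> borel_measurable lborel" by (rule borel_measurable_integrable)
    show "(\<lambda>x. g x \<bullet> ((v (x + s n *\<^sub>R e) - v x) /\<^sub>R s n)) \<in> borel_measurable lborel" for n
    proof -
      have "(\<lambda>x. g x \<bullet> ((v (x + s n *\<^sub>R e) - v x) /\<^sub>R s n))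
          = (\<lambda>x. (g x \<bullet> v (x + s n *\<^sub>R e) - g x \<bullet> v (x + 0 *\<^sub>R e)) / s n)"
        by (auto simp: inner_diff_right divide_inverse_commute)
      moreover have "(\<lambda>x. (g x \<bullet> v (x + s n *\<^sub>R e) - g x \<bullet> v (x + 0 *\<^sub>R e)) / s n) \<in> borel_measurable lborel"
        using int[of "s n"] int[of 0] s1[of n] d
        by (intro borel_measurable_divide borel_measurable_diff borel_measurable_integrable borel_measurable_const) auto
      ultimately show ?thesis by simp
    qed
    show "integrable lborel w" unfolding w_def by (intro borel_integrable_compact cK) auto
    show "AE x in lborel. (\<lambda>n. g x \<bullet> ((v (x + s n *\<^sub>R e) - v x) /\<^sub>R s n)) \<longlonglongrightarrow> g x \<bullet> H x e"
    proof (rule AE_I2)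
      fix x
      show "(\<lambda>n. g x \<bullet> ((v (x + s n *\<^sub>R e) - v x) /\<^sub>R s n)) \<longlonglongrightarrow> g x \<bullet> H x e"
      proof (cases "x \<in> K")
        case True
        then show ?thesis
          using K(1) by (intro tendsto_inner tendsto_const has_derivative_directional_limit[OF v(1) s0 s2]) auto
      qed (simp add: test_funD(4)[OF t])
    qed
    show "AE x in lborel. norm (g x \<bullet> ((v (x + s n *\<^sub>R e) - v x) /\<^sub>R s n)) \<le> w x" for n
    proof (rule AE_I2)
      fix x
      show "norm (g x \<bullet> ((v (x + s n *\<^sub>R e) - v x) /\<^sub>R s n)) \<le> w x"
      proof (cases "x \<in> K")
        case True
        have "norm (v (x + s n *\<^sub>R e) - v x) \<le> M * norm ((x + s n *\<^sub>R e) - x)"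
        proof (rule differentiable_bound[of "cball x r"])
          fix z assume z: "z \<in> cball x r"
          then have zz: "z \<in> K'" using K'1[OF True] by auto
          then show "(v has_derivative blinfun_apply (H z)) (at z within cball x r)"
            using v(1)[of z] K'W by (auto intro: has_derivative_at_withinI)
          show "onorm (blinfun_apply (H z)) \<le> M" using M(2)[OF zz] by (simp add: norm_blinfun.rep_eq)
        qed (use r de[of "s n"] s1[of n] in \<open>auto simp: dist_norm\<close>)
        then have a: "norm (v (x + s n *\<^sub>R e) - v x) \<le> (M * norm e) * s n"
          using s1(1)[of n] by (simp add: mult.assoc mult.commute[of "s n"])
        have "norm ((v (x + s n *\<^sub>R e) - v x) /\<^sub>R s n) = norm (v (x + s n *\<^sub>R e) - v x) / s n"
          using s1(1)[of n] by (simp add: divide_inverse_commute)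
        also have "\<dots> \<le> M * norm e"
          using a s1(1)[of n] by (simp add: pos_divide_le_eq)
        finally have "norm ((v (x + s n *\<^sub>R e) - v x) /\<^sub>R s n) \<le> M * norm e" .
        then have "norm (g x) * norm ((v (x + s n *\<^sub>R e) - v x) /\<^sub>R s n) \<le> B * (M * norm e)"
          using B by (intro mult_mono) auto
        then have "norm (g x \<bullet> ((v (x + s n *\<^sub>R e) - v x) /\<^sub>R s n)) \<le> B * (M * norm e)"
          unfolding real_norm_def by (rule order_trans[OF Cauchy_Schwarz_ineq2])
        then show ?thesis using True by (simp add: w_def)
      qed (simp add: test_funD(4)[OF t] w_def)
    qed
  qed
  have "(\<integral>x. g x \<bullet> ((v (x + s n *\<^sub>R e) - v x) /\<^sub>R s n) \<partial>lborel) = 0" for n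
  proof -
    have "(\<integral>x. g x \<bullet> ((v (x + s n *\<^sub>R e) - v x) /\<^sub>R s n) \<partial>lborel)
        = (\<integral>x. (g x \<bullet> v (x + s n *\<^sub>R e) - g x \<bullet> v (x + 0 *\<^sub>R e)) / s n \<partial>lborel)"
      by (rule Bochner_Integration.integral_cong) (auto simp: inner_diff_right divide_inverse_commute)
    also have "\<dots> = ((\<integral>x. g x \<bullet> v (x + s n *\<^sub>R e) \<partial>lborel) - (\<integral>x. g x \<bullet> v (x + 0 *\<^sub>R e) \<partial>lborel)) / s n"
      using int[of "s n"] int[of 0] s1[of n] d by (subst integral_divide_zero, subst Bochner_Integration.integral_diff) auto
    also have "\<dots> = 0" using shift0[of "s n"] shift0[of 0] s1[of n] d by simp
    finally show ?thesis .
  qed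
  with q have "(\<lambda>n. 0) \<longlonglongrightarrow> (\<integral>x. g x \<bullet> H x e \<partial>lborel)" by (simp only:)
  then show ?thesis by (rule LIMSEQ_unique[OF tendsto_const, symmetric])
qed

section \<open>Cut-off functions, volumes of strips and tubes, partitions of unity\<close>

definition pos2 :: "real \<Rightarrow> real" where "pos2 s = (max 0 s)\<^sup>2"

lemma pos2_deriv: "(pos2 has_real_derivative 2 * max 0 s) (at s)"
proof -
  consider "s > 0" | "s < 0" | "s = 0" by linarith
  then show ?thesis
  proof cases
    case 1
    have "((\<lambda>t. t\<^sup>2) has_real_derivative 2 * max 0 s) (at s)"
      using 1 by (auto intro!: derivative_eq_intros)
    then show ?thesis
      by (rule DERIV_cong_ev[THEN iffD1, rotated -1])
        (use 1 eventually_nhds_in_open[of "{0<..}" s] in \<open>auto simp: pos2_def elim!: eventually_mono\<close>)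
  next
    case 2
    have "((\<lambda>t. 0) has_real_derivative 2 * max 0 s) (at s)"
      using 2 by (auto intro!: derivative_eq_intros)
    then show ?thesis
      by (rule DERIV_cong_ev[THEN iffD1, rotated -1])
        (use 2 eventually_nhds_in_open[of "{..<0}" s] in \<open>auto simp: pos2_def elim!: eventually_mono\<close>)
  next
    case 3
    have "((\<lambda>h. pos2 h / h) \<longlongrightarrow> 0) (at 0)"
    proof (rule Lim_null_comparison)
      show "\<forall>\<^sub>F h in at 0. norm (pos2 h / h) \<le> \<bar>h\<bar>"
        by (rule always_eventually) (auto simp: pos2_def max_def power2_eq_square)
      show "((\<lambda>h::real. \<bar>h\<bar>) \<longlongrightarrow> 0) (at 0)" by (intro tendsto_eq_intros) auto
    qed
    then show ?thesis using 3 by (simp add: DERIV_def pos2_def)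
  qed
qed

text \<open>A piecewise quadratic C1 step: the second derivative is 4 between 1 and 3/2 and -4
  between 3/2 and 2, so the value rises from 0 to 1 with slope at most 2, attained at 3/2.\<close>

definition step :: "real \<Rightarrow> real" where
  "step s = 2 * pos2 (s - 1) - 4 * pos2 (s - 3/2) + 2 * pos2 (s - 2)"

definition step' :: "real \<Rightarrow> real" where
  "step' s = 4 * max 0 (s - 1) - 8 * max 0 (s - 3/2) + 4 * max 0 (s - 2)"

lemma step_deriv: "(step has_real_derivative step' s) (at s)"
proof -
  have a: "((\<lambda>s. pos2 (s - c)) has_real_derivative 2 * max 0 (s - c)) (at s)" for c
  proof -
    have "((\<lambda>s. pos2 (s - c)) has_real_derivative 2 * max 0 (s - c) * (1 - 0)) (at s)"
      by (rule DERIV_chain2[OF pos2_deriv]) (intro derivative_intros)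
    then show ?thesis by simp
  qed
  show ?thesis unfolding step_def[abs_def] step'_def
    by (rule derivative_eq_intros a refl)+ simp
qed

lemma continuous_step': "continuous_on S step'"
  unfolding step'_def[abs_def] by (intro continuous_intros)

lemma step_eq_0: "s \<le> 1 \<Longrightarrow> step s = 0"
  by (simp add: step_def pos2_def)

lemma step_eq_1: "s \<ge> 2 \<Longrightarrow> step s = 1"
  by (simp add: step_def pos2_def power2_eq_square algebra_simps)

lemma step'_nonneg: "0 \<le> step' s" and step'_le: "step' s \<le> 2"
  by (auto simp: step'_def max_def)

lemma step'_eq_0: "s \<le> 1 \<or> s \<ge> 2 \<Longrightarrow> step' s = 0"
  by (auto simp: step'_def max_def)

lemma step_mono: "s \<le> t \<Longrightarrow> step s \<le> step t"
  by (rule DERIV_nonneg_imp_nondecreasing) (use step_deriv step'_nonneg in blast)+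

lemma step_bounds: "0 \<le> step s" "step s \<le> 1"
proof -
  show "0 \<le> step s" using step_mono[of "min s 1" s] step_eq_0[of "min s 1"] by simp
  show "step s \<le> 1" using step_mono[of s "max s 2"] step_eq_1[of "max s 2"] by simp
qed

lemma compact_restrict_closed:
  assumes "compact K" "continuous_on K f" "closed T"
  shows "compact {x \<in> K. f x \<in> T}"
proof -
  have "{x \<in> K. f x \<in> T} = K \<inter> f -` T" by auto
  then show ?thesis
    using closedin_compact[OF assms(1) continuous_closedin_preimage[OF assms(2,3)]] by simp
qed

text \<open>Turns separation into smallness: the more disjoint translates of a set fit in a ball,
  the smaller its volume.\<close>

lemma packing_volume:
  fixes S :: "'a::euclidean_space set"
  assumes S: "compact S" and J: "finite J"
    and disj: "\<And>i j. i \<in> J \<Longrightarrow> j \<in> J \<Longrightarrow> i \<noteq> j \<Longrightarrow> ((+) (a i) ` S) \<inter> ((+) (a j) ` S) = {}"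
    and sub: "\<And>i. i \<in> J \<Longrightarrow> (+) (a i) ` S \<subseteq> cball 0 R"
  shows "real (card J) * measure lebesgue S \<le> measure lebesgue (cball (0::'a) R)"
proof -
  have cS: "compact ((+) (a i) ` S)" for i using S by (rule compact_translation)
  have fm: "(+) (a i) ` S \<in> fmeasurable lebesgue" for i using cS[of i] by (rule lmeasurable_compact)
  have "(\<Sum>i\<in>J. measure lebesgue ((+) (a i) ` S)) = measure lebesgue (\<Union>i\<in>J. (+) (a i) ` S)"
    by (rule measure_UNION'[symmetric]) (use J fm disj in \<open>auto simp: pairwise_def disjnt_def\<close>)
  also have "\<dots> \<le> measure lebesgue (cball (0::'a) R)"
    using sub by (intro measure_mono_fmeasurable) (auto intro!: sets.finite_UN J fmeasurableD[OF fm])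
  finally show ?thesis by (simp add: measure_translation)
qed

text \<open>Translating the strip along \<open>e\<close> by multiples of \<open>2 * \<epsilon> / \<kappa>\<close> gives disjoint copies inside a
  fixed ball.\<close>
lemma strip_volume:
  fixes K :: "'a::euclidean_space set" and f :: "'a \<Rightarrow> real"
  assumes K: "compact K" and f: "continuous_on K f" and e: "norm e = 1" and k: "\<kappa> > 0"
    and mono: "\<And>x s. x \<in> K \<Longrightarrow> x + s *\<^sub>R e \<in> K \<Longrightarrow> s \<ge> 0 \<Longrightarrow> f (x + s *\<^sub>R e) \<ge> f x + \<kappa> * s"
  obtains C where "C > 0" "\<And>\<epsilon>. 0 < \<epsilon> \<Longrightarrow> measure lebesgue {x \<in> K. 0 \<le> f x \<and> f x \<le> \<epsilon>} \<le> C * \<epsilon>"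
proof -
  obtain R where R: "R > 0" "\<And>x. x \<in> K \<Longrightarrow> norm x \<le> R"
    using compact_imp_bounded[OF K] unfolding bounded_pos by auto
  define V where "V = measure lebesgue (cball (0::'a) (R + 1))"
  have V0: "V \<ge> 0" by (simp add: V_def)
  have m_mono: "measure lebesgue {x \<in> K. 0 \<le> f x \<and> f x \<le> \<epsilon>} \<le> V" for \<epsilon>
    unfolding V_def
  proof (rule measure_mono_fmeasurable)
    have "compact {x \<in> K. 0 \<le> f x \<and> f x \<le> \<epsilon>}"
      using compact_restrict_closed[OF K f, of "{0..\<epsilon>}"] by simp
    then show "{x \<in> K. 0 \<le> f x \<and> f x \<le> \<epsilon>} \<in> sets lebesgue" by (simp add: fmeasurableD lmeasurable_compact)
    show "{x \<in> K. 0 \<le> f x \<and> f x \<le> \<epsilon>} \<subseteq> cball 0 (R + 1)" using R(2) by fastforce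
  qed simp
  \<comment> \<open>For \<open>\<delta> \<le> 1/2\<close> at least \<open>1 / (2 * \<delta>)\<close>
    translates fit, so the volume is at most \<open>V * 2 * \<delta>\<close>, which is
    \<open>V * 4 * \<epsilon> / \<kappa>\<close>. Larger \<open>\<delta>\<close> need only the
    trivial bound by \<open>V\<close>; the summand 1 keeps \<open>C\<close> positive.\<close>
  define C where "C = (V + 1) * (4 / \<kappa>)"
  show ?thesis
  proof (rule that[of C])
    show "C > 0" using V0 k by (simp add: C_def)
    fix \<epsilon> :: real assume eps: "\<epsilon> > 0"
    \<comment> \<open>A shift by \<open>\<delta>\<close> raises \<open>f\<close> by at least
      \<open>2 * \<epsilon>\<close>, more than the strip allows, so distinct translates are
      disjoint.\<close>
    define \<delta> where "\<delta> = 2 * \<epsilon> / \<kappa>"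
    have d: "\<delta> > 0" using eps k by (simp add: \<delta>_def)
    define S where "S = {x \<in> K. 0 \<le> f x \<and> f x \<le> \<epsilon>}"
    define M where "M = nat \<lfloor>1 / \<delta>\<rfloor>"
    have cS: "compact S"
      using compact_restrict_closed[OF K f, of "{0..\<epsilon>}"] by (simp add: S_def)
    have no: False if "k < l" "x \<in> S" "y \<in> S" "x + (real k * \<delta>) *\<^sub>R e = y + (real l * \<delta>) *\<^sub>R e" for k l x y
    proof -
      have x: "x = y + ((real l - real k) * \<delta>) *\<^sub>R e" using that(4) by (simp add: algebra_simps)
      have "f x \<ge> f y + \<kappa> * ((real l - real k) * \<delta>)"
        using mono[of y "(real l - real k) * \<delta>"] that x d by (auto simp: S_def)
      moreover have "\<kappa> * ((real l - real k) * \<delta>) \<ge> \<kappa> * (1 * \<delta>)"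
        using that(1) k d by (intro mult_left_mono mult_right_mono) auto
      moreover have "\<kappa> * (1 * \<delta>) = 2 * \<epsilon>" using k by (simp add: \<delta>_def)
      ultimately show False using that(2,3) eps by (simp add: S_def)
    qed
    have "real (card {..<M}) * measure lebesgue S \<le> V"
      unfolding V_def
    proof (rule packing_volume[where a="\<lambda>i. (real i * \<delta>) *\<^sub>R e"])
      fix i j assume ij: "i \<in> {..<M}" "j \<in> {..<M}" "i \<noteq> j"
      show "(+) ((real i * \<delta>) *\<^sub>R e) ` S \<inter> (+) ((real j * \<delta>) *\<^sub>R e) ` S = {}"
      proof (rule ccontr)
        assume "\<not> ?thesis"
        then obtain x y where xy: "x \<in> S" "y \<in> S" "x + (real i * \<delta>) *\<^sub>R e = y + (real j * \<delta>) *\<^sub>R e"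
          by (auto simp: add.commute)
        show False
        proof (cases "i < j")
          case True
          then show False by (rule no[OF _ xy])
        next
          case False
          then have "j < i" using ij(3) by simp
          then show False by (rule no[OF _ xy(2,1) xy(3)[symmetric]])
        qed
      qed
    next
      fix i assume i: "i \<in> {..<M}"
      have "real i \<le> 1 / \<delta>" using i d by (simp add: M_def) linarith
      then have "real i * \<delta> \<le> 1" using d by (simp add: pos_le_divide_eq)
      show "(+) ((real i * \<delta>) *\<^sub>R e) ` S \<subseteq> cball 0 (R + 1)"
      proof clarsimp
        fix x assume "x \<in> S"
        then have "norm x \<le> R" using R by (simp add: S_def)
        moreover have "norm ((real i * \<delta>) *\<^sub>R e) \<le> 1" using \<open>real i * \<delta> \<le> 1\<close> d e by simp
        ultimately show "norm ((real i * \<delta>) *\<^sub>R e + x) \<le> R + 1"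
          using norm_triangle_ineq[of "(real i * \<delta>) *\<^sub>R e" x] by linarith
      qed
    qed (use cS in auto)
    then have p: "real M * measure lebesgue S \<le> V" by simp
    show "measure lebesgue {x \<in> K. 0 \<le> f x \<and> f x \<le> \<epsilon>} \<le> C * \<epsilon>"
    proof (cases "\<delta> \<le> 1/2")
      case True
      have "real M \<ge> 1 / \<delta> - 1" unfolding M_def by linarith
      moreover have "1 / \<delta> - 1 \<ge> 1 / (2 * \<delta>)" using True d by (simp add: field_simps)
      ultimately have "1 / (2 * \<delta>) * measure lebesgue S \<le> real M * measure lebesgue S"
        by (intro mult_right_mono) auto
      with p have "1 / (2 * \<delta>) * measure lebesgue S \<le> V" by linarith
      then have "measure lebesgue S \<le> V * (2 * \<delta>)" using d by (simp add: field_simps)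
      also have "\<dots> \<le> (V + 1) * (2 * \<delta>)" using d by (intro mult_right_mono) auto
      also have "\<dots> = C * \<epsilon>" by (simp add: C_def \<delta>_def)
      finally show ?thesis by (simp add: S_def)
    next
      case False
      have "measure lebesgue {x \<in> K. 0 \<le> f x \<and> f x \<le> \<epsilon>} \<le> V * 1" using m_mono by simp
      also have "\<dots> \<le> (V + 1) * (2 * \<delta>)" using False V0 by (intro mult_mono) auto
      also have "\<dots> = C * \<epsilon>" by (simp add: C_def \<delta>_def)
      finally show ?thesis .
    qed
  qed
qed

text \<open>The packing argument with a planar grid of translates in the directions
  \<open>e1\<close> and \<open>e2\<close>: their number is of order
  \<open>1 / \<epsilon>\<^sup>2\<close>, whence the quadratic bound.\<close>

lemma tube_volume:
  fixes K :: "'a::euclidean_space set"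
  assumes K: "compact K" and e: "norm e1 = 1" "norm e2 = 1" "e1 \<bullet> e2 = 0"
  obtains C where "C > 0"
    "\<And>\<epsilon>. 0 < \<epsilon> \<Longrightarrow> measure lebesgue {x \<in> K. \<bar>x \<bullet> e1\<bar> \<le> \<epsilon> \<and> \<bar>x \<bullet> e2\<bar> \<le> \<epsilon>} \<le> C * \<epsilon>\<^sup>2"
proof -
  obtain R where R: "R > 0" "\<And>x. x \<in> K \<Longrightarrow> norm x \<le> R"
    using compact_imp_bounded[OF K] unfolding bounded_pos by auto
  define V where "V = measure lebesgue (cball (0::'a) (R + 2))"
  have V0: "V \<ge> 0" by (simp add: V_def)
  \<comment> \<open>With \<open>M \<ge> 1 / (2 * \<delta>)\<close> the \<open>M * M\<close>
    translates give volume at most \<open>V * (2 * \<delta>)\<^sup>2\<close>, and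
    \<open>2 * \<delta>\<close> is \<open>6 * \<epsilon>\<close>.\<close>
  define C where "C = (V + 1) * 36"
  show ?thesis
  proof (rule that[of C])
    show "C > 0" using V0 by (simp add: C_def)
    fix \<epsilon> :: real assume eps: "\<epsilon> > 0"
    \<comment> \<open>The grid spacing exceeds the tube width \<open>2 * \<epsilon>\<close>, so each
      coordinate separates the translates.\<close>
    define \<delta> where "\<delta> = 3 * \<epsilon>"
    have d: "\<delta> > 0" using eps by (simp add: \<delta>_def)
    define S where "S = {x \<in> K. \<bar>x \<bullet> e1\<bar> \<le> \<epsilon> \<and> \<bar>x \<bullet> e2\<bar> \<le> \<epsilon>}"
    have S_eq: "S = K \<inter> ({x. \<bar>x \<bullet> e1\<bar> \<le> \<epsilon>} \<inter> {x. \<bar>x \<bullet> e2\<bar> \<le> \<epsilon>})" by (auto simp: S_def)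
    have cS: "compact S" unfolding S_eq
      by (intro compact_Int_closed K closed_Int closed_Collect_le continuous_intros)
    define M where "M = nat \<lfloor>1 / \<delta>\<rfloor>"
    define a where "a = (\<lambda>(i::nat,j::nat). (real i * \<delta>) *\<^sub>R e1 + (real j * \<delta>) *\<^sub>R e2)"
    have ee: "e1 \<bullet> e1 = 1" "e2 \<bullet> e2 = 1" "e2 \<bullet> e1 = 0" using e by (simp_all add: norm_eq_1 inner_commute)
    have sep: "i = j" if "\<bar>x\<bar> \<le> \<epsilon>" "\<bar>y\<bar> \<le> \<epsilon>" "x + real i * \<delta> = y + real j * \<delta>" for i j x y
    proof (rule ccontr)
      assume "i \<noteq> j"
      then have "\<bar>real i - real j\<bar> \<ge> 1" by linarith
      then have "\<bar>real i - real j\<bar> * \<delta> \<ge> \<delta>" using d by simp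
      moreover have "\<bar>real i - real j\<bar> * \<delta> = \<bar>y - x\<bar>"
      proof -
        have "(real i - real j) * \<delta> = y - x" using that(3) by (simp add: left_diff_distrib)
        then show ?thesis using d by (metis abs_mult abs_of_pos)
      qed
      ultimately have "3 * \<epsilon> \<le> \<bar>y - x\<bar>" by (simp add: \<delta>_def)
      then show False using that(1,2) eps by linarith
    qed
    have "real (card ({..<M} \<times> {..<M})) * measure lebesgue S \<le> V"
      unfolding V_def
    proof (rule packing_volume[where a=a])
      fix i j assume ij: "i \<in> {..<M} \<times> {..<M}" "j \<in> {..<M} \<times> {..<M}" "i \<noteq> j"
      show "(+) (a i) ` S \<inter> (+) (a j) ` S = {}"
      proof (rule ccontr)
        assume "\<not> ?thesis"
        then obtain x y where xy: "x \<in> S" "y \<in> S" "x + a i = y + a j"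
          by (auto simp: add.commute)
        have "(x + a i) \<bullet> e1 = (y + a j) \<bullet> e1" "(x + a i) \<bullet> e2 = (y + a j) \<bullet> e2" using xy(3) by simp_all
        then have "fst i = fst j" "snd i = snd j" using xy(1,2)
          by (auto simp: a_def case_prod_beta inner_add_left ee e(3) S_def intro: sep)
        then show False using ij(3) by (simp add: prod_eq_iff)
      qed
    next
      fix ij assume ij: "ij \<in> {..<M} \<times> {..<M}"
      have *: "real i * \<delta> \<le> 1" if "i < M" for i
      proof -
        have "real i \<le> 1 / \<delta>" using that d by (simp add: M_def) linarith
        then show ?thesis using d by (simp add: pos_le_divide_eq)
      qed
      show "(+) (a ij) ` S \<subseteq> cball 0 (R + 2)"
      proof clarsimp
        fix x assume "x \<in> S"
        then have "norm x \<le> R" using R by (simp add: S_def)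
        moreover have "norm (a ij) \<le> 1 + 1"
          unfolding a_def case_prod_beta
          by (rule norm_triangle_le) (use ij *[of "fst ij"] *[of "snd ij"] d e in \<open>auto intro!: add_mono\<close>)
        ultimately show "norm (a ij + x) \<le> R + 2"
          using norm_triangle_ineq[of "a ij" x] by linarith
      qed
    qed (use cS in auto)
    then have p: "real M * real M * measure lebesgue S \<le> V" by simp
    show "measure lebesgue {x \<in> K. \<bar>x \<bullet> e1\<bar> \<le> \<epsilon> \<and> \<bar>x \<bullet> e2\<bar> \<le> \<epsilon>} \<le> C * \<epsilon>\<^sup>2"
    proof (cases "\<delta> \<le> 1/2")
      case True
      have "real M \<ge> 1 / \<delta> - 1" unfolding M_def by linarith
      moreover have "1 / \<delta> - 1 \<ge> 1 / (2 * \<delta>)" using True d by (simp add: field_simps)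
      ultimately have M: "1 / (2 * \<delta>) \<le> real M" by linarith
      have "1 / (2 * \<delta>) * (1 / (2 * \<delta>)) * measure lebesgue S \<le> real M * real M * measure lebesgue S"
        using M d by (intro mult_right_mono mult_mono) auto
      with p have "1 / (2 * \<delta>) * (1 / (2 * \<delta>)) * measure lebesgue S \<le> V" by linarith
      then have "measure lebesgue S \<le> V * (2 * \<delta>)\<^sup>2" using d by (simp add: field_simps power2_eq_square)
      also have "\<dots> \<le> (V + 1) * (2 * \<delta>)\<^sup>2" using d by (intro mult_right_mono) auto
      also have "\<dots> = C * \<epsilon>\<^sup>2" by (simp add: C_def \<delta>_def power2_eq_square)
      finally show ?thesis by (simp add: S_def)
    next
      case False
      have "measure lebesgue S \<le> V" unfolding V_def
      proof (rule measure_mono_fmeasurable)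
        show "S \<subseteq> cball 0 (R + 2)" using R(2) by (fastforce simp: S_def)
        show "S \<in> sets lebesgue" using cS by (simp add: fmeasurableD lmeasurable_compact)
      qed simp
      also have "V \<le> (V + 1) * 1" by simp
      also have "\<dots> \<le> (V + 1) * (2 * \<delta>)\<^sup>2"
      proof (intro mult_left_mono)
        have "1 < 2 * \<delta>" using False by simp
        then show "1 \<le> (2 * \<delta>)\<^sup>2" by (intro one_le_power) simp
      qed (use V0 in auto)
      also have "\<dots> = C * \<epsilon>\<^sup>2" by (simp add: C_def \<delta>_def power2_eq_square)
      finally show ?thesis by (simp add: S_def)
    qed
  qed
qed

lemma C1g_dist_sq: "C1g (\<lambda>x. (x - a) \<bullet> (x - a)) (\<lambda>x. 2 *\<^sub>R (x - a)) UNIV"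
  by (rule C1gI) (auto intro!: derivative_eq_intros continuous_intros simp: inner_commute algebra_simps)

lemma C1g_sum:
  assumes "\<And>i. i \<in> F \<Longrightarrow> C1g (f i) (g i) W"
  shows "C1g (\<lambda>x. \<Sum>i\<in>F. f i x) (\<lambda>x. \<Sum>i\<in>F. g i x) W"
  using assms by (auto simp: C1g_def inner_sum_left intro!: has_derivative_sum continuous_on_sum)

text \<open>The vanishing sum of gradients is a separate claim: \<open>K\<close> may have empty
  interior, so it does not follow from the sum of the functions being 1 on \<open>K\<close>. The
  normalising denominator is built to give both.\<close>

theorem C1_partition_of_unity:
  fixes K :: "'a::euclidean_space set"
  assumes K: "compact K" and r: "\<And>x. x \<in> K \<Longrightarrow> r x > 0"
  obtains F c g where "finite F" "F \<subseteq> K" "\<And>i. i \<in> F \<Longrightarrow> test_fun (c i) (g i) (cball i (r i))"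
    "\<And>i x. (c i :: 'a \<Rightarrow> real) x \<ge> 0" "\<And>x. x \<in> K \<Longrightarrow> (\<Sum>i\<in>F. c i x) = 1" "\<And>x. x \<in> K \<Longrightarrow> (\<Sum>i\<in>F. g i x) = 0"
proof (cases "K = {}")
  case True
  then show ?thesis using that[of "{}" "\<lambda>i x. 0" "\<lambda>i x. 0"] by simp
next
  case False
  obtain F where F: "F \<subseteq> K" "finite F" "K \<subseteq> (\<Union>i\<in>F. ball i (r i))"
  proof (rule compactE_image[OF K, of K "\<lambda>x. ball x (r x)"])
    show "K \<subseteq> (\<Union>x\<in>K. ball x (r x))" using r by (intro subsetI UN_I) auto
  qed auto
  define b where "b = (\<lambda>i x. pos2 ((r i)\<^sup>2 - (x - i) \<bullet> (x - i)))"
  define gb where "gb = (\<lambda>i x. (2 * max 0 ((r i)\<^sup>2 - (x - i) \<bullet> (x - i))) *\<^sub>R (- 2 *\<^sub>R (x - i)))"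
  have b: "C1g (b i) (gb i) UNIV" for i
  proof -
    have "C1g (\<lambda>x. (r i)\<^sup>2 - (x - i) \<bullet> (x - i)) (\<lambda>x. 0 - 2 *\<^sub>R (x - i)) UNIV"
      by (intro C1g_diff C1g_const C1g_dist_sq)
    then have "C1g (\<lambda>x. pos2 ((r i)\<^sup>2 - (x - i) \<bullet> (x - i)))
       (\<lambda>x. (2 * max 0 ((r i)\<^sup>2 - (x - i) \<bullet> (x - i))) *\<^sub>R (0 - 2 *\<^sub>R (x - i))) UNIV"
      by (rule C1g_compose) (auto intro!: pos2_deriv continuous_intros)
    then show ?thesis by (simp add: b_def gb_def)
  qed
  have b0: "b i x \<ge> 0" for i x by (simp add: b_def pos2_def)
  have bpos: "b i x > 0" if "x \<in> ball i (r i)" for i x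
  proof -
    have "norm (x - i) < r i" using that by (simp add: dist_norm norm_minus_commute)
    then have "(norm (x - i))\<^sup>2 < (r i)\<^sup>2" by (intro power_strict_mono) auto
    then show ?thesis by (simp add: b_def pos2_def power2_norm_eq_inner)
  qed
  have bz: "b i x = 0" if "x \<notin> cball i (r i)" "i \<in> F" for i x
  proof -
    have "norm (x - i) > r i" using that by (simp add: dist_norm norm_minus_commute)
    then have "(norm (x - i))\<^sup>2 \<ge> (r i)\<^sup>2" using r[of i] that F(1) by (intro power_mono) (auto intro: less_imp_le)
    then show ?thesis by (simp add: b_def pos2_def power2_norm_eq_inner)
  qed
  define s where "s = (\<lambda>x. \<Sum>i\<in>F. b i x)"
  define gs where "gs = (\<lambda>x. \<Sum>i\<in>F. gb i x)"
  have s: "C1g s gs UNIV" unfolding s_def gs_def by (intro C1g_sum b)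
  have spos: "s x > 0" if "x \<in> K" for x
  proof -
    have "x \<in> (\<Union>i\<in>F. ball i (r i))" using subsetD[OF F(3) that] .
    then obtain i where "i \<in> F" "x \<in> ball i (r i)" by (rule UN_E)
    then show ?thesis unfolding s_def using b0 bpos F(2) by (intro sum_pos2[of F i]) auto
  qed
  obtain x0 where x0: "x0 \<in> K" "\<And>x. x \<in> K \<Longrightarrow> s x0 \<le> s x"
    using continuous_attains_inf[OF K False continuous_on_subset[OF C1g_cont[OF s]]] by auto
  define m0 where "m0 = s x0"
  have m0: "m0 > 0" "\<And>x. x \<in> K \<Longrightarrow> s x \<ge> m0" using spos x0 by (auto simp: m0_def)
  have s0: "s x \<ge> 0" for x unfolding s_def by (intro sum_nonneg b0)
  \<comment> \<open>The sum \<open>s\<close> may vanish away from \<open>K\<close>, so it cannot be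
    a denominator. \<open>D\<close> is positive on all nonnegative numbers and agrees with the
    identity, with derivative 1, from the minimum \<open>m0\<close> of \<open>s\<close> on
    \<open>K\<close> upwards.\<close>
  define D where "D = (\<lambda>t. t + pos2 (m0 - t))"
  have Dpos: "D t > 0" if "t \<ge> 0" for t
    using that m0(1) by (cases "t > 0") (auto simp: D_def pos2_def add_pos_nonneg)
  define D' where "D' = (\<lambda>t. 1 - 2 * max 0 (m0 - t))"
  have D: "(D has_real_derivative D' t) (at t)" for t
  proof -
    have "((\<lambda>t. pos2 (m0 - t)) has_real_derivative 2 * max 0 (m0 - t) * (0 - 1)) (at t)"
      by (rule DERIV_chain2[OF pos2_deriv]) (intro derivative_intros)
    then show ?thesis unfolding D_def D'_def by (auto intro!: derivative_eq_intros)
  qed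
  have inv: "C1g (\<lambda>x. inverse (D (s x))) (\<lambda>x. (- (inverse (D (s x)) * D' (s x) * inverse (D (s x)))) *\<^sub>R gs x) UNIV"
  proof (rule C1g_compose[OF s, where \<theta>="\<lambda>t. inverse (D t)" and \<theta>'="\<lambda>t. - (inverse (D t) * D' t * inverse (D t))"])
    fix t assume "t \<in> range s"
    then have "D t \<noteq> 0" using Dpos[of t] s0 by auto
    then show "((\<lambda>t. inverse (D t)) has_real_derivative - (inverse (D t) * D' t * inverse (D t))) (at t)"
      by (rule DERIV_inverse'[OF D])
  next
    have cD: "continuous_on (range s) D" by (rule DERIV_continuous_on[OF has_field_derivative_at_within[OF D]])
    have "D t \<noteq> 0" if "t \<in> range s" for t using that Dpos[of t] s0 by auto
    then have "\<forall>t\<in>range s. D t \<noteq> 0" by blast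
    then show "continuous_on (range s) (\<lambda>t. - (inverse (D t) * D' t * inverse (D t)))"
      unfolding D'_def by (intro continuous_on_minus continuous_on_mult continuous_on_inverse cD continuous_on_diff continuous_on_const continuous_on_max continuous_on_id)
  qed
  define c where "c = (\<lambda>i x. b i x * inverse (D (s x)))"
  define g where "g = (\<lambda>i x. b i x *\<^sub>R ((- (inverse (D (s x)) * D' (s x) * inverse (D (s x)))) *\<^sub>R gs x) + inverse (D (s x)) *\<^sub>R gb i x)"
  have cg: "C1g (c i) (g i) UNIV" for i unfolding c_def g_def by (rule C1g_mult[OF b inv])
  show ?thesis
  proof (rule that[OF F(2,1)])
    show "test_fun (c i) (g i) (cball i (r i))" if "i \<in> F" for i
      by (rule test_funI[OF cg]) (use bz that in \<open>auto simp: c_def\<close>)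
    show "c i x \<ge> 0" for i x using b0[of i x] Dpos[OF s0[of x]] by (simp add: c_def)
    fix x assume x: "x \<in> K"
    have D1: "D (s x) = s x" "D' (s x) = 1" using m0(2)[OF x] by (auto simp: D_def D'_def pos2_def)
    have sx: "s x \<noteq> 0" using spos[OF x] by simp
    show "(\<Sum>i\<in>F. c i x) = 1" using sx D1 by (simp add: c_def s_def flip: sum_distrib_right)
    have "(\<Sum>i\<in>F. g i x) = (\<Sum>i\<in>F. b i x) *\<^sub>R ((- (inverse (s x) * inverse (s x))) *\<^sub>R gs x) + inverse (s x) *\<^sub>R (\<Sum>i\<in>F. gb i x)"
      unfolding g_def D1 by (simp add: sum_subtractf scaleR_sum_left scaleR_sum_right sum_distrib_right)
    also have "\<dots> = s x *\<^sub>R ((- (inverse (s x) * inverse (s x))) *\<^sub>R gs x) + inverse (s x) *\<^sub>R gs x"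
      by (simp only: s_def gs_def)
    also have "\<dots> = 0" using sx by simp
    finally show "(\<Sum>i\<in>F. g i x) = 0" .
  qed
qed

section \<open>Flux inequalities for weak divergences\<close>

text \<open>The points with \<open>f \<ge> 0\<close> and \<open>h \<le> - \<delta>\<close> form a
  compact set avoiding the zero level of \<open>f\<close>, so \<open>f\<close> has a positive
  minimum on it.\<close>

lemma small_level_bound:
  fixes f h :: "'a::euclidean_space \<Rightarrow> real"
  assumes K: "compact K" and f: "continuous_on K f" and h: "continuous_on K h"
    and nn: "\<And>x. x \<in> K \<Longrightarrow> f x = 0 \<Longrightarrow> h x \<ge> 0" and d: "\<delta> > 0"
  obtains \<epsilon> where "\<epsilon> > 0" "\<And>x. x \<in> K \<Longrightarrow> 0 \<le> f x \<Longrightarrow> f x \<le> \<epsilon> \<Longrightarrow> h x \<ge> - \<delta>"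
proof -
  define T where "T = {x \<in> K. (f x, h x) \<in> {0..} \<times> {..-\<delta>}}"
  have cT: "compact T" unfolding T_def
    by (intro compact_restrict_closed K continuous_on_Pair f h closed_Times closed_atLeast closed_atMost)
  show ?thesis
  proof (cases "T = {}")
    case True
    then have "h x \<ge> - \<delta>" if "x \<in> K" "0 \<le> f x" for x using that by (auto simp: T_def not_le)
    then show ?thesis using that[of 1] by simp
  next
    case False
    have "continuous_on T f" using f by (rule continuous_on_subset) (auto simp: T_def)
    then obtain x0 where x0: "x0 \<in> T" "\<And>x. x \<in> T \<Longrightarrow> f x0 \<le> f x"
      using continuous_attains_inf[OF cT False, of f] by auto
    have "f x0 > 0" using x0(1) nn[of x0] d by (cases "f x0 = 0") (auto simp: T_def)
    show ?thesis
    proof (rule that[of "f x0 / 2"])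
      fix x assume x: "x \<in> K" "0 \<le> f x" "f x \<le> f x0 / 2"
      show "h x \<ge> - \<delta>"
      proof (rule ccontr)
        assume "\<not> h x \<ge> - \<delta>"
        then have "x \<in> T" using x by (simp add: T_def)
        then show False using x0(2)[of x] x(3) \<open>f x0 > 0\<close> by simp
      qed
    qed (use \<open>f x0 > 0\<close> in simp)
  qed
qed

lemma compact_null_sets:
  fixes S :: "'a::euclidean_space set"
  assumes S: "compact S" and bound: "\<And>\<epsilon>. \<epsilon> > 0 \<Longrightarrow> measure lebesgue S \<le> C * \<epsilon>"
  shows "S \<in> null_sets lborel"
proof -
  have "measure lebesgue S = 0"
  proof (rule ccontr)
    assume "measure lebesgue S \<noteq> 0"
    then have m: "measure lebesgue S > 0" using zero_less_measure_iff by blast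
    define \<epsilon> where "\<epsilon> = measure lebesgue S / (2 * (\<bar>C\<bar> + 1))"
    have eps: "\<epsilon> > 0" using m by (simp add: \<epsilon>_def add_nonneg_pos)
    have "measure lebesgue S \<le> C * \<epsilon>" by (rule bound[OF eps])
    also have "\<dots> \<le> (\<bar>C\<bar> + 1) * \<epsilon>" using eps by (intro mult_right_mono) auto
    also have "\<dots> = measure lebesgue S / 2" by (simp add: \<epsilon>_def field_simps add_nonneg_eq_0_iff)
    finally show False using m by simp
  qed
  then have "measure lborel S = 0" using S by (simp add: measure_completion borel_compact)
  moreover have "emeasure lborel S \<noteq> \<infinity>" using emeasure_compact_finite[OF S] by simp
  ultimately have "emeasure lborel S = 0" by (simp add: emeasure_eq_ennreal_measure)
  then show ?thesis using S by (auto simp: null_sets_def borel_compact)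
qed

text \<open>\<open>weak\<close> says that \<open>G\<close> is the distributional divergence of the
  continuous field \<open>Y\<close> inside \<open>E\<close>. Nothing is assumed about the boundary
  of \<open>E\<close>.\<close>

locale weak_divergence =
  fixes E W C :: "'a::euclidean_space set" and Y :: "'a \<Rightarrow> 'a" and G :: "'a \<Rightarrow> real"
  assumes W: "open W" and C: "closed C" and E: "E = W \<inter> C"
    and Y: "continuous_on W Y" and G: "continuous_on W G"
    and weak: "\<And>\<psi> g K. test_fun \<psi> g K \<Longrightarrow> K \<subseteq> interior E \<Longrightarrow>
        (\<integral>x. \<psi> x * G x + g x \<bullet> Y x \<partial>lborel) = 0"
begin

text \<open>If the boundary of \<open>E\<close> were smooth, this would be the outward flux of
  \<open>\<psi> Y\<close> through it, by the divergence theorem.\<close>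

definition J :: "('a \<Rightarrow> real) \<Rightarrow> ('a \<Rightarrow> 'a) \<Rightarrow> real" where
  "J \<psi> g = (\<integral>x. indicator E x * (\<psi> x * G x + g x \<bullet> Y x) \<partial>lborel)"

text \<open>The outward flux is nonpositive near \<open>x0\<close>. The formulation through test
  functions on a ball needs no boundary regularity and can be patched by a partition of
  unity.\<close>

definition locally_ok :: "'a \<Rightarrow> bool" where
  "locally_ok x0 \<longleftrightarrow> (\<exists>r>0. cball x0 r \<subseteq> W \<and>
     (\<forall>\<psi> g. test_fun \<psi> g (cball x0 r) \<longrightarrow> (\<forall>x. \<psi> x \<ge> 0) \<longrightarrow> J \<psi> g \<le> 0))"

lemma integrable_E:
  fixes h :: "'a \<Rightarrow> real"
  assumes K: "compact K" "K \<subseteq> W" and h: "continuous_on K h" "\<And>x. x \<notin> K \<Longrightarrow> h x = 0"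
  shows "integrable lborel (\<lambda>x. indicator E x * h x)"
proof -
  have "integrable lborel (\<lambda>x. indicator (K \<inter> C) x *\<^sub>R h x)"
    by (intro borel_integrable_compact compact_Int_closed K(1) C continuous_on_subset[OF h(1)]) auto
  moreover have "(\<lambda>x. indicator (K \<inter> C) x *\<^sub>R h x) = (\<lambda>x. indicator E x * h x)"
  proof
    fix x show "indicator (K \<inter> C) x *\<^sub>R h x = indicator E x * h x"
      using K(2) h(2)[of x] by (cases "x \<in> K") (auto simp: E indicator_def)
  qed
  ultimately show ?thesis by simp
qed

lemma continuous_integrand:
  assumes "continuous_on K \<psi>" "continuous_on K g" "K \<subseteq> W"
  shows "continuous_on K (\<lambda>x. \<psi> x * G x + g x \<bullet> Y x)"
  by (intro continuous_intros assms continuous_on_subset[OF G] continuous_on_subset[OF Y])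

lemma J_integrable:
  assumes t: "test_fun \<psi> g K" "K \<subseteq> W"
  shows "integrable lborel (\<lambda>x. indicator E x * (\<psi> x * G x + g x \<bullet> Y x))"
  using test_funD[OF t(1)] t(2)
  by (intro integrable_E[of K] continuous_integrand) auto

lemma J_interior:
  assumes t: "test_fun \<psi> g K" "K \<subseteq> interior E"
  shows "J \<psi> g = 0"
proof -
  have *: "indicator E x * (\<psi> x * G x + g x \<bullet> Y x) = \<psi> x * G x + g x \<bullet> Y x" for x
    using test_funD(3,4)[OF t(1), of x] t(2) interior_subset[of E] by (cases "x \<in> K") (auto simp: indicator_def)
  show ?thesis unfolding J_def * using weak[OF t] .
qed

lemma locally_ok_interior:
  assumes "x0 \<in> interior E" shows "locally_ok x0"
proof -
  obtain r where r: "r > 0" "cball x0 r \<subseteq> interior E"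
    using assms open_contains_cball[of "interior E"] by auto
  have "cball x0 r \<subseteq> W" using r interior_subset[of E] E by auto
  then show ?thesis unfolding locally_ok_def using r J_interior by (intro exI[of _ r]) auto
qed

lemma locally_ok_exterior:
  assumes "x0 \<in> W" "x0 \<notin> E" shows "locally_ok x0"
proof -
  have "open (W - C)" using W C by (rule open_Diff)
  moreover have "x0 \<in> W - C" using assms E by auto
  ultimately obtain r where r: "r > 0" "cball x0 r \<subseteq> W - C"
    using open_contains_cball[of "W - C"] by auto
  have "J \<psi> g = 0" if t: "test_fun \<psi> g (cball x0 r)" for \<psi> g
  proof -
    have *: "indicator E x * (\<psi> x * G x + g x \<bullet> Y x) = 0" for x
      using test_funD(3,4)[OF t, of x] r(2) E by (cases "x \<in> cball x0 r") (auto simp: indicator_def)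
    show ?thesis unfolding J_def * by simp
  qed
  then show ?thesis unfolding locally_ok_def using r by (intro exI[of _ r]) auto
qed

text \<open>Here \<open>f\<close> is a defining function of \<open>E\<close>, so \<open>gf\<close>
  points inwards and \<open>flux\<close> says that \<open>Y\<close> does not point out. Multiplying
  \<open>\<psi>\<close> by \<open>step (f x / \<epsilon>)\<close> moves the support into the
  interior; the gradient of that factor concentrates in a strip along the boundary and yields the
  flux in the limit.\<close>

lemma locally_ok_boundary:
  assumes r: "r > 0" "ball x0 r \<subseteq> W" and f: "C1g f gf (ball x0 r)"
    and e: "norm e = 1" and k: "\<kappa> > 0" and slope: "\<And>x. x \<in> ball x0 r \<Longrightarrow> gf x \<bullet> e \<ge> \<kappa>"
    and side: "\<And>x. x \<in> ball x0 r \<Longrightarrow> x \<in> E \<longleftrightarrow> f x \<ge> 0"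
    and flux: "\<And>x. x \<in> ball x0 r \<Longrightarrow> f x = 0 \<Longrightarrow> gf x \<bullet> Y x \<ge> 0"
  shows "locally_ok x0"
proof -
  define K where "K = cball x0 (r/2)"
  have cK: "compact K" by (simp add: K_def)
  have Kb: "K \<subseteq> ball x0 r" using r by (auto simp: K_def)
  have KW: "K \<subseteq> W" using Kb r(2) by auto
  have fK: "continuous_on K f" using C1g_cont[OF f] Kb by (rule continuous_on_subset)
  have gfK: "continuous_on K gf" using C1g_cont_grad[OF f] Kb by (rule continuous_on_subset)
  have YK: "continuous_on K Y" using Y KW by (rule continuous_on_subset)
  have mono: "f (x + s *\<^sub>R e) \<ge> f x + \<kappa> * s" if "x \<in> K" "x + s *\<^sub>R e \<in> K" "s \<ge> 0" for x s
  proof -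
    have seg: "x + t *\<^sub>R e \<in> ball x0 r" if t: "0 \<le> t" "t \<le> s" for t
    proof (cases "s = 0")
      case True then show ?thesis using t \<open>x \<in> K\<close> Kb by auto
    next
      case False
      have "(1 - t/s) *\<^sub>R x + (t/s) *\<^sub>R (x + s *\<^sub>R e) \<in> ball x0 r"
        using t False \<open>s \<ge> 0\<close> \<open>x \<in> K\<close> \<open>x + s *\<^sub>R e \<in> K\<close> Kb
        by (intro convexD[OF convex_ball]) (auto simp: divide_simps)
      moreover have "(1 - t/s) *\<^sub>R x + (t/s) *\<^sub>R (x + s *\<^sub>R e) = x + t *\<^sub>R e"
        using False by (simp add: algebra_simps)
      ultimately show ?thesis by simp
    qed
    have "(\<lambda>t. f (x + t *\<^sub>R e) - \<kappa> * t) 0 \<le> (\<lambda>t. f (x + t *\<^sub>R e) - \<kappa> * t) s"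
    proof (rule DERIV_nonneg_imp_nondecreasing[OF that(3)])
      fix t assume t: "0 \<le> t" "t \<le> s"
      have "((\<lambda>t. f (x + t *\<^sub>R e)) has_derivative (\<lambda>h. gf (x + t *\<^sub>R e) \<bullet> (h *\<^sub>R e))) (at t)"
        by (rule has_derivative_compose[where f="\<lambda>t. x + t *\<^sub>R e" and g=f, OF _ C1g_deriv[OF f seg[OF t]]])
          (auto intro!: derivative_eq_intros)
      then have "((\<lambda>t. f (x + t *\<^sub>R e)) has_real_derivative gf (x + t *\<^sub>R e) \<bullet> e) (at t)"
        by (rule has_derivative_imp_has_field_derivative) simp
      then have "((\<lambda>t. f (x + t *\<^sub>R e) - \<kappa> * t) has_real_derivative gf (x + t *\<^sub>R e) \<bullet> e - \<kappa>) (at t)"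
        by (rule DERIV_diff) (simp add: DERIV_cmult_Id)
      then show "\<exists>y. ((\<lambda>t. f (x + t *\<^sub>R e) - \<kappa> * t) has_real_derivative y) (at t) \<and> y \<ge> 0"
        using slope[OF seg[OF t]] by auto
    qed
    then show ?thesis by simp
  qed
  obtain Cs where Cs: "Cs > 0" "\<And>\<epsilon>. 0 < \<epsilon> \<Longrightarrow> measure lebesgue {x \<in> K. 0 \<le> f x \<and> f x \<le> \<epsilon>} \<le> Cs * \<epsilon>"
    by (rule strip_volume[OF cK fK e k mono]) blast+
  have cS: "compact {x \<in> K. 0 \<le> f x \<and> f x \<le> \<epsilon>}" for \<epsilon>
    using compact_restrict_closed[OF cK fK, of "{0..\<epsilon>}"] by simp
  \<comment> \<open>The strip bound for every width makes the zero level a null set, so the cut-offs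
    converge to 1 almost everywhere on \<open>E\<close> within \<open>K\<close>.\<close>
  have null: "{x \<in> K. f x = 0} \<in> null_sets lborel"
  proof -
    have c0: "compact {x \<in> K. f x = 0}" using compact_restrict_closed[OF cK fK, of "{0}"] by simp
    have "measure lebesgue {x \<in> K. f x = 0} \<le> Cs * \<epsilon>" if "\<epsilon> > 0" for \<epsilon>
    proof -
      have "measure lebesgue {x \<in> K. f x = 0} \<le> measure lebesgue {x \<in> K. 0 \<le> f x \<and> f x \<le> \<epsilon>}"
        using that by (intro measure_mono_fmeasurable) (auto simp: lmeasurable_compact cS c0 fmeasurableD)
      then show ?thesis using Cs(2)[OF that] by linarith
    qed
    then show ?thesis by (rule compact_null_sets[OF c0])
  qed
  have "J \<psi> g \<le> 0" if t: "test_fun \<psi> g (cball x0 (r/2))" and nn: "\<And>x. \<psi> x \<ge> 0" for \<psi> g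
  proof -
    have tK: "test_fun \<psi> g K" using t by (simp add: K_def)
    obtain M where M: "M > 0" "\<And>x. \<bar>\<psi> x\<bar> \<le> M" by (rule test_fun_bounded[OF t]) blast
    define a where "a = (\<lambda>x. \<psi> x * G x + g x \<bullet> Y x)"
    have aK: "continuous_on K a" unfolding a_def
      by (intro continuous_integrand test_funD(5,6)[OF t] KW)
    have a0: "a x = 0" if "x \<notin> K" for x using test_funD(3,4)[OF tK that] by (simp add: a_def)
    define \<epsilon> where "\<epsilon> = (\<lambda>n. inverse (real (Suc n)))"
    have \<epsilon>: "\<epsilon> n > 0" for n by (simp add: \<epsilon>_def)
    have \<epsilon>0: "\<epsilon> \<longlonglongrightarrow> 0" unfolding \<epsilon>_def by (rule LIMSEQ_inverse_real_of_nat)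
    \<comment> \<open>The product rule splits the test integral: \<open>A\<close> carries the
      cut-off itself and tends to \<open>J \<psi> g\<close>, while \<open>B\<close> carries the
      gradient of the cut-off and is the approximate inward flux.\<close>
    define A where "A = (\<lambda>n. \<integral>x. indicator E x * (step (f x / \<epsilon> n) * a x) \<partial>lborel)"
    define B where "B = (\<lambda>n. \<integral>x. indicator E x * (\<psi> x * (step' (f x / \<epsilon> n) / \<epsilon> n) * (gf x \<bullet> Y x)) \<partial>lborel)"
    have cst: "continuous_on K (\<lambda>x. step (f x / \<epsilon> n))" for n
      by (rule continuous_on_compose2[OF DERIV_continuous_on[OF has_field_derivative_at_within[OF step_deriv], of UNIV]])
        (use \<epsilon>[of n] in \<open>auto intro!: continuous_intros fK\<close>)
    have cst': "continuous_on K (\<lambda>x. step' (f x / \<epsilon> n))" for n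
      by (rule continuous_on_compose2[OF continuous_step'[of UNIV]])
        (use \<epsilon>[of n] in \<open>auto intro!: continuous_intros fK\<close>)
    have intA: "integrable lborel (\<lambda>x. indicator E x * (step (f x / \<epsilon> n) * a x))" for n
      by (intro integrable_E[OF cK KW] continuous_intros cst aK) (simp add: a0)
    have intB: "integrable lborel (\<lambda>x. indicator E x * (\<psi> x * (step' (f x / \<epsilon> n) / \<epsilon> n) * (gf x \<bullet> Y x)))" for n
      by (intro integrable_E[OF cK KW] continuous_intros cst' gfK YK test_funD(5)[OF t])
        (use \<epsilon>[of n] test_funD(3)[OF tK] in auto)
    have AB: "A n + B n = 0" for n
    proof -
      have "C1g (\<lambda>x. f x / \<epsilon> n) (\<lambda>x. inverse (\<epsilon> n) *\<^sub>R gf x) (ball x0 r)"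
        using C1g_cmult[OF f, of "inverse (\<epsilon> n)"] by (simp add: divide_inverse_commute)
      then have eta: "C1g (\<lambda>x. step (f x / \<epsilon> n)) (\<lambda>x. step' (f x / \<epsilon> n) *\<^sub>R (inverse (\<epsilon> n) *\<^sub>R gf x)) (ball x0 r)"
        by (rule C1g_compose) (auto intro!: step_deriv continuous_step')
      have t1: "test_fun (\<lambda>x. \<psi> x * step (f x / \<epsilon> n)) (\<lambda>x. \<psi> x *\<^sub>R (step' (f x / \<epsilon> n) *\<^sub>R (inverse (\<epsilon> n) *\<^sub>R gf x)) + step (f x / \<epsilon> n) *\<^sub>R g x) K"
        by (rule test_fun_mult[OF tK Kb _ eta]) simp
      \<comment> \<open>The cut-off vanishes for \<open>f x \<le> \<epsilon> n\<close>, so the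
        product is supported inside \<open>E\<close>, where the weak identity is available.\<close>
      define K' where "K' = {x \<in> K. f x \<in> {\<epsilon> n..}}"
      have t2: "test_fun (\<lambda>x. \<psi> x * step (f x / \<epsilon> n)) (\<lambda>x. \<psi> x *\<^sub>R (step' (f x / \<epsilon> n) *\<^sub>R (inverse (\<epsilon> n) *\<^sub>R gf x)) + step (f x / \<epsilon> n) *\<^sub>R g x) K'"
      proof (rule test_funI[OF test_funD(1)[OF t1]])
        show "compact K'" unfolding K'_def by (intro compact_restrict_closed cK fK) simp
        show "\<psi> x * step (f x / \<epsilon> n) = 0" if "x \<notin> K'" for x
        proof (cases "x \<in> K")
          case True
          then have "f x / \<epsilon> n \<le> 1" using that \<epsilon>[of n] by (simp add: K'_def)
          then show ?thesis by (simp add: step_eq_0)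
        qed (simp add: test_funD(3)[OF tK])
      qed
      have K'int: "K' \<subseteq> interior E"
      proof
        fix x assume x: "x \<in> K'"
        have "open {y \<in> ball x0 r. f y \<in> {0<..}}"
          using continuous_open_preimage[OF C1g_cont[OF f], of "{0<..}"] by (simp add: vimage_def Int_def)
        moreover have "{y \<in> ball x0 r. f y \<in> {0<..}} \<subseteq> E" using side by auto
        moreover have "x \<in> {y \<in> ball x0 r. f y \<in> {0<..}}"
          using x Kb \<epsilon>[of n] by (auto simp: K'_def intro: less_le_trans)
        ultimately show "x \<in> interior E" using interior_maximal by blast
      qed
      have "0 = J (\<lambda>x. \<psi> x * step (f x / \<epsilon> n)) (\<lambda>x. \<psi> x *\<^sub>R (step' (f x / \<epsilon> n) *\<^sub>R (inverse (\<epsilon> n) *\<^sub>R gf x)) + step (f x / \<epsilon> n) *\<^sub>R g x)"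
        using J_interior[OF t2 K'int] by simp
      also have "\<dots> = (\<integral>x. indicator E x * (step (f x / \<epsilon> n) * a x) + indicator E x * (\<psi> x * (step' (f x / \<epsilon> n) / \<epsilon> n) * (gf x \<bullet> Y x)) \<partial>lborel)"
        unfolding J_def a_def
        by (rule Bochner_Integration.integral_cong) (auto simp: inner_add_left algebra_simps divide_inverse)
      also have "\<dots> = A n + B n" unfolding A_def B_def by (rule Bochner_Integration.integral_add[OF intA intB])
      finally show ?thesis by simp
    qed
    have Ja: "J \<psi> g = (\<integral>x. indicator E x * a x \<partial>lborel)" by (simp add: J_def a_def)
    have Alim: "A \<longlonglongrightarrow> J \<psi> g"
      unfolding A_def Ja
    proof (rule integral_dominated_convergence[where w="\<lambda>x. \<bar>indicator E x * a x\<bar>"])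
      show "(\<lambda>x. indicator E x * a x) \<in> borel_measurable lborel"
        by (intro borel_measurable_integrable integrable_E[OF cK KW aK a0])
      show "integrable lborel (\<lambda>x. \<bar>indicator E x * a x\<bar>)"
        by (intro integrable_abs integrable_E[OF cK KW aK a0])
      show "(\<lambda>x. indicator E x * (step (f x / \<epsilon> n) * a x)) \<in> borel_measurable lborel" for n
        using intA by (rule borel_measurable_integrable)
      show "AE x in lborel. norm (indicator E x * (step (f x / \<epsilon> n) * a x)) \<le> \<bar>indicator E x * a x\<bar>" for n
        by (rule AE_I2) (use step_bounds in \<open>auto simp: abs_mult indicator_def mult_left_le_one_le\<close>)
      show "AE x in lborel. (\<lambda>n. indicator E x * (step (f x / \<epsilon> n) * a x)) \<longlonglongrightarrow> indicator E x * a x"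
      proof (rule AE_mp[OF AE_not_in[OF null]], rule AE_I2, rule impI)
        fix x assume x: "x \<notin> {x \<in> K. f x = 0}"
        consider "x \<notin> K" | "x \<notin> E" | "x \<in> K" "f x > 0"
          using x side[of x] Kb by fastforce
        then show "(\<lambda>n. indicator E x * (step (f x / \<epsilon> n) * a x)) \<longlonglongrightarrow> indicator E x * a x"
        proof cases
          case 3
          have "\<forall>\<^sub>F n in sequentially. \<epsilon> n < f x / 2"
            using 3 by (intro order_tendstoD(2)[OF \<epsilon>0]) simp
          then have "\<forall>\<^sub>F n in sequentially. indicator E x * a x = indicator E x * (step (f x / \<epsilon> n) * a x)"
          proof eventually_elim
            case (elim n)
            then have "f x / \<epsilon> n \<ge> 2" using \<epsilon>[of n] by (simp add: pos_le_divide_eq)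
            then show ?case by (simp add: step_eq_1)
          qed
          then show ?thesis by (rule Lim_transform_eventually[OF tendsto_const])
        qed (auto simp: a0)
      qed
    qed
    \<comment> \<open>The steepness \<open>2 / \<epsilon> n\<close> of the cut-off is compensated by
      the strip volume \<open>Cs * (2 * \<epsilon> n)\<close>. Since \<open>gf \<bullet> Y\<close>
      is at least \<open>- \<delta>\<close> close to the boundary, \<open>B n\<close> is at least
      \<open>- 4 * M * Cs * \<delta>\<close>.\<close>
    have Aup: "\<exists>N. \<forall>n\<ge>N. A n \<le> 4 * M * Cs * \<delta>" if d: "\<delta> > 0" for \<delta>
    proof -
      obtain \<epsilon>1 where \<epsilon>1: "\<epsilon>1 > 0" "\<And>x. x \<in> K \<Longrightarrow> 0 \<le> f x \<Longrightarrow> f x \<le> \<epsilon>1 \<Longrightarrow> gf x \<bullet> Y x \<ge> - \<delta>"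
        by (rule small_level_bound[OF cK fK _ _ d, of "\<lambda>x. gf x \<bullet> Y x"])
          (use flux Kb in \<open>auto intro!: continuous_intros gfK YK\<close>)
      obtain N where N: "\<And>n. n \<ge> N \<Longrightarrow> \<epsilon> n < \<epsilon>1 / 2"
        using order_tendstoD(2)[OF \<epsilon>0, of "\<epsilon>1/2"] \<epsilon>1(1) by (auto simp: eventually_sequentially)
      have "A n \<le> 4 * M * Cs * \<delta>" if n: "n \<ge> N" for n
      proof -
        define S where "S = {x \<in> K. 0 \<le> f x \<and> f x \<le> 2 * \<epsilon> n}"
        have cSS: "compact S" unfolding S_def by (rule cS)
        have "(\<integral>x. indicator S x * (- (M * (2 / \<epsilon> n) * \<delta>)) \<partial>lborel) \<le> B n"
          unfolding B_def
        proof (rule integral_mono[OF _ intB])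
          show "integrable lborel (\<lambda>x. indicator S x * (- (M * (2 / \<epsilon> n) * \<delta>)))"
            using borel_integrable_compact[OF cSS, of "\<lambda>x. - (M * (2 / \<epsilon> n) * \<delta>)"] by simp
          fix x
          let ?l = "indicator S x * (- (M * (2 / \<epsilon> n) * \<delta>))"
          let ?q = "\<psi> x * (step' (f x / \<epsilon> n) / \<epsilon> n)"
          have lneg: "?l \<le> 0" using M(1) \<epsilon>[of n] d by (simp add: indicator_def)
          have q: "0 \<le> ?q" "?q \<le> M * (2 / \<epsilon> n)"
            using nn[of x] M(2)[of x] step'_nonneg[of "f x / \<epsilon> n"] step'_le[of "f x / \<epsilon> n"] \<epsilon>[of n]
            by (auto intro!: mult_mono divide_right_mono mult_nonneg_nonneg simp: less_imp_le)
          show "?l \<le> indicator E x * (?q * (gf x \<bullet> Y x))"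
          proof (cases "x \<in> S \<and> x \<in> E")
            case True
            then have "gf x \<bullet> Y x \<ge> - \<delta>" using N[OF n] by (intro \<epsilon>1(2)) (auto simp: S_def)
            then have "?q * (gf x \<bullet> Y x) \<ge> ?q * (- \<delta>)" using q(1) by (intro mult_left_mono) auto
            moreover have "?q * (- \<delta>) \<ge> - (M * (2 / \<epsilon> n) * \<delta>)" 
              unfolding mult_minus_right neg_le_iff_le by (rule mult_right_mono[OF q(2) less_imp_le[OF d]])
            ultimately show ?thesis using True by simp
          next
            case False
            have "?q = 0 \<or> x \<notin> E"
            proof (cases "x \<in> K \<and> x \<in> E")
              case True
              then have "f x \<ge> 0" using side[of x] Kb by auto
              with True False have "f x > 2 * \<epsilon> n" by (auto simp: S_def)
              then have "f x / \<epsilon> n \<ge> 2" using \<epsilon>[of n] by (simp add: pos_le_divide_eq)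
              then show ?thesis by (simp add: step'_eq_0)
            qed (use test_funD(3)[OF tK, of x] in auto)
            then show ?thesis using lneg by auto
          qed
        qed
        moreover have "(\<integral>x. indicator S x * (- (M * (2 / \<epsilon> n) * \<delta>)) \<partial>lborel) = - (measure lebesgue S * (M * (2 / \<epsilon> n) * \<delta>))"
          using cSS by (simp add: measure_completion borel_compact)
        moreover have "measure lebesgue S * (M * (2 / \<epsilon> n) * \<delta>) \<le> (Cs * (2 * \<epsilon> n)) * (M * (2 / \<epsilon> n) * \<delta>)"
          unfolding S_def using Cs(2)[of "2 * \<epsilon> n"] \<epsilon>[of n] M(1) d by (intro mult_right_mono) auto
        moreover have "(Cs * (2 * \<epsilon> n)) * (M * (2 / \<epsilon> n) * \<delta>) = 4 * M * Cs * \<delta>"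
          using \<epsilon>[of n] by simp
        ultimately show ?thesis using AB[of n] by linarith
      qed
      then show ?thesis by blast
    qed
    have "J \<psi> g \<le> \<eta>" if "\<eta> > 0" for \<eta>
    proof -
      define \<delta> where "\<delta> = \<eta> / (4 * M * Cs)"
      have d: "\<delta> > 0" using that M(1) Cs(1) by (simp add: \<delta>_def)
      have "4 * M * Cs * \<delta> = \<eta>" using M(1) Cs(1) by (simp add: \<delta>_def)
      then show ?thesis using Aup[OF d] by (intro LIMSEQ_le_const2[OF Alim]) auto
    qed
    then show ?thesis by (rule field_le_epsilon[of _ 0, simplified])
  qed
  then show ?thesis unfolding locally_ok_def using r KW by (intro exI[of _ "r/2"]) (auto simp: K_def)
qed

text \<open>Linearity of \<open>J\<close> and a partition of unity reduce the claim to single balls;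
  the cross term with the gradients of the partition drops out because these sum to zero on
  \<open>K\<close>.\<close>

lemma J_le_0:
  assumes t: "test_fun \<psi> g K" "K \<subseteq> W" and nn: "\<And>x. \<psi> x \<ge> 0" and ok: "\<And>x. x \<in> K \<Longrightarrow> locally_ok x"
  shows "J \<psi> g \<le> 0"
proof -
  have "\<forall>x\<in>K. \<exists>r. r > 0 \<and> cball x r \<subseteq> W \<and> (\<forall>\<psi> g. test_fun \<psi> g (cball x r) \<longrightarrow> (\<forall>x. \<psi> x \<ge> 0) \<longrightarrow> J \<psi> g \<le> 0)"
    using ok unfolding locally_ok_def by simp
  from bchoice[OF this] obtain r where r: "\<forall>x\<in>K. r x > 0 \<and> cball x (r x) \<subseteq> W \<and>
     (\<forall>\<psi> g. test_fun \<psi> g (cball x (r x)) \<longrightarrow> (\<forall>x. \<psi> x \<ge> 0) \<longrightarrow> J \<psi> g \<le> 0)"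
    by (rule exE)
  have r1: "r x > 0" and r2: "cball x (r x) \<subseteq> W" if "x \<in> K" for x using r that by simp_all
  have r3: "J \<phi> h \<le> 0" if "x \<in> K" "test_fun \<phi> h (cball x (r x))" "\<And>x. \<phi> x \<ge> 0" for x \<phi> h
    using r that by simp
  obtain F c gc where F: "finite F" "F \<subseteq> K" "\<And>i. i \<in> F \<Longrightarrow> test_fun (c i) (gc i) (cball i (r i))"
    "\<And>i x. (c i :: 'a \<Rightarrow> real) x \<ge> 0" "\<And>x. x \<in> K \<Longrightarrow> (\<Sum>i\<in>F. c i x) = 1" "\<And>x. x \<in> K \<Longrightarrow> (\<Sum>i\<in>F. gc i x) = 0"
  proof (rule C1_partition_of_unity[where r=r, OF test_funD(2)[OF t(1)]])
    show "r x > 0" if "x \<in> K" for x using that by (rule r1)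
  qed (rule that)
  have ti: "test_fun (\<lambda>x. c i x * \<psi> x) (\<lambda>x. c i x *\<^sub>R g x + \<psi> x *\<^sub>R gc i x) (cball i (r i))" if "i \<in> F" for i
    by (rule test_fun_mult[OF F(3)[OF that] _ open_UNIV test_funD(1)[OF t(1)]]) simp
  have "J \<psi> g = (\<integral>x. (\<Sum>i\<in>F. indicator E x * (c i x * \<psi> x * G x + (c i x *\<^sub>R g x + \<psi> x *\<^sub>R gc i x) \<bullet> Y x)) \<partial>lborel)"
    unfolding J_def
  proof (rule Bochner_Integration.integral_cong[OF refl])
    fix x
    have "(\<Sum>i\<in>F. c i x * \<psi> x * G x + (c i x *\<^sub>R g x + \<psi> x *\<^sub>R gc i x) \<bullet> Y x)
        = (\<Sum>i\<in>F. c i x) * (\<psi> x * G x + g x \<bullet> Y x) + \<psi> x * ((\<Sum>i\<in>F. gc i x) \<bullet> Y x)"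
      by (simp add: inner_add_left sum.distrib sum_distrib_left sum_distrib_right inner_sum_left algebra_simps)
    also have "\<dots> = \<psi> x * G x + g x \<bullet> Y x"
      using F(5,6)[of x] test_funD(3,4)[OF t(1), of x] by (cases "x \<in> K") auto
    finally show "indicator E x * (\<psi> x * G x + g x \<bullet> Y x)
      = (\<Sum>i\<in>F. indicator E x * (c i x * \<psi> x * G x + (c i x *\<^sub>R g x + \<psi> x *\<^sub>R gc i x) \<bullet> Y x))"
      by (simp only: sum_distrib_left[symmetric])
  qed
  also have "\<dots> = (\<Sum>i\<in>F. J (\<lambda>x. c i x * \<psi> x) (\<lambda>x. c i x *\<^sub>R g x + \<psi> x *\<^sub>R gc i x))"
    unfolding J_def using J_integrable[OF ti] r2 F(2) by (intro Bochner_Integration.integral_sum) auto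
  also have "\<dots> \<le> 0"
  proof (rule sum_nonpos)
    fix i assume i: "i \<in> F"
    show "J (\<lambda>x. c i x * \<psi> x) (\<lambda>x. c i x *\<^sub>R g x + \<psi> x *\<^sub>R gc i x) \<le> 0"
      by (rule r3[OF subsetD[OF F(2) i] ti[OF i]]) (intro mult_nonneg_nonneg F(4) nn)
  qed
  finally show ?thesis .
qed

end

context weak_divergence
begin

text \<open>A cut-off at scale \<open>\<epsilon>\<close> around the exceptional subspace has
  gradient of order \<open>1 / \<epsilon>\<close> on a tube of volume of order
  \<open>\<epsilon>\<^sup>2\<close>. As \<open>Y\<close> is bounded on \<open>K\<close>, the error
  is of order \<open>\<epsilon>\<close> and disappears.\<close>

lemma J_le_0_off_codim2:
  assumes t: "test_fun \<psi> g K" "K \<subseteq> W" and nn: "\<And>x. \<psi> x \<ge> 0"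
    and e: "norm e1 = 1" "norm e2 = 1" "e1 \<bullet> e2 = 0"
    and ok: "\<And>x. x \<in> K \<Longrightarrow> x \<bullet> e1 \<noteq> 0 \<or> x \<bullet> e2 \<noteq> 0 \<Longrightarrow> locally_ok x"
  shows "J \<psi> g \<le> 0"
proof -
  have cK: "compact K" using test_funD(2)[OF t(1)] .
  have ee: "e1 \<bullet> e1 = 1" "e2 \<bullet> e2 = 1" "e2 \<bullet> e1 = 0" using e by (simp_all add: norm_eq_1 inner_commute)
  \<comment> \<open>The squared distance from the exceptional subspace; unlike the distance it is
    smooth there.\<close>
  define q where "q = (\<lambda>x::'a. (x \<bullet> e1) * (x \<bullet> e1) + (x \<bullet> e2) * (x \<bullet> e2))"
  define gq where "gq = (\<lambda>x::'a. 2 *\<^sub>R ((x \<bullet> e1) *\<^sub>R e1 + (x \<bullet> e2) *\<^sub>R e2))"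
  have q: "C1g q gq UNIV"
    by (rule C1gI) (auto intro!: derivative_eq_intros continuous_intros simp: q_def gq_def fun_eq_iff inner_add_left inner_commute algebra_simps)
  have q0: "q x \<ge> 0" for x by (simp add: q_def)
  obtain M where M: "M > 0" "\<And>x. \<bar>\<psi> x\<bar> \<le> M" by (rule test_fun_bounded[OF t(1)]) blast
  have "bounded (Y ` K)" by (intro compact_imp_bounded compact_continuous_image continuous_on_subset[OF Y t(2)] cK)
  then obtain MY where MY: "MY > 0" "\<And>x. x \<in> K \<Longrightarrow> norm (Y x) \<le> MY"
    unfolding bounded_pos by auto
  obtain Cs where Cs: "Cs > 0" "\<And>\<epsilon>. 0 < \<epsilon> \<Longrightarrow> measure lebesgue {x \<in> K. \<bar>x \<bullet> e1\<bar> \<le> \<epsilon> \<and> \<bar>x \<bullet> e2\<bar> \<le> \<epsilon>} \<le> Cs * \<epsilon>\<^sup>2"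
    by (rule tube_volume[OF cK e]) blast+
  have cS: "compact {x \<in> K. \<bar>x \<bullet> e1\<bar> \<le> \<epsilon> \<and> \<bar>x \<bullet> e2\<bar> \<le> \<epsilon>}" for \<epsilon>
  proof -
    have "{x \<in> K. \<bar>x \<bullet> e1\<bar> \<le> \<epsilon> \<and> \<bar>x \<bullet> e2\<bar> \<le> \<epsilon>} = K \<inter> ({x. \<bar>x \<bullet> e1\<bar> \<le> \<epsilon>} \<inter> {x. \<bar>x \<bullet> e2\<bar> \<le> \<epsilon>})" by auto
    then show ?thesis by (simp only:) (intro compact_Int_closed cK closed_Int closed_Collect_le continuous_intros)
  qed
  have null: "{x \<in> K. \<bar>x \<bullet> e1\<bar> \<le> 0 \<and> \<bar>x \<bullet> e2\<bar> \<le> 0} \<in> null_sets lborel"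
  proof (rule compact_null_sets[OF cS, where C="Cs + measure lebesgue K"])
    fix \<epsilon> :: real assume eps: "\<epsilon> > 0"
    show "measure lebesgue {x \<in> K. \<bar>x \<bullet> e1\<bar> \<le> 0 \<and> \<bar>x \<bullet> e2\<bar> \<le> 0} \<le> (Cs + measure lebesgue K) * \<epsilon>"
    proof (cases "\<epsilon> \<le> 1")
      case True
      have "measure lebesgue {x \<in> K. \<bar>x \<bullet> e1\<bar> \<le> 0 \<and> \<bar>x \<bullet> e2\<bar> \<le> 0} \<le> measure lebesgue {x \<in> K. \<bar>x \<bullet> e1\<bar> \<le> \<epsilon> \<and> \<bar>x \<bullet> e2\<bar> \<le> \<epsilon>}"
        using eps by (intro measure_mono_fmeasurable lmeasurable_compact cS fmeasurableD) auto
      also have "\<dots> \<le> Cs * \<epsilon>\<^sup>2" using Cs(2)[OF eps] .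
      also have "\<dots> \<le> Cs * (\<epsilon> * 1)" unfolding power2_eq_square using eps True Cs(1) by (intro mult_left_mono) auto
      also have "\<dots> \<le> (Cs + measure lebesgue K) * \<epsilon>" using eps by (simp add: algebra_simps)
      finally show ?thesis .
    next
      case False
      have "measure lebesgue {x \<in> K. \<bar>x \<bullet> e1\<bar> \<le> 0 \<and> \<bar>x \<bullet> e2\<bar> \<le> 0} \<le> measure lebesgue K * 1"
        unfolding mult_1_right by (intro measure_mono_fmeasurable lmeasurable_compact cS cK fmeasurableD) auto
      also have "\<dots> \<le> (Cs + measure lebesgue K) * \<epsilon>" using False Cs(1) by (intro mult_mono) auto
      finally show ?thesis .
    qed
  qed
  define a where "a = (\<lambda>x. \<psi> x * G x + g x \<bullet> Y x)"
  have aK: "continuous_on K a" unfolding a_def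
    by (intro continuous_integrand test_funD(5,6)[OF t(1)] t(2))
  have a0: "a x = 0" if "x \<notin> K" for x using test_funD(3,4)[OF t(1) that] by (simp add: a_def)
  define \<epsilon> where "\<epsilon> = (\<lambda>n. inverse (real (Suc n)))"
  have \<epsilon>: "\<epsilon> n > 0" for n by (simp add: \<epsilon>_def)
  have \<epsilon>0: "\<epsilon> \<longlonglongrightarrow> 0" unfolding \<epsilon>_def by (rule LIMSEQ_inverse_real_of_nat)
  define \<eta> where "\<eta> = (\<lambda>n x. step (q x / (\<epsilon> n)\<^sup>2))"
  define \<eta>' where "\<eta>' = (\<lambda>n x. step' (q x / (\<epsilon> n)\<^sup>2) / (\<epsilon> n)\<^sup>2)"
  have eta: "C1g (\<eta> n) (\<lambda>x. \<eta>' n x *\<^sub>R gq x) UNIV" for n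
  proof -
    have "C1g (\<lambda>x. q x / (\<epsilon> n)\<^sup>2) (\<lambda>x. inverse ((\<epsilon> n)\<^sup>2) *\<^sub>R gq x) UNIV"
      using C1g_cmult[OF q, of "inverse ((\<epsilon> n)\<^sup>2)"] by (simp add: divide_inverse_commute)
    then have "C1g (\<lambda>x. step (q x / (\<epsilon> n)\<^sup>2)) (\<lambda>x. step' (q x / (\<epsilon> n)\<^sup>2) *\<^sub>R (inverse ((\<epsilon> n)\<^sup>2) *\<^sub>R gq x)) UNIV"
      by (rule C1g_compose) (auto intro!: step_deriv continuous_step')
    then show ?thesis by (simp add: \<eta>_def \<eta>'_def divide_inverse)
  qed
  have c\<eta>: "continuous_on K (\<eta> n)" for n using C1g_cont[OF eta] by (rule continuous_on_subset) simp
  have c\<eta>': "continuous_on K (\<lambda>x. \<eta>' n x *\<^sub>R gq x)" for n using C1g_cont_grad[OF eta] by (rule continuous_on_subset) simp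
  define A where "A = (\<lambda>n. \<integral>x. indicator E x * (\<eta> n x * a x) \<partial>lborel)"
  define B where "B = (\<lambda>n. \<integral>x. indicator E x * (\<psi> x * ((\<eta>' n x *\<^sub>R gq x) \<bullet> Y x)) \<partial>lborel)"
  have intA: "integrable lborel (\<lambda>x. indicator E x * (\<eta> n x * a x))" for n
    by (intro integrable_E[OF cK t(2)] continuous_intros c\<eta> aK) (simp add: a0)
  have intB: "integrable lborel (\<lambda>x. indicator E x * (\<psi> x * ((\<eta>' n x *\<^sub>R gq x) \<bullet> Y x)))" for n
    by (intro integrable_E[OF cK t(2)] continuous_on_mult continuous_on_inner c\<eta>' continuous_on_subset[OF Y t(2)] test_funD(5)[OF t(1)])
      (use test_funD(3)[OF t(1)] in auto)
  have AB: "A n + B n \<le> 0" for n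
  proof -
    have t1: "test_fun (\<lambda>x. \<psi> x * \<eta> n x) (\<lambda>x. \<psi> x *\<^sub>R (\<eta>' n x *\<^sub>R gq x) + \<eta> n x *\<^sub>R g x) K"
      by (rule test_fun_mult[OF t(1) _ open_UNIV eta]) simp
    define K' where "K' = {x \<in> K. q x \<in> {(\<epsilon> n)\<^sup>2..}}"
    have t2: "test_fun (\<lambda>x. \<psi> x * \<eta> n x) (\<lambda>x. \<psi> x *\<^sub>R (\<eta>' n x *\<^sub>R gq x) + \<eta> n x *\<^sub>R g x) K'"
    proof (rule test_funI[OF test_funD(1)[OF t1]])
      show "compact K'" unfolding K'_def
        by (intro compact_restrict_closed cK continuous_on_subset[OF C1g_cont[OF q]]) auto
      show "\<psi> x * \<eta> n x = 0" if "x \<notin> K'" for x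
      proof (cases "x \<in> K")
        case True
        then have "q x / (\<epsilon> n)\<^sup>2 \<le> 1" using that \<epsilon>[of n] by (simp add: K'_def)
        then show ?thesis by (simp add: step_eq_0 \<eta>_def)
      qed (simp add: test_funD(3)[OF t(1)])
    qed
    have "J (\<lambda>x. \<psi> x * \<eta> n x) (\<lambda>x. \<psi> x *\<^sub>R (\<eta>' n x *\<^sub>R gq x) + \<eta> n x *\<^sub>R g x) \<le> 0"
    proof (rule J_le_0[OF t2])
      show "K' \<subseteq> W" using t(2) by (auto simp: K'_def)
      show "0 \<le> \<psi> x * \<eta> n x" for x using nn step_bounds by (simp add: \<eta>_def)
      fix x assume x: "x \<in> K'"
      then have "(\<epsilon> n)\<^sup>2 \<le> q x" by (simp add: K'_def)
      moreover have "0 < (\<epsilon> n)\<^sup>2" using \<epsilon>[of n] by simp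
      ultimately have "q x > 0" by linarith
      then have "x \<bullet> e1 \<noteq> 0 \<or> x \<bullet> e2 \<noteq> 0" by (auto simp: q_def)
      then show "locally_ok x" using x by (intro ok) (auto simp: K'_def)
    qed
    also have "J (\<lambda>x. \<psi> x * \<eta> n x) (\<lambda>x. \<psi> x *\<^sub>R (\<eta>' n x *\<^sub>R gq x) + \<eta> n x *\<^sub>R g x)
       = (\<integral>x. indicator E x * (\<eta> n x * a x) + indicator E x * (\<psi> x * ((\<eta>' n x *\<^sub>R gq x) \<bullet> Y x)) \<partial>lborel)"
      unfolding J_def a_def
      by (rule Bochner_Integration.integral_cong) (auto simp: inner_add_left algebra_simps)
    also have "\<dots> = A n + B n" unfolding A_def B_def by (rule Bochner_Integration.integral_add[OF intA intB])
    finally show ?thesis .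
  qed
  have Ja: "J \<psi> g = (\<integral>x. indicator E x * a x \<partial>lborel)" by (simp add: J_def a_def)
  have Alim: "A \<longlonglongrightarrow> J \<psi> g"
    unfolding A_def Ja
  proof (rule integral_dominated_convergence[where w="\<lambda>x. \<bar>indicator E x * a x\<bar>"])
    show "(\<lambda>x. indicator E x * a x) \<in> borel_measurable lborel"
      by (intro borel_measurable_integrable integrable_E[OF cK t(2) aK a0])
    show "integrable lborel (\<lambda>x. \<bar>indicator E x * a x\<bar>)"
      by (intro integrable_abs integrable_E[OF cK t(2) aK a0])
    show "(\<lambda>x. indicator E x * (\<eta> n x * a x)) \<in> borel_measurable lborel" for n
      using intA by (rule borel_measurable_integrable)
    show "AE x in lborel. norm (indicator E x * (\<eta> n x * a x)) \<le> \<bar>indicator E x * a x\<bar>" for n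
      by (rule AE_I2) (use step_bounds in \<open>auto simp: \<eta>_def abs_mult indicator_def mult_left_le_one_le\<close>)
    show "AE x in lborel. (\<lambda>n. indicator E x * (\<eta> n x * a x)) \<longlonglongrightarrow> indicator E x * a x"
    proof (rule AE_mp[OF AE_not_in[OF null]], rule AE_I2, rule impI)
      fix x assume x: "x \<notin> {x \<in> K. \<bar>x \<bullet> e1\<bar> \<le> 0 \<and> \<bar>x \<bullet> e2\<bar> \<le> 0}"
      show "(\<lambda>n. indicator E x * (\<eta> n x * a x)) \<longlonglongrightarrow> indicator E x * a x"
      proof (cases "x \<in> K")
        case True
        then have "q x \<noteq> 0" using x by (auto simp: q_def sum_squares_eq_zero_iff)
        then have qx: "q x > 0" using q0[of x] by simp
        have "(\<lambda>n. (\<epsilon> n)\<^sup>2) \<longlonglongrightarrow> 0\<^sup>2" by (intro tendsto_intros \<epsilon>0)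
        then have "\<forall>\<^sub>F n in sequentially. (\<epsilon> n)\<^sup>2 < q x / 2"
          using qx by (intro order_tendstoD(2)[where y="0\<^sup>2"]) auto
        then have "\<forall>\<^sub>F n in sequentially. indicator E x * a x = indicator E x * (\<eta> n x * a x)"
        proof eventually_elim
          case (elim n)
          then have "q x / (\<epsilon> n)\<^sup>2 \<ge> 2" using \<epsilon>[of n] by (simp add: pos_le_divide_eq)
          then show ?case by (simp add: step_eq_1 \<eta>_def)
        qed
        then show ?thesis by (rule Lim_transform_eventually[OF tendsto_const])
      qed (simp add: a0)
    qed
  qed
  \<comment> \<open>Once one coordinate exceeds \<open>2 * \<epsilon> n\<close>, the argument of the
    step is at least 2 and its derivative is zero. On the tube the factors are
    \<open>Cs * (2 * \<epsilon> n)\<^sup>2\<close> for the volume,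
    \<open>2 / (\<epsilon> n)\<^sup>2\<close> for the step and \<open>8 * \<epsilon> n\<close> for
    \<open>gq\<close>, whence 64.\<close>
  have Bbound: "\<bar>B n\<bar> \<le> 64 * M * MY * Cs * \<epsilon> n" for n
  proof -
    define S where "S = {x \<in> K. \<bar>x \<bullet> e1\<bar> \<le> 2 * \<epsilon> n \<and> \<bar>x \<bullet> e2\<bar> \<le> 2 * \<epsilon> n}"
    have cSS: "compact S" unfolding S_def by (rule cS)
    define L where "L = M * ((2 / (\<epsilon> n)\<^sup>2) * (8 * \<epsilon> n) * MY)"
    have L: "L \<ge> 0" using M(1) MY(1) \<epsilon>[of n] by (simp add: L_def)
    have "norm (B n) \<le> (\<integral>x. indicator S x * L \<partial>lborel)"
      unfolding B_def
    proof (rule Bochner_Integration.integral_norm_bound_integral[OF intB])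
      show "integrable lborel (\<lambda>x. indicator S x * L)"
        using borel_integrable_compact[OF cSS, of "\<lambda>x. L"] by simp
      fix x
      show "norm (indicator E x * (\<psi> x * ((\<eta>' n x *\<^sub>R gq x) \<bullet> Y x))) \<le> indicator S x * L"
      proof (cases "x \<in> S")
        case True
        have x12: "\<bar>x \<bullet> e1\<bar> \<le> 2 * \<epsilon> n" "\<bar>x \<bullet> e2\<bar> \<le> 2 * \<epsilon> n" "x \<in> K" using True by (auto simp: S_def)
        have "norm (gq x) \<le> 8 * \<epsilon> n"
        proof -
          have "norm ((x \<bullet> e1) *\<^sub>R e1 + (x \<bullet> e2) *\<^sub>R e2) \<le> 2 * \<epsilon> n + 2 * \<epsilon> n"
            by (rule norm_triangle_le) (use x12 e in auto)
          then show ?thesis by (simp add: gq_def)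
        qed
        moreover have "\<bar>\<eta>' n x\<bar> \<le> 2 / (\<epsilon> n)\<^sup>2"
          using step'_nonneg step'_le \<epsilon>[of n] by (simp add: \<eta>'_def divide_right_mono)
        ultimately have "norm (\<eta>' n x *\<^sub>R gq x) \<le> (2 / (\<epsilon> n)\<^sup>2) * (8 * \<epsilon> n)"
          unfolding norm_scaleR by (intro mult_mono) auto
        then have "\<bar>(\<eta>' n x *\<^sub>R gq x) \<bullet> Y x\<bar> \<le> (2 / (\<epsilon> n)\<^sup>2) * (8 * \<epsilon> n) * MY"
          by (intro order_trans[OF Cauchy_Schwarz_ineq2] mult_mono MY x12) (use \<epsilon>[of n] in auto)
        then have "\<bar>\<psi> x\<bar> * \<bar>(\<eta>' n x *\<^sub>R gq x) \<bullet> Y x\<bar> \<le> L"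
          unfolding L_def using M by (intro mult_mono) auto
        then have le: "norm (\<psi> x * ((\<eta>' n x *\<^sub>R gq x) \<bullet> Y x)) \<le> L" by (simp only: real_norm_def abs_mult)
        have "norm (indicator E x * (\<psi> x * ((\<eta>' n x *\<^sub>R gq x) \<bullet> Y x))) \<le> L"
          using le L by (cases "x \<in> E") simp_all
        then show ?thesis using True by simp
      next
        case False
        have "\<psi> x * \<eta>' n x = 0"
        proof (cases "x \<in> K")
          case True
          have "q x \<ge> 4 * (\<epsilon> n)\<^sup>2"
          proof -
            from False True have "2 * \<epsilon> n \<le> \<bar>x \<bullet> e1\<bar> \<or> 2 * \<epsilon> n \<le> \<bar>x \<bullet> e2\<bar>" by (auto simp: S_def)
            then show ?thesis
            proof
              assume "2 * \<epsilon> n \<le> \<bar>x \<bullet> e1\<bar>"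
              then have "(2 * \<epsilon> n)\<^sup>2 \<le> \<bar>x \<bullet> e1\<bar>\<^sup>2" using \<epsilon>[of n] by (intro power_mono) auto
              then show ?thesis unfolding q_def power2_eq_square[symmetric] by (simp add: add_increasing2)
            next
              assume "2 * \<epsilon> n \<le> \<bar>x \<bullet> e2\<bar>"
              then have "(2 * \<epsilon> n)\<^sup>2 \<le> \<bar>x \<bullet> e2\<bar>\<^sup>2" using \<epsilon>[of n] by (intro power_mono) auto
              then show ?thesis unfolding q_def power2_eq_square[symmetric] by (simp add: add_increasing)
            qed
          qed
          then have "2 * (\<epsilon> n)\<^sup>2 \<le> q x" using zero_le_power2[of "\<epsilon> n"] by linarith
          then have "q x / (\<epsilon> n)\<^sup>2 \<ge> 2" using \<epsilon>[of n] by (simp add: pos_le_divide_eq)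
          then show ?thesis by (simp add: \<eta>'_def step'_eq_0)
        qed (simp add: test_funD(3)[OF t(1)])
        then have "indicator E x * (\<psi> x * ((\<eta>' n x *\<^sub>R gq x) \<bullet> Y x)) = (0::real)" by auto
        then show ?thesis using L by (simp only: norm_zero) simp
      qed
    qed
    also have "\<dots> = measure lebesgue S * L"
      using cSS by (simp add: measure_completion borel_compact)
    also have "\<dots> \<le> (Cs * (2 * \<epsilon> n)\<^sup>2) * L"
      unfolding S_def using Cs(2)[of "2 * \<epsilon> n"] \<epsilon>[of n] L by (intro mult_right_mono) auto
    also have "\<dots> = 64 * M * MY * Cs * \<epsilon> n"
      using \<epsilon>[of n] by (simp add: L_def power2_eq_square field_simps)
    finally show ?thesis by simp
  qed
  have "(\<lambda>n. 64 * M * MY * Cs * \<epsilon> n) \<longlonglongrightarrow> 64 * M * MY * Cs * 0" by (intro tendsto_intros \<epsilon>0)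
  moreover have "A n \<le> 64 * M * MY * Cs * \<epsilon> n" for n using AB[of n] Bbound[of n] by linarith
  ultimately show ?thesis using LIMSEQ_le[OF Alim] by auto
qed

end

section \<open>A divergence identity\<close>

text \<open>The transpose of \<open>H\<close> applied to \<open>w\<close>. For a Hessian it is
  \<open>H w\<close>; the coordinate form is the one in which \<open>inner_field_C1g\<close>
  delivers gradients.\<close>

definition adjv :: "('a::euclidean_space \<Rightarrow>\<^sub>L 'a) \<Rightarrow> 'a \<Rightarrow> 'a" where
  "adjv H w = (\<Sum>k\<in>Basis. (H k \<bullet> w) *\<^sub>R k)"

lemma adjv_inner: "adjv H w \<bullet> h = H h \<bullet> w"
proof -
  have "H h = H (\<Sum>k\<in>Basis. (h \<bullet> k) *\<^sub>R k)" by (simp add: euclidean_representation)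
  also have "\<dots> = (\<Sum>k\<in>Basis. (h \<bullet> k) *\<^sub>R H k)" by (simp add: blinfun.sum_right blinfun.scaleR_right)
  finally show ?thesis by (simp add: adjv_def inner_sum_left inner_sum_right inner_commute mult.commute)
qed

lemma adjv_symmetric:
  fixes H :: "'a::euclidean_space \<Rightarrow>\<^sub>L 'a"
  assumes "\<And>h k. H h \<bullet> k = H k \<bullet> h"
  shows "adjv H w = H w"
proof -
  have "adjv H w \<bullet> h = H w \<bullet> h" for h using assms[of h w] by (simp add: adjv_inner)
  then show ?thesis by (metis inner_commute vector_eq_ldot)
qed

lemma continuous_on_adjv:
  assumes "continuous_on S H" "continuous_on S w"
  shows "continuous_on S (\<lambda>x. adjv (H x) (w x))"
  unfolding adjv_def by (intro continuous_intros assms)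

lemma blinfun_inner_expand:
  fixes H :: "'a::euclidean_space \<Rightarrow>\<^sub>L 'b::real_normed_vector"
  shows "(\<Sum>j\<in>Basis. (v \<bullet> j) *\<^sub>R H j) = H v"
proof -
  have "H v = H (\<Sum>k\<in>Basis. (v \<bullet> k) *\<^sub>R k)" by (simp add: euclidean_representation)
  then show ?thesis by (simp add: blinfun.sum_right blinfun.scaleR_right)
qed

lemma C1g_inner_fields:
  fixes v v' :: "'a::euclidean_space \<Rightarrow> 'a"
  assumes v: "\<And>x. x \<in> W \<Longrightarrow> (v has_derivative blinfun_apply (H x)) (at x)" "continuous_on W H"
    and v': "\<And>x. x \<in> W \<Longrightarrow> (v' has_derivative blinfun_apply (H' x)) (at x)" "continuous_on W H'"
  shows "C1g (\<lambda>x. v x \<bullet> v' x) (\<lambda>x. adjv (H x) (v' x) + adjv (H' x) (v x)) W"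
proof (rule C1gI)
  fix x assume x: "x \<in> W"
  show "((\<lambda>x. v x \<bullet> v' x) has_derivative (\<lambda>h. (adjv (H x) (v' x) + adjv (H' x) (v x)) \<bullet> h)) (at x)"
  proof -
    have "(adjv (H x) (v' x) + adjv (H' x) (v x)) \<bullet> h = v x \<bullet> H' x h + H x h \<bullet> v' x" for h
      unfolding inner_add_left adjv_inner by (simp add: inner_commute)
    then show ?thesis using has_derivative_inner[OF v(1)[OF x] v'(1)[OF x]] by (simp only:)
  qed
next
  have "continuous_on W v" "continuous_on W v'"
    using v(1) v'(1) by (auto intro!: continuous_at_imp_continuous_on has_derivative_continuous)
  then show "continuous_on W (\<lambda>x. adjv (H x) (v' x) + adjv (H' x) (v x))"
    by (intro continuous_on_add continuous_on_adjv v(2) v'(2))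
qed

text \<open>\<open>U\<close> and \<open>U - V\<close> are homogeneous of degree zero, with gradients \<open>gu\<close>, \<open>g\<close> and Hessians \<open>Hu\<close>, \<open>H\<close>.\<close>

locale harmonic_pair =
  fixes E W C :: "'a::euclidean_space set" and U :: "'a \<Rightarrow> real" and gu g :: "'a \<Rightarrow> 'a"
    and Hu H :: "'a \<Rightarrow> 'a \<Rightarrow>\<^sub>L 'a" and p :: 'a and c2 :: real
  assumes W: "open W" "0 \<notin> W" and C: "closed C" and E: "E = W \<inter> C"
    and U: "C1g U gu W"
    and gu: "\<And>x. x \<in> W \<Longrightarrow> (gu has_derivative blinfun_apply (Hu x)) (at x)" and Hu: "continuous_on W Hu"
    and g: "\<And>x. x \<in> W \<Longrightarrow> (g has_derivative blinfun_apply (H x)) (at x)" and H: "continuous_on W H"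
    and symH: "\<And>x h k. x \<in> W \<Longrightarrow> H x h \<bullet> k = H x k \<bullet> h"
    and euler_u: "\<And>x. x \<in> W \<Longrightarrow> gu x \<bullet> x = 0" and euler: "\<And>x. x \<in> W \<Longrightarrow> g x \<bullet> x = 0"
    and euler2: "\<And>x. x \<in> W \<Longrightarrow> H x x = - g x"
    and gdiff: "\<And>x. x \<in> W \<Longrightarrow> gu x = g x + ((1 / norm x) *\<^sub>R p - ((x \<bullet> p) / norm x ^ 3) *\<^sub>R x)"
    and Hdiff: "\<And>x h. x \<in> W \<Longrightarrow> h \<bullet> x = 0 \<Longrightarrow>
        Hu x h = H x h - ((p \<bullet> h) / norm x ^ 3) *\<^sub>R x - ((x \<bullet> p) / norm x ^ 3) *\<^sub>R h"
    and harmonic: "\<And>x. x \<in> E \<Longrightarrow> (\<Sum>i\<in>Basis. H x i \<bullet> i) = 0"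
begin

definition V :: "'a \<Rightarrow> real" where "V x = (x \<bullet> p) / norm x"
definition gV :: "'a \<Rightarrow> 'a" where "gV x = (1 / norm x) *\<^sub>R p - ((x \<bullet> p) / norm x ^ 3) *\<^sub>R x"

definition F :: "'a \<Rightarrow> real" where
  "F x = ((x \<bullet> x) * (gu x \<bullet> gu x) + 2 * (U x * V x) - U x * U x - c2) / 2"

definition gF :: "'a \<Rightarrow> 'a" where
  "gF x = (x \<bullet> x) *\<^sub>R adjv (Hu x) (gu x) + (gu x \<bullet> gu x) *\<^sub>R x + U x *\<^sub>R gV x + V x *\<^sub>R gu x - U x *\<^sub>R gu x"

definition Y :: "'a \<Rightarrow> 'a" where
  "Y x = U x *\<^sub>R ((x \<bullet> x) *\<^sub>R H x (g x) + (g x \<bullet> g x) *\<^sub>R x) - F x *\<^sub>R g x"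

definition G :: "'a \<Rightarrow> real" where
  "G x = U x * ((x \<bullet> x) * (\<Sum>j\<in>Basis. H x j \<bullet> H x j) + (real DIM('a) - 3) * (g x \<bullet> g x))"

lemma cont_gu: "continuous_on W gu" and cont_g: "continuous_on W g"
  using gu g by (auto intro!: continuous_at_imp_continuous_on has_derivative_continuous)

lemma C1g_norm_sq: "C1g (\<lambda>x. x \<bullet> x) (\<lambda>x. 2 *\<^sub>R x) W"
  using C1g_subset[OF C1g_dist_sq[of 0]] by simp

lemma C1g_V: "C1g V gV W"
proof (rule C1gI)
  fix x assume "x \<in> W"
  then have x: "x \<noteq> 0" using W(2) by auto
  have n: "(norm has_derivative (\<lambda>h. h \<bullet> sgn x)) (at x)" by (rule has_derivative_norm[OF x])
  have "((\<lambda>x. (x \<bullet> p) / norm x) has_derivative (\<lambda>h. - (x \<bullet> p) * (inverse (norm x) * (h \<bullet> sgn x) * inverse (norm x)) + (h \<bullet> p) / norm x)) (at x)"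
    by (rule has_derivative_divide[OF _ n]) (use x in \<open>auto intro!: derivative_eq_intros\<close>)
  moreover have "(\<lambda>h. - (x \<bullet> p) * (inverse (norm x) * (h \<bullet> sgn x) * inverse (norm x)) + (h \<bullet> p) / norm x) = (\<lambda>h. gV x \<bullet> h)"
  proof
    fix h
    have "h \<bullet> sgn x = (x \<bullet> h) / norm x" by (simp add: sgn_div_norm inner_commute divide_inverse_commute)
    then show "- (x \<bullet> p) * (inverse (norm x) * (h \<bullet> sgn x) * inverse (norm x)) + (h \<bullet> p) / norm x = gV x \<bullet> h"
      by (simp add: gV_def inner_diff_left inner_commute[of p h] divide_inverse power3_eq_cube)
  qed
  ultimately show "(V has_derivative (\<lambda>h. gV x \<bullet> h)) (at x)" unfolding V_def[abs_def] by simp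
next
  show "continuous_on W gV" unfolding gV_def[abs_def] using W(2) by (intro continuous_intros) auto
qed

lemma C1g_F: "C1g F gF W"
proof -
  have 1: "C1g (\<lambda>x. gu x \<bullet> gu x) (\<lambda>x. adjv (Hu x) (gu x) + adjv (Hu x) (gu x)) W"
    by (rule C1g_inner_fields[OF gu Hu gu Hu])
  have 2: "C1g (\<lambda>x. (1/2) * (((x \<bullet> x) * (gu x \<bullet> gu x) + 2 * (U x * V x)) - (U x * U x) - c2))
     (\<lambda>x. (1/2) *\<^sub>R ((((x \<bullet> x) *\<^sub>R (adjv (Hu x) (gu x) + adjv (Hu x) (gu x)) + (gu x \<bullet> gu x) *\<^sub>R (2 *\<^sub>R x)) + 2 *\<^sub>R (U x *\<^sub>R gV x + V x *\<^sub>R gu x))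
        - (U x *\<^sub>R gu x + U x *\<^sub>R gu x) - 0)) W"
    by (intro C1g_cmult C1g_diff C1g_add C1g_mult 1 C1g_norm_sq U C1g_V C1g_const)
  show ?thesis
    by (rule C1g_transform[OF 2 W(1)]) (simp_all add: F_def gF_def algebra_simps flip: scaleR_2)
qed

text \<open>The terms containing \<open>V\<close> cancel: on vectors orthogonal to \<open>x\<close>,
  and up to multiples of \<open>x\<close>, \<open>Hu\<close> is \<open>H\<close> minus
  \<open>V / |x|^2\<close> times the identity, while \<open>gV\<close> is
  \<open>gu - g\<close>.\<close>

lemma gF_inner:
  assumes x: "x \<in> W"
  shows "gF x \<bullet> g x = (x \<bullet> x) * (H x (g x) \<bullet> gu x) - U x * (g x \<bullet> g x)"
proof -
  have x0: "x \<noteq> 0" using W(2) x by auto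
  have gx: "g x \<bullet> x = 0" "x \<bullet> g x = 0" and gux: "x \<bullet> gu x = 0"
    using euler[OF x] euler_u[OF x] by (simp_all add: inner_commute)
  have gV: "gV x = gu x - g x" using gdiff[OF x] by (simp add: gV_def)
  have n: "(x \<bullet> x) * ((x \<bullet> p) / norm x ^ 3) = V x"
    using x0 by (simp add: V_def power3_eq_cube flip: power2_norm_eq_inner) (simp add: power2_eq_square)
  have "(x \<bullet> x) * (Hu x (g x) \<bullet> gu x) = (x \<bullet> x) * (H x (g x) \<bullet> gu x) - ((x \<bullet> x) * ((x \<bullet> p) / norm x ^ 3)) * (g x \<bullet> gu x)"
    using Hdiff[OF x gx(1)] gux by (simp add: inner_diff_left right_diff_distrib)
  also have "\<dots> = (x \<bullet> x) * (H x (g x) \<bullet> gu x) - V x * (g x \<bullet> gu x)" by (simp only: n)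
  finally have 1: "(x \<bullet> x) * (Hu x (g x) \<bullet> gu x) = (x \<bullet> x) * (H x (g x) \<bullet> gu x) - V x * (g x \<bullet> gu x)" .
  have "gF x \<bullet> g x = (x \<bullet> x) * (Hu x (g x) \<bullet> gu x) + U x * (gV x \<bullet> g x) + V x * (gu x \<bullet> g x) - U x * (gu x \<bullet> g x)"
    using gx by (simp add: gF_def inner_add_left inner_diff_left adjv_inner)
  also have "\<dots> = (x \<bullet> x) * (H x (g x) \<bullet> gu x) - U x * (g x \<bullet> g x)"
    unfolding 1 gV by (simp add: inner_diff_left inner_commute algebra_simps)
  finally show ?thesis .
qed

lemma cont_Y: "continuous_on W Y"
  unfolding Y_def[abs_def] by (intro continuous_intros C1g_cont[OF U] H cont_g C1g_cont[OF C1g_F])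

lemma cont_G: "continuous_on W G"
  unfolding G_def[abs_def] by (intro continuous_intros C1g_cont[OF U] H cont_g)

lemma interior_E: "interior E \<subseteq> W" "interior E \<subseteq> E"
  using interior_subset[of E] E by auto

text \<open>\<open>Y\<close> is the sum of \<open>|x|^2 U H g\<close> and \<open>U |g|^2 x\<close>
  minus \<open>F g\<close>, and \<open>S1\<close>, \<open>S2\<close>, \<open>S3\<close> test these
  separately. Only the first contains \<open>H\<close>, which cannot be differentiated. The terms
  with \<open>H g \<bullet> gu\<close> cancel between \<open>S1\<close> and \<open>S3\<close>, and
  the coefficient of \<open>U |g|^2\<close> becomes
  \<open>-2 + (DIM - 2) + 1 = DIM - 3\<close>.\<close>

lemma weak_identity:
  assumes t: "test_fun \<psi> g\<psi> K" and K: "K \<subseteq> interior E"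
  shows "(\<integral>x. \<psi> x * G x + g\<psi> x \<bullet> Y x \<partial>lborel) = 0"
proof -
  have KW: "K \<subseteq> W" using K interior_E by auto
  have cK: "compact K" by (rule test_funD(2)[OF t])
  have gi: "(g has_derivative blinfun_apply (H x)) (at x)" if "x \<in> interior E" for x using g that interior_E by auto
  have Hi: "continuous_on (interior E) H" using H interior_E(1) by (rule continuous_on_subset)
  have tr: "(\<Sum>i\<in>Basis. H x i \<bullet> i) = 0" if "x \<in> interior E" for x using harmonic that interior_E by auto
  have z: "\<psi> x = 0" "g\<psi> x = 0" if "x \<notin> K" for x using test_funD(3,4)[OF t that] .
  note cts = test_funD(5,6)[OF t, of K] continuous_on_subset[OF H KW] continuous_on_subset[OF cont_g KW]
    continuous_on_subset[OF cont_gu KW] continuous_on_subset[OF C1g_cont[OF U] KW]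
    continuous_on_subset[OF C1g_cont[OF C1g_F] KW] continuous_on_subset[OF C1g_cont_grad[OF C1g_F] KW]
    continuous_on_subset[OF Hi K] continuous_on_subset[OF H KW]
  define q where "q = (\<lambda>x. (x \<bullet> x) * U x)"
  define gq where "gq = (\<lambda>x. (x \<bullet> x) *\<^sub>R gu x + U x *\<^sub>R (2 *\<^sub>R x))"
  have q: "C1g q gq W" unfolding q_def gq_def by (intro C1g_mult C1g_norm_sq U)
  have cq: "continuous_on K q" "continuous_on K gq" using C1g_cont[OF q] C1g_cont_grad[OF q] KW by (auto intro: continuous_on_subset)
  have gj: "C1g (\<lambda>x. g x \<bullet> j) (\<lambda>x. \<Sum>k\<in>Basis. (H x k \<bullet> j) *\<^sub>R k) W" for j
    by (rule inner_field_C1g[OF g H])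
  have Hj: "(\<Sum>k\<in>Basis. (H x k \<bullet> j) *\<^sub>R k) = H x j" if "x \<in> W" for x j
    using adjv_symmetric[of "H x" j, OF symH[OF that]] by (simp add: adjv_def)
  have t1: "test_fun (\<lambda>x. \<psi> x * (q x * (g x \<bullet> j)))
      (\<lambda>x. \<psi> x *\<^sub>R (q x *\<^sub>R (\<Sum>k\<in>Basis. (H x k \<bullet> j) *\<^sub>R k) + (g x \<bullet> j) *\<^sub>R gq x) + (q x * (g x \<bullet> j)) *\<^sub>R g\<psi> x) K" for j
    by (rule test_fun_mult[OF t KW W(1) C1g_mult[OF q gj]])
  \<comment> \<open>\<open>H x j\<close> is the derivative of the divergence-free field
    \<open>g\<close> in direction \<open>j\<close>, hence weakly divergence-free. The test function
    carries the weight \<open>g x \<bullet> j\<close>, so that summation over \<open>j\<close>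
    restores \<open>H x (g x)\<close>.\<close>
  define I1 where "I1 = (\<lambda>j x. (\<psi> x *\<^sub>R (q x *\<^sub>R H x j + (g x \<bullet> j) *\<^sub>R gq x) + (q x * (g x \<bullet> j)) *\<^sub>R g\<psi> x) \<bullet> H x j)"
  have I1: "(\<integral>x. I1 j x \<partial>lborel) = 0" for j
  proof -
    have "(\<integral>x. (\<psi> x *\<^sub>R (q x *\<^sub>R (\<Sum>k\<in>Basis. (H x k \<bullet> j) *\<^sub>R k) + (g x \<bullet> j) *\<^sub>R gq x) + (q x * (g x \<bullet> j)) *\<^sub>R g\<psi> x) \<bullet> H x j \<partial>lborel) = 0"
      by (rule integral_derivative_divergence_free[OF t1 K open_interior gi Hi tr])
    moreover have "(\<psi> x *\<^sub>R (q x *\<^sub>R (\<Sum>k\<in>Basis. (H x k \<bullet> j) *\<^sub>R k) + (g x \<bullet> j) *\<^sub>R gq x) + (q x * (g x \<bullet> j)) *\<^sub>R g\<psi> x) \<bullet> H x j = I1 j x" for x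
      using Hj[of x j] z[of x] KW unfolding I1_def by (cases "x \<in> K") (auto simp: subset_iff)
    ultimately show ?thesis by (simp only:)
  qed
  have int1: "integrable lborel (I1 j)" for j
    by (rule compact_support_integrable[OF cK]) (unfold I1_def, intro continuous_intros cts cq, simp add: z)
  define S1 where "S1 = (\<lambda>x. \<Sum>j\<in>Basis. I1 j x)"
  have intS1: "integrable lborel S1" unfolding S1_def by (intro Bochner_Integration.integrable_sum int1)
  have S1: "(\<integral>x. S1 x \<partial>lborel) = 0" unfolding S1_def
    by (subst Bochner_Integration.integral_sum) (simp_all add: int1 I1)
  have S1_eq: "S1 x = \<psi> x * (q x * (\<Sum>j\<in>Basis. H x j \<bullet> H x j) + gq x \<bullet> H x (g x)) + q x * (g\<psi> x \<bullet> H x (g x))" for x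
  proof -
    have a: "I1 j x = \<psi> x * q x * (H x j \<bullet> H x j) + (\<psi> x *\<^sub>R gq x + q x *\<^sub>R g\<psi> x) \<bullet> ((g x \<bullet> j) *\<^sub>R H x j)" for j
      by (simp add: I1_def inner_add_left algebra_simps)
    have "S1 x = \<psi> x * q x * (\<Sum>j\<in>Basis. H x j \<bullet> H x j) + (\<psi> x *\<^sub>R gq x + q x *\<^sub>R g\<psi> x) \<bullet> H x (g x)"
      unfolding S1_def a by (simp only: sum.distrib sum_distrib_left[symmetric] inner_sum_right[symmetric] blinfun_inner_expand)
    then show ?thesis by (simp add: inner_add_left algebra_simps)
  qed
  have gg: "C1g (\<lambda>x. g x \<bullet> g x) (\<lambda>x. adjv (H x) (g x) + adjv (H x) (g x)) W"
    by (rule C1g_inner_fields[OF g H g H])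
  have t2: "test_fun (\<lambda>x. \<psi> x * (U x * (g x \<bullet> g x)))
     (\<lambda>x. \<psi> x *\<^sub>R (U x *\<^sub>R (adjv (H x) (g x) + adjv (H x) (g x)) + (g x \<bullet> g x) *\<^sub>R gu x) + (U x * (g x \<bullet> g x)) *\<^sub>R g\<psi> x) K"
    by (rule test_fun_mult[OF t KW W(1) C1g_mult[OF U gg]])
  \<comment> \<open>The divergence theorem for the position field, whose divergence is
    \<open>DIM('a)\<close>. The radial derivative of \<open>g x \<bullet> g x\<close>, which has
    degree -2, later lowers this by 2.\<close>
  define S2 where "S2 = (\<lambda>x. (\<psi> x *\<^sub>R (U x *\<^sub>R (adjv (H x) (g x) + adjv (H x) (g x)) + (g x \<bullet> g x) *\<^sub>R gu x) + (U x * (g x \<bullet> g x)) *\<^sub>R g\<psi> x) \<bullet> x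
     + \<psi> x * (U x * (g x \<bullet> g x)) * real DIM('a))"
  have S2: "(\<integral>x. S2 x \<partial>lborel) = 0"
    using integral_divergence[OF t2 KW W(1), of "\<lambda>x. x" "\<lambda>x. id_blinfun"]
    by (simp add: S2_def has_derivative_ident id_blinfun.rep_eq)
  have intS2: "integrable lborel S2"
    by (rule compact_support_integrable[OF cK]) (unfold S2_def, intro continuous_intros cts continuous_on_adjv, simp add: z)
  have S2_eq: "S2 x = \<psi> x * ((real DIM('a) - 2) * (U x * (g x \<bullet> g x))) + U x * (g x \<bullet> g x) * (g\<psi> x \<bullet> x)" if x: "x \<in> W" for x
  proof -
    have "S2 x = \<psi> x * (U x * (2 * (H x x \<bullet> g x)) + (g x \<bullet> g x) * (gu x \<bullet> x)) + U x * (g x \<bullet> g x) * (g\<psi> x \<bullet> x) + \<psi> x * (U x * (g x \<bullet> g x)) * real DIM('a)"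
      by (simp add: S2_def inner_add_left adjv_inner algebra_simps)
    also have "\<dots> = \<psi> x * ((real DIM('a) - 2) * (U x * (g x \<bullet> g x))) + U x * (g x \<bullet> g x) * (g\<psi> x \<bullet> x)"
      using euler_u[OF x] euler2[OF x] by (simp add: algebra_simps)
    finally show ?thesis .
  qed
  have t3: "test_fun (\<lambda>x. \<psi> x * F x) (\<lambda>x. \<psi> x *\<^sub>R gF x + F x *\<^sub>R g\<psi> x) K"
    by (rule test_fun_mult[OF t KW W(1) C1g_F])
  \<comment> \<open>\<open>g\<close> has zero divergence on \<open>E\<close>, so only the derivative
    of \<open>\<psi> F\<close> in direction \<open>g\<close> is left.\<close>
  define S3 where "S3 = (\<lambda>x. (\<psi> x *\<^sub>R gF x + F x *\<^sub>R g\<psi> x) \<bullet> g x)"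
  have S3: "(\<integral>x. S3 x \<partial>lborel) = 0"
  proof -
    have "(\<integral>x. (\<psi> x *\<^sub>R gF x + F x *\<^sub>R g\<psi> x) \<bullet> g x + \<psi> x * F x * (\<Sum>i\<in>Basis. H x i \<bullet> i) \<partial>lborel) = 0"
      by (rule integral_divergence[OF t3 KW W(1) g H])
    moreover have "(\<psi> x *\<^sub>R gF x + F x *\<^sub>R g\<psi> x) \<bullet> g x + \<psi> x * F x * (\<Sum>i\<in>Basis. H x i \<bullet> i) = S3 x" for x
      using tr[of x] z[of x] K by (cases "x \<in> K") (auto simp: S3_def)
    ultimately show ?thesis by (simp only:)
  qed
  have intS3: "integrable lborel S3"
    by (rule compact_support_integrable[OF cK]) (unfold S3_def, intro continuous_intros cts, simp add: z)
  have S3_eq: "S3 x = \<psi> x * ((x \<bullet> x) * (H x (g x) \<bullet> gu x) - U x * (g x \<bullet> g x)) + F x * (g\<psi> x \<bullet> g x)" if x: "x \<in> W" for x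
    using gF_inner[OF x] by (simp add: S3_def inner_add_left)
  have "(\<integral>x. \<psi> x * G x + g\<psi> x \<bullet> Y x \<partial>lborel) = (\<integral>x. S1 x + S2 x - S3 x \<partial>lborel)"
  proof (rule Bochner_Integration.integral_cong[OF refl])
    fix x
    show "\<psi> x * G x + g\<psi> x \<bullet> Y x = S1 x + S2 x - S3 x"
    proof (cases "x \<in> K")
      case True
      then have x: "x \<in> W" using KW by auto
      \<comment> \<open>Symmetry moves \<open>H\<close> onto \<open>x\<close>, where it is known
        because \<open>g\<close> is homogeneous of degree -1.\<close>
      have e: "x \<bullet> H x (g x) = - (g x \<bullet> g x)"
        using symH[OF x, of "g x" x] euler2[OF x] by (simp add: inner_commute)
      have e2: "gq x \<bullet> H x (g x) = (x \<bullet> x) * (H x (g x) \<bullet> gu x) - 2 * U x * (g x \<bullet> g x)"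
        using e by (simp add: gq_def inner_add_left inner_commute[of "gu x"])
      then show ?thesis
        unfolding S1_eq e2 S2_eq[OF x] S3_eq[OF x] by (simp add: G_def Y_def q_def inner_diff_right inner_add_right algebra_simps)
    next
      case False
      then show ?thesis using z[OF False] by (simp add: S1_eq S2_def S3_def)
    qed
  qed
  also have "\<dots> = 0" using S1 S2 S3 intS1 intS2 intS3 by simp
  finally show ?thesis .
qed

sublocale wd: weak_divergence E W C Y G
  by unfold_locales (rule W C E cont_Y cont_G weak_identity; assumption?)+

text \<open>This is what the term \<open>|g|^2 x\<close> in \<open>Y\<close> is for: it cancels the
  radial part of \<open>|x|^2 H g\<close>, because \<open>H g \<bullet> x = - |g|^2\<close>.\<close>

lemma Y_tangential: "x \<in> W \<Longrightarrow> Y x \<bullet> x = 0"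
  using symH[of x "g x" x] euler2[of x] euler[of x]
  by (simp add: Y_def inner_diff_left inner_add_left algebra_simps)

end

section \<open>Homogeneous functions and the Laplace-Beltrami operator\<close>

text \<open>\<open>Ck\<close> controls derivatives only direction by direction; rebuilding the
  derivative from its values on \<open>Basis\<close> turns this into control of the
  operator.\<close>

lemma differentiable_frechet_expand:
  fixes f :: "'a::euclidean_space \<Rightarrow> 'b::real_normed_vector"
  assumes "f differentiable (at x)"
  shows "(f has_derivative blinfun_apply (\<Sum>k\<in>Basis. blinfun_scaleR_left (frechet_derivative f (at x) k) o\<^sub>L blinfun_inner_right k)) (at x)"
proof -
  have d: "(f has_derivative frechet_derivative f (at x)) (at x)" using assms by (rule frechet_derivative_works[THEN iffD1])
  then have l: "linear (frechet_derivative f (at x))" by (rule has_derivative_linear)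
  have "frechet_derivative f (at x) h = (\<Sum>k\<in>Basis. blinfun_scaleR_left (frechet_derivative f (at x) k) o\<^sub>L blinfun_inner_right k) h" for h
  proof -
    have "frechet_derivative f (at x) h = frechet_derivative f (at x) (\<Sum>k\<in>Basis. (h \<bullet> k) *\<^sub>R k)"
      by (simp add: euclidean_representation)
    also have "\<dots> = (\<Sum>k\<in>Basis. (h \<bullet> k) *\<^sub>R frechet_derivative f (at x) k)"
      using l by (simp add: linear_sum linear_scale)
    finally show ?thesis by (simp add: blinfun.sum_left blinfun_inner_right.rep_eq inner_commute)
  qed
  then have "blinfun_apply (\<Sum>k\<in>Basis. blinfun_scaleR_left (frechet_derivative f (at x) k) o\<^sub>L blinfun_inner_right k) = frechet_derivative f (at x)" by (intro ext) (rule sym)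
  with d show ?thesis by (simp only:)
qed

lemma C1_sum:
  assumes "finite F" "\<And>k. k \<in> F \<Longrightarrow> C1 (f k) W" shows "C1 (\<lambda>x. \<Sum>k\<in>F. f k x) W"
  using assms by (induction F) (auto intro!: C1_add)

text \<open>In finite dimension, continuity of the derivatives in each fixed direction gives
  continuity of the operator-valued derivative.\<close>

lemma Ck_2_imp_C2:
  fixes f :: "'a::euclidean_space \<Rightarrow> 'b::euclidean_space"
  assumes U: "open U" and f: "Ck 2 f U"
  shows "C2 f U"
proof -
  define D where "D = (\<lambda>k x. frechet_derivative f (at x) k)"
  have f1: "f differentiable_on U" and f2: "\<And>k. D k differentiable_on U"
    and f3: "\<And>k l. continuous_on U (\<lambda>x. frechet_derivative (D k) (at x) l)"
    using f by (auto simp: numeral_2_eq_2 D_def)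
  have "C1 (D k) U" for k
  proof (rule C1I)
    fix x assume "x \<in> U"
    then have "D k differentiable (at x)" using f2 U by (simp add: differentiable_on_eq_differentiable_at)
    then show "(D k has_derivative blinfun_apply (\<Sum>l\<in>Basis. blinfun_scaleR_left (frechet_derivative (D k) (at x) l) o\<^sub>L blinfun_inner_right l)) (at x)"
      by (rule differentiable_frechet_expand)
  next
    show "continuous_on U (\<lambda>x. \<Sum>l\<in>Basis. blinfun_scaleR_left (frechet_derivative (D k) (at x) l) o\<^sub>L blinfun_inner_right l)"
      by (intro continuous_on_sum bounded_bilinear.continuous_on[OF bounded_bilinear_blinfun_compose] f3 continuous_on_const
          bounded_linear.continuous_on[OF bounded_linear_blinfun_scaleR_left])
  qed
  then have c: "C1 (\<lambda>x. \<Sum>k\<in>Basis. blinfun_scaleR_left (D k x) o\<^sub>L blinfun_inner_right k) U"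
    by (intro C1_sum C1_bilinear[OF bounded_bilinear_blinfun_compose] C1_const C1_linear_compose[OF bounded_linear_blinfun_scaleR_left]) auto
  show ?thesis
  proof (rule C2I[OF _ c])
    fix x assume "x \<in> U"
    then have "f differentiable (at x)" using f1 U by (simp add: differentiable_on_eq_differentiable_at)
    then show "(f has_derivative blinfun_apply (\<Sum>k\<in>Basis. blinfun_scaleR_left (D k x) o\<^sub>L blinfun_inner_right k)) (at x)"
      unfolding D_def by (rule differentiable_frechet_expand)
  qed
qed

text \<open>Needed because \<open>sph_convex\<close> may only be applied to curves that satisfy
  \<open>Ck 2\<close>.\<close>

lemma C2_imp_Ck_2:
  fixes f :: "'a::euclidean_space \<Rightarrow> 'b::euclidean_space"
  assumes U: "open U" and f: "C2 f U"
  shows "Ck 2 f U"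
proof -
  obtain f' where f': "\<And>x. x \<in> U \<Longrightarrow> (f has_derivative blinfun_apply (f' x)) (at x)" "C1 f' U"
    by (rule C2E[OF f]) blast
  obtain f'' where f'': "\<And>x. x \<in> U \<Longrightarrow> (f' has_derivative blinfun_apply (f'' x)) (at x)" "continuous_on U f''"
    by (rule C1E[OF f'(2)]) blast
  have 1: "frechet_derivative f (at x) v = f' x v" if "x \<in> U" for x v
    using frechet_derivative_at[OF f'(1)[OF that]] by simp
  have 2: "((\<lambda>x. frechet_derivative f (at x) v) has_derivative (\<lambda>h. f'' x h v)) (at x)" if x: "x \<in> U" for x v
  proof (rule has_derivative_transform_within_open[OF _ U x])
    show "((\<lambda>x. f' x v) has_derivative (\<lambda>h. f'' x h v)) (at x)"
      by (rule bounded_linear.has_derivative[OF blinfun.bounded_linear_left f''(1)[OF x]])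
  qed (simp add: 1)
  have 3: "frechet_derivative (\<lambda>x. frechet_derivative f (at x) v) (at x) h = f'' x h v" if "x \<in> U" for x v h
    using fun_cong[OF frechet_derivative_at[OF 2[OF that, of v]], of h] by simp
  have "continuous_on U (\<lambda>x. f'' x h v)" for h v by (intro continuous_intros f''(2))
  then have "continuous_on U (\<lambda>x. frechet_derivative (\<lambda>x. frechet_derivative f (at x) v) (at x) h)" for v h
    using continuous_on_cong[of U U "\<lambda>x. f'' x h v" "\<lambda>x. frechet_derivative (\<lambda>x. frechet_derivative f (at x) v) (at x) h"] 3 by simp
  moreover have "f differentiable_on U"
    unfolding differentiable_on_def differentiable_def by (intro ballI exI) (rule has_derivative_at_withinI[OF f'(1)])
  moreover have "(\<lambda>x. frechet_derivative f (at x) v) differentiable_on U" for v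
    unfolding differentiable_on_def differentiable_def by (intro ballI exI) (rule has_derivative_at_withinI[OF 2])
  ultimately show ?thesis by (simp add: numeral_2_eq_2)
qed

lemma C2_gradient:
  fixes f :: "'a::euclidean_space \<Rightarrow> real"
  assumes W: "open W" and f: "C2 f W"
  obtains g H where "C1g f g W" "\<And>x. x \<in> W \<Longrightarrow> (g has_derivative blinfun_apply (H x)) (at x)"
    "continuous_on W H" "\<And>x h k. x \<in> W \<Longrightarrow> blinfun_apply (H x) h \<bullet> k = blinfun_apply (H x) k \<bullet> h"
proof -
  obtain f' where f': "\<And>x. x \<in> W \<Longrightarrow> (f has_derivative blinfun_apply (f' x)) (at x)" "C1 f' W"
    by (rule C2E[OF f]) blast
  obtain f'' where f'': "\<And>x. x \<in> W \<Longrightarrow> (f' has_derivative blinfun_apply (f'' x)) (at x)" "continuous_on W f''"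
    by (rule C1E[OF f'(2)]) blast
  \<comment> \<open>The Riesz map from functionals to vectors; composed with the two derivatives it
    gives the gradient and the Hessian.\<close>
  define l :: "('a \<Rightarrow>\<^sub>L real) \<Rightarrow> 'a" where "l = (\<lambda>\<phi>. \<Sum>i\<in>Basis. \<phi> i *\<^sub>R i)"
  have bl: "bounded_linear l"
    unfolding l_def by (intro bounded_linear_sum bounded_linear_compose[OF bounded_linear_scaleR_left] blinfun.bounded_linear_left)
  have li: "l \<phi> \<bullet> h = \<phi> h" for \<phi> h
  proof -
    have "\<phi> h = \<phi> (\<Sum>k\<in>Basis. (h \<bullet> k) *\<^sub>R k)" by (simp add: euclidean_representation)
    also have "\<dots> = (\<Sum>k\<in>Basis. (h \<bullet> k) * \<phi> k)" by (simp add: blinfun.sum_right blinfun.scaleR_right)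
    finally show ?thesis by (simp add: l_def inner_sum_left inner_sum_right inner_commute mult.commute)
  qed
  define g where "g = (\<lambda>x. l (f' x))"
  define H where "H = (\<lambda>x. Blinfun l o\<^sub>L f'' x)"
  have Hh: "H x h = l (f'' x h)" for x h by (simp add: H_def bounded_linear_Blinfun_apply[OF bl])
  show ?thesis
  proof (rule that[of g H])
    show "C1g f g W"
    proof (rule C1gI)
      fix x assume x: "x \<in> W"
      have "(\<lambda>h. g x \<bullet> h) = blinfun_apply (f' x)" by (simp add: g_def li fun_eq_iff)
      then show "(f has_derivative (\<lambda>h. g x \<bullet> h)) (at x)" using f'(1)[OF x] by simp
    qed (unfold g_def, intro bounded_linear.continuous_on[OF bl] C1_continuous_on f'(2))
    show "(g has_derivative blinfun_apply (H x)) (at x)" if "x \<in> W" for x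
    proof -
      have "blinfun_apply (H x) = (\<lambda>h. l (f'' x h))" by (simp add: Hh fun_eq_iff)
      then show ?thesis unfolding g_def using bounded_linear.has_derivative[OF bl f''(1)[OF that]] by simp
    qed
    show "continuous_on W H" unfolding H_def
      by (intro bounded_bilinear.continuous_on[OF bounded_bilinear_blinfun_compose] f'' continuous_on_const)
    show "H x h \<bullet> k = H x k \<bullet> h" if "x \<in> W" for x h k
      using second_derivative_symmetric[OF W that f'(1) f''(1) f''(2)] by (simp add: Hh li)
  qed
qed

lemma has_derivative_zero_constant_local:
  fixes f :: "'a::real_normed_vector \<Rightarrow> 'b::real_normed_vector"
  assumes "(f has_derivative f') (at x)" "open W" "x \<in> W" "\<And>y. y \<in> W \<Longrightarrow> f y = c"
  shows "f' h = 0"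
proof -
  have "((\<lambda>y. c) has_derivative f') (at x)"
    using has_derivative_transform_within_open[OF assms(1-3), of "\<lambda>y. c"] assms(4) by simp
  then have "f' = (\<lambda>h. 0)" by (rule has_derivative_unique[OF _ has_derivative_const])
  then show ?thesis by simp
qed

lemma inner_eqI:
  fixes a b :: "'a::real_inner"
  assumes "\<And>h. a \<bullet> h = b \<bullet> h" shows "a = b"
proof -
  have "(a - b) \<bullet> (a - b) = 0" using assms[of "a - b"] by (simp add: inner_diff_left)
  then show ?thesis by simp
qed

text \<open>The union of the open rays from the origin through \<open>S\<close>, when
  \<open>S\<close> lies on the unit sphere. As \<open>sgn\<close> is the radial projection to the
  sphere, \<open>u (sgn x)\<close> is the degree zero extension of \<open>u\<close>, defined on
  \<open>hcone U\<close>.\<close>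

definition hcone :: "'a::real_normed_vector set \<Rightarrow> 'a set" where
  "hcone S = {x. x \<noteq> 0 \<and> sgn x \<in> S}"

lemma open_hcone: "open U \<Longrightarrow> open (hcone U)"
proof -
  assume "open U"
  then have "open ((- {0}) \<inter> sgn -` U)"
    by (intro continuous_open_preimage C2_continuous_on[OF C2_sgn]) (auto simp: sgn_zero_iff intro!: continuous_on_sgn)
  moreover have "hcone U = (- {0}) \<inter> sgn -` U" by (auto simp: hcone_def)
  ultimately show ?thesis by simp
qed

lemma sgn_scale_pos: "s > 0 \<Longrightarrow> sgn (s *\<^sub>R x) = sgn (x::'a::real_normed_vector)"
  by (simp add: sgn_scaleR)

lemma hcone_scale: "s > 0 \<Longrightarrow> s *\<^sub>R x \<in> hcone S \<longleftrightarrow> x \<in> hcone S"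
  by (auto simp: hcone_def sgn_scaleR)

lemma hcone_sphere: "norm x = 1 \<Longrightarrow> x \<in> hcone S \<longleftrightarrow> x \<in> S"
  by (auto simp: hcone_def sgn_div_norm)

lemma sgn_idem: "sgn (sgn x) = sgn (x::'a::real_normed_vector)"
  by (cases "x = 0") (simp_all add: sgn_div_norm)

text \<open>Euler's relation, from differentiating the constant function
  \<open>U (s *\<^sub>R x)\<close> of \<open>s\<close> at 1; the scaling law, from differentiating
  \<open>U (s *\<^sub>R x) = U x\<close> in \<open>x\<close>.\<close>

lemma homogeneous_gradient:
  fixes U :: "'a::euclidean_space \<Rightarrow> real"
  assumes W: "open W" and cone: "\<And>x s. x \<in> W \<Longrightarrow> s > 0 \<Longrightarrow> s *\<^sub>R x \<in> W"
    and hom: "\<And>x s. x \<in> W \<Longrightarrow> s > 0 \<Longrightarrow> U (s *\<^sub>R x) = U x"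
    and g: "C1g U g W"
  shows "x \<in> W \<Longrightarrow> g x \<bullet> x = 0" "x \<in> W \<Longrightarrow> s > 0 \<Longrightarrow> g (s *\<^sub>R x) = g x /\<^sub>R s"
proof -
  assume x: "x \<in> W"
  have "((\<lambda>s. U (s *\<^sub>R x)) has_derivative (\<lambda>r. g (1 *\<^sub>R x) \<bullet> (r *\<^sub>R x))) (at 1)"
    by (rule has_derivative_compose[where f="\<lambda>s. s *\<^sub>R x" and g=U])
      (use C1g_deriv[OF g x] in \<open>auto intro!: derivative_eq_intros\<close>)
  then have "g (1 *\<^sub>R x) \<bullet> (1 *\<^sub>R x) = 0"
    by (rule has_derivative_zero_constant_local[where W="{0<..}" and c="U x"]) (use hom x in auto)
  then show "g x \<bullet> x = 0" by simp
next
  assume x: "x \<in> W" and s: "s > 0"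
  have "((\<lambda>y. U (s *\<^sub>R y)) has_derivative (\<lambda>h. g (s *\<^sub>R x) \<bullet> (s *\<^sub>R h))) (at x)"
    by (rule has_derivative_compose[where f="\<lambda>y. s *\<^sub>R y" and g=U])
      (use C1g_deriv[OF g cone[OF x s]] in \<open>auto intro!: derivative_eq_intros\<close>)
  then have "(U has_derivative (\<lambda>h. g (s *\<^sub>R x) \<bullet> (s *\<^sub>R h))) (at x)"
    by (rule has_derivative_transform_within_open[OF _ W x]) (use hom s in auto)
  then have "(\<lambda>h. g (s *\<^sub>R x) \<bullet> (s *\<^sub>R h)) = (\<lambda>h. g x \<bullet> h)"
    by (rule has_derivative_unique[OF _ C1g_deriv[OF g x]])
  then have "(s *\<^sub>R g (s *\<^sub>R x)) \<bullet> h = g x \<bullet> h" for h by (simp add: fun_eq_iff)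
  then have "s *\<^sub>R g (s *\<^sub>R x) = g x" by (rule inner_eqI)
  then have "g x /\<^sub>R s = s *\<^sub>R g (s *\<^sub>R x) /\<^sub>R s" by simp
  then show "g (s *\<^sub>R x) = g x /\<^sub>R s" using s by simp
qed

text \<open>Differentiate the relation \<open>g y \<bullet> y = 0\<close> and use the symmetry of
  the Hessian.\<close>

lemma homogeneous_hessian:
  fixes U :: "'a::euclidean_space \<Rightarrow> real"
  assumes W: "open W" and g: "\<And>x. x \<in> W \<Longrightarrow> g x \<bullet> x = 0"
    and H: "x \<in> W" "(g has_derivative blinfun_apply (H x)) (at x)"
    and sym: "\<And>h k. H x h \<bullet> k = H x k \<bullet> h"
  shows "H x x = - g x"
proof -
  have "((\<lambda>y. g y \<bullet> y) has_derivative (\<lambda>h. g x \<bullet> h + H x h \<bullet> x)) (at x)"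
    using has_derivative_inner[OF H(2) has_derivative_ident] by simp
  then have "g x \<bullet> h + H x h \<bullet> x = 0" for h
    by (rule has_derivative_zero_constant_local[OF _ W H(1)]) (rule g)
  then have "H x x \<bullet> h = (- g x) \<bullet> h" for h using sym[of h x] by (simp add: add_eq_0_iff)
  then show ?thesis by (rule inner_eqI)
qed

lemma orthonormal_basis_expand:
  fixes B :: "'a::euclidean_space set"
  assumes B: "finite B" "pairwise orthogonal B" "\<And>b. b \<in> B \<Longrightarrow> norm b = 1" "span B = UNIV"
  shows "(\<Sum>b\<in>B. (x \<bullet> b) *\<^sub>R b) = x"
proof -
  define y where "y = x - (\<Sum>b\<in>B. (x \<bullet> b) *\<^sub>R b)"
  have "orthogonal y b" if b: "b \<in> B" for b
  proof -
    have "(\<Sum>c\<in>B. (x \<bullet> c) * (c \<bullet> b)) = (\<Sum>c\<in>B. if c = b then x \<bullet> b else 0)"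
      using B(2,3) b by (intro sum.cong) (auto simp: pairwise_def orthogonal_def norm_eq_1)
    also have "\<dots> = x \<bullet> b" using B(1) b by simp
    finally show ?thesis by (simp add: y_def orthogonal_def inner_diff_left inner_sum_left)
  qed
  then have "orthogonal y y" using orthogonal_to_span[of y B y] B(4) by simp
  then show ?thesis by (simp add: y_def orthogonal_def)
qed

lemma trace_orthonormal:
  fixes H :: "'a::euclidean_space \<Rightarrow>\<^sub>L 'a"
  assumes B: "finite B" "pairwise orthogonal B" "\<And>b. b \<in> B \<Longrightarrow> norm b = 1" "span B = UNIV"
  shows "(\<Sum>b\<in>B. H b \<bullet> b) = (\<Sum>i\<in>Basis. H i \<bullet> i)"
proof -
  have "(\<Sum>b\<in>B. H b \<bullet> b) = (\<Sum>b\<in>B. \<Sum>i\<in>Basis. (b \<bullet> i) * (H i \<bullet> b))"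
  proof (rule sum.cong[OF refl])
    fix b
    have "H b \<bullet> b = (\<Sum>i\<in>Basis. (b \<bullet> i) *\<^sub>R H i) \<bullet> b" by (simp only: blinfun_inner_expand)
    then show "H b \<bullet> b = (\<Sum>i\<in>Basis. (b \<bullet> i) * (H i \<bullet> b))" by (simp add: inner_sum_left)
  qed
  also have "\<dots> = (\<Sum>i\<in>Basis. \<Sum>b\<in>B. (b \<bullet> i) * (H i \<bullet> b))" by (rule sum.swap)
  also have "\<dots> = (\<Sum>i\<in>Basis. H i \<bullet> i)"
  proof (rule sum.cong[OF refl])
    fix i
    have "H i \<bullet> i = (\<Sum>b\<in>B. (H i \<bullet> b) *\<^sub>R b) \<bullet> i" by (simp only: orthonormal_basis_expand[OF B])
    then show "(\<Sum>b\<in>B. (b \<bullet> i) * (H i \<bullet> b)) = H i \<bullet> i" by (simp add: inner_sum_left mult.commute)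
  qed
  finally show ?thesis .
qed

lemma norm_geod:
  assumes "norm x = 1" "norm e = 1" "e \<bullet> x = 0" shows "norm (geod x e t) = 1"
proof -
  have "x \<bullet> e = 0" "x \<bullet> x = 1" "e \<bullet> e = 1" using assms by (simp_all add: inner_commute norm_eq_1)
  then show ?thesis using assms(3)
    by (simp add: geod_def norm_eq_1 inner_add_left inner_add_right flip: power2_eq_square)
qed

lemma geod_has_vector_derivative:
  "(geod x e has_vector_derivative (- sin t *\<^sub>R x + cos t *\<^sub>R e)) (at t)"
  unfolding geod_def[abs_def] by (auto intro!: derivative_eq_intros)

text \<open>The great circle has acceleration \<open>- x\<close> at \<open>x\<close>, which accounts
  for the gradient term.\<close>

lemma second_derivative_geod:
  assumes W: "open W" and g: "C1g U g W" and H: "\<And>y. y \<in> W \<Longrightarrow> (g has_derivative blinfun_apply (H y)) (at y)"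
    and x: "x \<in> W"
  shows "deriv (deriv (\<lambda>t. U (geod x e t))) 0 = H x e \<bullet> e - g x \<bullet> x"
proof -
  define \<gamma>' where "\<gamma>' = (\<lambda>t. - sin t *\<^sub>R x + cos t *\<^sub>R e)"
  have gd: "(geod x e has_derivative (\<lambda>r. r *\<^sub>R \<gamma>' t)) (at t)" for t
    using geod_has_vector_derivative[of x e t] by (simp add: has_vector_derivative_def \<gamma>'_def)
  have "continuous_on UNIV (geod x e)" unfolding geod_def[abs_def] by (intro continuous_intros)
  then have oT: "open (geod x e -` W)" by (rule open_vimage[OF W])
  have T0: "0 \<in> geod x e -` W" using x by (simp add: geod_def)
  have d1: "((\<lambda>t. U (geod x e t)) has_real_derivative g (geod x e t) \<bullet> \<gamma>' t) (at t)" if "geod x e t \<in> W" for t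
  proof -
    have "((\<lambda>t. U (geod x e t)) has_derivative (\<lambda>r. g (geod x e t) \<bullet> (r *\<^sub>R \<gamma>' t))) (at t)"
      by (rule has_derivative_compose[where f="geod x e" and g=U, OF gd C1g_deriv[OF g that]])
    then show ?thesis by (rule has_derivative_imp_has_field_derivative) simp
  qed
  have "((\<lambda>t. g (geod x e t) \<bullet> \<gamma>' t) has_derivative (\<lambda>r. g (geod x e 0) \<bullet> (r *\<^sub>R (- x)) + H (geod x e 0) (r *\<^sub>R \<gamma>' 0) \<bullet> \<gamma>' 0)) (at 0)"
  proof (rule has_derivative_inner)
    show "((\<lambda>t. g (geod x e t)) has_derivative (\<lambda>r. H (geod x e 0) (r *\<^sub>R \<gamma>' 0))) (at 0)"
      by (rule has_derivative_compose[where f="geod x e" and g=g, OF gd H]) (use T0 in simp)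
    show "(\<gamma>' has_derivative (\<lambda>r. r *\<^sub>R (- x))) (at 0)"
      unfolding \<gamma>'_def by (auto intro!: derivative_eq_intros)
  qed
  then have dd: "((\<lambda>t. g (geod x e t) \<bullet> \<gamma>' t) has_real_derivative H x e \<bullet> e - g x \<bullet> x) (at 0)"
    by (rule has_derivative_imp_has_field_derivative) (simp add: geod_def \<gamma>'_def blinfun.scaleR_right algebra_simps)
  have ev: "eventually (\<lambda>t. deriv (\<lambda>t. U (geod x e t)) t = g (geod x e t) \<bullet> \<gamma>' t) (nhds 0)"
    using eventually_nhds_in_open[OF oT T0] by eventually_elim (auto intro!: DERIV_imp_deriv d1)
  have "(deriv (\<lambda>t. U (geod x e t)) has_real_derivative H x e \<bullet> e - g x \<bullet> x) (at 0)"
    using dd unfolding DERIV_cong_ev[OF refl ev refl] .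
  then show ?thesis by (rule DERIV_imp_deriv)
qed

text \<open>The frame picked by \<open>SOME\<close> is harmless. Together with \<open>x\<close> it
  is an orthonormal basis, in which the trace may be computed, and the radial entry
  \<open>H x x \<bullet> x = - g x \<bullet> x\<close> is zero.\<close>

lemma laplace_beltrami_eq_trace:
  fixes u :: "'a::euclidean_space \<Rightarrow> real"
  assumes W: "open W" and cone: "\<And>x s. x \<in> W \<Longrightarrow> s > 0 \<Longrightarrow> s *\<^sub>R x \<in> W"
    and hom: "\<And>x s. x \<in> W \<Longrightarrow> s > 0 \<Longrightarrow> U (s *\<^sub>R x) = U x"
    and g: "C1g U g W" and H: "\<And>y. y \<in> W \<Longrightarrow> (g has_derivative blinfun_apply (H y)) (at y)"
    and HE: "H x x = - g x"
    and eq: "\<And>y. norm y = 1 \<Longrightarrow> u y = U y"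
    and x: "x \<in> W" "norm x = 1"
  shows "laplace_beltrami u x = (\<Sum>i\<in>Basis. H x i \<bullet> i)"
proof -
  define B where "B = (SOME B. sphere_tangent_onb x B)"
  have "\<exists>B. sphere_tangent_onb x B"
  proof -
    obtain S where S: "x \<in> S" "pairwise orthogonal S" "\<And>y. y \<in> S \<Longrightarrow> norm y = 1" "independent S" "card S = DIM('a)"
      by (rule vector_in_orthonormal_basis[OF x(2)]) blast
    have fS: "finite S" using S(4) by (rule finiteI_independent)
    have "sphere_tangent_onb x (S - {x})"
      unfolding sphere_tangent_onb_def using S fS
      by (auto simp: pairwise_def orthogonal_def)
    then show ?thesis ..
  qed
  then have "sphere_tangent_onb x B" unfolding B_def by (rule someI_ex)
  then have B: "finite B" "card B = DIM('a) - 1" "\<And>e. e \<in> B \<Longrightarrow> norm e = 1" "\<And>e. e \<in> B \<Longrightarrow> e \<bullet> x = 0" "pairwise orthogonal B"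
    by (auto simp: sphere_tangent_onb_def)
  have xB: "x \<notin> B" using B(4)[of x] x(2) by auto
  have gx: "g x \<bullet> x = 0" by (rule homogeneous_gradient(1)[OF W cone hom g x(1)])
  have ob: "pairwise orthogonal (insert x B)"
    using B(4,5) by (auto simp: pairwise_insert orthogonal_def inner_commute)
  have nb: "norm b = 1" if "b \<in> insert x B" for b using B(3) x(2) that by auto
  have "0 \<notin> insert x B" using nb by force
  then have ind: "independent (insert x B)" using ob by (intro pairwise_orthogonal_independent)
  have "card (insert x B) = DIM('a)" using B(1,2) xB DIM_positive[where 'a='a] by simp
  then have sp: "span (insert x B) = UNIV"
    using card_eq_dim[of "insert x B" UNIV] ind B(1) by auto
  have "laplace_beltrami u x = (\<Sum>e\<in>B. deriv (deriv (\<lambda>t. U (geod x e t))) 0)"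
    unfolding laplace_beltrami_def B_def[symmetric]
    by (rule sum.cong) (use eq norm_geod[OF x(2) B(3,4)] in auto)
  also have "\<dots> = (\<Sum>e\<in>B. H x e \<bullet> e)"
    by (rule sum.cong[OF refl]) (simp add: second_derivative_geod[OF W g H x(1)] gx)
  also have "\<dots> = (\<Sum>e\<in>insert x B. H x e \<bullet> e)"
    using xB B(1) HE gx by simp
  also have "\<dots> = (\<Sum>i\<in>Basis. H x i \<bullet> i)"
    by (rule trace_orthonormal[OF _ ob nb sp]) (use B(1) in simp)
  finally show ?thesis .
qed

lemma dim_orthogonal_pair:
  fixes a b :: "'a::euclidean_space"
  assumes "a \<noteq> 0" "b \<noteq> 0" "a \<bullet> b = 0"
  shows "dim {h. h \<bullet> a = 0 \<and> h \<bullet> b = 0} = DIM('a) - 2"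
proof -
  have "a \<noteq> b" using assms by auto
  have "independent {a, b}" using assms
    by (intro pairwise_orthogonal_independent) (auto simp: pairwise_insert orthogonal_def inner_commute)
  then have d: "dim (span {a, b}) = 2" using \<open>a \<noteq> b\<close> by (simp add: dim_span dim_eq_card_independent)
  have "{y \<in> UNIV. \<forall>x \<in> span {a, b}. orthogonal x y} = {h. h \<bullet> a = 0 \<and> h \<bullet> b = 0}" (is "?L = ?R")
  proof
    show "?L \<subseteq> ?R" by (auto simp: orthogonal_def inner_commute intro: span_base)
    show "?R \<subseteq> ?L"
    proof
      fix y assume "y \<in> ?R"
      then have y: "y \<bullet> a = 0" "y \<bullet> b = 0" by auto
      have "orthogonal x y" if x: "x \<in> span {a, b}" for x
        using orthogonal_to_span[OF x, of y] y by (auto simp: orthogonal_def inner_commute)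
      then show "y \<in> ?L" by simp
    qed
  qed
  then show ?thesis
    using dim_subspace_orthogonal_to_vectors[of "span {a, b}" UNIV] d by simp
qed

section \<open>The two sides of a hypersurface\<close>

lemma slope_increase:
  assumes f: "C1g f gf S" "convex S" and slope: "\<And>x. x \<in> S \<Longrightarrow> gf x \<bullet> e \<ge> \<kappa>"
    and x: "x \<in> S" "x + s *\<^sub>R e \<in> S" "s \<ge> 0"
  shows "f (x + s *\<^sub>R e) \<ge> f x + \<kappa> * s"
proof -
  have seg: "x + t *\<^sub>R e \<in> S" if t: "0 \<le> t" "t \<le> s" for t
  proof (cases "s = 0")
    case True then show ?thesis using t x by auto
  next
    case False
    have "(1 - t/s) *\<^sub>R x + (t/s) *\<^sub>R (x + s *\<^sub>R e) \<in> S"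
      using t False x by (intro convexD[OF f(2)]) (auto simp: divide_simps)
    moreover have "(1 - t/s) *\<^sub>R x + (t/s) *\<^sub>R (x + s *\<^sub>R e) = x + t *\<^sub>R e"
      using False by (simp add: algebra_simps)
    ultimately show ?thesis by simp
  qed
  have "(\<lambda>t. f (x + t *\<^sub>R e) - \<kappa> * t) 0 \<le> (\<lambda>t. f (x + t *\<^sub>R e) - \<kappa> * t) s"
  proof (rule DERIV_nonneg_imp_nondecreasing[OF x(3)])
    fix t assume t: "0 \<le> t" "t \<le> s"
    have "((\<lambda>t. f (x + t *\<^sub>R e)) has_derivative (\<lambda>h. gf (x + t *\<^sub>R e) \<bullet> (h *\<^sub>R e))) (at t)"
      by (rule has_derivative_compose[where f="\<lambda>t. x + t *\<^sub>R e" and g=f, OF _ C1g_deriv[OF f(1) seg[OF t]]])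
        (auto intro!: derivative_eq_intros)
    then have "((\<lambda>t. f (x + t *\<^sub>R e)) has_real_derivative gf (x + t *\<^sub>R e) \<bullet> e) (at t)"
      by (rule has_derivative_imp_has_field_derivative) simp
    then have "((\<lambda>t. f (x + t *\<^sub>R e) - \<kappa> * t) has_real_derivative gf (x + t *\<^sub>R e) \<bullet> e - \<kappa>) (at t)"
      by (rule DERIV_diff) (simp add: DERIV_cmult_Id)
    then show "\<exists>y. ((\<lambda>t. f (x + t *\<^sub>R e) - \<kappa> * t) has_real_derivative y) (at t) \<and> y \<ge> 0"
      using slope[OF seg[OF t]] by auto
  qed
  then show ?thesis by simp
qed

text \<open>Each side of a small ball is connected through a small ball around \<open>x0 + h e\<close> or \<open>x0 - h e\<close>.\<close>

lemma level_side:
  assumes f: "C1g f gf (ball x0 r)" and e: "norm e = 1" and k: "\<kappa> > 0"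
    and slope: "\<And>x. x \<in> ball x0 r \<Longrightarrow> gf x \<bullet> e \<ge> \<kappa>"
    and fr: "\<And>x. x \<in> ball x0 r \<Longrightarrow> x \<in> frontier Q \<Longrightarrow> f x = 0"
    and d: "0 < h" "0 < \<delta>" "h + \<delta> < r" and top: "\<And>x. x \<in> ball (x0 + h *\<^sub>R e) \<delta> \<Longrightarrow> f x > 0"
    and ab: "a \<in> ball x0 \<delta>" "f a > 0" "b \<in> ball x0 \<delta>" "f b > 0" and aQ: "a \<in> Q"
  shows "b \<in> Q"
proof (rule ccontr)
  assume bQ: "b \<notin> Q"
  have inr: "closed_segment x (x + h *\<^sub>R e) \<subseteq> ball x0 r" if x: "x \<in> ball x0 \<delta>" for x
  proof -
    have "norm (x0 - x) < \<delta>" using x by (simp add: dist_norm)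
    moreover have "norm (x0 - (x + h *\<^sub>R e)) \<le> norm (x0 - x) + norm (h *\<^sub>R e)"
      using norm_triangle_ineq4[of "x0 - x" "h *\<^sub>R e"] by (simp add: algebra_simps)
    ultimately have "x \<in> ball x0 r" "x + h *\<^sub>R e \<in> ball x0 r" using d e by (auto simp: dist_norm)
    then show ?thesis by (intro closed_segment_subset convex_ball)
  qed
  have pos: "f y > 0" if x: "x \<in> ball x0 \<delta>" "f x > 0" and y: "y \<in> closed_segment x (x + h *\<^sub>R e)" for x y
  proof -
    obtain t where t: "0 \<le> t" "t \<le> 1" "y = (1 - t) *\<^sub>R x + t *\<^sub>R (x + h *\<^sub>R e)"
      using y unfolding closed_segment_def by auto
    then have yy: "y = x + (t * h) *\<^sub>R e" by (simp add: algebra_simps)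
    have "f (x + (t * h) *\<^sub>R e) \<ge> f x + \<kappa> * (t * h)"
    proof (rule slope_increase[OF f convex_ball slope])
      show "x \<in> ball x0 r" using inr[OF x(1)] by auto
      show "x + (t * h) *\<^sub>R e \<in> ball x0 r" using inr[OF x(1)] y yy by auto
    qed (use t d in auto)
    moreover have "\<kappa> * (t * h) \<ge> 0" using t d k by simp
    ultimately show ?thesis using x(2) unfolding yy by linarith
  qed
  have top_mem: "x + h *\<^sub>R e \<in> ball (x0 + h *\<^sub>R e) \<delta>" if "x \<in> ball x0 \<delta>" for x
    using that by (simp add: dist_norm)
  have tr: "ball (x0 + h *\<^sub>R e) \<delta> \<subseteq> ball x0 r"
  proof
    fix y assume "y \<in> ball (x0 + h *\<^sub>R e) \<delta>"
    then have "norm (x0 + h *\<^sub>R e - y) < \<delta>" by (simp add: dist_norm)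
    then show "y \<in> ball x0 r"
      using norm_triangle_ineq4[of "x0 + h *\<^sub>R e - y" "h *\<^sub>R e"] d e by (simp add: dist_norm)
  qed
  \<comment> \<open>A connected set containing \<open>a\<close> and \<open>b\<close> on which
    \<open>f\<close> is positive. It would have to meet the frontier of \<open>Q\<close>, where
    \<open>f\<close> vanishes.\<close>
  define T where "T = closed_segment a (a + h *\<^sub>R e) \<union> ball (x0 + h *\<^sub>R e) \<delta> \<union> closed_segment b (b + h *\<^sub>R e)"
  have cT: "connected T"
  proof -
    have "connected (closed_segment a (a + h *\<^sub>R e) \<union> ball (x0 + h *\<^sub>R e) \<delta>)"
      by (rule connected_Un) (use top_mem[OF ab(1)] in auto)
    then show ?thesis unfolding T_def
    proof (rule connected_Un)
      have "b + h *\<^sub>R e \<in> closed_segment b (b + h *\<^sub>R e)" by simp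
      then show "(closed_segment a (a + h *\<^sub>R e) \<union> ball (x0 + h *\<^sub>R e) \<delta>) \<inter> closed_segment b (b + h *\<^sub>R e) \<noteq> {}"
        using top_mem[OF ab(3)] by blast
    qed auto
  qed
  have "a \<in> T" "b \<in> T" by (auto simp: T_def)
  then have "T \<inter> frontier Q \<noteq> {}"
    using connected_Int_frontier[OF cT, of Q] aQ bQ by blast
  then obtain y where y: "y \<in> T" "y \<in> frontier Q" by auto
  have "y \<in> ball x0 r" "f y > 0"
    using y(1) inr[OF ab(1)] inr[OF ab(3)] tr pos[OF ab(1,2)] pos[OF ab(3,4)] top by (auto simp: T_def)
  then show False using fr[of y] y(2) by simp
qed

text \<open>A point on the level is the limit of its translates in direction \<open>e\<close>, which
  lie strictly on the positive side.\<close>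

lemma level_closure:
  assumes f: "C1g f gf (ball x0 r)" and e: "norm e = 1" and k: "\<kappa> > 0"
    and slope: "\<And>x. x \<in> ball x0 r \<Longrightarrow> gf x \<bullet> e \<ge> \<kappa>"
    and d: "\<delta> \<le> r" and sub: "\<And>x. x \<in> ball x0 \<delta> \<Longrightarrow> f x > 0 \<Longrightarrow> x \<in> Q" and x: "x \<in> ball x0 \<delta>" "f x \<ge> 0"
  shows "x \<in> closure Q"
proof -
  define s where "s = (\<lambda>n. inverse (real (Suc n)))"
  have s0: "s \<longlonglongrightarrow> 0" unfolding s_def by (rule LIMSEQ_inverse_real_of_nat)
  have s1: "s n > 0" for n by (simp add: s_def)
  have "(\<lambda>n. x + s n *\<^sub>R e) \<longlonglongrightarrow> x + 0 *\<^sub>R e" by (intro tendsto_intros s0)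
  then have l: "(\<lambda>n. x + s n *\<^sub>R e) \<longlonglongrightarrow> x" by simp
  then have "\<forall>\<^sub>F n in sequentially. x + s n *\<^sub>R e \<in> ball x0 \<delta>"
    by (rule topological_tendstoD) (use x in auto)
  then have "\<forall>\<^sub>F n in sequentially. x + s n *\<^sub>R e \<in> closure Q"
  proof eventually_elim
    case (elim n)
    have "f (x + s n *\<^sub>R e) \<ge> f x + \<kappa> * s n"
      by (rule slope_increase[OF f convex_ball slope]) (use elim x d s1[of n] in \<open>auto simp: less_imp_le\<close>)
    moreover have "\<kappa> * s n > 0" using k s1 by simp
    ultimately have "x + s n *\<^sub>R e \<in> Q" using elim x(2) by (intro sub) auto
    then show ?case by (rule subsetD[OF closure_subset])
  qed
  then show ?thesis by (rule Lim_in_closed_set[OF closed_closure _ sequentially_bot l])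
qed

text \<open>Knowing that the frontier lies in a regular level of \<open>f\<close> does not tell on
  which side \<open>Q\<close> lies. By \<open>level_side\<close> each side is near \<open>x0\<close>
  either contained in \<open>Q\<close> or disjoint from it, and one of them is contained. If both
  are, the frontier is a slit and \<open>x0\<close> is interior to the closure; this case cannot be
  excluded here. The sign \<open>\<sigma>\<close> records the side otherwise.\<close>

lemma sides_dichotomy:
  assumes Q: "open Q" and x0: "x0 \<in> closure Q" and r: "r > 0"
    and f: "C1g f gf (ball x0 r)" and f0: "f x0 = 0" and ne: "gf x0 \<noteq> 0"
    and fr: "\<And>x. x \<in> ball x0 r \<Longrightarrow> x \<in> frontier Q \<Longrightarrow> f x = 0"
  obtains (two) \<rho> where "\<rho> > 0" "ball x0 \<rho> \<subseteq> closure Q"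
  | (one) \<rho> \<sigma> e \<kappa> where "\<rho> > 0" "\<rho> \<le> r" "\<sigma> = 1 \<or> \<sigma> = (-1::real)" "norm e = 1" "\<kappa> > 0"
     "\<And>x. x \<in> ball x0 \<rho> \<Longrightarrow> (\<sigma> *\<^sub>R gf x) \<bullet> e \<ge> \<kappa>"
     "\<And>x. x \<in> ball x0 \<rho> \<Longrightarrow> x \<in> Q \<longleftrightarrow> \<sigma> * f x > 0"
     "\<And>x. x \<in> ball x0 \<rho> \<Longrightarrow> x \<in> closure Q \<longleftrightarrow> \<sigma> * f x \<ge> 0"
proof -
  define e where "e = sgn (gf x0)"
  have e: "norm e = 1" using ne by (simp add: e_def norm_sgn)
  define \<kappa> where "\<kappa> = norm (gf x0) / 2"
  have k: "\<kappa> > 0" using ne by (simp add: \<kappa>_def)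
  have ge: "gf x0 \<bullet> e = norm (gf x0)"
    using ne by (simp add: e_def sgn_div_norm inner_commute flip: power2_norm_eq_inner) (simp add: power2_eq_square)
  have "continuous_on (ball x0 r) (\<lambda>x. gf x \<bullet> e)" by (intro continuous_intros C1g_cont_grad[OF f])
  then have "isCont (\<lambda>x. gf x \<bullet> e) x0" using r by (simp add: continuous_on_eq_continuous_at)
  then obtain d1 where d1: "d1 > 0" "\<And>x. dist x x0 < d1 \<Longrightarrow> \<bar>gf x \<bullet> e - gf x0 \<bullet> e\<bar> < \<kappa>"
    using k unfolding continuous_at_eps_delta dist_real_def by blast
  define r1 where "r1 = min r d1"
  have r1: "r1 > 0" "r1 \<le> r" using r d1 by (auto simp: r1_def)
  have slope: "gf x \<bullet> e \<ge> \<kappa>" if "x \<in> ball x0 r1" for x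
  proof -
    have "\<bar>gf x \<bullet> e - gf x0 \<bullet> e\<bar> < \<kappa>" using that by (intro d1(2)) (simp add: r1_def dist_commute)
    then show ?thesis unfolding ge \<kappa>_def by linarith
  qed
  have f1: "C1g f gf (ball x0 r1)" by (rule C1g_subset[OF f]) (use r1 in auto)
  have fr1: "f x = 0" if "x \<in> ball x0 r1" "x \<in> frontier Q" for x using fr[of x] that r1 by auto
  have nf: "C1g (\<lambda>x. - f x) (\<lambda>x. - gf x) (ball x0 r1)" using C1g_cmult[OF f1, of "-1"] by simp
  have nslope: "- gf x \<bullet> - e \<ge> \<kappa>" if "x \<in> ball x0 r1" for x using slope[OF that] by simp
  define h where "h = r1 / 2"
  have h: "h > 0" "h < r1" using r1 by (auto simp: h_def)
  have mem: "x0 + t *\<^sub>R e \<in> ball x0 r1" if "\<bar>t\<bar> \<le> h" for t using that e h by (simp add: dist_norm)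
  have cf: "continuous_on (ball x0 r1) f" by (rule C1g_cont[OF f1])
  have ftop: "f (x0 + h *\<^sub>R e) > 0"
  proof -
    have "f (x0 + h *\<^sub>R e) \<ge> f x0 + \<kappa> * h"
      by (rule slope_increase[OF f1 convex_ball slope]) (use mem[of 0] mem[of h] h in auto)
    moreover have "\<kappa> * h > 0" using k h by simp
    ultimately show ?thesis using f0 by linarith
  qed
  have fbot: "- f (x0 + h *\<^sub>R (- e)) > 0"
  proof -
    have "- f (x0 + h *\<^sub>R (- e)) \<ge> - f x0 + \<kappa> * h"
      by (rule slope_increase[OF nf convex_ball nslope]) (use mem[of 0] mem[of "-h"] h in auto)
    moreover have "\<kappa> * h > 0" using k h by simp
    ultimately show ?thesis using f0 by linarith
  qed
  have op: "open {x \<in> ball x0 r1. f x \<in> T}" if "open T" for T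
  proof -
    have "{x \<in> ball x0 r1. f x \<in> T} = ball x0 r1 \<inter> f -` T" by auto
    then show ?thesis using continuous_open_preimage[OF cf open_ball that] by simp
  qed
  obtain d2 where d2: "d2 > 0" "ball (x0 + h *\<^sub>R e) d2 \<subseteq> {x \<in> ball x0 r1. f x \<in> {0<..}}"
    using openE[OF op[OF open_greaterThan], of "x0 + h *\<^sub>R e" 0] mem[of h] ftop h by auto
  obtain d3 where d3: "d3 > 0" "ball (x0 + h *\<^sub>R (- e)) d3 \<subseteq> {x \<in> ball x0 r1. f x \<in> {..<0}}"
    using openE[OF op[OF open_lessThan], of "x0 + h *\<^sub>R (- e)" 0] mem[of "-h"] fbot h by auto
  define \<delta> where "\<delta> = min (min d2 d3) (h / 2)"
  have d: "\<delta> > 0" "h + \<delta> < r1" "\<delta> \<le> r1" "\<delta> \<le> d2" "\<delta> \<le> d3" using d2 d3 h by (auto simp: \<delta>_def h_def)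
  have top: "0 < f x" if "x \<in> ball (x0 + h *\<^sub>R e) \<delta>" for x
  proof -
    have "x \<in> ball (x0 + h *\<^sub>R e) d2" using that d(4) by simp
    from subsetD[OF d2(2) this] show ?thesis by simp
  qed
  have bot: "0 < - f x" if "x \<in> ball (x0 + h *\<^sub>R (- e)) \<delta>" for x
  proof -
    have "x \<in> ball (x0 + h *\<^sub>R (- e)) d3" using that d(5) by simp
    from subsetD[OF d3(2) this] show ?thesis by simp
  qed
  have up: "b \<in> Q" if "a \<in> ball x0 \<delta>" "f a > 0" "b \<in> ball x0 \<delta>" "f b > 0" "a \<in> Q" for a b
    by (rule level_side[OF f1 e k slope fr1 h(1) d(1,2) top that])
  have dn: "b \<in> Q" if "a \<in> ball x0 \<delta>" "- f a > 0" "b \<in> ball x0 \<delta>" "- f b > 0" "a \<in> Q" for a b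
  proof (rule level_side[OF nf _ k nslope _ h(1) d(1,2) _ that])
    show "norm (- e) = 1" using e by simp
    show "- f x = 0" if "x \<in> ball x0 r1" "x \<in> frontier Q" for x using fr1[OF that] by simp
    show "0 < - f x" if "x \<in> ball (x0 + h *\<^sub>R (- e)) \<delta>" for x using bot[OF that] .
  qed
  have posQ: "\<And>x. x \<in> ball x0 \<delta> \<Longrightarrow> f x \<ge> 0 \<Longrightarrow> x \<in> closure Q"
    if "\<And>x. x \<in> ball x0 \<delta> \<Longrightarrow> f x > 0 \<Longrightarrow> x \<in> Q"
    using level_closure[OF f1 e k slope d(3), of Q] that by blast
  have ne1: "norm (- e) = 1" using e by simp
  have negQ: "\<And>x. x \<in> ball x0 \<delta> \<Longrightarrow> - f x \<ge> 0 \<Longrightarrow> x \<in> closure Q"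
    if "\<And>x. x \<in> ball x0 \<delta> \<Longrightarrow> - f x > 0 \<Longrightarrow> x \<in> Q"
    using level_closure[OF nf ne1 k nslope d(3), of Q] that by blast
  have opd: "open {x \<in> ball x0 \<delta>. f x \<in> T}" if "open T" for T
  proof -
    have "{x \<in> ball x0 \<delta>. f x \<in> T} = ball x0 \<delta> \<inter> {x \<in> ball x0 r1. f x \<in> T}" using d(3) by auto
    then show ?thesis by (simp only:) (intro open_Int open_ball op[OF that])
  qed
  have x0d: "x0 \<in> ball x0 \<delta>" using d by simp
  \<comment> \<open>Handles both choices of side at once, with \<open>\<sigma> * f\<close> positive
    on the side filled by \<open>Q\<close>.\<close>
  have one_sided: thesis
    if out: "\<And>x. x \<in> ball x0 \<delta> \<Longrightarrow> \<sigma> * f x < 0 \<Longrightarrow> x \<notin> Q"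
      and ins: "\<And>x. x \<in> ball x0 \<delta> \<Longrightarrow> \<sigma> * f x > 0 \<Longrightarrow> x \<in> Q"
      and s: "\<sigma> = 1 \<or> \<sigma> = -1" for \<sigma>
  proof -
    have clo: "x \<notin> closure Q" if x: "x \<in> ball x0 \<delta>" "\<sigma> * f x < 0" for x
    proof -
      have o: "open {y \<in> ball x0 \<delta>. f y \<in> {t. \<sigma> * t < 0}}" by (intro opd open_Collect_less continuous_intros)
      moreover have "{y \<in> ball x0 \<delta>. f y \<in> {t. \<sigma> * t < 0}} \<inter> Q = {}" using out by auto
      moreover have "x \<in> {y \<in> ball x0 \<delta>. f y \<in> {t. \<sigma> * t < 0}}" using x by simp
      ultimately show ?thesis using open_Int_closure_eq_empty[OF o, of Q] by blast
    qed
    have cl: "x \<in> closure Q \<longleftrightarrow> \<sigma> * f x \<ge> 0" if x: "x \<in> ball x0 \<delta>" for x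
    proof
      show "\<sigma> * f x \<ge> 0" if "x \<in> closure Q" using clo[OF x] that by force
      assume "\<sigma> * f x \<ge> 0"
      then show "x \<in> closure Q" using posQ[OF _ x] negQ[OF _ x] ins s by auto
    qed
    have oQ: "x \<in> Q \<longleftrightarrow> \<sigma> * f x > 0" if x: "x \<in> ball x0 \<delta>" for x
    proof
      show "x \<in> Q" if "\<sigma> * f x > 0" using ins x that by simp
      assume xQ: "x \<in> Q"
      \<comment> \<open>A point of the open set \<open>Q\<close> on the level could be moved
        slightly to the excluded side without leaving \<open>Q\<close>.\<close>
      have "\<sigma> * f x \<noteq> 0"
      proof
        assume z: "\<sigma> * f x = 0"
        then have fx: "f x = 0" using s by auto
        have op2: "open (Q \<inter> ball x0 \<delta>)" using Q by auto
        then obtain q where q: "q > 0" "ball x q \<subseteq> Q \<inter> ball x0 \<delta>" using xQ x openE[OF op2, of x] by auto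
        define t where "t = - \<sigma> * (q / 2)"
        have tm: "x + t *\<^sub>R e \<in> ball x q" using q e s by (auto simp: t_def dist_norm)
        then have yb: "x + t *\<^sub>R e \<in> ball x0 \<delta>" "x + t *\<^sub>R e \<in> Q" using q(2) by blast+
        have "\<sigma> * f (x + t *\<^sub>R e) < 0"
        proof (cases "\<sigma> = 1")
          case True
          have "- f (x + (q/2) *\<^sub>R (- e)) \<ge> - f x + \<kappa> * (q/2)"
            by (rule slope_increase[OF nf convex_ball nslope]) (use yb x d(3) q True in \<open>auto simp: t_def\<close>)
          moreover have "\<kappa> * (q/2) > 0" using k q by simp
          ultimately show ?thesis using fx True by (simp add: t_def)
        next
          case False
          then have sm: "\<sigma> = -1" using s by simp
          have "f (x + (q/2) *\<^sub>R e) \<ge> f x + \<kappa> * (q/2)"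
            by (rule slope_increase[OF f1 convex_ball slope]) (use yb x d(3) q sm in \<open>auto simp: t_def\<close>)
          moreover have "\<kappa> * (q/2) > 0" using k q by simp
          ultimately show ?thesis using fx sm by (simp add: t_def)
        qed
        then show False using out[OF yb(1)] yb(2) by simp
      qed
      moreover have "\<sigma> * f x \<ge> 0" using cl[OF x] xQ closure_subset by blast
      ultimately show "\<sigma> * f x > 0" by linarith
    qed
    show thesis
    proof (rule one[of \<delta> \<sigma> "\<sigma> *\<^sub>R e" \<kappa>])
      show "(\<sigma> *\<^sub>R gf x) \<bullet> (\<sigma> *\<^sub>R e) \<ge> \<kappa>" if "x \<in> ball x0 \<delta>" for x
        using slope[of x] that d(3) s by auto
      show "norm (\<sigma> *\<^sub>R e) = 1" using s e by auto
    qed (use d r1 s k cl oQ in auto)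
  qed
  \<comment> \<open>\<open>f\<close> is strictly increasing in direction \<open>e\<close>, so a
    point of \<open>Q\<close> on the level can be moved off it inside \<open>Q\<close>.\<close>
  have "\<exists>a\<in>ball x0 \<delta>. a \<in> Q \<and> f a \<noteq> 0"
  proof -
    have "ball x0 \<delta> \<inter> Q \<noteq> {}" using x0 x0d open_Int_closure_eq_empty[OF open_ball, of x0 \<delta> Q] by blast
    then obtain a where a: "a \<in> ball x0 \<delta>" "a \<in> Q" by auto
    have op2: "open (Q \<inter> ball x0 \<delta>)" using Q by auto
    obtain q where q: "q > 0" "ball a q \<subseteq> Q \<inter> ball x0 \<delta>" using a openE[OF op2, of a] by auto
    have m: "a + (q/2) *\<^sub>R e \<in> ball a q" "a \<in> ball a q" using q e by (auto simp: dist_norm)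
    then have m2: "a + (q/2) *\<^sub>R e \<in> ball x0 \<delta>" "a + (q/2) *\<^sub>R e \<in> Q" using q by blast+
    have "f (a + (q/2) *\<^sub>R e) \<ge> f a + \<kappa> * (q/2)"
      by (rule slope_increase[OF f1 convex_ball slope]) (use m2 a d(3) q in auto)
    moreover have "\<kappa> * (q/2) > 0" using k q by simp
    ultimately have "f a \<noteq> 0 \<or> f (a + (q/2) *\<^sub>R e) \<noteq> 0" by linarith
    then show ?thesis using a m2 by blast
  qed
  then obtain a where a: "a \<in> ball x0 \<delta>" "a \<in> Q" "f a \<noteq> 0" by blast
  show thesis
  proof (cases "\<exists>a\<in>ball x0 \<delta>. a \<in> Q \<and> f a > 0")
    case True
    then have P: "\<And>x. x \<in> ball x0 \<delta> \<Longrightarrow> f x > 0 \<Longrightarrow> x \<in> Q" using up by blast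
    show thesis
    proof (cases "\<exists>a\<in>ball x0 \<delta>. a \<in> Q \<and> - f a > 0")
      case True
      then have N: "\<And>x. x \<in> ball x0 \<delta> \<Longrightarrow> - f x > 0 \<Longrightarrow> x \<in> Q" using dn by blast
      have "ball x0 \<delta> \<subseteq> closure Q"
      proof
        fix x assume x: "x \<in> ball x0 \<delta>"
        show "x \<in> closure Q" using posQ[OF P x] negQ[OF N x] by (cases "f x \<ge> 0") auto
      qed
      then show thesis by (rule two[OF d(1)])
    next
      case False
      show thesis by (rule one_sided[of 1]) (use False P in auto)
    qed
  next
    case False
    then have "- f a > 0" using a by force
    then have N: "\<And>x. x \<in> ball x0 \<delta> \<Longrightarrow> - f x > 0 \<Longrightarrow> x \<in> Q" using dn a by blast
    show thesis by (rule one_sided[of "-1"]) (use False N in auto)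
  qed
qed

section \<open>Charts and outward normals\<close>

lemma has_derivative_sgn:
  fixes q :: "'a::real_inner"
  assumes q: "q \<noteq> 0"
  shows "(sgn has_derivative (\<lambda>h. h /\<^sub>R norm q - ((q \<bullet> h) / norm q ^ 3) *\<^sub>R q)) (at q)"
proof -
  have n: "(norm has_derivative (\<lambda>h. h \<bullet> sgn q)) (at q)" by (rule has_derivative_norm[OF q])
  have i: "((\<lambda>x. inverse (norm x)) has_derivative (\<lambda>h. - (inverse (norm q) * (h \<bullet> sgn q) * inverse (norm q)))) (at q)"
    by (rule Deriv.has_derivative_inverse[OF _ n]) (use q in simp)
  have "((\<lambda>x. inverse (norm x) *\<^sub>R x) has_derivative
     (\<lambda>h. inverse (norm q) *\<^sub>R h + (- (inverse (norm q) * (h \<bullet> sgn q) * inverse (norm q))) *\<^sub>R q)) (at q)"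
    by (rule has_derivative_scaleR[OF i has_derivative_ident])
  moreover have "(\<lambda>h. inverse (norm q) *\<^sub>R h + (- (inverse (norm q) * (h \<bullet> sgn q) * inverse (norm q))) *\<^sub>R q)
     = (\<lambda>h. h /\<^sub>R norm q - ((q \<bullet> h) / norm q ^ 3) *\<^sub>R q)"
    by (simp add: fun_eq_iff sgn_div_norm divide_inverse power3_eq_cube inner_commute algebra_simps)
  ultimately show ?thesis by (simp add: sgn_div_norm[abs_def])
qed

lemma closure_hcone:
  fixes S :: "'a::real_inner set"
  assumes S: "S \<subseteq> sphere 0 1" and x: "x \<noteq> 0"
  shows "x \<in> closure (hcone S) \<longleftrightarrow> sgn x \<in> closure S"
proof
  assume "x \<in> closure (hcone S)"
  then obtain s where s: "\<And>n. s n \<in> hcone S" "s \<longlonglongrightarrow> x" unfolding closure_sequential by blast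
  have "(\<lambda>n. sgn (s n)) \<longlonglongrightarrow> sgn x" by (rule tendsto_sgn[OF s(2) x])
  moreover have "sgn (s n) \<in> S" for n using s(1)[of n] by (simp add: hcone_def)
  ultimately show "sgn x \<in> closure S" unfolding closure_sequential by (intro exI[of _ "\<lambda>n. sgn (s n)"]) simp
next
  assume "sgn x \<in> closure S"
  then obtain s where s: "\<And>n. s n \<in> S" "s \<longlonglongrightarrow> sgn x" unfolding closure_sequential by blast
  have "(\<lambda>n. norm x *\<^sub>R s n) \<longlonglongrightarrow> norm x *\<^sub>R sgn x" by (intro tendsto_intros s)
  moreover have "norm x *\<^sub>R sgn x = x" using x by (simp add: sgn_div_norm)
  moreover have "norm x *\<^sub>R s n \<in> hcone S" for n
  proof -
    have "norm (s n) = 1" using s(1)[of n] S by auto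
    then show ?thesis using hcone_scale[of "norm x" "s n" S] hcone_sphere[of "s n" S] s(1)[of n] x by simp
  qed
  ultimately show "x \<in> closure (hcone S)" unfolding closure_sequential by (intro exI[of _ "\<lambda>n. norm x *\<^sub>R s n"]) simp
qed

lemma open_hcone_sphere:
  fixes S :: "'a::real_inner set"
  assumes "openin (top_of_set (sphere 0 1)) S"
  shows "open (hcone S)"
proof -
  obtain T where T: "open T" "S = sphere 0 1 \<inter> T" using assms by (auto simp: openin_open)
  have "hcone S = hcone T"
    by (auto simp: hcone_def T(2) norm_sgn)
  then show ?thesis using open_hcone[OF T(1)] by simp
qed

lemma derivative_along_curve_zero:
  assumes c: "(Z has_vector_derivative v) (at 0)" and F: "(F has_derivative F') (at (Z 0))"
    and z: "\<forall>\<^sub>F s in nhds (0::real). F (Z s) = (k::'b::real_normed_vector)"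
  shows "F' v = 0"
proof -
  obtain S where S: "open S" "0 \<in> S" "\<And>s. s \<in> S \<Longrightarrow> F (Z s) = k" using z unfolding eventually_nhds by blast
  have "((\<lambda>s. F (Z s)) has_derivative (\<lambda>r. F' (r *\<^sub>R v))) (at 0)"
    by (rule has_derivative_compose[where f=Z and g=F, OF _ F]) (use c in \<open>simp add: has_vector_derivative_def\<close>)
  then have "F' (1 *\<^sub>R v) = 0"
    by (rule has_derivative_zero_constant_local[OF _ S])
  then show ?thesis by simp
qed

text \<open>A curve in the boundary stays in the zero level of \<open>f\<close>, so its velocity is
  orthogonal to \<open>gf\<close>; along the great circle in direction \<open>- sgn gf\<close> the
  function \<open>f\<close> decreases strictly through zero, which gives both one-sided
  conditions.\<close>

lemma outward_normalI:
  fixes \<Omega> :: "'a::euclidean_space set"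
  assumes sub: "\<Omega> \<subseteq> sphere 0 1" and z: "norm z = 1" and N: "open N" "z \<in> N"
    and f: "(f has_derivative (\<lambda>h. gf \<bullet> h)) (at z)" and gf: "gf \<noteq> 0" "gf \<bullet> z = 0" and fz: "f z = (0::real)"
    and inn: "\<And>x. x \<in> N \<Longrightarrow> norm x = 1 \<Longrightarrow> x \<in> \<Omega> \<longleftrightarrow> f x > 0"
    and cl: "\<And>x. x \<in> N \<Longrightarrow> norm x = 1 \<Longrightarrow> x \<in> closure \<Omega> \<longleftrightarrow> f x \<ge> 0"
  shows "outward_normal \<Omega> z (- sgn gf)"
proof -
  define \<nu> where "\<nu> = - sgn gf"
  have n1: "norm \<nu> = 1" using gf by (simp add: \<nu>_def norm_sgn)
  have nz: "\<nu> \<bullet> z = 0" using gf by (simp add: \<nu>_def sgn_div_norm)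
  have closN: "norm x = 1" if "x \<in> closure \<Omega>" for x
    using closure_minimal[OF sub closed_sphere] that by auto
  have tang: "\<nu> \<bullet> v = 0" if v: "v \<in> tangent_vecs (rbdry \<Omega>) z" for v
  proof -
    obtain \<gamma> \<epsilon> where g: "\<epsilon> > 0" "\<gamma> 0 = z" "\<And>t. t \<in> {-\<epsilon><..<\<epsilon>} \<Longrightarrow> \<gamma> t \<in> rbdry \<Omega>" "(\<gamma> has_vector_derivative v) (at 0)"
      using v unfolding tangent_vecs_def by blast
    have "isCont \<gamma> 0" using g(4) by (rule has_vector_derivative_continuous)
    then have "\<forall>\<^sub>F t in at 0. \<gamma> t \<in> N"
      unfolding isCont_def by (rule topological_tendstoD) (use N g(2) in auto)
    then have "\<forall>\<^sub>F t in nhds 0. \<gamma> t \<in> N"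
      unfolding eventually_at_filter
    proof (rule eventually_mono)
      fix t assume "t \<noteq> 0 \<longrightarrow> t \<in> UNIV \<longrightarrow> \<gamma> t \<in> N"
      then show "\<gamma> t \<in> N" using N(2) g(2) by (cases "t = 0") auto
    qed
    moreover have "\<forall>\<^sub>F t in nhds 0. t \<in> {-\<epsilon><..<\<epsilon>}" using g(1) by (intro eventually_nhds_in_open) auto
    ultimately have fz: "\<forall>\<^sub>F t in nhds 0. f (\<gamma> t) = 0"
    proof eventually_elim
      case (elim t)
      have r: "\<gamma> t \<in> closure \<Omega>" "\<gamma> t \<notin> \<Omega>" using g(3)[OF elim(2)] by (auto simp: rbdry_def)
      show ?case using inn[OF elim(1) closN[OF r(1)]] cl[OF elim(1) closN[OF r(1)]] r by force
    qed
    have "gf \<bullet> v = 0" by (rule derivative_along_curve_zero[OF g(4) _ fz]) (use f g(2) in simp)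
    then show ?thesis by (simp add: \<nu>_def sgn_div_norm)
  qed
  have sg: "(\<lambda>t. f (geod z \<nu> t)) 0 = 0" using fz by (simp add: geod_def)
  have "(geod z \<nu> has_derivative (\<lambda>r. r *\<^sub>R \<nu>)) (at 0)"
    using geod_has_vector_derivative[of z \<nu> 0] by (simp add: has_vector_derivative_def)
  then have "((\<lambda>t. f (geod z \<nu> t)) has_derivative (\<lambda>r. gf \<bullet> (r *\<^sub>R \<nu>))) (at 0)"
    by (rule has_derivative_compose[where f="geod z \<nu>" and g=f]) (use f in \<open>simp add: geod_def\<close>)
  then have d: "((\<lambda>t. f (geod z \<nu> t)) has_real_derivative gf \<bullet> \<nu>) (at 0)"
    by (rule has_derivative_imp_has_field_derivative) simp
  have "gf \<bullet> \<nu> = - (gf \<bullet> sgn gf)" by (simp add: \<nu>_def)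
  also have "gf \<bullet> sgn gf = norm gf" using gf(1) by (simp add: sgn_div_norm flip: power2_norm_eq_inner) (simp add: power2_eq_square)
  finally have neg: "gf \<bullet> \<nu> < 0" using gf(1) by simp
  obtain d1 where d1: "d1 > 0" "\<And>h. 0 < h \<Longrightarrow> h < d1 \<Longrightarrow> f (geod z \<nu> (0 + h)) < f (geod z \<nu> 0)"
    using DERIV_neg_dec_right[OF d neg] by blast
  obtain d2 where d2: "d2 > 0" "\<And>h. 0 < h \<Longrightarrow> h < d2 \<Longrightarrow> f (geod z \<nu> (0 - h)) > f (geod z \<nu> 0)"
    using DERIV_neg_dec_left[OF d neg] by blast
  have "continuous_on UNIV (geod z \<nu>)" unfolding geod_def[abs_def] by (intro continuous_intros)
  then have "open (geod z \<nu> -` N)" by (rule open_vimage[OF N(1)])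
  moreover have "0 \<in> geod z \<nu> -` N" using N by (simp add: geod_def)
  ultimately obtain d3 where d3: "d3 > 0" "ball 0 d3 \<subseteq> geod z \<nu> -` N" by (rule openE)
  have ng: "norm (geod z \<nu> t) = 1" for t by (rule norm_geod[OF z n1 nz])
  have "geod z \<nu> (- t) \<in> \<Omega> \<and> geod z \<nu> t \<notin> closure \<Omega>" if t: "t \<in> {0<..<min d1 (min d2 d3)}" for t
  proof -
    have "t \<in> ball 0 d3" "-t \<in> ball 0 d3" using t by (auto simp: dist_norm)
    then have m: "geod z \<nu> t \<in> N" "geod z \<nu> (- t) \<in> N" using d3(2) by blast+
    have "f (geod z \<nu> (- t)) > 0" "f (geod z \<nu> t) < 0" using d1(2)[of t] d2(2)[of t] t sg by auto
    then show ?thesis using inn[OF m(2) ng] cl[OF m(1) ng] by simp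
  qed
  then have "\<exists>\<epsilon>>0. \<forall>t\<in>{0<..<\<epsilon>}. geod z \<nu> (- t) \<in> \<Omega> \<and> geod z \<nu> t \<notin> closure \<Omega>"
    using d1(1) d2(1) d3(1) by (intro exI[of _ "min d1 (min d2 d3)"]) auto
  then show ?thesis unfolding outward_normal_def using n1 nz tang unfolding \<nu>_def by blast
qed

lemma submanifold_chart:
  fixes M :: "'a::euclidean_space set"
  assumes M: "smooth_submanifold k M" and z: "z \<in> M"
  obtains U V \<phi> \<psi> L where "open U" "z \<in> U" "open V" "\<phi> ` U = V" "\<psi> ` V = U"
    "\<And>y. y \<in> U \<Longrightarrow> \<psi> (\<phi> y) = y" "\<And>y. y \<in> V \<Longrightarrow> \<phi> (\<psi> y) = y" "C2 (\<phi> :: 'a \<Rightarrow> 'a) U" "C2 (\<psi> :: 'a \<Rightarrow> 'a) V"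
    "subspace L" "dim L = k" "\<And>x. x \<in> M \<Longrightarrow> x \<in> U \<Longrightarrow> \<phi> x \<in> L" "\<And>y. y \<in> V \<Longrightarrow> y \<in> L \<Longrightarrow> \<psi> y \<in> M"
proof -
  obtain U V \<phi> \<psi> L where c: "open U" "z \<in> U" "open V" "\<phi> ` U = V" "\<psi> ` V = U"
    "\<And>y. y \<in> U \<Longrightarrow> \<psi> (\<phi> y) = y" "\<And>y. y \<in> V \<Longrightarrow> \<phi> (\<psi> y) = y" "smooth_on (\<phi> :: 'a \<Rightarrow> 'a) U" "smooth_on (\<psi> :: 'a \<Rightarrow> 'a) V"
    "subspace L" "dim L = k" "\<phi> ` (M \<inter> U) = V \<inter> L"
    using M z unfolding smooth_submanifold_def by metis
  show ?thesis
  proof (rule that[OF c(1-7) _ _ c(10,11)])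
    show "C2 \<phi> U" using c(8) by (intro Ck_2_imp_C2[OF c(1)]) (simp add: smooth_on_def)
    show "C2 \<psi> V" using c(9) by (intro Ck_2_imp_C2[OF c(3)]) (simp add: smooth_on_def)
    show "\<phi> x \<in> L" if "x \<in> M" "x \<in> U" for x using c(12) that by blast
    show "\<psi> y \<in> M" if y: "y \<in> V" "y \<in> L" for y
    proof -
      have "y \<in> \<phi> ` (M \<inter> U)" using c(12) y by blast
      then obtain x where "x \<in> M" "x \<in> U" "y = \<phi> x" by blast
      then show ?thesis using c(6) by simp
    qed
  qed
qed

lemma inverse_derivatives:
  assumes "open U" "z \<in> U" "\<And>y. y \<in> U \<Longrightarrow> \<psi> (\<phi> y) = y"
    and "(\<phi> has_derivative \<phi>') (at z)" "(\<psi> has_derivative \<psi>') (at (\<phi> z))"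
  shows "\<psi>' (\<phi>' h) = h"
proof -
  have "((\<lambda>y. \<psi> (\<phi> y)) has_derivative (\<lambda>h. \<psi>' (\<phi>' h))) (at z)"
    by (rule has_derivative_compose[where f=\<phi> and g=\<psi>, OF assms(4,5)])
  then have "((\<lambda>y. y) has_derivative (\<lambda>h. \<psi>' (\<phi>' h))) (at z)"
    by (rule has_derivative_transform_within_open[OF _ assms(1,2)]) (rule assms(3))
  then have "(\<lambda>h. \<psi>' (\<phi>' h)) = (\<lambda>h. h)" by (rule has_derivative_unique[OF _ has_derivative_ident])
  then show ?thesis by (rule fun_cong)
qed

lemma subspace_memI_orthogonal:
  fixes L :: "'a::euclidean_space set"
  assumes "subspace L" "\<And>a. (\<And>l. l \<in> L \<Longrightarrow> a \<bullet> l = 0) \<Longrightarrow> y \<bullet> a = 0"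
  shows "y \<in> L"
proof -
  obtain l n where ln: "l \<in> span L" "\<And>w. w \<in> span L \<Longrightarrow> orthogonal n w" "y = l + n"
    by (rule orthogonal_subspace_decomp_exists[where S=L]) blast
  have sL: "span L = L" using assms(1) by (simp add: span_eq_iff)
  have "n \<bullet> w = 0" if "w \<in> L" for w using ln(2)[of w] that sL by (simp add: orthogonal_def)
  then have "y \<bullet> n = 0" by (rule assms(2))
  moreover have "l \<bullet> n = 0" using ln(1) ln(2)[of l] by (simp add: orthogonal_def inner_commute)
  ultimately have "n \<bullet> n = 0" using ln(3) by (simp add: inner_add_left)
  then show ?thesis using ln sL by simp
qed

text \<open>The chart flattens a manifold of codimension 2 in the ambient space, hence of
  codimension 1 in the sphere. The tangent hyperplane at \<open>z\<close> has dimension larger than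
  \<open>L\<close>, so the injective differential cannot map it into \<open>L\<close>, and some
  functional \<open>a\<close> vanishing on \<open>L\<close> detects this. It makes
  \<open>\<phi> x \<bullet> a\<close> a defining function with nonzero derivative along the
  sphere.\<close>

lemma chart_transversal:
  fixes \<phi>' :: "'a::euclidean_space \<Rightarrow> 'a"
  assumes lin: "linear \<phi>'" and inj: "\<And>h. \<psi>' (\<phi>' h) = h" and L: "subspace L" "dim L = DIM('a) - 2"
    and z: "z \<noteq> 0" and d: "DIM('a) \<ge> 2"
  obtains a h where "\<And>l. l \<in> L \<Longrightarrow> a \<bullet> l = 0" "h \<bullet> z = 0" "\<phi>' h \<bullet> a \<noteq> 0"
proof (rule ccontr)
  note hyp = that
  assume no: "\<not> thesis"
  have *: "\<phi>' h \<bullet> a = 0" if al: "\<And>l. l \<in> L \<Longrightarrow> a \<bullet> l = 0" and hz: "h \<bullet> z = 0" for a h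
  proof (rule ccontr)
    assume "\<phi>' h \<bullet> a \<noteq> 0"
    with al hz have thesis by (rule hyp)
    with no show False by simp
  qed
  have sub: "\<phi>' ` {h. z \<bullet> h = 0} \<subseteq> L"
  proof clarify
    fix h assume "z \<bullet> h = 0"
    then show "\<phi>' h \<in> L" using * by (intro subspace_memI_orthogonal[OF L(1)]) (simp add: inner_commute)
  qed
  have "inj_on \<phi>' (span {h. z \<bullet> h = 0})" using inj by (metis inj_onI)
  then have "dim (\<phi>' ` {h. z \<bullet> h = 0}) = dim {h. z \<bullet> h = 0}" by (rule dim_image_eq[OF lin])
  also have "\<dots> = DIM('a) - 1" by (rule dim_hyperplane[OF z])
  finally have "DIM('a) - 1 \<le> DIM('a) - 2" using dim_subset[OF sub] L(2) by simp
  then show False using d by simp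
qed

text \<open>Straight lines in the flat model give curves with prescribed velocity; for directions in
  \<open>L\<close> they stay in the manifold.\<close>

lemma chart_curve:
  fixes \<psi> :: "'a::euclidean_space \<Rightarrow> 'a"
  assumes V: "open V" and y: "y \<in> V" and \<psi>: "(\<psi> has_derivative \<psi>') (at y)"
  shows "((\<lambda>s. \<psi> (y + s *\<^sub>R \<zeta>)) has_vector_derivative \<psi>' \<zeta>) (at 0)"
    and "\<forall>\<^sub>F s in nhds 0. y + s *\<^sub>R \<zeta> \<in> V"
proof -
  have "((\<lambda>s. y + s *\<^sub>R \<zeta>) has_derivative (\<lambda>r. r *\<^sub>R \<zeta>)) (at 0)" by (auto intro!: derivative_eq_intros)
  then have "((\<lambda>s. \<psi> (y + s *\<^sub>R \<zeta>)) has_derivative (\<lambda>r. \<psi>' (r *\<^sub>R \<zeta>))) (at 0)"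
    by (rule has_derivative_compose[where f="\<lambda>s. y + s *\<^sub>R \<zeta>" and g=\<psi>]) (use \<psi> in simp)
  then show "((\<lambda>s. \<psi> (y + s *\<^sub>R \<zeta>)) has_vector_derivative \<psi>' \<zeta>) (at 0)"
    using has_derivative_linear[OF \<psi>] by (simp add: has_vector_derivative_def linear_scale)
  have "continuous_on UNIV (\<lambda>s. y + s *\<^sub>R \<zeta>)" by (intro continuous_intros)
  then have "open ((\<lambda>s. y + s *\<^sub>R \<zeta>) -` V)" by (rule open_vimage[OF V])
  then show "\<forall>\<^sub>F s in nhds 0. y + s *\<^sub>R \<zeta> \<in> V"
    using eventually_nhds_in_open[of "(\<lambda>s. y + s *\<^sub>R \<zeta>) -` V" 0] y by simp
qed

text \<open>By comparison of dimensions.\<close>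
lemma chart_tangent_space:
  fixes \<psi> :: "'a::euclidean_space \<Rightarrow> 'a"
  assumes V: "open V" "y \<in> V" "y \<in> L" and \<psi>: "(\<psi> has_derivative \<psi>') (at y)"
    and inj: "\<And>h. \<phi>' (\<psi>' h) = h" and L: "subspace L" "dim L = DIM('a) - 2"
    and M: "\<And>y. y \<in> V \<Longrightarrow> y \<in> L \<Longrightarrow> \<psi> y \<in> M" "M \<subseteq> sphere 0 1"
    and f: "(f has_derivative (\<lambda>h. gf \<bullet> h)) (at (\<psi> y))" and gf: "gf \<noteq> 0" "\<psi> y \<bullet> gf = 0"
    and N: "open N" "\<psi> y \<in> N" "\<And>x. x \<in> M \<Longrightarrow> x \<in> N \<Longrightarrow> f x = (0::real)"
    and h: "h \<bullet> \<psi> y = 0" "h \<bullet> gf = 0"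
  obtains \<zeta> where "\<zeta> \<in> L" "\<psi>' \<zeta> = h"
proof -
  define T where "T = \<psi>' ` L"
  have lin: "linear \<psi>'" by (rule has_derivative_linear[OF \<psi>])
  have injon: "inj_on \<psi>' (span L)" using inj by (metis inj_onI)
  have dT: "dim T = DIM('a) - 2" unfolding T_def using dim_image_eq[OF lin injon] L(2) by simp
  have sT: "subspace T" unfolding T_def by (rule linear_subspace_image[OF lin L(1)])
  have z0: "\<psi> y \<noteq> 0" using M(1)[OF V(2,3)] M(2) by force
  \<comment> \<open>Along curves in \<open>M\<close> both \<open>x \<bullet> x\<close> and
    \<open>f\<close> are constant, so tangent vectors are orthogonal to \<open>\<psi> y\<close> and
    to \<open>gf\<close>. The space so described has the dimension of \<open>T\<close>, whence
    equality.\<close>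
  have "T \<subseteq> {h. h \<bullet> \<psi> y = 0 \<and> h \<bullet> gf = 0}"
  proof
    fix w assume "w \<in> T"
    then obtain \<zeta> where \<zeta>: "\<zeta> \<in> L" "w = \<psi>' \<zeta>" by (auto simp: T_def)
    have c: "((\<lambda>s. \<psi> (y + s *\<^sub>R \<zeta>)) has_vector_derivative \<psi>' \<zeta>) (at 0)" by (rule chart_curve(1)[OF V(1,2) \<psi>])
    have inV: "\<forall>\<^sub>F s in nhds 0. y + s *\<^sub>R \<zeta> \<in> V" by (rule chart_curve(2)[OF V(1,2) \<psi>])
    have "((\<lambda>x. x \<bullet> x) has_derivative (\<lambda>h. \<psi> y \<bullet> h + h \<bullet> \<psi> y)) (at (\<psi> (y + 0 *\<^sub>R \<zeta>)))"
      by (auto intro!: derivative_eq_intros)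
    then have 1: "\<psi> y \<bullet> \<psi>' \<zeta> + \<psi>' \<zeta> \<bullet> \<psi> y = 0"
    proof (rule derivative_along_curve_zero[OF c])
      show "\<forall>\<^sub>F s in nhds 0. \<psi> (y + s *\<^sub>R \<zeta>) \<bullet> \<psi> (y + s *\<^sub>R \<zeta>) = 1"
        using inV
      proof eventually_elim
        case (elim s)
        then have "\<psi> (y + s *\<^sub>R \<zeta>) \<in> M" using L(1) V(3) \<zeta>(1) by (intro M(1)) (auto intro: subspace_add subspace_scale)
        then have "norm (\<psi> (y + s *\<^sub>R \<zeta>)) = 1" using M(2) by auto
        then show ?case by (simp add: norm_eq_1)
      qed
    qed
    have "isCont (\<lambda>s. \<psi> (y + s *\<^sub>R \<zeta>)) 0" using c by (rule has_vector_derivative_continuous)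
    then have "\<forall>\<^sub>F s in at 0. \<psi> (y + s *\<^sub>R \<zeta>) \<in> N"
      unfolding isCont_def by (rule topological_tendstoD) (use N in auto)
    then have "\<forall>\<^sub>F s in nhds 0. \<psi> (y + s *\<^sub>R \<zeta>) \<in> N"
      unfolding eventually_at_filter
    proof (rule eventually_mono)
      fix t :: real assume "t \<noteq> 0 \<longrightarrow> t \<in> UNIV \<longrightarrow> \<psi> (y + t *\<^sub>R \<zeta>) \<in> N"
      then show "\<psi> (y + t *\<^sub>R \<zeta>) \<in> N" using N(2) by (cases "t = 0") auto
    qed
    then have "\<forall>\<^sub>F s in nhds 0. f (\<psi> (y + s *\<^sub>R \<zeta>)) = 0"
      using inV
    proof eventually_elim
      case (elim s)
      then have "\<psi> (y + s *\<^sub>R \<zeta>) \<in> M" using L(1) V(3) \<zeta>(1) by (intro M(1)) (auto intro: subspace_add subspace_scale)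
      then show ?case using elim by (intro N(3))
    qed
    from derivative_along_curve_zero[OF c _ this, of "\<lambda>h. gf \<bullet> h"]
    have 2: "gf \<bullet> \<psi>' \<zeta> = 0" using f by simp
    show "w \<in> {h. h \<bullet> \<psi> y = 0 \<and> h \<bullet> gf = 0}" using 1 2 \<zeta>(2) by (simp add: inner_commute)
  qed
  moreover have "dim {h. h \<bullet> \<psi> y = 0 \<and> h \<bullet> gf = 0} = DIM('a) - 2"
    by (rule dim_orthogonal_pair[OF z0 gf])
  moreover have "subspace {h. h \<bullet> \<psi> y = 0 \<and> h \<bullet> gf = 0}" by (auto simp: subspace_def inner_add_left)
  ultimately have "T = {h. h \<bullet> \<psi> y = 0 \<and> h \<bullet> gf = 0}"
    using dT sT by (intro subspace_dim_equal) auto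
  then have "h \<in> T" using h by auto
  then show ?thesis using that by (auto simp: T_def)
qed

section \<open>Cones over subsets of the equator\<close>

definition proj :: "'a::real_inner \<Rightarrow> 'a \<Rightarrow> 'a" where "proj p x = x - (x \<bullet> p) *\<^sub>R p"

text \<open>The angular coordinate: it recovers \<open>y\<close> from
  \<open>cos t p + sin t y\<close>. It is unchanged by positive scaling and by adding multiples of
  \<open>p\<close>; on the axis itself it is 0 because \<open>sgn 0 = 0\<close>.\<close>

definition lat :: "'a::real_inner \<Rightarrow> 'a \<Rightarrow> 'a" where "lat p x = sgn (proj p x)"

lemma proj_affine: "norm p = 1 \<Longrightarrow> proj p (s *\<^sub>R x + t *\<^sub>R p) = s *\<^sub>R proj p x"
  by (simp add: proj_def norm_eq_1 inner_add_left algebra_simps)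

lemma proj_orth: "norm p = 1 \<Longrightarrow> proj p x \<bullet> p = 0"
  by (simp add: proj_def norm_eq_1 inner_diff_left)

lemma proj_id: "x \<bullet> p = 0 \<Longrightarrow> proj p x = x"
  by (simp add: proj_def)

lemma lat_affine: "norm p = 1 \<Longrightarrow> s > 0 \<Longrightarrow> lat p (s *\<^sub>R x + t *\<^sub>R p) = lat p x"
  by (simp add: lat_def proj_affine sgn_scale_pos)

lemma lat_id: "norm y = 1 \<Longrightarrow> y \<bullet> p = 0 \<Longrightarrow> lat p y = y"
  by (simp add: lat_def proj_id sgn_div_norm)

lemma lat_combo: "norm p = 1 \<Longrightarrow> norm y = 1 \<Longrightarrow> y \<bullet> p = 0 \<Longrightarrow> b > 0 \<Longrightarrow> lat p (a *\<^sub>R p + b *\<^sub>R y) = y"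
  using lat_affine[of p b y a] lat_id[of y p] by (simp add: add.commute)

lemma proj_combo: "norm p = 1 \<Longrightarrow> y \<bullet> p = 0 \<Longrightarrow> proj p (a *\<^sub>R p + b *\<^sub>R y) = b *\<^sub>R y"
  using proj_affine[of p b y a] proj_id[of y p] by (simp add: add.commute)

lemma lat_sgn: "norm p = 1 \<Longrightarrow> x \<noteq> 0 \<Longrightarrow> lat p (sgn x) = lat p x"
  using lat_affine[of p "inverse (norm x)" x 0] by (simp add: sgn_div_norm)

lemma proj_sgn: "proj p (sgn x) = proj p x /\<^sub>R norm x"
  by (simp add: proj_def sgn_div_norm scaleR_diff_right)

lemma proj_decomp: "x = (x \<bullet> p) *\<^sub>R p + norm (proj p x) *\<^sub>R lat p x"
  by (cases "proj p x = 0") (simp_all add: lat_def sgn_div_norm, simp_all add: proj_def)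

lemma norm_lat: "proj p x \<noteq> 0 \<Longrightarrow> norm (lat p x) = 1"
  by (simp add: lat_def norm_sgn)

lemma lat_orth: "norm p = 1 \<Longrightarrow> lat p x \<bullet> p = 0"
  by (simp add: lat_def sgn_div_norm proj_orth)

lemma norm_proj_sq:
  assumes "norm p = 1" shows "(norm (proj p x))\<^sup>2 = (norm x)\<^sup>2 - (x \<bullet> p)\<^sup>2"
proof -
  have "p \<bullet> p = 1" using assms by (simp add: norm_eq_1)
  then have "proj p x \<bullet> proj p x = x \<bullet> x - (x \<bullet> p) * (x \<bullet> p)"
    by (simp add: proj_def inner_diff_left inner_diff_right inner_commute algebra_simps)
  then show ?thesis by (simp add: power2_norm_eq_inner power2_eq_square[of "x \<bullet> p"])
qed

lemma bounded_linear_proj: "bounded_linear (proj p)"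
  unfolding proj_def[abs_def]
  by (intro bounded_linear_sub bounded_linear_ident bounded_linear_compose[OF bounded_linear_scaleR_left] bounded_linear_inner_left)

lemma C2_lat: "C2 (lat p) {x. proj p x \<noteq> 0}"
  unfolding lat_def[abs_def] by (rule C2_compose[OF C2_sgn C2_linear[OF bounded_linear_proj]]) auto

lemma open_proj_nonzero: "open {x. proj p x \<noteq> 0}"
  by (intro open_Collect_neq continuous_intros linear_continuous_on[OF bounded_linear_proj])

lemma lat_derivative:
  assumes "proj p x \<noteq> 0"
  shows "(lat p has_derivative (\<lambda>h. proj p h /\<^sub>R norm (proj p x) - ((proj p x \<bullet> proj p h) / norm (proj p x) ^ 3) *\<^sub>R proj p x)) (at x)"
  unfolding lat_def[abs_def]
  by (rule has_derivative_compose[where f="proj p" and g=sgn, OF bounded_linear_imp_has_derivative[OF bounded_linear_proj] has_derivative_sgn[OF assms]])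

text \<open>Replaces the polar parametrisation by conditions on \<open>lat\<close> and the height,
  which behave well under limits and scaling.\<close>

lemma cone_over_iff:
  assumes p: "norm p = 1" and sub: "\<omega> \<subseteq> equator p"
  shows "x \<in> cone_over p \<omega> \<longleftrightarrow> norm x = 1 \<and> x \<bullet> p > 0 \<and> proj p x \<noteq> 0 \<and> lat p x \<in> \<omega>"
proof
  assume "x \<in> cone_over p \<omega>"
  then obtain y t where y: "x = geod p y t" "y \<in> \<omega>" "0 < t" "t < pi / 2" by (auto simp: cone_over_def)
  have e: "norm y = 1" "y \<bullet> p = 0" using sub y(2) by (auto simp: equator_def)
  have st: "sin t > 0" "cos t > 0" using y by (auto intro: sin_gt_zero2 cos_gt_zero)
  have "x \<bullet> p = cos t" using p e by (simp add: y(1) geod_def inner_add_left norm_eq_1)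
  moreover have "proj p x = sin t *\<^sub>R y" unfolding y(1) geod_def by (rule proj_combo[OF p e(2)])
  moreover have "lat p x = y" unfolding y(1) geod_def by (rule lat_combo[OF p e st(1)])
  moreover have "norm x = 1" unfolding y(1) by (rule norm_geod[OF p e])
  moreover have "y \<noteq> 0" using e by auto
  ultimately show "norm x = 1 \<and> x \<bullet> p > 0 \<and> proj p x \<noteq> 0 \<and> lat p x \<in> \<omega>" using st y(2) by simp
next
  assume x: "norm x = 1 \<and> x \<bullet> p > 0 \<and> proj p x \<noteq> 0 \<and> lat p x \<in> \<omega>"
  have "(norm (proj p x))\<^sup>2 = 1 - (x \<bullet> p)\<^sup>2" using norm_proj_sq[OF p, of x] x by simp
  moreover have "(norm (proj p x))\<^sup>2 > 0" using x by simp
  ultimately have lt: "(x \<bullet> p)\<^sup>2 < 1" by simp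
  then have lt1: "x \<bullet> p < 1" using x power2_less_imp_less[of "x \<bullet> p" 1] by simp
  define t where "t = arccos (x \<bullet> p)"
  have t: "0 < t" "t < pi / 2"
  proof -
    show "t < pi / 2" using x lt1 arccos_less_arccos[of 0 "x \<bullet> p"] by (simp add: t_def)
    show "0 < t" using x lt1 arccos_less_arccos[of "x \<bullet> p" 1] by (simp add: t_def)
  qed
  have c: "cos t = x \<bullet> p" using x lt1 by (simp add: t_def)
  have "sin t = sqrt (1 - (x \<bullet> p)\<^sup>2)" using x lt1 by (simp add: t_def sin_arccos)
  also have "\<dots> = norm (proj p x)" using \<open>(norm (proj p x))\<^sup>2 = 1 - (x \<bullet> p)\<^sup>2\<close>
    by (metis norm_ge_zero real_sqrt_unique)
  finally have s: "sin t = norm (proj p x)" .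
  have "x = geod p (lat p x) t" unfolding geod_def c s by (rule proj_decomp)
  then show "x \<in> cone_over p \<omega>" using t x by (auto simp: cone_over_def)
qed

text \<open>Away from the axis \<open>lat\<close> is continuous, so boundary points of the cone
  project to boundary points of \<open>\<omega>\<close>. The only point of the axis in the
  hemisphere is \<open>p\<close>.\<close>

lemma cone_bdry_lat:
  assumes p: "norm p = 1" and sub: "\<omega> \<subseteq> equator p" and z: "z \<in> cone_bdry p (cone_over p \<omega>)" "z \<noteq> p"
  shows "norm z = 1" "z \<bullet> p > 0" "proj p z \<noteq> 0" "lat p z \<in> rbdry \<omega>"
proof -
  have zh: "z \<in> closure (cone_over p \<omega>)" "z \<notin> cone_over p \<omega>" and n: "norm z = 1" "z \<bullet> p > 0"
    using z by (auto simp: cone_bdry_def hemi_def)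
  show "norm z = 1" "z \<bullet> p > 0" by fact+
  show pz: "proj p z \<noteq> 0"
  proof
    assume 0: "proj p z = 0"
    then have eq: "z = (z \<bullet> p) *\<^sub>R p" by (simp add: proj_def)
    then have "norm z = \<bar>z \<bullet> p\<bar> * norm p" by (metis norm_scaleR)
    then have "z \<bullet> p = 1" using n p by simp
    then show False using eq z(2) by simp
  qed
  obtain s where s: "\<And>n. s n \<in> cone_over p \<omega>" "s \<longlonglongrightarrow> z" using zh(1) unfolding closure_sequential by blast
  have "isCont (lat p) z" using lat_derivative[OF pz] by (rule has_derivative_continuous)
  then have "(\<lambda>n. lat p (s n)) \<longlonglongrightarrow> lat p z" using s(2) by (rule isCont_tendsto_compose)
  moreover have "\<And>n. lat p (s n) \<in> \<omega>" using s(1) by (simp add: cone_over_iff[OF p sub])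
  ultimately have "lat p z \<in> closure \<omega>" unfolding closure_sequential by (intro exI[of _ "\<lambda>n. lat p (s n)"]) simp
  moreover have "lat p z \<notin> \<omega>" using zh(2) n pz by (simp add: cone_over_iff[OF p sub])
  ultimately show "lat p z \<in> rbdry \<omega>" by (simp add: rbdry_def)
qed

lemma rbdry_equator:
  assumes "\<omega> \<subseteq> equator p" "y \<in> rbdry \<omega>"
  shows "norm y = 1" "y \<bullet> p = 0"
proof -
  have "equator p = sphere 0 1 \<inter> {y. y \<bullet> p = 0}" by (auto simp: equator_def)
  moreover have "closed {y. y \<bullet> p = 0}" by (intro closed_Collect_eq continuous_intros)
  ultimately have "closed (equator p)" by (simp add: closed_Int)
  then have "closure \<omega> \<subseteq> equator p" using assms(1) by (rule closure_minimal[rotated])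
  then show "norm y = 1" "y \<bullet> p = 0" using assms(2) by (auto simp: rbdry_def equator_def)
qed

text \<open>A partial converse to \<open>cone_bdry_lat\<close>: the whole open quarter circle from
  \<open>p\<close> towards a boundary point of \<open>\<omega>\<close> lies in the lateral
  boundary.\<close>

lemma cone_bdry_memI:
  assumes p: "norm p = 1" and sub: "\<omega> \<subseteq> equator p" and y: "y \<in> rbdry \<omega>" and ab: "a > 0" "b > 0" "a\<^sup>2 + b\<^sup>2 = 1"
  shows "a *\<^sub>R p + b *\<^sub>R y \<in> cone_bdry p (cone_over p \<omega>) - {p}"
proof -
  note yy = rbdry_equator[OF sub y]
  have nn: "norm (a *\<^sub>R p + b *\<^sub>R v) = 1" if v: "norm v = 1" "v \<bullet> p = 0" for v
  proof -
    have "(a *\<^sub>R p + b *\<^sub>R v) \<bullet> (a *\<^sub>R p + b *\<^sub>R v) = a\<^sup>2 + b\<^sup>2"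
      using v p by (simp add: inner_add_left inner_add_right norm_eq_1 inner_commute power2_eq_square)
    then show ?thesis using ab by (simp add: norm_eq_1)
  qed
  have ip: "(a *\<^sub>R p + b *\<^sub>R v) \<bullet> p = a" if "v \<bullet> p = 0" for v using that p by (simp add: inner_add_left norm_eq_1)
  have inC: "a *\<^sub>R p + b *\<^sub>R v \<in> cone_over p \<omega> \<longleftrightarrow> v \<in> \<omega>" if v: "norm v = 1" "v \<bullet> p = 0" for v
  proof -
    have "v \<noteq> 0" using v by auto
    then show ?thesis using nn[OF v] ip[OF v(2)] ab proj_combo[OF p v(2), of a b] lat_combo[OF p v ab(2), of a]
      by (simp add: cone_over_iff[OF p sub])
  qed
  have "y \<in> closure \<omega>" using y by (simp add: rbdry_def)
  then obtain s where s: "\<And>n. s n \<in> \<omega>" "s \<longlonglongrightarrow> y" unfolding closure_sequential by blast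
  have "(\<lambda>n. a *\<^sub>R p + b *\<^sub>R s n) \<longlonglongrightarrow> a *\<^sub>R p + b *\<^sub>R y" by (intro tendsto_intros s)
  moreover have "a *\<^sub>R p + b *\<^sub>R s n \<in> cone_over p \<omega>" for n using inC[of "s n"] s(1)[of n] sub by (auto simp: equator_def)
  ultimately have "a *\<^sub>R p + b *\<^sub>R y \<in> closure (cone_over p \<omega>)"
    unfolding closure_sequential by (intro exI[of _ "\<lambda>n. a *\<^sub>R p + b *\<^sub>R s n"]) simp
  moreover have "a *\<^sub>R p + b *\<^sub>R y \<notin> cone_over p \<omega>" using inC[OF yy] y by (simp add: rbdry_def)
  moreover have "a *\<^sub>R p + b *\<^sub>R y \<in> hemi p" using nn[OF yy] ip[OF yy(2)] ab by (simp add: hemi_def)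
  moreover have "a *\<^sub>R p + b *\<^sub>R y \<noteq> p"
  proof
    assume "a *\<^sub>R p + b *\<^sub>R y = p"
    then have "(a *\<^sub>R p + b *\<^sub>R y) \<bullet> y = p \<bullet> y" by (rule arg_cong)
    moreover have "p \<bullet> y = 0" "y \<bullet> y = 1" using yy by (simp_all add: inner_commute norm_eq_1)
    ultimately show False using ab by (simp only: inner_add_left inner_scaleR_left)
  qed
  ultimately show ?thesis by (simp add: cone_bdry_def)
qed

text \<open>\<open>gu\<close>, \<open>Hu\<close> and \<open>g\<close>, \<open>H\<close> are the gradients and Hessians of the extensions, homogeneous of degree
  zero, of \<open>u\<close> and of \<open>u - cos r\<close>.\<close>

locale serrin =
  fixes p :: "'a::euclidean_space" and \<omega> \<Omega> U :: "'a set" and u :: "'a \<Rightarrow> real" and c :: real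
    and gu g :: "'a \<Rightarrow> 'a" and Hu H :: "'a \<Rightarrow> 'a \<Rightarrow>\<^sub>L 'a"
  assumes dim: "DIM('a) \<ge> 3"
    and pole: "norm p = 1"
    and omega_sub: "\<omega> \<subseteq> equator p"
    and omega_open: "openin (top_of_set (equator p)) \<omega>"
    and omega_conn: "connected \<omega>" and omega_ne: "\<omega> \<noteq> {}"
    and omega_convex: "sph_convex p \<omega>"
    and cone_smooth: "smooth_submanifold (DIM('a) - 2) (cone_bdry p (cone_over p \<omega>) - {p})"
    and adm: "admissible p (cone_over p \<omega>) \<Omega>"
    and U: "open U" "closure \<Omega> \<subseteq> U" "C2 u U"
    and pde: "\<forall>x\<in>\<Omega>. laplace_beltrami u x = - real (DIM('a) - 1) * cos (gdist p x)"
    and dir: "\<forall>x\<in>Gamma0 p (cone_over p \<omega>) \<Omega>. u x = 0"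
    and neu0: "\<forall>x\<in>Gamma0 p (cone_over p \<omega>) \<Omega>. \<forall>\<nu>. outward_normal \<Omega> x \<nu> \<longrightarrow>
                 frechet_derivative u (at x) \<nu> = c"
    and neu1: "\<forall>x\<in>Gamma1 p (cone_over p \<omega>) \<Omega> - {p}. \<forall>\<nu>. outward_normal \<Omega> x \<nu> \<longrightarrow>
                 frechet_derivative u (at x) \<nu> = 0"
    and gu: "C1g (\<lambda>x. u (sgn x)) gu (hcone U)"
      "\<And>x. x \<in> hcone U \<Longrightarrow> (gu has_derivative blinfun_apply (Hu x)) (at x)" "continuous_on (hcone U) Hu"
      "\<And>x h k. x \<in> hcone U \<Longrightarrow> Hu x h \<bullet> k = Hu x k \<bullet> h"
    and g: "C1g (\<lambda>x. u (sgn x) - sgn x \<bullet> p) g (hcone U)"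
      "\<And>x. x \<in> hcone U \<Longrightarrow> (g has_derivative blinfun_apply (H x)) (at x)" "continuous_on (hcone U) H"
      "\<And>x h k. x \<in> hcone U \<Longrightarrow> H x h \<bullet> k = H x k \<bullet> h"
begin

abbreviation "C \<equiv> cone_over p \<omega>"
abbreviation "\<Gamma>0 \<equiv> Gamma0 p C \<Omega>"
abbreviation "\<Gamma>1 \<equiv> Gamma1 p C \<Omega>"
abbreviation "W \<equiv> hcone U"
abbreviation "E \<equiv> hcone (closure \<Omega>)"
abbreviation "Q \<equiv> hcone \<Omega>"

lemma W_open: "open W" and W0: "0 \<notin> W"
  using open_hcone[OF U(1)] by (auto simp: hcone_def)

lemma W_scale: "x \<in> W \<Longrightarrow> s > 0 \<Longrightarrow> s *\<^sub>R x \<in> W"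
  by (simp add: hcone_scale)

lemma Omega_facts: "openin (top_of_set (sphere 0 1)) \<Omega>" "connected \<Omega>" "\<Omega> \<noteq> {}" "\<Omega> \<subseteq> C" "closure \<Omega> \<subseteq> hemi p"
  "p \<in> rbdry \<Omega>" "\<Gamma>0 \<noteq> {}" "smooth_submanifold (DIM('a) - 2) \<Gamma>0"
  using adm by (auto simp: admissible_def)

lemma Omega_sphere: "\<Omega> \<subseteq> sphere 0 1"
  using Omega_facts(1) by (rule openin_imp_subset)

lemma closure_Omega_norm: "x \<in> closure \<Omega> \<Longrightarrow> norm x = 1"
  using Omega_facts(5) by (auto simp: hemi_def)

lemma Q_open: "open Q"
  by (rule open_hcone_sphere[OF Omega_facts(1)])

lemma closure_Q: "x \<noteq> 0 \<Longrightarrow> x \<in> closure Q \<longleftrightarrow> x \<in> E"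
  using closure_hcone[OF Omega_sphere, of x] by (simp add: hcone_def)

lemma E_sub_W: "E \<subseteq> W" and Q_sub_E: "Q \<subseteq> E"
  using U(2) closure_subset[of \<Omega>] by (auto simp: hcone_def)

text \<open>Exhibits \<open>E\<close> as relatively closed in \<open>W\<close>, the form required by
  \<open>weak_divergence\<close>. The origin, which the closure of \<open>Q\<close> may contain, is
  removed by \<open>W\<close>.\<close>

lemma E_eq: "E = W \<inter> closure Q"
proof (intro equalityI subsetI)
  fix x assume "x \<in> E"
  then show "x \<in> W \<inter> closure Q" using E_sub_W closure_Q[of x] by (auto simp: hcone_def)
next
  fix x assume "x \<in> W \<inter> closure Q"
  then show "x \<in> E" using W0 closure_Q[of x] by auto
qed

lemma Q_sub_int: "Q \<subseteq> interior E"
  using Q_open Q_sub_E by (rule interior_maximal[rotated])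

lemma frontier_Q: "x \<noteq> 0 \<Longrightarrow> x \<in> frontier Q \<longleftrightarrow> sgn x \<in> rbdry \<Omega>"
  using closure_Q[of x] Q_open by (auto simp: frontier_def interior_open rbdry_def hcone_def)

text \<open>At a unit vector the derivative of \<open>sgn\<close> is the identity on orthogonal
  vectors, so the extension has the same tangential derivative as \<open>u\<close>.\<close>

lemma gu_tangent:
  assumes z: "z \<in> U" "norm z = 1" and \<nu>: "\<nu> \<bullet> z = 0"
  shows "gu z \<bullet> \<nu> = frechet_derivative u (at z) \<nu>"
proof -
  have z0: "z \<noteq> 0" and sz: "sgn z = z" and zW: "z \<in> W" using z by (auto simp: sgn_div_norm hcone_def)
  obtain u' where u': "\<And>x. x \<in> U \<Longrightarrow> (u has_derivative blinfun_apply (u' x)) (at x)"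
    by (rule C2E[OF U(3)]) blast
  have "((\<lambda>x. u (sgn x)) has_derivative (\<lambda>h. u' z (h /\<^sub>R norm z - ((z \<bullet> h) / norm z ^ 3) *\<^sub>R z))) (at z)"
    by (rule has_derivative_compose[where f=sgn and g=u, OF has_derivative_sgn[OF z0]]) (use u'[OF z(1)] sz in simp)
  then have "(\<lambda>h. gu z \<bullet> h) = (\<lambda>h. u' z (h /\<^sub>R norm z - ((z \<bullet> h) / norm z ^ 3) *\<^sub>R z))"
    using has_derivative_unique[OF C1g_deriv[OF gu(1) zW]] by simp
  then have "gu z \<bullet> \<nu> = u' z \<nu>" using \<nu> z(2) by (simp add: fun_eq_iff inner_commute)
  moreover have "frechet_derivative u (at z) = u' z" using frechet_derivative_at[OF u'[OF z(1)]] by simp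
  ultimately show ?thesis by simp
qed

lemma hom_u: "s > 0 \<Longrightarrow> u (sgn (s *\<^sub>R x)) = u (sgn x)" and hom_w: "s > 0 \<Longrightarrow> u (sgn (s *\<^sub>R x)) - sgn (s *\<^sub>R x) \<bullet> p = u (sgn x) - sgn x \<bullet> p"
  by (simp_all add: sgn_scale_pos)

lemma gu_euler: "x \<in> W \<Longrightarrow> gu x \<bullet> x = 0" and gu_scale: "x \<in> W \<Longrightarrow> s > 0 \<Longrightarrow> gu (s *\<^sub>R x) = gu x /\<^sub>R s"
  using homogeneous_gradient[OF W_open W_scale hom_u gu(1)] by blast+

lemma g_euler: "x \<in> W \<Longrightarrow> g x \<bullet> x = 0" and g_scale: "x \<in> W \<Longrightarrow> s > 0 \<Longrightarrow> g (s *\<^sub>R x) = g x /\<^sub>R s"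
  using homogeneous_gradient[OF W_open W_scale hom_w g(1)] by blast+

lemma Hu_euler: "x \<in> W \<Longrightarrow> Hu x x = - gu x"
  by (rule homogeneous_hessian[OF W_open gu_euler _ gu(2) gu(4)])

lemma H_euler: "x \<in> W \<Longrightarrow> H x x = - g x"
  by (rule homogeneous_hessian[OF W_open g_euler _ g(2) g(4)])

text \<open>Scaling by \<open>norm x\<close> carries a one-sided defining function near a point of
  the ambient cone to one near \<open>sgn x\<close> on the sphere.\<close>

lemma normal_derivative:
  assumes x: "x \<noteq> 0" and f: "(f has_derivative (\<lambda>h. gf \<bullet> h)) (at x)" and gf: "gf \<noteq> 0" "gf \<bullet> x = 0"
    and N: "open N" "x \<in> N" and inn: "\<And>y. y \<in> N \<Longrightarrow> y \<in> Q \<longleftrightarrow> f y > (0::real)"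
    and cl: "\<And>y. y \<in> N \<Longrightarrow> y \<in> closure Q \<longleftrightarrow> f y \<ge> 0" and fx: "f x = 0"
  shows "outward_normal \<Omega> (sgn x) (- sgn gf)"
proof -
  define r where "r = norm x"
  have r: "r > 0" using x by (simp add: r_def)
  have rx: "r *\<^sub>R sgn x = x" using x by (simp add: r_def sgn_div_norm)
  define N1 where "N1 = (\<lambda>y. r *\<^sub>R y) -` N"
  have oN1: "open N1" unfolding N1_def by (intro open_vimage N continuous_intros)
  have "outward_normal \<Omega> (sgn x) (- sgn (r *\<^sub>R gf))"
  proof (rule outward_normalI[OF Omega_sphere _ oN1])
    show "norm (sgn x) = 1" using x by (simp add: norm_sgn)
    show "sgn x \<in> N1" using N rx by (simp add: N1_def)
    show "((\<lambda>y. f (r *\<^sub>R y)) has_derivative (\<lambda>h. (r *\<^sub>R gf) \<bullet> h)) (at (sgn x))"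
    proof -
      have "((\<lambda>y. f (r *\<^sub>R y)) has_derivative (\<lambda>h. gf \<bullet> (r *\<^sub>R h))) (at (sgn x))"
        by (rule has_derivative_compose[where f="\<lambda>y. r *\<^sub>R y" and g=f]) (use f rx in \<open>auto intro!: derivative_eq_intros\<close>)
      then show ?thesis by simp
    qed
    show "r *\<^sub>R gf \<noteq> 0" using r gf by simp
    show "(r *\<^sub>R gf) \<bullet> sgn x = 0" using gf by (simp add: sgn_div_norm)
    show "f (r *\<^sub>R sgn x) = 0" using fx rx by simp
    fix y assume y: "y \<in> N1" "norm y = 1"
    then have yN: "r *\<^sub>R y \<in> N" and y0: "y \<noteq> 0" by (auto simp: N1_def)
    show "y \<in> \<Omega> \<longleftrightarrow> f (r *\<^sub>R y) > 0"
      using inn[OF yN] hcone_scale[OF r, of y \<Omega>] hcone_sphere[OF y(2), of \<Omega>] by simp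
    show "y \<in> closure \<Omega> \<longleftrightarrow> f (r *\<^sub>R y) \<ge> 0"
      using cl[OF yN] closure_Q[of "r *\<^sub>R y"] hcone_scale[OF r, of y "closure \<Omega>"] hcone_sphere[OF y(2), of "closure \<Omega>"] y0 r by simp
  qed
  then show ?thesis using r by (simp add: sgn_scale_pos)
qed

text \<open>\<open>gf\<close> points inwards, hence the minus sign; the division by
  \<open>norm x\<close> is the degree -1 scaling of \<open>gu\<close> from \<open>sgn x\<close> to
  \<open>x\<close>.\<close>

lemma gu_normal:
  assumes "x \<in> W" "frechet_derivative u (at (sgn x)) (- sgn gf) = k" "gf \<bullet> x = 0"
  shows "gu x \<bullet> gf = - k * norm gf / norm x"
proof -
  have x0: "x \<noteq> 0" and sU: "sgn x \<in> U" using assms(1) by (auto simp: hcone_def)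
  have "gu (sgn x) \<bullet> (- sgn gf) = k"
    using gu_tangent[OF sU, of "- sgn gf"] assms x0 by (simp add: norm_sgn sgn_div_norm[of x] sgn_div_norm[of gf])
  moreover have "gu (sgn x) = norm x *\<^sub>R gu x"
    using gu_scale[OF assms(1), of "inverse (norm x)"] x0 by (simp add: sgn_div_norm)
  ultimately have "- (norm x * (gu x \<bullet> sgn gf)) = k" by simp
  moreover have "gu x \<bullet> gf = norm gf * (gu x \<bullet> sgn gf)" by (cases "gf = 0") (simp_all add: sgn_div_norm)
  ultimately show ?thesis using x0 by (auto simp: field_simps)
qed

lemma gdiff: "x \<in> W \<Longrightarrow> gu x = g x + ((1 / norm x) *\<^sub>R p - ((x \<bullet> p) / norm x ^ 3) *\<^sub>R x)"
proof -
  assume x: "x \<in> W"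
  then have x0: "x \<noteq> 0" using W0 by auto
  have "((\<lambda>x. sgn x \<bullet> p) has_derivative (\<lambda>h. (h /\<^sub>R norm x - ((x \<bullet> h) / norm x ^ 3) *\<^sub>R x) \<bullet> p)) (at x)"
    by (rule has_derivative_inner_left[OF has_derivative_sgn[OF x0]])
  then have "((\<lambda>y. u (sgn y) - (u (sgn y) - sgn y \<bullet> p)) has_derivative (\<lambda>h. (h /\<^sub>R norm x - ((x \<bullet> h) / norm x ^ 3) *\<^sub>R x) \<bullet> p)) (at x)"
    by simp
  moreover have "((\<lambda>y. u (sgn y) - (u (sgn y) - sgn y \<bullet> p)) has_derivative (\<lambda>h. gu x \<bullet> h - g x \<bullet> h)) (at x)"
    by (rule has_derivative_diff[OF C1g_deriv[OF gu(1) x] C1g_deriv[OF g(1) x]])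
  ultimately have "(\<lambda>h. gu x \<bullet> h - g x \<bullet> h) = (\<lambda>h. (h /\<^sub>R norm x - ((x \<bullet> h) / norm x ^ 3) *\<^sub>R x) \<bullet> p)"
    by (rule has_derivative_unique[rotated])
  then have "gu x \<bullet> h = (g x + ((1 / norm x) *\<^sub>R p - ((x \<bullet> p) / norm x ^ 3) *\<^sub>R x)) \<bullet> h" for h
    by (simp add: fun_eq_iff inner_add_left inner_diff_left inner_commute divide_inverse algebra_simps)
  then show ?thesis by (rule inner_eqI)
qed

end

section \<open>The lateral boundary of the cone\<close>

lemma norm_scaleR_sgn: "norm v *\<^sub>R sgn v = (v::'a::real_normed_vector)"
  by (cases "v = 0") (simp_all add: sgn_div_norm)

lemma inner_sgn_self: "v \<bullet> sgn v = norm (v::'a::real_inner)"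
proof -
  have "norm v * (v \<bullet> sgn v) = v \<bullet> (norm v *\<^sub>R sgn v)" by simp
  also have "\<dots> = norm v * norm v" by (simp only: norm_scaleR_sgn power2_norm_eq_inner[symmetric] power2_eq_square)
  finally show ?thesis by (cases "v = 0") simp_all
qed

lemma has_vector_derivative_compose_derivative:
  assumes "(Z has_vector_derivative v) (at t)" "(F has_derivative F') (at (Z t))"
  shows "((\<lambda>s. F (Z s)) has_vector_derivative F' v) (at t)"
proof -
  have "((\<lambda>s. F (Z s)) has_derivative (\<lambda>r. F' (r *\<^sub>R v))) (at t)"
    by (rule has_derivative_compose[where f=Z and g=F, OF _ assms(2)]) (use assms(1) in \<open>simp add: has_vector_derivative_def\<close>)
  then show ?thesis using has_derivative_linear[OF assms(2)] by (simp add: has_vector_derivative_def linear_scale)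
qed

text \<open>Delivers the acceleration also in the nested \<open>vector_derivative\<close> form in
  which \<open>sph_convex\<close> mentions it.\<close>

lemma C2_real_curve:
  fixes \<gamma> :: "real \<Rightarrow> 'a::real_normed_vector"
  assumes "open S" "C2 \<gamma> S" "0 \<in> S"
  obtains \<gamma>' \<gamma>'' where "\<And>s. s \<in> S \<Longrightarrow> (\<gamma> has_vector_derivative \<gamma>' s) (at s)" "(\<gamma>' has_vector_derivative \<gamma>'') (at 0)"
    "vector_derivative (\<lambda>s. vector_derivative \<gamma> (at s)) (at 0) = \<gamma>''"
proof -
  obtain d where d: "\<And>x. x \<in> S \<Longrightarrow> (\<gamma> has_derivative blinfun_apply (d x)) (at x)" "C1 d S"
    by (rule C2E[OF assms(2)]) blast
  obtain dd where dd: "\<And>x. x \<in> S \<Longrightarrow> (d has_derivative blinfun_apply (dd x)) (at x)"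
    by (rule C1E[OF d(2)]) blast
  define \<gamma>' where "\<gamma>' = (\<lambda>s. d s 1)"
  define \<gamma>'' where "\<gamma>'' = dd 0 1 1"
  have 1: "(\<gamma> has_vector_derivative \<gamma>' s) (at s)" if "s \<in> S" for s
  proof -
    have "blinfun_apply (d s) = (\<lambda>r. r *\<^sub>R \<gamma>' s)"
      by (simp add: \<gamma>'_def fun_eq_iff flip: blinfun.scaleR_right)
    then show ?thesis using d(1)[OF that] by (simp add: has_vector_derivative_def)
  qed
  have 2: "(\<gamma>' has_vector_derivative \<gamma>'') (at 0)"
  proof -
    have "((\<lambda>s. d s 1) has_derivative (\<lambda>r. dd 0 r 1)) (at 0)"
      by (rule bounded_linear.has_derivative[OF blinfun.bounded_linear_left dd[OF assms(3)]])
    moreover have "(\<lambda>r. dd 0 r 1) = (\<lambda>r. r *\<^sub>R \<gamma>'')"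
    proof
      fix r show "dd 0 r 1 = r *\<^sub>R \<gamma>''"
        using blinfun.scaleR_right[of "dd 0" r 1] by (simp add: \<gamma>''_def blinfun.scaleR_left)
    qed
    ultimately show ?thesis by (simp add: has_vector_derivative_def \<gamma>'_def)
  qed
  have 3: "((\<lambda>s. vector_derivative \<gamma> (at s)) has_vector_derivative \<gamma>'') (at 0)"
    by (rule has_vector_derivative_transform_within_open[OF 2 assms(1,3)]) (simp add: vector_derivative_at[OF 1])
  show ?thesis by (rule that[OF 1 2 vector_derivative_at[OF 3]])
qed

lemma eventually_nhds_curve_open:
  assumes "isCont X (0::real)" "open S" "X 0 \<in> S"
  shows "\<forall>\<^sub>F s in nhds 0. X s \<in> S"
proof -
  have "\<forall>\<^sub>F s in at 0. X s \<in> S"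
    using assms(1) unfolding isCont_def by (rule topological_tendstoD) (use assms in auto)
  then show ?thesis unfolding eventually_at_filter
  proof (rule eventually_mono)
    fix s :: real assume "s \<noteq> 0 \<longrightarrow> s \<in> UNIV \<longrightarrow> X s \<in> S"
    then show "X s \<in> S" using assms(3) by (cases "s = 0") auto
  qed
qed

lemma curve_inner_zero_derivative:
  assumes a: "(a has_vector_derivative a') (at (0::real))" and b: "(b has_vector_derivative b') (at 0)"
    and z: "\<forall>\<^sub>F s in nhds 0. a s \<bullet> b s = 0"
  shows "a 0 \<bullet> b' + a' \<bullet> b 0 = 0"
proof -
  obtain S where S: "open S" "0 \<in> S" "\<And>s. s \<in> S \<Longrightarrow> a s \<bullet> b s = 0" using z unfolding eventually_nhds by blast
  have "((\<lambda>s. a s \<bullet> b s) has_derivative (\<lambda>r. a 0 \<bullet> (r *\<^sub>R b') + (r *\<^sub>R a') \<bullet> b 0)) (at 0)"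
    by (rule has_derivative_inner) (use a b in \<open>simp_all add: has_vector_derivative_def\<close>)
  then have "a 0 \<bullet> (1 *\<^sub>R b') + (1 *\<^sub>R a') \<bullet> b 0 = 0"
    by (rule has_derivative_zero_constant_local[OF _ S])
  then show ?thesis by simp
qed

context serrin
begin

text \<open>Here the Neumann condition and convexity enter. The defining function depends on
  \<open>lat\<close> alone, so \<open>gf\<close> is orthogonal to \<open>x\<close> and to
  \<open>p\<close>; hence the Neumann condition passes from \<open>gu\<close> to \<open>g\<close>.
  Differentiating \<open>gf \<bullet> g = 0\<close> along the boundary in direction \<open>g\<close>
  expresses \<open>H g \<bullet> gf\<close> by the second fundamental form of the cone, whose sign
  is that of the curvature of the boundary of \<open>\<omega>\<close>. The first alternative covers
  a boundary piece that is a slit.\<close>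

lemma boundary_function:
  assumes x0: "x0 \<noteq> 0" and b: "sgn x0 \<in> rbdry \<Omega>" "sgn x0 \<notin> closure \<Gamma>0" and np: "sgn x0 \<noteq> p"
  shows "x0 \<in> interior E \<or> (\<exists>r f gf e \<kappa>. r > 0 \<and> ball x0 r \<subseteq> W \<and> C1g f gf (ball x0 r) \<and> norm e = 1 \<and> \<kappa> > 0 \<and>
     (\<forall>x\<in>ball x0 r. gf x \<bullet> e \<ge> \<kappa> \<and> (x \<in> E \<longleftrightarrow> f x \<ge> 0) \<and>
        (f x = 0 \<longrightarrow> gf x \<bullet> x = 0 \<and> gf x \<bullet> gu x = 0 \<and> gf x \<bullet> g x = 0 \<and> H x (g x) \<bullet> gf x \<ge> 0)))"
proof -
  define z where "z = sgn x0"
  have bd_cone: "y \<in> cone_bdry p C" if "y \<in> rbdry \<Omega>" "y \<notin> closure \<Gamma>0" for y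
  proof (rule ccontr)
    assume "y \<notin> cone_bdry p C"
    then have "y \<in> \<Gamma>0" using that by (simp add: Gamma0_def)
    then show False using that(2) closure_subset by blast
  qed
  have zM: "z \<in> cone_bdry p C - {p}" using bd_cone[OF b] np by (simp add: z_def)
  define \<alpha>0 where "\<alpha>0 = z \<bullet> p"
  define \<beta>0 where "\<beta>0 = norm (proj p z)"
  define y0 where "y0 = lat p z"
  have zz: "norm z = 1" "\<alpha>0 > 0" "proj p z \<noteq> 0" "y0 \<in> rbdry \<omega>"
    using cone_bdry_lat[OF pole omega_sub, of z] zM by (auto simp: \<alpha>0_def y0_def)
  have b0: "\<beta>0 > 0" using zz by (simp add: \<beta>0_def)
  have ab0: "\<alpha>0\<^sup>2 + \<beta>0\<^sup>2 = 1" using norm_proj_sq[OF pole, of z] zz by (simp add: \<alpha>0_def \<beta>0_def)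
  have zeq: "z = \<alpha>0 *\<^sub>R p + \<beta>0 *\<^sub>R y0" unfolding \<alpha>0_def \<beta>0_def y0_def by (rule proj_decomp)
  note yy0 = rbdry_equator[OF omega_sub zz(4)]
  have pp: "p \<bullet> p = 1" using pole by (simp add: norm_eq_1)
  have y0y0: "y0 \<bullet> y0 = 1" "p \<bullet> y0 = 0" using yy0 by (simp_all add: norm_eq_1 inner_commute)
  \<comment> \<open>The slice of the lateral boundary at the height of \<open>z\<close>. The chart
    of the cone boundary is evaluated only on this slice.\<close>
  define B where "B = (\<lambda>y. \<alpha>0 *\<^sub>R p + \<beta>0 *\<^sub>R y)"
  have BM: "B y \<in> cone_bdry p C - {p}" if "y \<in> rbdry \<omega>" for y
    unfolding B_def by (rule cone_bdry_memI[OF pole omega_sub that zz(2) b0 ab0])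

  \<comment> \<open>A defining function of the lateral boundary in the angular coordinate\<close>
  obtain Uc Vc \<phi> \<psi> L where ch: "open Uc" "z \<in> Uc" "open Vc" "\<phi> ` Uc = Vc" "\<psi> ` Vc = Uc"
    "\<And>y. y \<in> Uc \<Longrightarrow> \<psi> (\<phi> y) = y" "\<And>y. y \<in> Vc \<Longrightarrow> \<phi> (\<psi> y) = y" "C2 (\<phi> :: 'a \<Rightarrow> 'a) Uc" "C2 (\<psi> :: 'a \<Rightarrow> 'a) Vc"
    "subspace L" "dim L = DIM('a) - 2" "\<And>x. x \<in> cone_bdry p C - {p} \<Longrightarrow> x \<in> Uc \<Longrightarrow> \<phi> x \<in> L"
    "\<And>y. y \<in> Vc \<Longrightarrow> y \<in> L \<Longrightarrow> \<psi> y \<in> cone_bdry p C - {p}"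
    by (rule submanifold_chart[OF cone_smooth zM]) (rule that)
  obtain \<phi>1 where \<phi>1: "\<And>x. x \<in> Uc \<Longrightarrow> (\<phi> has_derivative blinfun_apply (\<phi>1 x)) (at x)"
    by (rule C2E[OF ch(8)]) blast
  obtain \<psi>1 where \<psi>1: "\<And>x. x \<in> Vc \<Longrightarrow> (\<psi> has_derivative blinfun_apply (\<psi>1 x)) (at x)"
    by (rule C2E[OF ch(9)]) blast
  have \<phi>V: "\<phi> x \<in> Vc" if "x \<in> Uc" for x using ch(4) that by blast
  have inv1: "\<psi>1 (\<phi> x) (\<phi>1 x h) = h" if "x \<in> Uc" for x h
    by (rule inverse_derivatives[where \<phi>=\<phi> and \<psi>=\<psi>, OF ch(1) that ch(6) \<phi>1[OF that] \<psi>1[OF \<phi>V[OF that]]])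
  have inv2: "\<phi>1 x (\<psi>1 (\<phi> x) h) = h" if x: "x \<in> Uc" for x h
  proof (rule inverse_derivatives[where \<phi>=\<psi> and \<psi>=\<phi>, OF ch(3) \<phi>V[OF x] ch(7) \<psi>1[OF \<phi>V[OF x]]])
    show "(\<phi> has_derivative blinfun_apply (\<phi>1 x)) (at (\<psi> (\<phi> x)))" using \<phi>1[OF x] ch(6)[OF x] by simp
  qed
  have z0: "z \<noteq> 0" using zz(1) by auto
  obtain a h1 where ah: "\<And>l. l \<in> L \<Longrightarrow> a \<bullet> l = 0" "h1 \<bullet> z = 0" "\<phi>1 z h1 \<bullet> a \<noteq> 0"
  proof (rule chart_transversal[where \<phi>'="blinfun_apply (\<phi>1 z)" and \<psi>'="blinfun_apply (\<psi>1 (\<phi> z))", OF _ _ ch(10,11) z0])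
    show "linear (blinfun_apply (\<phi>1 z))" by (rule has_derivative_linear[OF \<phi>1[OF ch(2)]])
    show "\<psi>1 (\<phi> z) (\<phi>1 z h) = h" for h by (rule inv1[OF ch(2)])
    show "DIM('a) \<ge> 2" using dim by simp
  qed (rule that)
  define P0 where "P0 = {x. proj p x \<noteq> 0}"
  have oP0: "open P0" unfolding P0_def by (rule open_proj_nonzero)
  have C2B: "C2 (\<lambda>x. B (lat p x)) P0" unfolding B_def P0_def
    by (intro C2_add C2_const C2_linear_compose[OF bounded_linear_scaleR_right] C2_lat)
  define D where "D = {x. proj p x \<noteq> 0 \<and> B (lat p x) \<in> Uc}"
  have DP0: "D \<subseteq> P0" by (auto simp: D_def P0_def)
  have oD: "open D"
  proof -
    have "D = P0 \<inter> (\<lambda>x. B (lat p x)) -` Uc" by (auto simp: D_def P0_def)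
    then show ?thesis using continuous_open_preimage[OF C2_continuous_on[OF C2B] oP0 ch(1)] by simp
  qed
  \<comment> \<open>Composing the chart with \<open>B (lat p x)\<close>, and not with
    \<open>x\<close>, makes \<open>f\<close> invariant under scaling and under shifts along
    \<open>p\<close>.\<close>
  define f where "f = (\<lambda>x. \<phi> (B (lat p x)) \<bullet> a)"
  have C2f: "C2 f D" unfolding f_def
  proof (rule C2_inner[OF C2_compose[OF ch(8) C2_subset[OF C2B DP0]] C2_const])
    show "(\<lambda>x. B (lat p x)) ` D \<subseteq> Uc" by (auto simp: D_def)
  qed
  have Bz: "B (lat p z) = z" unfolding B_def y0_def[symmetric] by (rule zeq[symmetric])
  have zD: "z \<in> D" using zz(3) ch(2) unfolding D_def mem_Collect_eq Bz by simp
  have affD: "s *\<^sub>R x + t *\<^sub>R p \<in> D" and aff: "f (s *\<^sub>R x + t *\<^sub>R p) = f x" if "x \<in> D" "s > 0" for s t x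
  proof -
    have 1: "proj p (s *\<^sub>R x + t *\<^sub>R p) = s *\<^sub>R proj p x" by (rule proj_affine[OF pole])
    have 2: "lat p (s *\<^sub>R x + t *\<^sub>R p) = lat p x" by (rule lat_affine[OF pole that(2)])
    show "s *\<^sub>R x + t *\<^sub>R p \<in> D" using that unfolding D_def mem_Collect_eq 1 2 by simp
    show "f (s *\<^sub>R x + t *\<^sub>R p) = f x" unfolding f_def 2 ..
  qed
  have f0: "f x = 0" if "x \<in> D" "lat p x \<in> rbdry \<omega>" for x
  proof -
    have "B (lat p x) \<in> Uc" using that(1) by (simp add: D_def)
    from ah(1)[OF ch(12)[OF BM[OF that(2)] this]] show ?thesis unfolding f_def by (subst inner_commute)
  qed
  obtain gf Hf where gf: "C1g f gf D" "\<And>x. x \<in> D \<Longrightarrow> (gf has_derivative blinfun_apply (Hf x)) (at x)"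
    by (rule C2_gradient[OF oD C2f]) blast
  have gf_aff: "gf x = s *\<^sub>R gf (s *\<^sub>R x + t *\<^sub>R p)" if x: "x \<in> D" "s > 0" for s t x
  proof (rule inner_eqI)
    fix h
    have "((\<lambda>y. f (s *\<^sub>R y + t *\<^sub>R p)) has_derivative (\<lambda>h. gf (s *\<^sub>R x + t *\<^sub>R p) \<bullet> (s *\<^sub>R h))) (at x)"
      by (rule has_derivative_compose[where f="\<lambda>y. s *\<^sub>R y + t *\<^sub>R p" and g=f, OF _ C1g_deriv[OF gf(1) affD[OF x]]])
        (auto intro!: derivative_eq_intros)
    then have "(f has_derivative (\<lambda>h. gf (s *\<^sub>R x + t *\<^sub>R p) \<bullet> (s *\<^sub>R h))) (at x)"
      by (rule has_derivative_transform_within_open[OF _ oD x(1)]) (rule aff[OF _ x(2)])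
    then have "(\<lambda>h. gf x \<bullet> h) = (\<lambda>h. gf (s *\<^sub>R x + t *\<^sub>R p) \<bullet> (s *\<^sub>R h))"
      by (rule has_derivative_unique[OF C1g_deriv[OF gf(1) x(1)]])
    then show "gf x \<bullet> h = (s *\<^sub>R gf (s *\<^sub>R x + t *\<^sub>R p)) \<bullet> h" by (simp add: fun_eq_iff)
  qed
  have gfx: "gf x \<bullet> x = 0" if "x \<in> D" for x
  proof (rule homogeneous_gradient(1)[OF oD _ _ gf(1) that])
    show "s *\<^sub>R x \<in> D" if "x \<in> D" "s > 0" for x s using affD[OF that, of 0] by simp
    show "f (s *\<^sub>R x) = f x" if "x \<in> D" "s > 0" for x s using aff[OF that, of 0] by simp
  qed
  have gfp: "gf x \<bullet> p = 0" if "x \<in> D" for x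
  proof -
    have "gf (x + p) \<bullet> (x + p) = 0" using gfx[OF affD[OF that, of 1 1]] by simp
    moreover have "gf x = gf (x + p)" using gf_aff[OF that, of 1 1] by simp
    ultimately show ?thesis using gfx[OF that] by (simp add: inner_add_right)
  qed
  have lat_der: "(lat p has_derivative (\<lambda>h. proj p h /\<^sub>R norm (proj p x) - ((proj p x \<bullet> proj p h) / norm (proj p x) ^ 3) *\<^sub>R proj p x)) (at x)"
    if "x \<in> D" for x using that by (intro lat_derivative) (simp add: D_def)
  \<comment> \<open>The meridian through \<open>z\<close> with velocity \<open>\<tau>\<close> lies
    in the lateral boundary, so the functional \<open>a\<close> does not see \<open>\<tau>\<close>.
    The transversal vector \<open>h1\<close> may therefore be made orthogonal to
    \<open>\<tau>\<close>, hence to \<open>p\<close> and \<open>y0\<close>, and on such vectors the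
    derivative of \<open>B (lat p x)\<close> at \<open>z\<close> is the identity.\<close>
  have gfz: "gf z \<noteq> 0"
  proof -
    define \<tau> where "\<tau> = (- \<beta>0) *\<^sub>R p + \<alpha>0 *\<^sub>R y0"
    have ab1: "\<alpha>0 * \<alpha>0 + \<beta>0 * \<beta>0 = 1" using ab0 by (simp add: power2_eq_square)
    have tt: "\<tau> \<bullet> \<tau> = 1" "\<tau> \<bullet> z = 0"
      using pp y0y0 ab1 by (simp_all add: \<tau>_def zeq inner_add_left inner_add_right inner_diff_left inner_diff_right inner_commute[of y0 p])
    have gz: "geod z \<tau> s = (\<alpha>0 * cos s - \<beta>0 * sin s) *\<^sub>R p + (\<beta>0 * cos s + \<alpha>0 * sin s) *\<^sub>R y0" for s
      by (simp add: geod_def zeq \<tau>_def algebra_simps)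
    have c: "(geod z \<tau> has_vector_derivative \<tau>) (at 0)" using geod_has_vector_derivative[of z \<tau> 0] by simp
    have "\<forall>\<^sub>F s in nhds 0. \<phi> (geod z \<tau> s) \<bullet> a = 0"
    proof -
      have i: "isCont (geod z \<tau>) 0" using c by (rule has_vector_derivative_continuous)
      have "\<forall>\<^sub>F s in nhds 0. geod z \<tau> s \<in> Uc"
        by (rule eventually_nhds_curve_open[OF i ch(1)]) (use ch(2) in \<open>simp add: geod_def\<close>)
      moreover have "\<forall>\<^sub>F s in nhds 0. \<alpha>0 * cos s - \<beta>0 * sin s \<in> {0<..}"
        by (rule eventually_nhds_curve_open) (use zz(2) in \<open>auto intro!: continuous_intros\<close>)
      moreover have "\<forall>\<^sub>F s in nhds 0. \<beta>0 * cos s + \<alpha>0 * sin s \<in> {0<..}"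
        by (rule eventually_nhds_curve_open) (use b0 in \<open>auto intro!: continuous_intros\<close>)
      ultimately show ?thesis
      proof eventually_elim
        case (elim s)
        have "(\<alpha>0 * k - \<beta>0 * l)\<^sup>2 + (\<beta>0 * k + \<alpha>0 * l)\<^sup>2 = (\<alpha>0\<^sup>2 + \<beta>0\<^sup>2) * (k\<^sup>2 + l\<^sup>2)" for k l :: real
          by (simp add: power2_eq_square algebra_simps)
        from this[of "cos s" "sin s"]
        have "(\<alpha>0 * cos s - \<beta>0 * sin s)\<^sup>2 + (\<beta>0 * cos s + \<alpha>0 * sin s)\<^sup>2 = 1" using ab0 by simp
        then have "geod z \<tau> s \<in> cone_bdry p C - {p}"
          unfolding gz using elim by (intro cone_bdry_memI[OF pole omega_sub zz(4)]) auto
        then show ?case using ah(1)[OF ch(12)] elim by (simp add: inner_commute)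
      qed
    qed
    then have 1: "\<phi>1 z \<tau> \<bullet> a = 0"
      using derivative_along_curve_zero[OF c, of "\<lambda>x. \<phi> x \<bullet> a" "\<lambda>h. \<phi>1 z h \<bullet> a"]
        has_derivative_inner_left[OF \<phi>1[OF ch(2)], of a] by (simp add: geod_def)
    define h where "h = h1 - (h1 \<bullet> \<tau>) *\<^sub>R \<tau>"
    have hz: "h \<bullet> z = 0" "h \<bullet> \<tau> = 0" using ah(2) tt by (simp_all add: h_def inner_diff_left)
    have pe: "p = \<alpha>0 *\<^sub>R z - \<beta>0 *\<^sub>R \<tau>" and ye: "y0 = \<beta>0 *\<^sub>R z + \<alpha>0 *\<^sub>R \<tau>"
    proof -
      have "\<alpha>0 *\<^sub>R z - \<beta>0 *\<^sub>R \<tau> = (\<alpha>0 * \<alpha>0 + \<beta>0 * \<beta>0) *\<^sub>R p" unfolding \<tau>_def zeq by (simp add: algebra_simps)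
      then show "p = \<alpha>0 *\<^sub>R z - \<beta>0 *\<^sub>R \<tau>" using ab1 by simp
      have "\<beta>0 *\<^sub>R z + \<alpha>0 *\<^sub>R \<tau> = (\<alpha>0 * \<alpha>0 + \<beta>0 * \<beta>0) *\<^sub>R y0" unfolding \<tau>_def zeq by (simp add: algebra_simps)
      then show "y0 = \<beta>0 *\<^sub>R z + \<alpha>0 *\<^sub>R \<tau>" using ab1 by simp
    qed
    have hp: "h \<bullet> p = 0" using hz by (subst pe) (simp add: inner_diff_right)
    have hy: "h \<bullet> y0 = 0" using hz by (subst ye) (simp add: inner_add_right)
    have pz: "proj p z = \<beta>0 *\<^sub>R y0" by (subst zeq) (rule proj_combo[OF pole yy0(2)])
    have "((\<lambda>x. \<phi> (B (lat p x))) has_derivative (\<lambda>k. \<phi>1 (B (lat p z)) (\<beta>0 *\<^sub>R (proj p k /\<^sub>R norm (proj p z) - ((proj p z \<bullet> proj p k) / norm (proj p z) ^ 3) *\<^sub>R proj p z)))) (at z)"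
    proof -
      have d1: "((\<lambda>x. B (lat p x)) has_derivative (\<lambda>k. \<beta>0 *\<^sub>R (proj p k /\<^sub>R norm (proj p z) - ((proj p z \<bullet> proj p k) / norm (proj p z) ^ 3) *\<^sub>R proj p z))) (at z)"
        unfolding B_def using has_derivative_add[OF has_derivative_const has_derivative_scaleR_right[OF lat_der[OF zD]], of "\<alpha>0 *\<^sub>R p" \<beta>0] by simp
      have d2: "(\<phi> has_derivative blinfun_apply (\<phi>1 (B (lat p z)))) (at (B (lat p z)))"
        using zD by (intro \<phi>1) (simp add: D_def)
      show ?thesis by (rule has_derivative_compose[where f="\<lambda>x. B (lat p x)" and g=\<phi>, OF d1 d2])
    qed
    then have "(f has_derivative (\<lambda>k. \<phi>1 (B (lat p z)) (\<beta>0 *\<^sub>R (proj p k /\<^sub>R norm (proj p z) - ((proj p z \<bullet> proj p k) / norm (proj p z) ^ 3) *\<^sub>R proj p z)) \<bullet> a)) (at z)"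
      unfolding f_def by (rule has_derivative_inner_left)
    then have "(\<lambda>k. gf z \<bullet> k) = (\<lambda>k. \<phi>1 (B (lat p z)) (\<beta>0 *\<^sub>R (proj p k /\<^sub>R norm (proj p z) - ((proj p z \<bullet> proj p k) / norm (proj p z) ^ 3) *\<^sub>R proj p z)) \<bullet> a)"
      by (rule has_derivative_unique[OF C1g_deriv[OF gf(1) zD]])
    from fun_cong[OF this, of h] have "gf z \<bullet> h = \<phi>1 (B (lat p z)) (\<beta>0 *\<^sub>R (proj p h /\<^sub>R norm (proj p z) - ((proj p z \<bullet> proj p h) / norm (proj p z) ^ 3) *\<^sub>R proj p z)) \<bullet> a" .
    also have "B (lat p z) = z" by (rule Bz)
    also have "\<beta>0 *\<^sub>R (proj p h /\<^sub>R norm (proj p z) - ((proj p z \<bullet> proj p h) / norm (proj p z) ^ 3) *\<^sub>R proj p z) = h"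
      using hy proj_id[OF hp] pz b0 yy0(1) by (simp add: inner_commute)
    also have "\<phi>1 z h \<bullet> a = \<phi>1 z h1 \<bullet> a" using 1 by (simp add: h_def blinfun.diff_right blinfun.scaleR_right inner_diff_left)
    finally show ?thesis using ah(3) by auto
  qed
  have x0z: "norm x0 *\<^sub>R z + 0 *\<^sub>R p = x0" using x0 by (simp add: z_def sgn_div_norm)
  have nx0: "norm x0 > 0" using x0 by simp
  have x0D: "x0 \<in> D" using affD[OF zD nx0, of 0] unfolding x0z .
  have gfx0: "gf x0 \<noteq> 0"
  proof
    assume "gf x0 = 0"
    then show False using gf_aff[OF zD nx0, of 0] gfz unfolding x0z by simp
  qed

  \<comment> \<open>The domain near the boundary point\<close>
  have clOm: "z \<in> closure \<Omega>" "z \<notin> \<Omega>" using b by (auto simp: z_def rbdry_def)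
  have x0W: "x0 \<in> W" using clOm U(2) x0 by (auto simp: hcone_def z_def)
  \<comment> \<open>Avoiding the closed set \<open>closure \<Gamma>0\<close> ensures that all
    frontier points near \<open>x0\<close> are lateral ones, where the homogeneous Neumann condition
    holds.\<close>
  define N0 where "N0 = (D \<inter> W) \<inter> hcone (- closure \<Gamma>0)"
  have oN0: "open N0" unfolding N0_def by (intro open_Int oD W_open open_hcone) auto
  have x0N0: "x0 \<in> N0" using x0D x0W b(2) x0 by (simp add: N0_def hcone_def)
  obtain r where r: "r > 0" "ball x0 r \<subseteq> N0" using openE[OF oN0 x0N0] by blast
  have rD: "ball x0 r \<subseteq> D" "ball x0 r \<subseteq> W" using r(2) by (auto simp: N0_def)
  have bdry_pt: "lat p x \<in> rbdry \<omega>" "sgn x \<in> \<Gamma>1 - {p}" "sgn x \<in> rbdry \<Omega>" if x: "x \<in> ball x0 r" "x \<in> frontier Q" for x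
  proof -
    have "x \<in> N0" by (rule subsetD[OF r(2) x(1)])
    then have xW: "x \<noteq> 0" "x \<in> D" "sgn x \<notin> closure \<Gamma>0" by (auto simp: N0_def hcone_def)
    show sb: "sgn x \<in> rbdry \<Omega>" using frontier_Q[OF xW(1)] x(2) by simp
    have "proj p (sgn x) \<noteq> 0" using xW by (simp add: proj_sgn D_def)
    then have sp: "sgn x \<noteq> p" using pp by (auto simp: proj_def)
    show "lat p x \<in> rbdry \<omega>"
      using cone_bdry_lat(4)[OF pole omega_sub bd_cone[OF sb xW(3)] sp] lat_sgn[OF pole xW(1)] by simp
    show "sgn x \<in> \<Gamma>1 - {p}" using sb xW(3) sp by (simp add: Gamma1_def)
  qed
  have x0fr: "x0 \<in> frontier Q" using frontier_Q[OF x0] b(1) by simp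
  have x0cl: "x0 \<in> closure Q" using x0fr by (simp add: frontier_def)
  have fx0: "f x0 = 0" by (rule f0[OF x0D bdry_pt(1)[OF _ x0fr]]) (use r in simp)
  have ffr: "f x = 0" if "x \<in> ball x0 r" "x \<in> frontier Q" for x
    by (rule f0[OF subsetD[OF rD(1) that(1)] bdry_pt(1)[OF that]])
  show ?thesis
  proof (rule sides_dichotomy[OF Q_open x0cl r(1) C1g_subset[OF gf(1) rD(1)] fx0 gfx0 ffr])
    \<comment> \<open>The slit case: there is no outward normal and no information from the Neumann
      condition, but none is needed.\<close>
    fix \<rho> assume rho: "\<rho> > 0" "ball x0 \<rho> \<subseteq> closure Q"
    have "ball x0 (min \<rho> r) \<subseteq> E" using rho(2) rD(2) unfolding E_eq by auto
    then have "x0 \<in> interior E" using rho(1) r(1) interior_maximal[OF _ open_ball, of x0 "min \<rho> r" E] by auto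
    then show ?thesis by blast
  next
    fix \<rho> \<sigma> e \<kappa>
    assume rho: "\<rho> > 0" "\<rho> \<le> r" and sg: "\<sigma> = 1 \<or> \<sigma> = (-1::real)" and e: "norm e = 1" and k: "\<kappa> > 0"
      and slope: "\<And>x. x \<in> ball x0 \<rho> \<Longrightarrow> (\<sigma> *\<^sub>R gf x) \<bullet> e \<ge> \<kappa>"
      and inn: "\<And>x. x \<in> ball x0 \<rho> \<Longrightarrow> x \<in> Q \<longleftrightarrow> \<sigma> * f x > 0"
      and cl: "\<And>x. x \<in> ball x0 \<rho> \<Longrightarrow> x \<in> closure Q \<longleftrightarrow> \<sigma> * f x \<ge> 0"
    have br: "ball x0 \<rho> \<subseteq> ball x0 r" using rho by auto
    have bD: "ball x0 \<rho> \<subseteq> D" and bW: "ball x0 \<rho> \<subseteq> W" using br rD by auto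
    have f1: "C1g (\<lambda>x. \<sigma> * f x) (\<lambda>x. \<sigma> *\<^sub>R gf x) (ball x0 \<rho>)"
      by (rule C1g_cmult[OF C1g_subset[OF gf(1) bD]])
    have key: "(\<sigma> *\<^sub>R gf x) \<bullet> x = 0 \<and> (\<sigma> *\<^sub>R gf x) \<bullet> gu x = 0 \<and> (\<sigma> *\<^sub>R gf x) \<bullet> g x = 0 \<and> H x (g x) \<bullet> (\<sigma> *\<^sub>R gf x) \<ge> 0"
      if x: "x \<in> ball x0 \<rho>" and fx: "\<sigma> * f x = 0" for x
    proof -
      have xD: "x \<in> D" and xW: "x \<in> W" and xr: "x \<in> ball x0 r" using x bD bW br by auto
      have xn0: "x \<noteq> 0" using xW W0 by auto
      have "x \<in> closure Q" "x \<notin> Q" using cl[OF x] inn[OF x] fx by auto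
      then have xfr: "x \<in> frontier Q" using Q_open by (simp add: frontier_def interior_open)
      note bp = bdry_pt[OF xr xfr]
      have gn: "\<sigma> *\<^sub>R gf x \<noteq> 0" using slope[OF x] k by auto
      have gx: "(\<sigma> *\<^sub>R gf x) \<bullet> x = 0" using gfx[OF xD] by simp
      have neumann: "gu x' \<bullet> gf x' = 0" if x': "x' \<in> ball x0 \<rho>" and fx': "f x' = 0" for x'
      proof -
        have m: "x' \<in> D" "x' \<in> W" "x' \<in> ball x0 r" using x' bD bW br by auto
        have n0: "x' \<noteq> 0" using m W0 by auto
        have "x' \<in> closure Q" "x' \<notin> Q" using cl[OF x'] inn[OF x'] fx' by auto
        then have "x' \<in> frontier Q" using Q_open by (simp add: frontier_def interior_open)
        note b' = bdry_pt[OF m(3) this]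
        have ge: "(\<sigma> *\<^sub>R gf x') \<bullet> x' = 0" using gfx[OF m(1)] by simp
        have gne: "\<sigma> *\<^sub>R gf x' \<noteq> 0" using slope[OF x'] k by auto
        have f0': "\<sigma> * f x' = 0" using fx' by simp
        have "outward_normal \<Omega> (sgn x') (- sgn (\<sigma> *\<^sub>R gf x'))"
          by (rule normal_derivative[OF n0 C1g_deriv[OF f1 x'] gne ge open_ball x' inn cl f0'])
        then have "frechet_derivative u (at (sgn x')) (- sgn (\<sigma> *\<^sub>R gf x')) = 0" using neu1 b'(2) by blast
        from gu_normal[OF m(2) this ge] have "gu x' \<bullet> (\<sigma> *\<^sub>R gf x') = 0" by simp
        then show ?thesis using sg by auto
      qed
      \<comment> \<open>\<open>gu - g\<close> is a combination of \<open>p\<close> and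
        \<open>x'\<close>, both orthogonal to \<open>gf x'\<close>.\<close>
      have neumann_g: "g x' \<bullet> gf x' = 0" if x': "x' \<in> ball x0 \<rho>" and fx': "f x' = 0" for x'
      proof -
        have m: "x' \<in> D" "x' \<in> W" using x' bD bW by auto
        have "p \<bullet> gf x' = 0" "x' \<bullet> gf x' = 0" using gfx[OF m(1)] gfp[OF m(1)] by (simp_all add: inner_commute)
        moreover have "(g x' + ((1 / norm x') *\<^sub>R p - ((x' \<bullet> p) / norm x' ^ 3) *\<^sub>R x')) \<bullet> gf x' = 0"
          using neumann[OF that] by (simp only: gdiff[OF m(2)])
        ultimately show ?thesis by (simp add: inner_add_left inner_diff_left)
      qed
      have fx0': "f x = 0" using fx sg by auto

      \<comment> \<open>The second fundamental form in the direction of the gradient\<close>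
      define \<alpha> where "\<alpha> = x \<bullet> p"
      define \<beta> where "\<beta> = norm (proj p x)"
      define y where "y = lat p x"
      have bpos: "\<beta> > 0" using xD by (simp add: \<beta>_def D_def)
      have xeq: "x = \<alpha> *\<^sub>R p + \<beta> *\<^sub>R y" unfolding \<alpha>_def \<beta>_def y_def by (rule proj_decomp)
      have yb: "y \<in> rbdry \<omega>" using bp(1) by (simp add: y_def)
      note ye = rbdry_equator[OF omega_sub yb]
      have yy: "y \<bullet> y = 1" "p \<bullet> y = 0" using ye by (simp_all add: norm_eq_1 inner_commute)
      have laty: "lat p y = y" by (rule lat_id[OF ye])
      define z1 where "z1 = B y"
      have z1U: "z1 \<in> Uc" using xD by (simp add: z1_def y_def D_def)
      have z1M: "z1 \<in> cone_bdry p C - {p}" unfolding z1_def by (rule BM[OF yb])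
      have yn0: "y \<noteq> 0" using ye by auto
      have latz1: "lat p z1 = y" unfolding z1_def B_def by (rule lat_combo[OF pole ye b0])
      have projz1: "proj p z1 = \<beta>0 *\<^sub>R y" unfolding z1_def B_def by (rule proj_combo[OF pole ye(2)])
      have z1D: "z1 \<in> D" using z1U projz1 b0 yn0 latz1 z1_def by (simp add: D_def)
      have yD: "y \<in> D" using z1U ye yn0 laty z1_def by (simp add: D_def proj_id)
      have gfy: "gf y = \<beta> *\<^sub>R gf x"
        using gf_aff[OF yD bpos, of \<alpha>] xeq by (simp add: add.commute)
      have gfz1: "gf y = \<beta>0 *\<^sub>R gf z1"
        using gf_aff[OF yD b0, of \<alpha>0] by (simp add: z1_def B_def add.commute)
      define v where "v = g x"
      have vgf: "v \<bullet> gf x = 0" unfolding v_def by (rule neumann_g[OF x fx0'])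
      have gfxy: "gf x \<bullet> y = 0"
      proof -
        have "gf y \<bullet> y = 0" by (rule gfx[OF yD])
        then show ?thesis using gfy bpos by simp
      qed
      \<comment> \<open>The velocity of the angular coordinate when \<open>x\<close> moves with
        velocity \<open>v\<close>: the part of \<open>v\<close> outside the plane of
        \<open>p\<close> and \<open>y\<close>, divided by the radius \<open>\<beta>\<close>.\<close>
      define \<tau> where "\<tau> = (v - (v \<bullet> p) *\<^sub>R p - (v \<bullet> y) *\<^sub>R y) /\<^sub>R \<beta>"
      have tau: "\<tau> \<bullet> p = 0" "\<tau> \<bullet> y = 0" "\<tau> \<bullet> gf x = 0"
        using pp yy ye(2) vgf gfxy gfp[OF xD]
        by (simp_all add: \<tau>_def inner_diff_left inner_diff_right inner_commute)
      have bt: "\<beta> *\<^sub>R \<tau> = v - (v \<bullet> p) *\<^sub>R p - (v \<bullet> y) *\<^sub>R y" using bpos by (simp add: \<tau>_def)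
      have Msph: "cone_bdry p C - {p} \<subseteq> sphere 0 1" by (auto simp: cone_bdry_def hemi_def)
      have z1n: "\<psi> (\<phi> z1) = z1" by (rule ch(6)[OF z1U])
      have gfz1n: "gf z1 \<noteq> 0" using gfy gfz1 gn bpos by auto
      \<comment> \<open>Every vector tangent to the lateral boundary is the velocity of a curve in
        it. The radius of the slice through \<open>z1\<close> is \<open>\<beta>0\<close>, so angular
        velocity \<open>\<tau>\<close> means velocity
        \<open>\<beta>0 *\<^sub>R \<tau>\<close>.\<close>
      obtain \<zeta> where ze: "\<zeta> \<in> L" "\<psi>1 (\<phi> z1) \<zeta> = \<beta>0 *\<^sub>R \<tau>"
      proof (rule chart_tangent_space[where \<psi>=\<psi> and \<psi>'="blinfun_apply (\<psi>1 (\<phi> z1))" and \<phi>'="blinfun_apply (\<phi>1 z1)" and f=f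
            and gf="gf z1" and N=D and M="cone_bdry p C - {p}" and h="\<beta>0 *\<^sub>R \<tau>" and y="\<phi> z1" and V=Vc and L=L])
        show "open Vc" "\<phi> z1 \<in> Vc" "\<phi> z1 \<in> L" "subspace L" "dim L = DIM('a) - 2" "open D"
          using ch(3,10,11) \<phi>V[OF z1U] ch(12)[OF z1M z1U] oD by auto
        show "(\<psi> has_derivative blinfun_apply (\<psi>1 (\<phi> z1))) (at (\<phi> z1))" by (rule \<psi>1[OF \<phi>V[OF z1U]])
        show "\<phi>1 z1 (\<psi>1 (\<phi> z1) h) = h" for h by (rule inv2[OF z1U])
        show "\<psi> y \<in> cone_bdry p C - {p}" if "y \<in> Vc" "y \<in> L" for y using that by (rule ch(13))
        show "cone_bdry p C - {p} \<subseteq> sphere 0 1" by (rule Msph)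
        show "(f has_derivative (\<lambda>h. gf z1 \<bullet> h)) (at (\<psi> (\<phi> z1)))" unfolding z1n by (rule C1g_deriv[OF gf(1) z1D])
        show "gf z1 \<noteq> 0" by (rule gfz1n)
        show "\<psi> (\<phi> z1) \<bullet> gf z1 = 0" unfolding z1n using gfx[OF z1D] by (simp add: inner_commute)
        show "\<psi> (\<phi> z1) \<in> D" unfolding z1n by (rule z1D)
        show "f x = 0" if "x \<in> cone_bdry p C - {p}" "x \<in> D" for x
          by (rule f0[OF that(2)]) (use cone_bdry_lat(4)[OF pole omega_sub, of x] that in auto)
        show "(\<beta>0 *\<^sub>R \<tau>) \<bullet> \<psi> (\<phi> z1) = 0" unfolding z1n unfolding z1_def B_def using tau by (simp add: inner_add_right)
        show "(\<beta>0 *\<^sub>R \<tau>) \<bullet> gf z1 = 0"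
        proof -
          have "\<beta>0 *\<^sub>R gf z1 = \<beta> *\<^sub>R gf x" using gfy gfz1 by simp
          then have "\<tau> \<bullet> (\<beta>0 *\<^sub>R gf z1) = 0" using tau(3) by simp
          then show ?thesis by simp
        qed
      qed (rule that)
      define Zc where "Zc = (\<lambda>s. \<psi> (\<phi> z1 + s *\<^sub>R \<zeta>))"
      define S where "S = (\<lambda>s. \<phi> z1 + s *\<^sub>R \<zeta>) -` Vc"
      have oS: "open S" unfolding S_def by (intro open_vimage ch(3) continuous_intros)
      have S0: "0 \<in> S" using \<phi>V[OF z1U] by (simp add: S_def)
      have ZM: "Zc s \<in> cone_bdry p C - {p}" if "s \<in> S" for s
        unfolding Zc_def using that ch(10) ze(1) ch(12)[OF z1M z1U]
        by (intro ch(13)) (auto simp: S_def intro: subspace_add subspace_scale)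
      have latZ: "lat p (Zc s) \<in> rbdry \<omega>" "proj p (Zc s) \<noteq> 0" if "s \<in> S" for s
        using cone_bdry_lat(3,4)[OF pole omega_sub, of "Zc s"] ZM[OF that] by auto
      \<comment> \<open>The chart curve projected to the boundary of \<open>\<omega>\<close>: a C2
        curve through \<open>y\<close> with velocity \<open>\<tau>\<close>, to which convexity
        applies.\<close>
      define yc where "yc = (\<lambda>s. lat p (Zc s))"
      have C2y: "C2 yc S"
      proof -
        have "C2 (\<lambda>s. \<phi> z1 + s *\<^sub>R \<zeta>) S"
          by (intro C2_add C2_const C2_linear bounded_linear_scaleR_left)
        then have "C2 Zc S" unfolding Zc_def by (rule C2_compose[OF ch(9)]) (auto simp: S_def)
        then show ?thesis unfolding yc_def by (rule C2_compose[OF C2_lat[of p]]) (use latZ in auto)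
      qed
      obtain y1 y2 where y1: "\<And>s. s \<in> S \<Longrightarrow> (yc has_vector_derivative y1 s) (at s)" "(y1 has_vector_derivative y2) (at 0)"
        "vector_derivative (\<lambda>s. vector_derivative yc (at s)) (at 0) = y2"
        by (rule C2_real_curve[OF oS C2y S0]) blast
      have Z0: "Zc 0 = z1" using z1n by (simp add: Zc_def)
      have yc0: "yc 0 = y" using latz1 Z0 by (simp add: yc_def)
      have y10: "y1 0 = \<tau>"
      proof -
        have cz: "(Zc has_vector_derivative \<beta>0 *\<^sub>R \<tau>) (at 0)"
          unfolding Zc_def ze(2)[symmetric] by (rule chart_curve(1)[OF ch(3) \<phi>V[OF z1U] \<psi>1[OF \<phi>V[OF z1U]]])
        have "(yc has_vector_derivative (proj p (\<beta>0 *\<^sub>R \<tau>) /\<^sub>R norm (proj p z1) - ((proj p z1 \<bullet> proj p (\<beta>0 *\<^sub>R \<tau>)) / norm (proj p z1) ^ 3) *\<^sub>R proj p z1)) (at 0)"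
          unfolding yc_def by (rule has_vector_derivative_compose_derivative[OF cz]) (use lat_der[OF z1D] Z0 in simp)
        moreover have "proj p (\<beta>0 *\<^sub>R \<tau>) = \<beta>0 *\<^sub>R \<tau>" using tau by (intro proj_id) simp
        ultimately have "(yc has_vector_derivative \<tau>) (at 0)" using projz1 tau b0 ye(1) by (simp add: inner_commute)
        then show ?thesis using vector_derivative_unique_at[OF y1(1)[OF S0]] by simp
      qed
      \<comment> \<open>The inward normal of \<open>\<omega>\<close> at \<open>y\<close>. It may be
        read off at \<open>x\<close> because \<open>gf y\<close> is a positive multiple of
        \<open>gf x\<close>.\<close>
      define N where "N = sgn (\<sigma> *\<^sub>R gf x)"
      have Ninw: "inward_normal_eq p \<omega> y N"
        unfolding inward_normal_eq_def
      proof (intro conjI ballI)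
        show "norm N = 1" using gn by (simp add: N_def norm_sgn)
        show "N \<bullet> y = 0" using gfxy by (simp add: N_def sgn_div_norm)
        show "N \<bullet> p = 0" using gfp[OF xD] by (simp add: N_def sgn_div_norm)
      next
        fix w assume "w \<in> tangent_vecs (rbdry \<omega>) y"
        then obtain \<gamma> \<epsilon> where ga: "\<epsilon> > 0" "\<gamma> 0 = y" "\<And>t. t \<in> {-\<epsilon><..<\<epsilon>} \<Longrightarrow> \<gamma> t \<in> rbdry \<omega>" "(\<gamma> has_vector_derivative w) (at 0)"
          unfolding tangent_vecs_def by blast
        have "\<forall>\<^sub>F t in nhds 0. \<gamma> t \<in> D"
          by (rule eventually_nhds_curve_open[OF has_vector_derivative_continuous[OF ga(4)] oD]) (use ga(2) yD in simp)
        moreover have "\<forall>\<^sub>F t in nhds 0. t \<in> {-\<epsilon><..<\<epsilon>}" using ga(1) by (intro eventually_nhds_in_open) auto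
        ultimately have "\<forall>\<^sub>F t in nhds 0. f (\<gamma> t) = 0"
        proof eventually_elim
          case (elim t)
          have "\<gamma> t \<in> rbdry \<omega>" using ga(3)[OF elim(2)] .
          then show ?case using f0[OF elim(1)] lat_id[OF rbdry_equator[OF omega_sub]] by simp
        qed
        from derivative_along_curve_zero[OF ga(4) _ this, of "\<lambda>h. gf y \<bullet> h"]
        have "gf y \<bullet> w = 0" using C1g_deriv[OF gf(1) yD] ga(2) by simp
        then show "N \<bullet> w = 0" using gfy bpos by (simp add: N_def sgn_div_norm)
      next
        have "(geod y N has_vector_derivative N) (at 0)" using geod_has_vector_derivative[of y N 0] by simp
        have nN: "norm N = 1" using gn by (simp add: N_def norm_sgn)
        have Ny: "N \<bullet> y = 0" using gfxy by (simp add: N_def sgn_div_norm)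
        have Np: "N \<bullet> p = 0" using gfp[OF xD] by (simp add: N_def sgn_div_norm)
        have gc: "isCont (geod y N) 0" unfolding geod_def[abs_def] by (intro continuous_intros)
        have g0: "geod y N 0 = y" by (simp add: geod_def)
        have "((\<lambda>t. f (geod y N t)) has_vector_derivative gf y \<bullet> N) (at 0)"
          by (rule has_vector_derivative_compose_derivative[where F'="\<lambda>h. gf y \<bullet> h"])
            (use \<open>(geod y N has_vector_derivative N) (at 0)\<close> C1g_deriv[OF gf(1) yD] g0 in simp_all)
        then have "((\<lambda>t. f (geod y N t)) has_real_derivative gf y \<bullet> N) (at 0)"
          by (simp add: has_real_derivative_iff_has_vector_derivative)
        then have "((\<lambda>t. \<sigma> * f (geod y N t)) has_real_derivative \<sigma> * (gf y \<bullet> N)) (at 0)"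
          by (rule DERIV_cmult)
        moreover have "\<sigma> * (gf y \<bullet> N) > 0"
        proof -
          have "\<sigma> * (gf y \<bullet> N) = \<beta> * ((\<sigma> *\<^sub>R gf x) \<bullet> N)" using gfy by simp
          also have "(\<sigma> *\<^sub>R gf x) \<bullet> N = norm (\<sigma> *\<^sub>R gf x)"
            unfolding N_def by (rule inner_sgn_self)
          finally show ?thesis using bpos gn by simp
        qed
        ultimately obtain d1 where d1: "d1 > 0" "\<And>h. 0 < h \<Longrightarrow> h < d1 \<Longrightarrow> \<sigma> * f (geod y N 0) < \<sigma> * f (geod y N (0 + h))"
          using DERIV_pos_inc_right by blast
        have fy: "f y = 0" by (rule f0[OF yD]) (use laty yb in simp)
        have "\<forall>\<^sub>F t in nhds 0. geod y N t \<in> D"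
          by (rule eventually_nhds_curve_open[OF gc oD]) (use g0 yD in simp)
        moreover have "\<forall>\<^sub>F t in nhds 0. \<beta> *\<^sub>R geod y N t + \<alpha> *\<^sub>R p \<in> ball x0 \<rho>"
        proof (rule eventually_nhds_curve_open[OF _ open_ball])
          show "isCont (\<lambda>t. \<beta> *\<^sub>R geod y N t + \<alpha> *\<^sub>R p) 0" by (intro continuous_intros gc)
          show "\<beta> *\<^sub>R geod y N 0 + \<alpha> *\<^sub>R p \<in> ball x0 \<rho>" using x xeq g0 by (simp add: add.commute)
        qed
        ultimately have "\<forall>\<^sub>F t in nhds 0. geod y N t \<in> D \<and> \<beta> *\<^sub>R geod y N t + \<alpha> *\<^sub>R p \<in> ball x0 \<rho>" by eventually_elim simp
        then obtain d2 where d2: "d2 > 0" "\<And>t. dist t 0 < d2 \<Longrightarrow> geod y N t \<in> D \<and> \<beta> *\<^sub>R geod y N t + \<alpha> *\<^sub>R p \<in> ball x0 \<rho>"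
          unfolding eventually_nhds_metric by blast
        have "geod y N t \<in> \<omega>" if t: "t \<in> {0<..<min d1 d2}" for t
        proof -
          have tD: "geod y N t \<in> D" and tb: "\<beta> *\<^sub>R geod y N t + \<alpha> *\<^sub>R p \<in> ball x0 \<rho>" using d2(2)[of t] t by auto
          have "\<sigma> * f (geod y N t) > 0" using d1(2)[of t] t fy g0 by simp
          then have "\<sigma> * f (\<beta> *\<^sub>R geod y N t + \<alpha> *\<^sub>R p) > 0" using aff[OF tD bpos] by simp
          then have q: "\<beta> *\<^sub>R geod y N t + \<alpha> *\<^sub>R p \<in> Q" using inn[OF tb] by simp
          then have qn: "\<beta> *\<^sub>R geod y N t + \<alpha> *\<^sub>R p \<noteq> 0" and "sgn (\<beta> *\<^sub>R geod y N t + \<alpha> *\<^sub>R p) \<in> C"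
            using Omega_facts(4) by (auto simp: hcone_def)
          then have "lat p (sgn (\<beta> *\<^sub>R geod y N t + \<alpha> *\<^sub>R p)) \<in> \<omega>" by (simp add: cone_over_iff[OF pole omega_sub])
          then have 1: "lat p (geod y N t) \<in> \<omega>" using lat_sgn[OF pole qn] lat_affine[OF pole bpos] by simp
          have "norm (geod y N t) = 1" by (rule norm_geod[OF ye(1) nN Ny])
          moreover have "geod y N t \<bullet> p = 0" using ye(2) Np by (simp add: geod_def inner_add_left)
          ultimately show ?thesis using 1 lat_id by metis
        qed
        then show "\<exists>\<epsilon>>0. \<forall>t\<in>{0<..<\<epsilon>}. geod y N t \<in> \<omega>" using d1(1) d2(1) by (intro exI[of _ "min d1 d2"]) auto
      qed
      have y2N: "y2 \<bullet> N \<ge> 0"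
      proof -
        obtain \<epsilon> where eps: "\<epsilon> > 0" "ball 0 \<epsilon> \<subseteq> S" using openE[OF oS S0] by blast
        have sub: "{-\<epsilon><..<\<epsilon>} \<subseteq> S" using eps(2) by (auto simp: subset_iff dist_norm)
        have ck: "Ck 2 yc {-\<epsilon><..<\<epsilon>}" by (rule C2_imp_Ck_2[OF _ C2_subset[OF C2y sub]]) simp
        have "\<forall>t\<in>{-\<epsilon><..<\<epsilon>}. yc t \<in> rbdry \<omega>" using sub latZ(1) by (auto simp: yc_def)
        then have "vector_derivative (\<lambda>s. vector_derivative yc (at s)) (at 0) \<bullet> N \<ge> 0"
          using omega_convex yb Ninw eps(1) yc0 ck unfolding sph_convex_def by blast
        then show ?thesis unfolding y1(3) .
      qed
      have y2gf: "y2 \<bullet> (\<sigma> *\<^sub>R gf x) \<ge> 0"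
      proof -
        have "\<sigma> *\<^sub>R gf x = norm (\<sigma> *\<^sub>R gf x) *\<^sub>R N" unfolding N_def by (rule norm_scaleR_sgn[symmetric])
        then have "y2 \<bullet> (\<sigma> *\<^sub>R gf x) = norm (\<sigma> *\<^sub>R gf x) * (y2 \<bullet> N)" by (metis inner_scaleR_right)
        then show ?thesis using y2N by (simp only: mult_nonneg_nonneg norm_ge_zero)
      qed
      \<comment> \<open>A curve in the cone over \<open>yc\<close> with velocity exactly
        \<open>v\<close> at \<open>x\<close>: height and radius change linearly at the rates
        \<open>v \<bullet> p\<close> and \<open>v \<bullet> y\<close>. Since
        \<open>lat p (X s)\<close> is \<open>yc s\<close>, it stays in the zero level of
        \<open>f\<close>.\<close>
      define X where "X = (\<lambda>s. (\<alpha> + s * (v \<bullet> p)) *\<^sub>R p + (\<beta> + s * (v \<bullet> y)) *\<^sub>R yc s)"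
      define X1 where "X1 = (\<lambda>s. (v \<bullet> p) *\<^sub>R p + ((v \<bullet> y) *\<^sub>R yc s + (\<beta> + s * (v \<bullet> y)) *\<^sub>R y1 s))"
      have lin: "((\<lambda>s. k0 + s * k1) has_real_derivative k1) (at s)" for k0 k1 s :: real
        by (auto intro!: derivative_eq_intros)
      have X1: "(X has_vector_derivative X1 s) (at s)" if "s \<in> S" for s
      proof -
        have "((\<lambda>s. (\<beta> + s * (v \<bullet> y)) *\<^sub>R yc s) has_vector_derivative ((\<beta> + s * (v \<bullet> y)) *\<^sub>R y1 s + (v \<bullet> y) *\<^sub>R yc s)) (at s)"
          by (rule has_vector_derivative_scaleR[OF lin y1(1)[OF that]])
        moreover have "((\<lambda>s. (\<alpha> + s * (v \<bullet> p)) *\<^sub>R p) has_vector_derivative ((\<alpha> + s * (v \<bullet> p)) *\<^sub>R 0 + (v \<bullet> p) *\<^sub>R p)) (at s)"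
          by (rule has_vector_derivative_scaleR[OF lin has_vector_derivative_const])
        ultimately have "(X has_vector_derivative (((\<alpha> + s * (v \<bullet> p)) *\<^sub>R 0 + (v \<bullet> p) *\<^sub>R p) + ((\<beta> + s * (v \<bullet> y)) *\<^sub>R y1 s + (v \<bullet> y) *\<^sub>R yc s))) (at s)"
          unfolding X_def by (intro has_vector_derivative_add)
        then show ?thesis by (simp add: X1_def add.commute)
      qed
      have X2: "(X1 has_vector_derivative (2 * (v \<bullet> y)) *\<^sub>R \<tau> + \<beta> *\<^sub>R y2) (at 0)"
      proof -
        have "((\<lambda>s. (\<beta> + s * (v \<bullet> y)) *\<^sub>R y1 s) has_vector_derivative ((\<beta> + 0 * (v \<bullet> y)) *\<^sub>R y2 + (v \<bullet> y) *\<^sub>R y1 0)) (at 0)"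
          by (rule has_vector_derivative_scaleR[OF lin y1(2)])
        moreover have "((\<lambda>s. (v \<bullet> y) *\<^sub>R yc s) has_vector_derivative (v \<bullet> y) *\<^sub>R y1 0) (at 0)"
          using bounded_linear.has_vector_derivative[OF bounded_linear_scaleR_right y1(1)[OF S0]] .
        ultimately have der: "(X1 has_vector_derivative (0 + ((v \<bullet> y) *\<^sub>R y1 0 + ((\<beta> + 0 * (v \<bullet> y)) *\<^sub>R y2 + (v \<bullet> y) *\<^sub>R y1 0)))) (at 0)"
          unfolding X1_def by (intro has_vector_derivative_add has_vector_derivative_const)
        have d: "(2 * k) *\<^sub>R w = k *\<^sub>R w + k *\<^sub>R w" for k and w :: 'a
          by (simp flip: scaleR_left_distrib)
        have eq: "0 + ((v \<bullet> y) *\<^sub>R y1 0 + ((\<beta> + 0 * (v \<bullet> y)) *\<^sub>R y2 + (v \<bullet> y) *\<^sub>R y1 0)) = (2 * (v \<bullet> y)) *\<^sub>R \<tau> + \<beta> *\<^sub>R y2"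
          unfolding y10 d by (simp only: mult_zero_left add_0_right add_0_left add_ac)
        show ?thesis by (rule back_subst[of "\<lambda>d. (X1 has_vector_derivative d) (at 0)", OF der eq])
      qed
      have X0: "X 0 = x" using yc0 xeq by (simp add: X_def)
      have X10: "X1 0 = v" using yc0 y10 bt by (simp add: X1_def)
      have Xc: "isCont X 0" using X1[OF S0] by (rule has_vector_derivative_continuous)
      have ev: "\<forall>\<^sub>F s in nhds 0. s \<in> S \<and> X s \<in> ball x0 \<rho> \<and> f (X s) = 0"
      proof -
        have "\<forall>\<^sub>F s in nhds 0. s \<in> S" by (rule eventually_nhds_in_open[OF oS S0])
        moreover have "\<forall>\<^sub>F s in nhds 0. X s \<in> ball x0 \<rho>"
          by (rule eventually_nhds_curve_open[OF Xc open_ball]) (use X0 x in simp)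
        moreover have "\<forall>\<^sub>F s in nhds 0. \<beta> + s * (v \<bullet> y) \<in> {0<..}"
          by (rule eventually_nhds_curve_open) (use bpos in \<open>auto intro!: continuous_intros\<close>)
        ultimately show ?thesis
        proof eventually_elim
          case (elim s)
          have yr: "yc s \<in> rbdry \<omega>" using latZ(1)[OF elim(1)] by (simp add: yc_def)
          have "lat p (X s) = yc s" unfolding X_def
            by (rule lat_combo[OF pole rbdry_equator[OF omega_sub yr]]) (use elim in simp)
          then have "f (X s) = 0" using yr subsetD[OF bD elim(2)] by (intro f0) auto
          then show ?case using elim by simp
        qed
      qed
      obtain T where T: "open T" "0 \<in> T" "\<And>s. s \<in> T \<Longrightarrow> s \<in> S \<and> X s \<in> ball x0 \<rho> \<and> f (X s) = 0"
        using ev unfolding eventually_nhds by blast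
      have tan: "gf (X s) \<bullet> X1 s = 0" if s: "s \<in> T" for s
      proof -
        have "((\<lambda>s. f (X s)) has_vector_derivative gf (X s) \<bullet> X1 s) (at s)"
          by (rule has_vector_derivative_compose_derivative[OF X1 C1g_deriv[OF gf(1)]]) (use T(3)[OF s] bD in auto)
        then have "((\<lambda>s. f (X s)) has_derivative (\<lambda>r. r *\<^sub>R (gf (X s) \<bullet> X1 s))) (at s)" by (simp add: has_vector_derivative_def)
        then have "1 *\<^sub>R (gf (X s) \<bullet> X1 s) = 0"
          by (rule has_derivative_zero_constant_local[OF _ T(1) s]) (use T(3) in blast)
        then show ?thesis by simp
      qed
      have evT: "\<forall>\<^sub>F s in nhds 0. s \<in> T" by (rule eventually_nhds_in_open[OF T(1,2)])
      have gfX: "((\<lambda>s. gf (X s)) has_vector_derivative Hf x v) (at 0)"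
        using has_vector_derivative_compose_derivative[OF X1[OF S0], of gf "blinfun_apply (Hf x)"] gf(2)[OF xD] X0 X10 by simp
      have gX: "((\<lambda>s. g (X s)) has_vector_derivative H x v) (at 0)"
        using has_vector_derivative_compose_derivative[OF X1[OF S0], of g "blinfun_apply (H x)"] g(2)[OF xW] X0 X10 by simp
      \<comment> \<open>Differentiates the tangency \<open>gf (X s) \<bullet> X1 s = 0\<close>. The
        part \<open>2 * (v \<bullet> y)\<close> of the acceleration along \<open>\<tau>\<close> is
        orthogonal to \<open>gf x\<close>, so only the curvature term with \<open>y2\<close> is
        left.\<close>
      have "gf (X 0) \<bullet> ((2 * (v \<bullet> y)) *\<^sub>R \<tau> + \<beta> *\<^sub>R y2) + Hf x v \<bullet> X1 0 = 0"
        by (rule curve_inner_zero_derivative[OF gfX X2]) (rule eventually_mono[OF evT tan])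
      then have e1: "Hf x v \<bullet> v = - \<beta> * (y2 \<bullet> gf x)"
        using X0 X10 tau(3) by (simp add: inner_add_right inner_commute)
      \<comment> \<open>Differentiates the Neumann condition along the same curve; as
        \<open>v\<close> is \<open>g x\<close>, the Hessian of \<open>f\<close> enters through
        \<open>Hf x v \<bullet> v\<close> only, which is already known.\<close>
      have "\<forall>\<^sub>F s in nhds 0. g (X s) \<bullet> gf (X s) = 0"
        using evT by (rule eventually_mono) (use neumann_g T(3) in blast)
      then have "g (X 0) \<bullet> Hf x v + H x v \<bullet> gf (X 0) = 0"
        by (rule curve_inner_zero_derivative[OF gX gfX])
      then have e2: "H x v \<bullet> gf x = \<beta> * (y2 \<bullet> gf x)" using X0 e1 by (simp add: v_def inner_commute)
      have "H x v \<bullet> (\<sigma> *\<^sub>R gf x) = \<beta> * (y2 \<bullet> (\<sigma> *\<^sub>R gf x))" using e2 by simp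
      then have "H x v \<bullet> (\<sigma> *\<^sub>R gf x) \<ge> 0"
        using mult_nonneg_nonneg[OF less_imp_le[OF bpos] y2gf] by (simp only:)
      then have "H x (g x) \<bullet> (\<sigma> *\<^sub>R gf x) \<ge> 0" unfolding v_def .
      moreover have "(\<sigma> *\<^sub>R gf x) \<bullet> gu x = 0" "(\<sigma> *\<^sub>R gf x) \<bullet> g x = 0"
        using neumann[OF x fx0'] vgf by (simp_all add: v_def inner_commute)
      ultimately show ?thesis using gx by blast
    qed
    have clE: "x \<in> E \<longleftrightarrow> \<sigma> * f x \<ge> 0" if "x \<in> ball x0 \<rho>" for x
      using cl[OF that] bW that unfolding E_eq by auto
    show ?thesis
    proof (rule disjI2, rule exI[of _ \<rho>], rule exI[of _ "\<lambda>x. \<sigma> * f x"], rule exI[of _ "\<lambda>x. \<sigma> *\<^sub>R gf x"],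
        rule exI[of _ e], rule exI[of _ \<kappa>], intro conjI ballI)
      show "\<rho> > 0" "ball x0 \<rho> \<subseteq> W" "norm e = 1" "\<kappa> > 0" by fact+
      show "C1g (\<lambda>x. \<sigma> * f x) (\<lambda>x. \<sigma> *\<^sub>R gf x) (ball x0 \<rho>)" by (rule f1)
      fix x assume x: "x \<in> ball x0 \<rho>"
      show "\<kappa> \<le> (\<sigma> *\<^sub>R gf x) \<bullet> e" by (rule slope[OF x])
      show "x \<in> E \<longleftrightarrow> \<sigma> * f x \<ge> 0" by (rule clE[OF x])
      show "\<sigma> * f x = 0 \<longrightarrow> (\<sigma> *\<^sub>R gf x) \<bullet> x = 0 \<and> (\<sigma> *\<^sub>R gf x) \<bullet> gu x = 0 \<and> (\<sigma> *\<^sub>R gf x) \<bullet> g x = 0 \<and> H x (g x) \<bullet> (\<sigma> *\<^sub>R gf x) \<ge> 0"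
        using key[OF x] by simp
    qed
  qed
qed

end

section \<open>Flux through the boundary of the domain\<close>

text \<open>Carries equations and weak inequalities from \<open>Q\<close> or \<open>\<Omega>\<close>
  to the closure.\<close>

lemma continuous_on_closure_closed:
  fixes T :: "'a::metric_space \<Rightarrow> 'b::metric_space"
  assumes W: "open W" "continuous_on W T" and S: "closed S" and Q: "\<And>x. x \<in> Q \<Longrightarrow> T x \<in> S"
    and x: "x \<in> W" "x \<in> closure Q"
  shows "T x \<in> S"
proof -
  obtain s where s: "\<And>n. s n \<in> Q" "s \<longlonglongrightarrow> x" using x(2) unfolding closure_sequential by blast
  have "isCont T x" using W x(1) by (simp add: continuous_on_eq_continuous_at)
  then have "(\<lambda>n. T (s n)) \<longlonglongrightarrow> T x" by (rule isCont_tendsto_compose[OF _ s(2)])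
  then show ?thesis by (rule closed_sequentially[OF S Q[OF s(1)]])
qed

text \<open>Supported in the interval from 1 to 8 and equal to 1 from 2 to 4. Evaluated at
  \<open>x \<bullet> x\<close> it confines the integrals over the infinite cone to an
  annulus.\<close>

definition cut :: "real \<Rightarrow> real" where "cut t = step t * (1 - step (t / 4))"
definition cut' :: "real \<Rightarrow> real" where "cut' t = step' t * (1 - step (t / 4)) - step t * (step' (t / 4) / 4)"

lemma cut_deriv: "(cut has_real_derivative cut' t) (at t)"
proof -
  have "((\<lambda>t. step (t / 4)) has_real_derivative step' (t / 4) * (1 / 4)) (at t)"
    by (rule DERIV_chain'[where f="\<lambda>t. t / 4" and g=step, OF _ step_deriv]) (auto intro!: derivative_eq_intros)
  from DERIV_mult[OF step_deriv DERIV_diff[OF DERIV_const[of 1] this]]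
  show ?thesis unfolding cut_def[abs_def] cut'_def by (simp add: algebra_simps)
qed

lemma continuous_on_step: "continuous_on S step"
  using step_deriv by (intro DERIV_continuous_on) (auto intro: has_field_derivative_at_within)

lemma continuous_on_cut': "continuous_on S cut'"
  unfolding cut'_def
  by (intro continuous_intros continuous_step' continuous_on_step
      continuous_on_compose2[of UNIV step, OF continuous_on_step] continuous_on_compose2[of UNIV step', OF continuous_step']) auto

lemma cut_nonneg: "cut t \<ge> 0"
  unfolding cut_def using step_bounds[of t] step_bounds[of "t / 4"] by simp

lemma cut_eq_0: "t \<le> 1 \<or> t \<ge> 8 \<Longrightarrow> cut t = 0" "t \<le> 1 \<or> t \<ge> 8 \<Longrightarrow> cut' t = 0"
  by (auto simp: cut_def cut'_def step_eq_0 step_eq_1 step'_eq_0)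

lemma cut_eq_1: "2 \<le> t \<Longrightarrow> t \<le> 4 \<Longrightarrow> cut t = 1"
  by (simp add: cut_def step_eq_0 step_eq_1)

lemma cut_le_1: "cut t \<le> 1"
  unfolding cut_def using step_bounds[of t] step_bounds[of "t / 4"] by (simp add: mult_le_one)

lemma C1g_cut: "C1g (\<lambda>x. cut (x \<bullet> x)) (\<lambda>x. cut' (x \<bullet> x) *\<^sub>R (2 *\<^sub>R x)) UNIV"
  using C1g_compose[OF C1g_dist_sq[of 0] cut_deriv continuous_on_cut'] by simp

context serrin
begin

text \<open>Differentiates \<open>gdiff\<close> in a direction orthogonal to \<open>x\<close>, in
  which the derivative of the norm vanishes.\<close>

lemma Hdiff:
  assumes x: "x \<in> W" and h: "h \<bullet> x = 0"
  shows "Hu x h = H x h - ((p \<bullet> h) / norm x ^ 3) *\<^sub>R x - ((x \<bullet> p) / norm x ^ 3) *\<^sub>R h"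
proof -
  have x0: "x \<noteq> 0" using x W0 by auto
  define i where "i = (\<lambda>y::'a. inverse (norm y))"
  define Di where "Di = (\<lambda>h. - (inverse (norm x) * (h \<bullet> sgn x) * inverse (norm x)))"
  have i: "(i has_derivative Di) (at x)"
    unfolding i_def Di_def by (rule Deriv.has_derivative_inverse[OF _ has_derivative_norm[OF x0]]) (use x0 in simp)
  note k = has_derivative_diff[OF has_derivative_scaleR_left[OF i, of p] has_derivative_scaleR[OF has_derivative_mult[OF
        has_derivative_inner_left[OF has_derivative_ident, of p] has_derivative_mult[OF i has_derivative_mult[OF i i]]] has_derivative_ident]]
  have eq: "g y + (i y *\<^sub>R p - ((y \<bullet> p) * (i y * (i y * i y))) *\<^sub>R y) = gu y" if "y \<in> W" for y
    unfolding gdiff[OF that] by (simp add: i_def power3_eq_cube divide_inverse mult.assoc)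
  have "(gu has_derivative (\<lambda>h. H x h + (Di h *\<^sub>R p - (((x \<bullet> p) * (i x * (i x * i x))) *\<^sub>R h
      + ((x \<bullet> p) * (i x * (i x * Di h + Di h * i x) + Di h * (i x * i x)) + (h \<bullet> p) * (i x * (i x * i x))) *\<^sub>R x)))) (at x)"
    by (rule has_derivative_transform_within_open[OF has_derivative_add[OF g(2)[OF x] k] W_open x eq])
  from has_derivative_unique[OF gu(2)[OF x] this]
  have "Hu x h = H x h + (Di h *\<^sub>R p - (((x \<bullet> p) * (i x * (i x * i x))) *\<^sub>R h
      + ((x \<bullet> p) * (i x * (i x * Di h + Di h * i x) + Di h * (i x * i x)) + (h \<bullet> p) * (i x * (i x * i x))) *\<^sub>R x))"
    by (rule fun_cong)
  moreover have Di0: "Di h = 0" using h by (simp add: Di_def sgn_div_norm)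
  moreover have i3: "i x * (i x * i x) = inverse (norm x ^ 3)" by (simp add: i_def power3_eq_cube)
  ultimately have "Hu x h = H x h + (0 *\<^sub>R p - (((x \<bullet> p) * inverse (norm x ^ 3)) *\<^sub>R h
      + ((x \<bullet> p) * (i x * (i x * 0 + 0 * i x) + 0 * (i x * i x)) + (h \<bullet> p) * inverse (norm x ^ 3)) *\<^sub>R x))"
    by (simp only:)
  then show ?thesis by (simp add: divide_inverse inner_commute[of p h] diff_diff_eq add.commute)
qed

text \<open>The identity \<open>\<Delta> cos r = - n cos r\<close> in ambient form: each of the
  \<open>n\<close> directions orthogonal to \<open>x\<close> contributes the same amount, and the
  radial entries vanish by Euler's relation.\<close>

lemma trace_diff:
  assumes x: "x \<in> W"
  shows "(\<Sum>i\<in>Basis. Hu x i \<bullet> i) = (\<Sum>i\<in>Basis. H x i \<bullet> i) - real (DIM('a) - 1) * ((x \<bullet> p) / norm x ^ 3)"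
proof -
  have x0: "x \<noteq> 0" using x W0 by auto
  obtain B where B: "sgn x \<in> B" "pairwise orthogonal B" "\<And>b. b \<in> B \<Longrightarrow> norm b = 1" "independent B" "card B = DIM('a)" "span B = UNIV"
    by (rule vector_in_orthonormal_basis[of "sgn x"]) (use x0 in \<open>auto simp: norm_sgn\<close>)
  have fB: "finite B" using B(4) by (rule independent_imp_finite)
  have s: "sgn x = inverse (norm x) *\<^sub>R x" by (simp add: sgn_div_norm)
  have 1: "Hu x (sgn x) \<bullet> sgn x = 0" "H x (sgn x) \<bullet> sgn x = 0"
    unfolding s blinfun.scaleR_right by (simp_all add: Hu_euler[OF x] H_euler[OF x] gu_euler[OF x] g_euler[OF x])
  have 2: "Hu x b \<bullet> b = H x b \<bullet> b - (x \<bullet> p) / norm x ^ 3" if b: "b \<in> B - {sgn x}" for b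
  proof -
    have "orthogonal b (sgn x)" using B(1,2) b by (auto simp: pairwise_def)
    then have "b \<bullet> x = 0" using x0 by (simp add: orthogonal_def s)
    moreover have "b \<bullet> b = 1" using B(3) b by (simp add: norm_eq_1)
    ultimately show ?thesis using Hdiff[OF x, of b] by (simp add: inner_diff_left inner_commute[of x b])
  qed
  have "(\<Sum>b\<in>B. Hu x b \<bullet> b) = (\<Sum>b\<in>B - {sgn x}. Hu x b \<bullet> b)"
    using 1 by (subst sum.remove[OF fB B(1)]) simp
  also have "\<dots> = (\<Sum>b\<in>B - {sgn x}. H x b \<bullet> b) - real (card (B - {sgn x})) * ((x \<bullet> p) / norm x ^ 3)"
    by (simp add: 2 sum_subtractf)
  also have "(\<Sum>b\<in>B - {sgn x}. H x b \<bullet> b) = (\<Sum>b\<in>B. H x b \<bullet> b)"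
    using 1 by (subst sum.remove[OF fB B(1), of "\<lambda>b. H x b \<bullet> b"]) simp
  also have "card (B - {sgn x}) = DIM('a) - 1" using B(1,5) fB by simp
  finally show ?thesis by (simp only: trace_orthonormal[OF fB B(2,3,6)])
qed

lemma H_scale:
  assumes x: "x \<in> W" and s: "s > 0"
  shows "H (s *\<^sub>R x) h = H x h /\<^sub>R s\<^sup>2"
proof -
  have "((\<lambda>y. s *\<^sub>R g (s *\<^sub>R y)) has_derivative (\<lambda>h. s *\<^sub>R H (s *\<^sub>R x) (s *\<^sub>R h))) (at x)"
    by (intro has_derivative_scaleR_right has_derivative_compose[where f="\<lambda>y. s *\<^sub>R y" and g=g, OF _ g(2)[OF W_scale[OF x s]]])
      (auto intro!: derivative_eq_intros)
  then have "(g has_derivative (\<lambda>h. s *\<^sub>R H (s *\<^sub>R x) (s *\<^sub>R h))) (at x)"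
    by (rule has_derivative_transform_within_open[OF _ W_open x]) (use s g_scale in simp)
  from fun_cong[OF has_derivative_unique[OF g(2)[OF x] this], of h]
  have "H x h = s\<^sup>2 *\<^sub>R H (s *\<^sub>R x) h" by (simp add: blinfun.scaleR_right power2_eq_square)
  then show ?thesis using s by simp
qed

text \<open>The right-hand side of the equation is the Laplacian of \<open>cos r\<close>, so it
  cancels in \<open>w\<close>; the Hessian has degree -2, which carries the result from the sphere
  to all rays.\<close>

lemma trace_H_Q:
  assumes x: "x \<in> Q"
  shows "(\<Sum>i\<in>Basis. H x i \<bullet> i) = 0"
proof -
  define z where "z = sgn x"
  have xW: "x \<in> W" using x Q_sub_E E_sub_W by auto
  then have x0: "x \<noteq> 0" using W0 by auto
  have z: "z \<in> \<Omega>" "norm z = 1" using x x0 by (auto simp: hcone_def z_def norm_sgn)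
  have zW: "z \<in> W" using z hcone_sphere[OF z(2), of \<Omega>] Q_sub_E E_sub_W by blast
  have "\<bar>p \<bullet> z\<bar> \<le> 1" using Cauchy_Schwarz_ineq2[of p z] pole z(2) by simp
  then have cz: "cos (gdist p z) = z \<bullet> p" unfolding gdist_def by (simp add: cos_arccos_abs inner_commute)
  have "laplace_beltrami u z = (\<Sum>i\<in>Basis. Hu z i \<bullet> i)"
    by (rule laplace_beltrami_eq_trace[OF W_open W_scale hom_u gu(1,2) Hu_euler[OF zW] _ zW z(2)]) (simp_all add: sgn_div_norm)
  then have "(\<Sum>i\<in>Basis. H z i \<bullet> i) = 0"
    using pde z trace_diff[OF zW] cz by (simp add: left_diff_distrib)
  moreover have "H z i \<bullet> i = (norm x)\<^sup>2 * (H x i \<bullet> i)" for i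
    using H_scale[OF xW, of "inverse (norm x)" i] x0 by (simp add: z_def sgn_div_norm power_inverse)
  ultimately have "(norm x)\<^sup>2 * (\<Sum>i\<in>Basis. H x i \<bullet> i) = 0" by (simp add: sum_distrib_left)
  then show ?thesis using x0 by simp
qed

lemma trace_H_E:
  assumes x: "x \<in> E"
  shows "(\<Sum>i\<in>Basis. H x i \<bullet> i) = 0"
proof -
  have "(\<Sum>i\<in>Basis. H x i \<bullet> i) \<in> {0}"
  proof (rule continuous_on_closure_closed[OF W_open, where Q=Q])
    show "continuous_on W (\<lambda>x. \<Sum>i\<in>Basis. H x i \<bullet> i)" by (intro continuous_intros g(3))
    show "x \<in> W" "x \<in> closure Q" using x unfolding E_eq by blast+
    show "(\<Sum>i\<in>Basis. H y i \<bullet> i) \<in> {0}" if "y \<in> Q" for y using trace_H_Q[OF that] by blast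
  qed (rule closed_singleton)
  then show ?thesis by simp
qed

sublocale hp: harmonic_pair E W "closure Q" "\<lambda>x. u (sgn x)" gu g Hu H p "c\<^sup>2"
  by unfold_locales (rule W_open W0 closed_closure E_eq gu g gu_euler g_euler H_euler gdiff Hdiff trace_H_E; assumption?)+

text \<open>The sign is chosen so that the divergence is positive on \<open>E\<close>. By the
  Neumann condition this field has no lateral flux at all.\<close>

lemma weak_divergence_gu: "weak_divergence E W (closure Q) (\<lambda>x. - gu x) (\<lambda>x. - (\<Sum>i\<in>Basis. Hu x i \<bullet> i))"
proof
  show "continuous_on W (\<lambda>x. - gu x)" by (intro continuous_intros hp.cont_gu)
  show "continuous_on W (\<lambda>x. - (\<Sum>i\<in>Basis. Hu x i \<bullet> i))" by (intro continuous_intros gu(3))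
  fix \<psi> :: "'a \<Rightarrow> real" and g' K assume t: "test_fun \<psi> g' K" and K: "K \<subseteq> interior E"
  have KW: "K \<subseteq> W" using K interior_subset[of E] E_sub_W by auto
  have "(\<integral>x. \<psi> x * - (\<Sum>i\<in>Basis. Hu x i \<bullet> i) + g' x \<bullet> - gu x \<partial>lborel)
      = (\<integral>x. - (g' x \<bullet> gu x + \<psi> x * (\<Sum>i\<in>Basis. Hu x i \<bullet> i)) \<partial>lborel)"
    by (rule Bochner_Integration.integral_cong) simp_all
  also have "\<dots> = - (\<integral>x. g' x \<bullet> gu x + \<psi> x * (\<Sum>i\<in>Basis. Hu x i \<bullet> i) \<partial>lborel)"
    by (rule Bochner_Integration.integral_minus)
  also have "\<dots> = 0" using integral_divergence[OF t KW W_open gu(2,3)] by (simp only: neg_equal_0_iff_equal)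
  finally show "(\<integral>x. \<psi> x * - (\<Sum>i\<in>Basis. Hu x i \<bullet> i) + g' x \<bullet> - gu x \<partial>lborel) = 0" .
qed (rule W_open closed_closure E_eq)+

text \<open>In \<open>flux\<close> the vector \<open>v\<close> stands for the inward gradient of a
  local defining function, and the premises list what \<open>boundary_function\<close> knows about
  it. Thus only the sign of \<open>v \<bullet> Y\<close> depends on the field. Interior points,
  exterior points and lateral boundary points are all harmless; what is left lies over the
  vertex.\<close>

lemma flux_inequality:
  assumes wd: "weak_divergence E W (closure Q) Y G"
    and flux: "\<And>x v. x \<in> E \<Longrightarrow> v \<bullet> x = 0 \<Longrightarrow> v \<bullet> gu x = 0 \<Longrightarrow> v \<bullet> g x = 0 \<Longrightarrow> H x (g x) \<bullet> v \<ge> 0 \<Longrightarrow> v \<bullet> Y x \<ge> 0"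
    and t: "test_fun \<psi> g' K" "K \<subseteq> W" "\<And>x. \<psi> x \<ge> 0"
    and off: "\<And>x. x \<in> K \<Longrightarrow> x \<in> E \<Longrightarrow> sgn x \<notin> closure \<Gamma>0"
  shows "(\<integral>x. indicator E x * (\<psi> x * G x + g' x \<bullet> Y x) \<partial>lborel) \<le> 0"
proof -
  interpret wd: weak_divergence E W "closure Q" Y G by (rule wd)
  \<comment> \<open>Two unit vectors orthogonal to \<open>p\<close> exist because the ambient
    dimension is at least 3. Their common kernel has codimension 2 and contains the ray over the
    vertex.\<close>
  obtain B where B: "p \<in> B" "pairwise orthogonal B" "\<And>b. b \<in> B \<Longrightarrow> norm b = 1" "independent B" "card B = DIM('a)" "span B = UNIV"
    by (rule vector_in_orthonormal_basis[OF pole]) (rule that)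
  have fB: "finite B" using B(4) by (rule independent_imp_finite)
  have "card (B - {p}) \<ge> 2" using B(1,5) fB dim by simp
  then obtain e1 where e1: "e1 \<in> B - {p}" by (metis all_not_in_conv card.empty not_numeral_le_zero)
  have "card (B - {p} - {e1}) \<ge> 1" using B(1,5) fB dim e1 by simp
  then obtain e2 where e2: "e2 \<in> B - {p} - {e1}" by (metis all_not_in_conv card.empty not_one_le_zero)
  have orth: "e1 \<bullet> e2 = 0" "p \<bullet> e1 = 0" "p \<bullet> e2 = 0"
    using B(1,2) e1 e2 by (auto simp: pairwise_def orthogonal_def)
  have "wd.J \<psi> g' \<le> 0"
  proof (rule wd.J_le_0_off_codim2[OF t _ _ orth(1)])
    show "norm e1 = 1" "norm e2 = 1" using B(3) e1 e2 by auto
    fix x assume x: "x \<in> K" "x \<bullet> e1 \<noteq> 0 \<or> x \<bullet> e2 \<noteq> 0"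
    have xW: "x \<in> W" using x(1) t(2) by auto
    then have x0: "x \<noteq> 0" using W0 by auto
    show "wd.locally_ok x"
    proof (cases "x \<in> E")
      case False then show ?thesis using xW by (intro wd.locally_ok_exterior)
    next
      case xE: True
      show ?thesis
      proof (cases "sgn x \<in> \<Omega>")
        case True
        then have "x \<in> interior E" using x0 Q_sub_int by (auto simp: hcone_def)
        then show ?thesis by (rule wd.locally_ok_interior)
      next
        case False
        then have b: "sgn x \<in> rbdry \<Omega>" using xE by (auto simp: rbdry_def hcone_def)
        have np: "sgn x \<noteq> p"
        proof
          assume "sgn x = p"
          then have "x \<bullet> e1 = norm x * (p \<bullet> e1)" "x \<bullet> e2 = norm x * (p \<bullet> e2)"
            using norm_scaleR_sgn[of x] by (metis inner_scaleR_left)+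
          then show False using x(2) orth by simp
        qed
        consider "x \<in> interior E" | r f gf e \<kappa> where "r > 0" "ball x r \<subseteq> W" "C1g f gf (ball x r)" "norm e = 1" "\<kappa> > 0"
          "\<forall>y\<in>ball x r. gf y \<bullet> e \<ge> \<kappa> \<and> (y \<in> E \<longleftrightarrow> f y \<ge> 0) \<and>
            (f y = 0 \<longrightarrow> gf y \<bullet> y = 0 \<and> gf y \<bullet> gu y = 0 \<and> gf y \<bullet> g y = 0 \<and> H y (g y) \<bullet> gf y \<ge> 0)"
          using boundary_function[OF x0 b off[OF x(1) xE] np] by blast
        then show ?thesis
        proof cases
          case 1 then show ?thesis by (rule wd.locally_ok_interior)
        next
          case (2 r f gf e \<kappa>)
          show ?thesis
          proof (rule wd.locally_ok_boundary[OF 2(1,2,3,4,5)])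
            fix y assume y: "y \<in> ball x r"
            show "gf y \<bullet> e \<ge> \<kappa>" "y \<in> E \<longleftrightarrow> f y \<ge> 0" using 2(6) y by auto
            assume "f y = 0"
            then show "gf y \<bullet> Y y \<ge> 0" using 2(6) y subsetD[OF 2(2) y] by (intro flux) auto
          qed
        qed
      qed
    qed
  qed
  then show ?thesis unfolding wd.J_def .
qed

lemma compact_annulus: "compact {x \<in> closure Q. x \<bullet> x \<in> {1..8}}" "{x \<in> closure Q. x \<bullet> x \<in> {1..8}} \<subseteq> E"
proof -
  have "norm x \<le> 3" if "x \<bullet> x \<le> 8" for x :: 'a
  proof (rule power2_le_imp_le)
    show "(norm x)\<^sup>2 \<le> 3\<^sup>2" using that by (simp add: power2_norm_eq_inner)
  qed simp
  then have eq: "{x \<in> closure Q. x \<bullet> x \<in> {1..8}} = {x \<in> cball 0 3. x \<bullet> x \<in> {1..8}} \<inter> closure Q"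
    unfolding mem_cball_0 atLeastAtMost_iff by blast
  show "compact {x \<in> closure Q. x \<bullet> x \<in> {1..8}}"
    unfolding eq
    by (intro compact_Int_closed compact_restrict_closed compact_cball continuous_intros closed_atLeastAtMost closed_closure)
  show "{x \<in> closure Q. x \<bullet> x \<in> {1..8}} \<subseteq> E"
  proof
    fix x assume x: "x \<in> {x \<in> closure Q. x \<bullet> x \<in> {1..8}}"
    then have "x \<noteq> 0" by auto
    then show "x \<in> E" using x closure_Q[of x] by blast
  qed
qed

text \<open>Brings \<open>flux_inequality\<close> into the form used later. \<open>\<Phi>\<close>
  need not have compact support and is switched off near \<open>\<Gamma>0\<close> by the condition
  on \<open>\<tau>\<close>; the derivative of the radial cut-off does not appear since it is
  parallel to \<open>x\<close>.\<close>

lemma radial_flux_inequality: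
  assumes wd: "weak_divergence E W (closure Q) Y G" and Yx: "\<And>x. x \<in> W \<Longrightarrow> Y x \<bullet> x = 0"
    and flux: "\<And>x v. x \<in> E \<Longrightarrow> v \<bullet> x = 0 \<Longrightarrow> v \<bullet> gu x = 0 \<Longrightarrow> v \<bullet> g x = 0 \<Longrightarrow> H x (g x) \<bullet> v \<ge> 0 \<Longrightarrow> v \<bullet> Y x \<ge> 0"
    and \<Phi>: "C1g \<Phi> g\<Phi> W" "\<And>x. x \<in> W \<Longrightarrow> \<Phi> x \<ge> 0"
    and \<tau>: "continuous_on W \<tau>" "closed (A :: real set)" "\<And>x. x \<in> W \<Longrightarrow> \<tau> x \<notin> A \<Longrightarrow> \<Phi> x = 0"
    and off: "\<And>x. x \<in> E \<Longrightarrow> \<tau> x \<in> A \<Longrightarrow> sgn x \<notin> closure \<Gamma>0"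
  shows "(\<integral>x. indicator E x * (cut (x \<bullet> x) * (\<Phi> x * G x + g\<Phi> x \<bullet> Y x)) \<partial>lborel) \<le> 0"
proof -
  define K0 where "K0 = {x \<in> closure Q. x \<bullet> x \<in> {1..8}}"
  have K0: "compact K0" "K0 \<subseteq> E" using compact_annulus by (simp_all only: K0_def)
  have "\<exists>r. \<forall>x\<in>K0. r x > 0 \<and> cball x (r x) \<subseteq> W"
  proof (rule bchoice, rule ballI)
    fix x assume "x \<in> K0"
    then have "x \<in> W" by (rule subsetD[OF E_sub_W, OF subsetD[OF K0(2)]])
    then show "\<exists>r>0. cball x r \<subseteq> W" by (rule open_contains_cball[THEN iffD1, OF W_open, rule_format])
  qed
  then obtain r where rr: "\<forall>x\<in>K0. r x > 0 \<and> cball x (r x) \<subseteq> W" by (rule exE)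
  have r: "r x > 0" "cball x (r x) \<subseteq> W" if "x \<in> K0" for x using bspec[OF rr that] by (rule conjunct1, rule conjunct2)
  obtain F cf gc where F: "finite F" "F \<subseteq> K0" "\<And>i. i \<in> F \<Longrightarrow> test_fun (cf i) (gc i) (cball i (r i))"
    "\<And>i x. (cf i :: 'a \<Rightarrow> real) x \<ge> 0" "\<And>x. x \<in> K0 \<Longrightarrow> (\<Sum>i\<in>F. cf i x) = 1" "\<And>x. x \<in> K0 \<Longrightarrow> (\<Sum>i\<in>F. gc i x) = 0"
    by (rule C1_partition_of_unity[where r=r, OF K0(1) r(1)]) (assumption, rule that, assumption+)
  define K1 where "K1 = (\<Union>i\<in>F. cball i (r i))"
  have K1: "compact K1" "K1 \<subseteq> W"
    unfolding K1_def by (intro compact_UN F(1) compact_cball) (intro UN_least r(2) subsetD[OF F(2)])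
  \<comment> \<open>Identically 1 with zero gradient on the annulus part \<open>K0\<close> of the
    closed cone and compactly supported in \<open>W\<close>. It makes the integrand a test function
    in the ambient space without changing it on \<open>E\<close>.\<close>
  define b where "b = (\<lambda>x. \<Sum>i\<in>F. cf i x)"
  define gb where "gb = (\<lambda>x. \<Sum>i\<in>F. gc i x)"
  have tb: "test_fun b gb K1"
  proof (rule test_funI[OF _ K1(1)])
    show "C1g b gb UNIV" unfolding b_def gb_def by (intro C1g_sum test_funD(1)[OF F(3)])
    fix x assume x: "x \<notin> K1"
    show "b x = 0" unfolding b_def
    proof (intro sum.neutral ballI)
      fix i assume i: "i \<in> F"
      then have "x \<notin> cball i (r i)" using x unfolding K1_def by blast
      then show "cf i x = 0" by (rule test_funD(3)[OF F(3)[OF i]])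
    qed
  qed
  define \<psi> where "\<psi> = (\<lambda>x. b x * (cut (x \<bullet> x) * \<Phi> x))"
  define g\<psi> where "g\<psi> = (\<lambda>x. b x *\<^sub>R (cut (x \<bullet> x) *\<^sub>R g\<Phi> x + \<Phi> x *\<^sub>R (cut' (x \<bullet> x) *\<^sub>R (2 *\<^sub>R x))) + (cut (x \<bullet> x) * \<Phi> x) *\<^sub>R gb x)"
  have t1: "test_fun \<psi> g\<psi> K1" unfolding \<psi>_def g\<psi>_def
    by (rule test_fun_mult[OF tb K1(2) W_open C1g_mult[OF C1g_subset[OF C1g_cut subset_UNIV] \<Phi>(1)]])
  define K where "K = {x \<in> K1. \<tau> x \<in> A}"
  have t2: "test_fun \<psi> g\<psi> K"
  proof (rule test_funI[OF test_funD(1)[OF t1]])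
    show "compact K" unfolding K_def by (rule compact_restrict_closed[OF K1(1) continuous_on_subset[OF \<tau>(1) K1(2)] \<tau>(2)])
    fix x assume "x \<notin> K"
    then show "\<psi> x = 0" using test_funD(3)[OF t1, of x] \<tau>(3)[of x] K1(2) by (cases "x \<in> K1") (auto simp: K_def \<psi>_def)
  qed
  have nn: "\<psi> x \<ge> 0" for x
  proof (cases "x \<in> K1")
    case True
    then show ?thesis unfolding \<psi>_def b_def
      by (intro mult_nonneg_nonneg sum_nonneg cut_nonneg F(4) \<Phi>(2) subsetD[OF K1(2)])
  qed (use test_funD(3)[OF t1] in simp)
  have le: "(\<integral>x. indicator E x * (\<psi> x * G x + g\<psi> x \<bullet> Y x) \<partial>lborel) \<le> 0"
    by (rule flux_inequality[OF wd flux t2 _ nn]) (use K1(2) off in \<open>auto simp: K_def\<close>)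
  have eq: "indicator E x * (\<psi> x * G x + g\<psi> x \<bullet> Y x) = indicator E x * (cut (x \<bullet> x) * (\<Phi> x * G x + g\<Phi> x \<bullet> Y x))" for x
  proof (cases "x \<in> E")
    case True
    then have xW: "x \<in> W" and xc: "x \<in> closure Q" using E_eq by auto
    show ?thesis
    proof (cases "x \<in> K0")
      case True
      then have "b x = 1" "gb x = 0" using F(5,6) by (auto simp: b_def gb_def)
      then show ?thesis using Yx[OF xW] inner_commute[of x "Y x"] by (simp add: \<psi>_def g\<psi>_def inner_add_left distrib_left mult.assoc)
    next
      case False
      then have "x \<bullet> x \<le> 1 \<or> x \<bullet> x \<ge> 8" using xc by (auto simp: K0_def)
      then show ?thesis by (simp add: \<psi>_def g\<psi>_def cut_eq_0)
    qed
  qed simp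
  have "(\<integral>x. indicator E x * (cut (x \<bullet> x) * (\<Phi> x * G x + g\<Phi> x \<bullet> Y x)) \<partial>lborel)
      = (\<integral>x. indicator E x * (\<psi> x * G x + g\<psi> x \<bullet> Y x) \<partial>lborel)"
    by (rule Bochner_Integration.integral_cong[OF refl eq[symmetric]])
  also note le
  finally show ?thesis .
qed

end

section \<open>Positivity and the gradient on the free boundary\<close>

lemma line_derivative:
  assumes f: "C1g f gf S" and x: "x + t *\<^sub>R e \<in> S"
  shows "((\<lambda>t. f (x + t *\<^sub>R e)) has_real_derivative gf (x + t *\<^sub>R e) \<bullet> e) (at t)"
proof -
  have "((\<lambda>t. f (x + t *\<^sub>R e)) has_derivative (\<lambda>h. gf (x + t *\<^sub>R e) \<bullet> (h *\<^sub>R e))) (at t)"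
    by (rule has_derivative_compose[where f="\<lambda>t. x + t *\<^sub>R e" and g=f, OF _ C1g_deriv[OF f x]])
      (auto intro!: derivative_eq_intros)
  then show ?thesis by (rule has_derivative_imp_has_field_derivative) simp
qed

text \<open>A negative diagonal entry would make the function strictly decrease from
  \<open>x\<close> along that coordinate axis.\<close>

lemma local_minimum_trace_nonneg:
  fixes f :: "'a::euclidean_space \<Rightarrow> real"
  assumes f: "C1g f gf S" and H: "\<And>x. x \<in> S \<Longrightarrow> (gf has_derivative blinfun_apply (H x)) (at x)" "continuous_on S H"
    and x: "r > 0" "ball x r \<subseteq> S" and min: "\<And>y. y \<in> ball x r \<Longrightarrow> f x \<le> f y"
  shows "(\<Sum>i\<in>Basis. H x i \<bullet> i) \<ge> 0"
proof (rule sum_nonneg, rule ccontr)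
  fix i :: 'a assume i: "i \<in> Basis" and neg: "\<not> H x i \<bullet> i \<ge> 0"
  have b: "x + t *\<^sub>R i \<in> ball x r" if "\<bar>t\<bar> < r" for t using that i by (simp add: dist_norm)
  have bS: "x + t *\<^sub>R i \<in> S" if "\<bar>t\<bar> < r" for t using b[OF that] x(2) by blast
  define \<phi> where "\<phi> = (\<lambda>t. f (x + t *\<^sub>R i))"
  define \<phi>' where "\<phi>' = (\<lambda>t. gf (x + t *\<^sub>R i) \<bullet> i)"
  have d1: "(\<phi> has_real_derivative \<phi>' t) (at t)" if "\<bar>t\<bar> < r" for t
    unfolding \<phi>_def \<phi>'_def by (rule line_derivative[OF f bS[OF that]])
  have d2: "(\<phi>' has_real_derivative H x i \<bullet> i) (at 0)"
    using line_derivative[OF inner_field_C1g[OF H], of x 0 i i] bS[of 0] x(1) adjv_inner[of "H x" i i]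
    by (simp add: \<phi>'_def adjv_def)
  have "\<phi>' 0 = 0"
  proof (rule DERIV_local_min[OF d1 x(1)])
    show "\<forall>y. \<bar>0 - y\<bar> < r \<longrightarrow> \<phi> 0 \<le> \<phi> y" using min[OF b] by (simp add: \<phi>_def)
  qed (use x(1) in simp)
  moreover obtain d where d: "d > 0" "\<forall>h>0. h < d \<longrightarrow> \<phi>' 0 > \<phi>' (0 + h)"
    using DERIV_neg_dec_right[OF d2] neg by force
  ultimately have lt: "\<phi>' h < 0" if "0 < h" "h < d" for h using d(2) that by force
  define s where "s = min d r / 2"
  have s: "0 < s" "s < d" "s < r" using d(1) x(1) by (auto simp: s_def)
  have "\<phi> s < \<phi> 0"
  proof (rule DERIV_neg_imp_decreasing_open[OF s(1)])
    show "\<exists>y. (\<phi> has_real_derivative y) (at t) \<and> y < 0" if "0 < t" "t < s" for t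
      by (rule exI[of _ "\<phi>' t"], rule conjI[OF d1 lt]) (use that s in auto)
    have "isCont \<phi> t" if "t \<in> {0..s}" for t
      by (rule DERIV_isCont[OF d1]) (use that s in auto)
    then show "continuous_on {0..s} \<phi>" by (intro continuous_at_imp_continuous_on ballI)
  qed
  moreover have "\<phi> 0 \<le> \<phi> s" using min[OF b, of s] s by (simp add: \<phi>_def)
  ultimately show False by simp
qed

context serrin
begin

lemma annulus_integrable:
  assumes f: "continuous_on W f"
  shows "integrable lborel (\<lambda>x. indicator E x * (cut (x \<bullet> x) * f x))"
proof -
  define K where "K = {x \<in> closure Q. x \<bullet> x \<in> {1..8}}"
  have K: "compact K" "K \<subseteq> E" using compact_annulus by (simp_all only: K_def)
  define h where "h = (\<lambda>x. indicator E x * (cut (x \<bullet> x) * f x))"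
  have hK: "h x = indicator K x *\<^sub>R (cut (x \<bullet> x) * f x)" for x
  proof (cases "x \<in> K")
    case True
    then have "x \<in> E" using K(2) by blast
    then show ?thesis using True by (simp add: h_def)
  next
    case False
    then have "x \<notin> E \<or> x \<bullet> x \<le> 1 \<or> x \<bullet> x \<ge> 8" unfolding E_eq K_def by auto
    then show ?thesis using False by (auto simp: h_def cut_eq_0)
  qed
  have "integrable lborel (\<lambda>x. indicator K x *\<^sub>R (cut (x \<bullet> x) * f x))"
  proof (rule borel_integrable_compact[OF K(1)])
    have "continuous_on K f" by (rule continuous_on_subset[OF f order_trans[OF K(2) E_sub_W]])
    then show "continuous_on K (\<lambda>x. cut (x \<bullet> x) * f x)"
      by (intro continuous_on_mult continuous_on_subset[OF C1g_cont[OF C1g_cut] subset_UNIV])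
  qed
  then show ?thesis by (simp only: hK[symmetric] h_def)
qed

text \<open>A nonnegative integrand with nonpositive integral vanishes almost everywhere, and by
  continuity everywhere in the open part of \<open>Q\<close> where the cut-off is 1.\<close>

lemma annulus_integral_vanish:
  assumes f: "continuous_on W f" "\<And>x. x \<in> E \<Longrightarrow> f x \<ge> 0"
    and le: "(\<integral>x. indicator E x * (cut (x \<bullet> x) * f x) \<partial>lborel) \<le> 0"
    and x0: "x0 \<in> Q" "2 < x0 \<bullet> x0" "x0 \<bullet> x0 < 4"
  shows "f x0 = 0"
proof (rule ccontr)
  assume ne: "f x0 \<noteq> 0"
  define h where "h = (\<lambda>x. indicator E x * (cut (x \<bullet> x) * f x))"
  have int: "integrable lborel h" unfolding h_def by (rule annulus_integrable[OF f(1)])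
  have nn: "h x \<ge> 0" for x
  proof (cases "x \<in> E")
    case True
    then show ?thesis using mult_nonneg_nonneg[OF cut_nonneg f(2)[OF True]] by (simp add: h_def)
  qed (simp add: h_def)
  have "integral\<^sup>L lborel h = 0"
    using le Bochner_Integration.integral_nonneg[of lborel h] nn unfolding h_def by (intro antisym) auto
  then have ae: "AE x in lborel. h x = 0"
    using integral_nonneg_eq_0_iff_AE[OF int] nn by simp
  have xE: "x0 \<in> E" and xW: "x0 \<in> W" using x0(1) Q_sub_E E_sub_W by blast+
  define S0 where "S0 = {x \<in> Q. 2 < x \<bullet> x \<and> x \<bullet> x < 4 \<and> f x \<noteq> 0}"
  have QW: "Q \<subseteq> W" by (rule order_trans[OF Q_sub_E E_sub_W])
  have "open (Q \<inter> (\<lambda>x. (x \<bullet> x, f x)) -` ({2<..<4} \<times> (- {0})))"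
    by (intro continuous_open_preimage Q_open open_Times continuous_intros continuous_on_subset[OF f(1) QW])
  moreover have "Q \<inter> (\<lambda>x. (x \<bullet> x, f x)) -` ({2<..<4} \<times> (- {0})) = S0" by (auto simp: S0_def)
  ultimately have "open S0" by simp
  moreover have "x0 \<in> S0" using x0 ne by (simp add: S0_def)
  ultimately obtain r where r: "r > 0" "ball x0 r \<subseteq> S0" unfolding open_contains_ball by blast
  have "AE x in lborel. x \<notin> ball x0 r"
    using ae
  proof (rule AE_mp, intro AE_I2 impI notI)
    fix x assume h0: "h x = 0" and "x \<in> ball x0 r"
    then have "x \<in> S0" using r(2) by blast
    then have "x \<in> E" "cut (x \<bullet> x) = 1" "f x \<noteq> 0" using Q_sub_E by (auto simp: S0_def cut_eq_1)
    then show False using h0 by (simp add: h_def)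
  qed
  then have "ball x0 r \<in> null_sets lborel" using AE_iff_null_sets[of "ball x0 r" lborel] by simp
  then have "measure lborel (ball x0 r) = 0" by (rule measure_eq_0_null_sets)
  then show False using content_ball_pos[OF r(1), of x0] by simp
qed

lemma annulus_scale:
  assumes x: "x \<in> Q"
  obtains s where "s > 0" "s *\<^sub>R x \<in> Q" "2 < (s *\<^sub>R x) \<bullet> (s *\<^sub>R x)" "(s *\<^sub>R x) \<bullet> (s *\<^sub>R x) < 4"
proof (rule that)
  have x0: "x \<noteq> 0" using x by (auto simp: hcone_def)
  \<comment> \<open>The squared norm becomes 3, in the middle of the range from 2 to 4 where the
    cut-off is 1.\<close>
  show s: "sqrt 3 / norm x > 0" using x0 by simp
  show "(sqrt 3 / norm x) *\<^sub>R x \<in> Q" using hcone_scale[OF s] x by blast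
  have "norm ((sqrt 3 / norm x) *\<^sub>R x) = sqrt 3" using x0 by simp
  then have "((sqrt 3 / norm x) *\<^sub>R x) \<bullet> ((sqrt 3 / norm x) *\<^sub>R x) = 3"
    unfolding power2_norm_eq_inner[symmetric] by simp
  then show "2 < ((sqrt 3 / norm x) *\<^sub>R x) \<bullet> ((sqrt 3 / norm x) *\<^sub>R x)" "((sqrt 3 / norm x) *\<^sub>R x) \<bullet> ((sqrt 3 / norm x) *\<^sub>R x) < 4"
    by simp_all
qed

lemma Gamma0_sub: "\<Gamma>0 \<subseteq> rbdry \<Omega>" "closure \<Gamma>0 \<subseteq> closure \<Omega>"
proof -
  show 1: "\<Gamma>0 \<subseteq> rbdry \<Omega>" by (auto simp: Gamma0_def)
  then show "closure \<Gamma>0 \<subseteq> closure \<Omega>" by (intro closure_minimal) (auto simp: rbdry_def)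
qed

lemma u_closure_Gamma0: "z \<in> closure \<Gamma>0 \<Longrightarrow> u z = 0"
proof -
  assume z: "z \<in> closure \<Gamma>0"
  have "u z \<in> {0}"
  proof (rule continuous_on_closure_closed[OF U(1) C2_continuous_on[OF U(3)] closed_singleton _ _ z])
    show "z \<in> U" using z Gamma0_sub(2) U(2) by blast
  qed (use dir in blast)
  then show ?thesis by simp
qed

lemma E_height: "x \<in> E \<Longrightarrow> x \<bullet> p > 0"
proof -
  assume x: "x \<in> E"
  then have "x \<noteq> 0" "sgn x \<bullet> p > 0" using Omega_facts(5) by (auto simp: hcone_def hemi_def)
  then show ?thesis by (simp add: sgn_div_norm zero_less_mult_iff)
qed

lemma trace_Hu_neg: "x \<in> E \<Longrightarrow> (\<Sum>i\<in>Basis. Hu x i \<bullet> i) < 0"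
proof -
  assume x: "x \<in> E"
  then have xW: "x \<in> W" and x0: "x \<noteq> 0" using E_sub_W W0 by blast+
  have "real (DIM('a) - 1) * ((x \<bullet> p) / norm x ^ 3) > 0" using E_height[OF x] x0 dim by simp
  then show ?thesis using trace_diff[OF xW] trace_H_E[OF x] by simp
qed

text \<open>A weak minimum principle. The field \<open>- gu\<close> is tested with a truncation of
  the negative part of \<open>u\<close>; its divergence is positive and the gradient term is a
  square, so both vanish.\<close>

lemma u_nonneg:
  assumes x: "x \<in> E"
  shows "u (sgn x) \<ge> 0"
proof -
  have Q: "u (sgn x) \<ge> 0" if x: "x \<in> Q" for x
  proof -
    obtain s where s: "s > 0" "s *\<^sub>R x \<in> Q" "2 < (s *\<^sub>R x) \<bullet> (s *\<^sub>R x)" "(s *\<^sub>R x) \<bullet> (s *\<^sub>R x) < 4"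
      by (rule annulus_scale[OF x])
    define y where "y = s *\<^sub>R x"
    have yE: "y \<in> E" using s(2) Q_sub_E by (auto simp: y_def)
    have eps: "- u (sgn y) \<le> \<epsilon>" if \<epsilon>: "\<epsilon> > 0" for \<epsilon>
    proof -
      \<comment> \<open>The level \<open>- \<epsilon>\<close> in place of 0 keeps the support of the
        truncation away from the closure of \<open>\<Gamma>0\<close>, where \<open>u\<close> is zero
        and nothing is known about the shape of the boundary.\<close>
      define \<theta> where "\<theta> = (\<lambda>t. pos2 (- \<epsilon> - t))"
      define \<theta>' where "\<theta>' = (\<lambda>t. - (2 * max 0 (- \<epsilon> - t)))"
      have th: "(\<theta> has_real_derivative \<theta>' t) (at t)" for t
      proof -
        have "(\<theta> has_real_derivative 2 * max 0 (- \<epsilon> - t) * (- 1)) (at t)" unfolding \<theta>_def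
          by (rule DERIV_chain'[where f="\<lambda>t. - \<epsilon> - t" and g=pos2, OF _ pos2_deriv]) (auto intro!: derivative_eq_intros)
        then show ?thesis by (simp add: \<theta>'_def)
      qed
      have thc: "continuous_on S \<theta>'" for S unfolding \<theta>'_def by (intro continuous_intros)
      have \<Phi>: "C1g (\<lambda>x. \<theta> (u (sgn x))) (\<lambda>x. \<theta>' (u (sgn x)) *\<^sub>R gu x) W"
        by (rule C1g_compose[OF gu(1) th thc])
      define f where "f = (\<lambda>x. \<theta> (u (sgn x)) * - (\<Sum>i\<in>Basis. Hu x i \<bullet> i) + (\<theta>' (u (sgn x)) *\<^sub>R gu x) \<bullet> - gu x)"
      have le: "(\<integral>x. indicator E x * (cut (x \<bullet> x) * f x) \<partial>lborel) \<le> 0" unfolding f_def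
      proof (rule radial_flux_inequality[OF weak_divergence_gu _ _ \<Phi> _ C1g_cont[OF gu(1)]])
        show "closed {..- \<epsilon>}" by (rule closed_atMost)
        show "- gu x \<bullet> x = 0" if "x \<in> W" for x using gu_euler[OF that] by simp
        show "v \<bullet> - gu x \<ge> 0" if "v \<bullet> gu x = 0" for x v using that by simp
        show "\<theta> (u (sgn x)) \<ge> 0" for x by (simp add: \<theta>_def pos2_def)
        show "\<theta> (u (sgn x)) = 0" if "u (sgn x) \<notin> {..- \<epsilon>}" for x using that by (simp add: \<theta>_def pos2_def)
        show "sgn x \<notin> closure \<Gamma>0" if "u (sgn x) \<in> {..- \<epsilon>}" for x using u_closure_Gamma0[of "sgn x"] \<epsilon> that by auto
      qed
      have fc: "continuous_on W f" unfolding f_def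
        by (intro continuous_intros C1g_cont[OF \<Phi>] C1g_cont_grad[OF \<Phi>] hp.cont_gu gu(3))
      have parts: "\<theta> (u (sgn x)) * - (\<Sum>i\<in>Basis. Hu x i \<bullet> i) \<ge> 0" "(\<theta>' (u (sgn x)) *\<^sub>R gu x) \<bullet> - gu x \<ge> 0" if "x \<in> E" for x
        using trace_Hu_neg[OF that] by (auto simp: \<theta>_def \<theta>'_def pos2_def mult_nonneg_nonpos)
      have fnn: "f x \<ge> 0" if "x \<in> E" for x unfolding f_def by (rule add_nonneg_nonneg[OF parts[OF that]])
      have "f y = 0" unfolding y_def by (rule annulus_integral_vanish[OF fc fnn le s(2,3,4)])
      then have "\<theta> (u (sgn y)) * - (\<Sum>i\<in>Basis. Hu y i \<bullet> i) = 0" using parts[OF yE] by (simp only: f_def add_nonneg_eq_0_iff)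
      then have "\<theta> (u (sgn y)) = 0" using trace_Hu_neg[OF yE] by simp
      then show ?thesis by (simp add: \<theta>_def pos2_def max_def split: if_splits)
    qed
    have "- u (sgn y) \<le> 0"
    proof (rule field_le_epsilon)
      fix e :: real assume "e > 0"
      from eps[OF this] show "- u (sgn y) \<le> 0 + e" by (simp only: add_0_left)
    qed
    then show ?thesis using s(1) by (simp add: y_def hom_u)
  qed
  have "u (sgn x) \<in> {0..}"
  proof (rule continuous_on_closure_closed[OF W_open C1g_cont[OF gu(1)] closed_atLeast, where Q=Q])
    show "x \<in> W" "x \<in> closure Q" using x unfolding E_eq by blast+
    show "u (sgn y) \<in> {0..}" if "y \<in> Q" for y using Q[OF that] by simp
  qed
  then show ?thesis by simp
qed

text \<open>A zero of \<open>u\<close> would be a local minimum, against the negative trace of the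
  Hessian. Using \<open>interior E\<close> and not \<open>Q\<close> covers slit points as
  well.\<close>

lemma u_pos_interior:
  assumes x: "x \<in> interior E"
  shows "u (sgn x) > 0"
proof (rule ccontr)
  assume "\<not> u (sgn x) > 0"
  then have le: "u (sgn x) \<le> 0" by simp
  obtain r where r: "r > 0" "ball x r \<subseteq> E" using x unfolding mem_interior by blast
  have min: "u (sgn x) \<le> u (sgn y)" if "y \<in> ball x r" for y
    using le u_nonneg[of y] r(2) that by force
  have "(\<Sum>i\<in>Basis. Hu x i \<bullet> i) \<ge> 0"
    by (rule local_minimum_trace_nonneg[OF gu(1,2,3) r(1) order_trans[OF r(2) E_sub_W]]) (assumption | erule min)+
  moreover have "x \<in> E" using x interior_subset by blast
  ultimately show False using trace_Hu_neg[of x] by simp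
qed

lemma hcone_C_open: "open (hcone C)"
proof -
  obtain T where T: "open T" "\<omega> = equator p \<inter> T" using omega_open unfolding openin_open by blast
  have "hcone C = {x. x \<bullet> p > 0} \<inter> ({x. proj p x \<noteq> 0} \<inter> lat p -` T)"
  proof (intro set_eqI iffI)
    fix x assume "x \<in> hcone C"
    then have x: "x \<noteq> 0" "sgn x \<bullet> p > 0" "proj p (sgn x) \<noteq> 0" "lat p (sgn x) \<in> \<omega>"
      using cone_over_iff[OF pole omega_sub] by (auto simp: hcone_def)
    have "x \<bullet> p > 0" using x(1,2) by (simp add: sgn_div_norm zero_less_mult_iff)
    moreover have "proj p x \<noteq> 0" using x(3) by (auto simp: proj_sgn)
    moreover have "lat p x \<in> T" using x(4) T(2) lat_sgn[OF pole x(1)] by simp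
    ultimately show "x \<in> {x. x \<bullet> p > 0} \<inter> ({x. proj p x \<noteq> 0} \<inter> lat p -` T)" by simp
  next
    fix x assume x: "x \<in> {x. x \<bullet> p > 0} \<inter> ({x. proj p x \<noteq> 0} \<inter> lat p -` T)"
    then have x0: "x \<noteq> 0" by auto
    have "lat p x \<in> equator p" using x norm_lat[of p x] lat_orth[OF pole, of x] by (simp add: equator_def)
    then have "lat p (sgn x) \<in> \<omega>" using x T(2) lat_sgn[OF pole x0] by simp
    moreover have "sgn x \<bullet> p > 0" using x x0 by (simp add: sgn_div_norm zero_less_mult_iff)
    moreover have "proj p (sgn x) \<noteq> 0" using x x0 by (simp add: proj_sgn)
    ultimately show "x \<in> hcone C" using x0 cone_over_iff[OF pole omega_sub, of "sgn x"]
      by (simp add: hcone_def norm_sgn)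
  qed
  moreover have "open ({x. proj p x \<noteq> 0} \<inter> lat p -` T)"
    by (rule continuous_open_preimage[OF C2_continuous_on[OF C2_lat] open_proj_nonzero T(1)])
  moreover have "open {x. x \<bullet> p > 0}" by (intro open_Collect_less continuous_intros)
  ultimately show ?thesis by (simp only: open_Int)
qed

text \<open>A boundary point of \<open>\<Omega>\<close> lies in the hemisphere and in the closure of
  the cone, so it is off \<open>cone_bdry\<close> exactly when it is in the open cone.\<close>

lemma rbdry_Int_C: "z \<in> rbdry \<Omega> \<Longrightarrow> z \<in> C \<longleftrightarrow> z \<in> \<Gamma>0"
proof -
  assume z: "z \<in> rbdry \<Omega>"
  then have "z \<in> closure \<Omega>" by (simp add: rbdry_def)
  then have "z \<in> closure C" "z \<in> hemi p" using closure_mono[OF Omega_facts(4)] Omega_facts(5) by blast+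
  then show ?thesis using z by (auto simp: Gamma0_def cone_bdry_def)
qed

text \<open>\<open>u\<close> is constant along \<open>\<Gamma>0\<close>, so \<open>gu\<close> is
  normal there, and its normal component is prescribed, provided that an outward normal exists. For
  this the slit case has to be excluded first.\<close>

lemma Gamma0_gradient:
  assumes z: "z \<in> \<Gamma>0"
  shows "gu z \<bullet> gu z = c\<^sup>2" "c \<le> 0"
proof -
  have zr: "z \<in> rbdry \<Omega>" using z Gamma0_sub(1) by blast
  have zcl: "z \<in> closure \<Omega>" using zr by (simp add: rbdry_def)
  have zC: "z \<in> C" using rbdry_Int_C[OF zr] z by simp
  have nz: "norm z = 1" by (rule closure_Omega_norm[OF zcl])
  then have z0: "z \<noteq> 0" and sz: "sgn z = z" by (auto simp: sgn_div_norm)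
  have zE: "z \<in> E" using hcone_sphere[OF nz] zcl by blast
  have zW: "z \<in> W" using zE E_sub_W by blast
  have uz: "u z = 0" using dir z by blast
  obtain Uc Vc \<phi> \<psi> L where ch: "open Uc" "z \<in> Uc" "open Vc" "\<phi> ` Uc = Vc" "\<psi> ` Vc = Uc"
    "\<And>y. y \<in> Uc \<Longrightarrow> \<psi> (\<phi> y) = y" "\<And>y. y \<in> Vc \<Longrightarrow> \<phi> (\<psi> y) = y" "C2 (\<phi> :: 'a \<Rightarrow> 'a) Uc" "C2 (\<psi> :: 'a \<Rightarrow> 'a) Vc"
    "subspace L" "dim L = DIM('a) - 2" "\<And>x. x \<in> \<Gamma>0 \<Longrightarrow> x \<in> Uc \<Longrightarrow> \<phi> x \<in> L"
    "\<And>y. y \<in> Vc \<Longrightarrow> y \<in> L \<Longrightarrow> \<psi> y \<in> \<Gamma>0"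
    by (rule submanifold_chart[OF Omega_facts(8) z]) (rule that)
  obtain \<phi>1 where \<phi>1: "\<And>x. x \<in> Uc \<Longrightarrow> (\<phi> has_derivative blinfun_apply (\<phi>1 x)) (at x)"
    by (rule C2E[OF ch(8)]) blast
  obtain \<psi>1 where \<psi>1: "\<And>x. x \<in> Vc \<Longrightarrow> (\<psi> has_derivative blinfun_apply (\<psi>1 x)) (at x)"
    by (rule C2E[OF ch(9)]) blast
  have \<phi>V: "\<phi> z \<in> Vc" using ch(2,4) by blast
  have \<psi>z: "\<psi> (\<phi> z) = z" by (rule ch(6)[OF ch(2)])
  have inv1: "\<psi>1 (\<phi> z) (\<phi>1 z h) = h" for h
    by (rule inverse_derivatives[where \<phi>=\<phi> and \<psi>=\<psi>, OF ch(1) ch(2) ch(6) \<phi>1[OF ch(2)] \<psi>1[OF \<phi>V]])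
  have inv2: "\<phi>1 z (\<psi>1 (\<phi> z) h) = h" for h
  proof (rule inverse_derivatives[where \<phi>=\<psi> and \<psi>=\<phi>, OF ch(3) \<phi>V ch(7) \<psi>1[OF \<phi>V]])
    show "(\<phi> has_derivative blinfun_apply (\<phi>1 z)) (at (\<psi> (\<phi> z)))" using \<phi>1[OF ch(2)] \<psi>z by simp
  qed
  obtain a h1 where ah: "\<And>l. l \<in> L \<Longrightarrow> a \<bullet> l = 0" "h1 \<bullet> z = 0" "\<phi>1 z h1 \<bullet> a \<noteq> 0"
  proof (rule chart_transversal[where \<phi>'="blinfun_apply (\<phi>1 z)" and \<psi>'="blinfun_apply (\<psi>1 (\<phi> z))", OF _ _ ch(10,11) z0])
    show "linear (blinfun_apply (\<phi>1 z))" by (rule has_derivative_linear[OF \<phi>1[OF ch(2)]])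
    show "\<psi>1 (\<phi> z) (\<phi>1 z h) = h" for h by (rule inv1)
    show "DIM('a) \<ge> 2" using dim by simp
  qed (rule that)
  define D where "D = hcone Uc \<inter> hcone C \<inter> W"
  have oD: "open D" unfolding D_def by (intro open_Int open_hcone ch(1) hcone_C_open W_open)
  have zD: "z \<in> D" using zW ch(2) zC hcone_sphere[OF nz] by (simp add: D_def)
  have Dscale: "s *\<^sub>R x \<in> D" if "x \<in> D" "s > 0" for x s using that by (simp add: D_def hcone_scale)
  define f where "f = (\<lambda>x. \<phi> (sgn x) \<bullet> a)"
  have C2f: "C2 f D" unfolding f_def
  proof (rule C2_inner[OF C2_compose[OF ch(8) C2_subset[OF C2_sgn]] C2_const])
    show "D \<subseteq> - {0}" "sgn ` D \<subseteq> Uc" by (auto simp: D_def hcone_def)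
  qed
  obtain gf Hf where gf: "C1g f gf D" "\<And>x. x \<in> D \<Longrightarrow> (gf has_derivative blinfun_apply (Hf x)) (at x)"
    by (rule C2_gradient[OF oD C2f]) blast
  have gfx: "gf x \<bullet> x = 0" if "x \<in> D" for x
    by (rule homogeneous_gradient(1)[OF oD Dscale _ gf(1) that]) (simp_all add: f_def sgn_scale_pos)
  have ffr: "f x = 0" if x: "x \<in> D" "x \<in> frontier Q" for x
  proof -
    have "x \<noteq> 0" "sgn x \<in> Uc" "sgn x \<in> C" using x(1) by (auto simp: D_def hcone_def)
    then have "sgn x \<in> \<Gamma>0" using frontier_Q[of x] x(2) rbdry_Int_C by blast
    from ah(1)[OF ch(12)[OF this \<open>sgn x \<in> Uc\<close>]] show ?thesis unfolding f_def by (subst inner_commute)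
  qed
  have fz: "f z = 0" by (rule ffr[OF zD]) (use frontier_Q[OF z0] sz zr in simp)
  have gfz: "gf z \<noteq> 0"
  proof -
    have "((\<lambda>x. \<phi> (sgn x) \<bullet> a) has_derivative (\<lambda>h. \<phi>1 z (h /\<^sub>R norm z - ((z \<bullet> h) / norm z ^ 3) *\<^sub>R z) \<bullet> a)) (at z)"
      by (rule has_derivative_inner_left, rule has_derivative_compose[where f=sgn and g=\<phi>, OF has_derivative_sgn[OF z0]])
        (use \<phi>1[OF ch(2)] sz in simp)
    from fun_cong[OF has_derivative_unique[OF C1g_deriv[OF gf(1) zD, unfolded f_def] this], of h1]
    have "gf z \<bullet> h1 = \<phi>1 z h1 \<bullet> a" using ah(2) nz by (simp add: inner_commute[of z h1])
    then show ?thesis using ah(3) by auto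
  qed
  have zQ: "z \<in> closure Q" using zE E_eq by blast
  obtain r where r: "r > 0" "ball z r \<subseteq> D" using oD zD unfolding open_contains_ball by blast
  have "gu z \<bullet> gu z = c\<^sup>2 \<and> c \<le> 0"
  proof (rule sides_dichotomy[OF Q_open zQ r(1) C1g_subset[OF gf(1) r(2)] fz gfz ffr[OF subsetD[OF r(2)]]])
    \<comment> \<open>With the domain on both sides of \<open>\<Gamma>0\<close> the point
      \<open>z\<close> would be interior to \<open>E\<close>, where \<open>u\<close> is
      positive.\<close>
    fix \<rho> assume rho: "\<rho> > 0" "ball z \<rho> \<subseteq> closure Q"
    have "ball z (min \<rho> r) \<subseteq> E" using rho(2) r(2) unfolding E_eq D_def by auto
    then have "z \<in> interior E" using rho(1) r(1) interior_maximal[OF _ open_ball, of z "min \<rho> r" E] by auto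
    then show ?thesis using u_pos_interior[of z] sz uz by simp
  next
    fix \<rho> \<sigma> e \<kappa>
    assume rho: "\<rho> > 0" "\<rho> \<le> r" and sg: "\<sigma> = 1 \<or> \<sigma> = (-1::real)"
      and inn: "\<And>x. x \<in> ball z \<rho> \<Longrightarrow> x \<in> Q \<longleftrightarrow> \<sigma> * f x > 0"
      and cl: "\<And>x. x \<in> ball z \<rho> \<Longrightarrow> x \<in> closure Q \<longleftrightarrow> \<sigma> * f x \<ge> 0"
    have bD: "ball z \<rho> \<subseteq> D" using rho r by auto
    have zb: "z \<in> ball z \<rho>" using rho(1) by simp
    have f1: "C1g (\<lambda>x. \<sigma> * f x) (\<lambda>x. \<sigma> *\<^sub>R gf x) (ball z \<rho>)" by (rule C1g_cmult[OF C1g_subset[OF gf(1) bD]])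
    \<comment> \<open>The inward unit normal, along which \<open>u\<close> has derivative
      \<open>- c\<close>.\<close>
    define n where "n = sgn (\<sigma> *\<^sub>R gf z)"
    have gne: "\<sigma> *\<^sub>R gf z \<noteq> 0" using gfz sg by auto
    have gz: "(\<sigma> *\<^sub>R gf z) \<bullet> z = 0" using gfx[OF zD] by simp
    have n: "norm n = 1" using gne by (simp add: n_def norm_sgn)
    have nzz: "n \<bullet> z = 0" using gz by (simp add: n_def sgn_div_norm)
    have ngf: "(\<sigma> *\<^sub>R gf z) \<bullet> n = norm (\<sigma> *\<^sub>R gf z)" unfolding n_def by (rule inner_sgn_self)
    have "outward_normal \<Omega> (sgn z) (- sgn (\<sigma> *\<^sub>R gf z))"
      by (rule normal_derivative[OF z0 C1g_deriv[OF f1 zb] gne gz open_ball zb inn cl]) (simp_all add: fz)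
    then have "frechet_derivative u (at (sgn z)) (- sgn (\<sigma> *\<^sub>R gf z)) = c" using neu0 z sz by simp
    from gu_normal[OF zW this gz] have gk: "gu z \<bullet> (norm (\<sigma> *\<^sub>R gf z) *\<^sub>R n) = - c * norm (\<sigma> *\<^sub>R gf z)"
      unfolding n_def norm_scaleR_sgn nz by simp
    define k where "k = norm (\<sigma> *\<^sub>R gf z)"
    have "k * (gu z \<bullet> n + c) = 0" using gk unfolding k_def[symmetric] by (simp add: algebra_simps)
    moreover have "k \<noteq> 0" using gne unfolding k_def by (simp only: norm_eq_zero not_False_eq_True)
    ultimately have gun: "gu z \<bullet> n = - c" by simp
    have tang: "gu z \<bullet> h = 0" if h: "h \<bullet> z = 0" "h \<bullet> gf z = 0" for h
    proof -
      obtain \<zeta> where \<zeta>: "\<zeta> \<in> L" "\<psi>1 (\<phi> z) \<zeta> = h"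
      proof (rule chart_tangent_space[where \<psi>=\<psi> and \<psi>'="blinfun_apply (\<psi>1 (\<phi> z))" and \<phi>'="blinfun_apply (\<phi>1 z)" and f=f
            and gf="gf z" and N=D and M=\<Gamma>0 and h=h and y="\<phi> z" and V=Vc and L=L])
        show "open Vc" "\<phi> z \<in> Vc" "subspace L" "dim L = DIM('a) - 2" "open D" by fact+
        show "\<phi> z \<in> L" by (rule ch(12)[OF z ch(2)])
        show "(\<psi> has_derivative blinfun_apply (\<psi>1 (\<phi> z))) (at (\<phi> z))" by (rule \<psi>1[OF \<phi>V])
        show "\<phi>1 z (\<psi>1 (\<phi> z) h) = h" for h by (rule inv2)
        show "\<psi> y \<in> \<Gamma>0" if "y \<in> Vc" "y \<in> L" for y using that by (rule ch(13))
        show "\<Gamma>0 \<subseteq> sphere 0 1" using Gamma0_sub(1) closure_Omega_norm by (auto simp: rbdry_def)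
        show "(f has_derivative (\<lambda>h. gf z \<bullet> h)) (at (\<psi> (\<phi> z)))" unfolding \<psi>z by (rule C1g_deriv[OF gf(1) zD])
        show "gf z \<noteq> 0" by (rule gfz)
        show "\<psi> (\<phi> z) \<bullet> gf z = 0" unfolding \<psi>z using gfx[OF zD] by (simp add: inner_commute)
        show "\<psi> (\<phi> z) \<in> D" unfolding \<psi>z by (rule zD)
        show "f x = 0" if x: "x \<in> \<Gamma>0" "x \<in> D" for x
        proof (rule ffr[OF x(2)])
          have xr: "x \<in> rbdry \<Omega>" using x(1) Gamma0_sub(1) by blast
          then have "norm x = 1" by (intro closure_Omega_norm) (simp add: rbdry_def)
          then have "x \<noteq> 0" "sgn x = x" by (auto simp: sgn_div_norm)
          then show "x \<in> frontier Q" using frontier_Q[of x] xr by simp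
        qed
        show "h \<bullet> \<psi> (\<phi> z) = 0" "h \<bullet> gf z = 0" unfolding \<psi>z by (fact h)+
      qed (rule that)
      have L\<phi>: "\<phi> z \<in> L" by (rule ch(12)[OF z ch(2)])
      note cu = chart_curve[OF ch(3) \<phi>V \<psi>1[OF \<phi>V], of \<zeta>]
      have "(\<lambda>h. gu z \<bullet> h) (\<psi>1 (\<phi> z) \<zeta>) = 0"
      proof (rule derivative_along_curve_zero[OF cu(1)])
        show "((\<lambda>x. u (sgn x)) has_derivative (\<lambda>h. gu z \<bullet> h)) (at (\<psi> (\<phi> z + 0 *\<^sub>R \<zeta>)))"
          using C1g_deriv[OF gu(1) zW] \<psi>z by simp
        show "\<forall>\<^sub>F s in nhds 0. u (sgn (\<psi> (\<phi> z + s *\<^sub>R \<zeta>))) = 0"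
          using cu(2)
        proof (rule eventually_mono)
          fix s assume "\<phi> z + s *\<^sub>R \<zeta> \<in> Vc"
          moreover have "\<phi> z + s *\<^sub>R \<zeta> \<in> L" using L\<phi> \<zeta>(1) ch(10) by (simp add: subspace_add subspace_scale)
          ultimately have w: "\<psi> (\<phi> z + s *\<^sub>R \<zeta>) \<in> \<Gamma>0" by (rule ch(13))
          then have "\<psi> (\<phi> z + s *\<^sub>R \<zeta>) \<in> closure \<Omega>" using Gamma0_sub(1) by (auto simp: rbdry_def)
          then have "sgn (\<psi> (\<phi> z + s *\<^sub>R \<zeta>)) = \<psi> (\<phi> z + s *\<^sub>R \<zeta>)" using closure_Omega_norm by (simp add: sgn_div_norm)
          then show "u (sgn (\<psi> (\<phi> z + s *\<^sub>R \<zeta>))) = 0" using dir w by simp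
        qed
      qed
      then show ?thesis using \<zeta>(2) by simp
    qed
    \<comment> \<open>The difference is tangential to \<open>\<Gamma>0\<close>, hence orthogonal to
      \<open>gu z\<close>; this identifies the squared length of \<open>gu z\<close> with the square
      of its normal component.\<close>
    have "gu z \<bullet> (gu z - (gu z \<bullet> n) *\<^sub>R n) = 0"
    proof (rule tang)
      show "(gu z - (gu z \<bullet> n) *\<^sub>R n) \<bullet> z = 0" using gu_euler[OF zW] nzz by (simp add: inner_diff_left)
      have "(gu z - (gu z \<bullet> n) *\<^sub>R n) \<bullet> n = 0" using n by (simp add: inner_diff_left norm_eq_1)
      then have "(gu z - (gu z \<bullet> n) *\<^sub>R n) \<bullet> (norm (\<sigma> *\<^sub>R gf z) *\<^sub>R n) = 0" by simp
      then have "(gu z - (gu z \<bullet> n) *\<^sub>R n) \<bullet> (\<sigma> *\<^sub>R gf z) = 0" unfolding n_def norm_scaleR_sgn .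
      then show "(gu z - (gu z \<bullet> n) *\<^sub>R n) \<bullet> gf z = 0" using sg by auto
    qed
    then have 1: "gu z \<bullet> gu z = c\<^sup>2" unfolding inner_diff_right inner_scaleR_right gun by (simp add: power2_eq_square)
    \<comment> \<open>For positive \<open>c\<close> the function would become negative on entering
      the domain.\<close>
    have "c \<le> 0"
    proof (rule ccontr)
      assume "\<not> c \<le> 0"
      then have cp: "- c < 0" by simp
      have z00: "z + 0 *\<^sub>R n = z" by simp
      have d1: "((\<lambda>t. u (sgn (z + t *\<^sub>R n))) has_real_derivative - c) (at 0)"
        using line_derivative[OF gu(1), of z 0 n] zW gun by simp
      have d2: "((\<lambda>t. \<sigma> * f (z + t *\<^sub>R n)) has_real_derivative norm (\<sigma> *\<^sub>R gf z)) (at 0)"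
        using line_derivative[OF f1, of z 0 n] zb ngf by simp
      obtain t1 where t1: "t1 > 0" "\<forall>h>0. h < t1 \<longrightarrow> u (sgn (z + 0 *\<^sub>R n)) > u (sgn (z + (0 + h) *\<^sub>R n))"
        using DERIV_neg_dec_right[OF d1 cp] by blast
      obtain t2 where t2: "t2 > 0" "\<forall>h>0. h < t2 \<longrightarrow> \<sigma> * f (z + 0 *\<^sub>R n) < \<sigma> * f (z + (0 + h) *\<^sub>R n)"
        using DERIV_pos_inc_right[OF d2] gne by (auto simp only: zero_less_norm_iff)
      define t where "t = min (min t1 t2) \<rho> / 2"
      have t: "0 < t" "t < t1" "t < t2" "t < \<rho>" using t1(1) t2(1) rho(1) by (auto simp: t_def)
      have "u (sgn (z + t *\<^sub>R n)) < 0" using t1(2) t uz sz by simp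
      moreover have "z + t *\<^sub>R n \<in> ball z \<rho>" using t n by (simp add: dist_norm)
      moreover have "\<sigma> * f (z + t *\<^sub>R n) > 0" using t2(2) t fz by simp
      ultimately have "z + t *\<^sub>R n \<in> Q" using inn by blast
      then have "u (sgn (z + t *\<^sub>R n)) \<ge> 0" using Q_sub_E by (intro u_nonneg) blast
      then show False using \<open>u (sgn (z + t *\<^sub>R n)) < 0\<close> by simp
    qed
    with 1 show ?thesis by simp
  qed
  then show "gu z \<bullet> gu z = c\<^sup>2" "c \<le> 0" by simp_all
qed

end

section \<open>Rigidity\<close>

text \<open>Both vectors are linear in the pair \<open>(s, t)\<close>, so their pairing is
  quadratic. With \<open>s = u\<close> and \<open>t = F\<close> this bounds the gradient of
  \<open>u^2 + F^2\<close> against \<open>Y\<close> by a multiple of \<open>u^2 + F^2\<close>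
  itself.\<close>

lemma bilinear_pair_bound:
  fixes a b a' b' :: "'a::real_inner"
  assumes n: "norm a \<le> M" "norm b \<le> M" "norm a' \<le> M" "norm b' \<le> M"
  shows "\<bar>((s *\<^sub>R a + s *\<^sub>R a) + (t *\<^sub>R b + t *\<^sub>R b)) \<bullet> (s *\<^sub>R a' - t *\<^sub>R b')\<bar> \<le> 4 * M\<^sup>2 * (s * s + t * t)"
proof -
  define l where "l = \<bar>s\<bar> + \<bar>t\<bar>"
  have M: "M \<ge> 0" using n(1) norm_ge_zero[of a] by linarith
  have l: "l \<ge> 0" by (simp add: l_def)
  have m: "\<bar>s\<bar> * norm v \<le> \<bar>s\<bar> * M" "\<bar>t\<bar> * norm v \<le> \<bar>t\<bar> * M" if "norm v \<le> M" for v :: 'a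
    using that by (simp_all add: mult_left_mono)
  have 1: "norm ((s *\<^sub>R a + s *\<^sub>R a) + (t *\<^sub>R b + t *\<^sub>R b)) \<le> 2 * (l * M)"
  proof -
    have "norm ((s *\<^sub>R a + s *\<^sub>R a) + (t *\<^sub>R b + t *\<^sub>R b)) \<le> (\<bar>s\<bar> * norm a + \<bar>s\<bar> * norm a) + (\<bar>t\<bar> * norm b + \<bar>t\<bar> * norm b)"
      by (intro norm_triangle_le add_mono) simp_all
    then show ?thesis using m(1)[OF n(1)] m(2)[OF n(2)] by (simp add: l_def distrib_right)
  qed
  have 2: "norm (s *\<^sub>R a' - t *\<^sub>R b') \<le> l * M"
  proof -
    have "norm (s *\<^sub>R a' - t *\<^sub>R b') \<le> \<bar>s\<bar> * norm a' + \<bar>t\<bar> * norm b'" using norm_triangle_ineq4[of "s *\<^sub>R a'" "t *\<^sub>R b'"] by simp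
    then show ?thesis using m(1)[OF n(3)] m(2)[OF n(4)] by (simp add: l_def distrib_right)
  qed
  have "\<bar>((s *\<^sub>R a + s *\<^sub>R a) + (t *\<^sub>R b + t *\<^sub>R b)) \<bullet> (s *\<^sub>R a' - t *\<^sub>R b')\<bar> \<le> (2 * (l * M)) * (l * M)"
    by (rule order_trans[OF Cauchy_Schwarz_ineq2 mult_mono[OF 1 2]]) (use M l in simp_all)
  also have "\<dots> = 2 * M\<^sup>2 * l\<^sup>2" by (simp add: power2_eq_square)
  also have "\<dots> \<le> 2 * M\<^sup>2 * (2 * (s * s + t * t))"
  proof (rule mult_left_mono)
    have "0 \<le> (\<bar>s\<bar> - \<bar>t\<bar>)\<^sup>2" by simp
    then show "l\<^sup>2 \<le> 2 * (s * s + t * t)" by (simp add: l_def power2_eq_square algebra_simps abs_mult_self_eq)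
  qed simp
  also have "\<dots> = 4 * M\<^sup>2 * (s * s + t * t)" by (simp only: mult.assoc mult.left_commute)
  finally show ?thesis .
qed

context serrin
begin

text \<open>The gradient condition extends to the closure by continuity and off the sphere because
  \<open>|x|^2 |gu|^2\<close> has degree zero.\<close>

lemma F_closure_Gamma0:
  assumes x: "x \<noteq> 0" "sgn x \<in> closure \<Gamma>0"
  shows "hp.F x = 0"
proof -
  define z where "z = sgn x"
  have z: "z \<in> closure \<Gamma>0" "norm z = 1" using x by (simp_all add: z_def norm_sgn)
  have zE: "z \<in> E" using z Gamma0_sub(2) hcone_sphere[OF z(2)] by blast
  have zW: "z \<in> W" and xW: "x \<in> W" using zE E_sub_W x(1) by (auto simp: z_def hcone_def sgn_idem)
  have "gu z \<bullet> gu z \<in> {c\<^sup>2}"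
    by (rule continuous_on_closure_closed[OF W_open continuous_on_inner[OF hp.cont_gu hp.cont_gu] closed_singleton _ zW z(1)])
      (simp add: Gamma0_gradient(1))
  moreover have "gu z = norm x *\<^sub>R gu x"
    using gu_scale[OF xW, of "inverse (norm x)"] x(1) by (simp add: z_def sgn_div_norm)
  ultimately have "(norm x * norm x) * (gu x \<bullet> gu x) = c\<^sup>2" by (simp add: mult.assoc)
  then have "(x \<bullet> x) * (gu x \<bullet> gu x) = c\<^sup>2" by (simp add: power2_norm_eq_inner flip: power2_eq_square)
  then show ?thesis using u_closure_Gamma0[OF x(2)] by (simp add: hp.F_def)
qed

lemma G_nonneg: "x \<in> E \<Longrightarrow> hp.G x \<ge> 0"
  using u_nonneg dim unfolding hp.G_def by (intro mult_nonneg_nonneg add_nonneg_nonneg sum_nonneg) auto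

text \<open>The factors \<open>step (k i * \<zeta> x)\<close> keep away from the closure of
  \<open>\<Gamma>0\<close>, including its edge on the cone, since both \<open>u\<close> and
  \<open>F\<close> vanish there. Dominated convergence then removes the factor, with no information
  on the geometry near that set.\<close>

lemma integral_G_le_0: "(\<integral>x. indicator E x * (cut (x \<bullet> x) * hp.G x) \<partial>lborel) \<le> 0"
proof -
  define v where "v = (\<lambda>x::'a. u (sgn x))"
  define \<zeta> where "\<zeta> = (\<lambda>x. v x * v x + hp.F x * hp.F x)"
  define g\<zeta> where "g\<zeta> = (\<lambda>x. (v x *\<^sub>R gu x + v x *\<^sub>R gu x) + (hp.F x *\<^sub>R hp.gF x + hp.F x *\<^sub>R hp.gF x))"
  have v: "C1g v gu W" unfolding v_def by (rule gu(1))
  have \<zeta>: "C1g \<zeta> g\<zeta> W" unfolding \<zeta>_def g\<zeta>_def by (intro C1g_add C1g_mult v hp.C1g_F)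
  have \<zeta>0: "\<zeta> x \<ge> 0" for x by (simp add: \<zeta>_def)
  define A where "A = (\<lambda>x. (x \<bullet> x) *\<^sub>R H x (g x) + (g x \<bullet> g x) *\<^sub>R x)"
  have Y: "hp.Y x = v x *\<^sub>R A x - hp.F x *\<^sub>R g x" for x by (simp add: hp.Y_def A_def v_def)
  define K where "K = {x \<in> closure Q. x \<bullet> x \<in> {1..8}}"
  have K: "compact K" "K \<subseteq> E" using compact_annulus by (simp_all only: K_def)
  have KW: "K \<subseteq> W" by (rule order_trans[OF K(2) E_sub_W])
  obtain M where M: "\<And>x. x \<in> K \<Longrightarrow> norm (norm (gu x) + norm (hp.gF x) + norm (A x) + norm (g x)) \<le> M"
  proof (rule continuous_on_compact_bound[OF K(1)])
    have "continuous_on W (\<lambda>x. norm (gu x) + norm (hp.gF x) + norm (A x) + norm (g x))"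
      unfolding A_def by (intro continuous_intros hp.cont_gu hp.cont_g C1g_cont_grad[OF hp.C1g_F] g(3))
    then show "continuous_on K (\<lambda>x. norm (gu x) + norm (hp.gF x) + norm (A x) + norm (g x))" by (rule continuous_on_subset[OF _ KW])
  qed (rule that)
  have bound: "\<bar>g\<zeta> x \<bullet> hp.Y x\<bar> \<le> 4 * M\<^sup>2 * \<zeta> x" if x: "x \<in> K" for x
    unfolding g\<zeta>_def Y \<zeta>_def
  proof (rule bilinear_pair_bound)
    have "norm (gu x) + norm (hp.gF x) + norm (A x) + norm (g x) \<le> M" using M[OF x] by simp
    then show "norm (gu x) \<le> M" "norm (hp.gF x) \<le> M" "norm (A x) \<le> M" "norm (g x) \<le> M"
      using norm_ge_zero[of "gu x"] norm_ge_zero[of "hp.gF x"] norm_ge_zero[of "A x"] norm_ge_zero[of "g x"] by linarith+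
  qed
  define k where "k = (\<lambda>i. real (Suc i))"
  have k: "k i > 0" for i by (simp add: k_def)
  define \<theta>' where "\<theta>' = (\<lambda>i t. step' (k i * t) * k i)"
  define q where "q = (\<lambda>i x. step (k i * \<zeta> x) * hp.G x + (\<theta>' i (\<zeta> x) *\<^sub>R g\<zeta> x) \<bullet> hp.Y x)"
  have th: "((\<lambda>t. step (k i * t)) has_real_derivative \<theta>' i t) (at t)" for i t
    unfolding \<theta>'_def by (rule DERIV_chain'[where f="\<lambda>t. k i * t" and g=step, OF _ step_deriv]) (auto intro!: derivative_eq_intros)
  have thc: "continuous_on S (\<theta>' i)" for S i
    unfolding \<theta>'_def
    by (intro continuous_intros continuous_on_compose2[of UNIV step', OF continuous_step']) simp_all
  have \<Phi>: "C1g (\<lambda>x. step (k i * \<zeta> x)) (\<lambda>x. \<theta>' i (\<zeta> x) *\<^sub>R g\<zeta> x) W" for i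
    by (rule C1g_compose[OF \<zeta> th thc])
  have zero: "v x = 0 \<and> hp.F x = 0" if "\<zeta> x = 0" for x
    using that by (simp add: \<zeta>_def sum_squares_eq_zero_iff)
  have le: "(\<integral>x. indicator E x * (cut (x \<bullet> x) * q i x) \<partial>lborel) \<le> 0" for i
    unfolding q_def
  proof (rule radial_flux_inequality[OF hp.wd.weak_divergence_axioms hp.Y_tangential _ \<Phi> _ C1g_cont[OF \<zeta>]])
    show "closed {1 / k i..}" by (rule closed_atLeast)
    show "step (k i * \<zeta> x) \<ge> 0" for x by (rule step_bounds)
    show "step (k i * \<zeta> x) = 0" if "\<zeta> x \<notin> {1 / k i..}" for x
      using that k[of i] by (intro step_eq_0) (simp add: field_simps)
    show "sgn x \<notin> closure \<Gamma>0" if x: "x \<in> E" "\<zeta> x \<in> {1 / k i..}" for x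
    proof
      assume "sgn x \<in> closure \<Gamma>0"
      then have "\<zeta> x = 0" using u_closure_Gamma0[of "sgn x"] F_closure_Gamma0[of x] x(1) by (simp add: \<zeta>_def v_def hcone_def)
      moreover have "1 / k i > 0" using k[of i] by simp
      ultimately show False using x(2) by simp
    qed
    fix x w assume x: "x \<in> E" and w: "w \<bullet> x = 0" "w \<bullet> gu x = 0" "w \<bullet> g x = 0" "H x (g x) \<bullet> w \<ge> 0"
    \<comment> \<open>\<open>w\<close> is orthogonal to \<open>x\<close> and to \<open>g x\<close>,
      so only the Hessian term of \<open>Y\<close> meets the lateral boundary, and convexity gives
      its sign.\<close>
    have "w \<bullet> hp.Y x = v x * ((x \<bullet> x) * (H x (g x) \<bullet> w))"
      unfolding Y A_def using w by (simp add: inner_diff_right inner_add_right inner_commute[of w "H x (g x)"])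
    then show "w \<bullet> hp.Y x \<ge> 0" using u_nonneg[OF x] w(4) by (simp add: v_def)
  qed
  have qc: "continuous_on W (q i)" for i unfolding q_def
    by (intro continuous_intros C1g_cont[OF \<Phi>] C1g_cont_grad[OF \<Phi>] hp.cont_G hp.cont_Y)
  \<comment> \<open>Where \<open>\<zeta>\<close> is zero, so are \<open>G\<close>, through its
    factor \<open>u\<close>, and \<open>g\<zeta>\<close>. Elsewhere the step is eventually 1 with
    zero derivative. Hence the pointwise limit has no contribution from the gradient term.\<close>
  define s where "s = (\<lambda>i x. indicator E x * (cut (x \<bullet> x) * q i x))"
  have lim: "(\<lambda>i. s i x) \<longlonglongrightarrow> indicator E x * (cut (x \<bullet> x) * hp.G x)" for x
  proof (cases "\<zeta> x = 0")
    case True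
    then have "hp.G x = 0" "g\<zeta> x = 0" using zero[OF True] by (auto simp: hp.G_def g\<zeta>_def v_def)
    then have "s i x = indicator E x * (cut (x \<bullet> x) * hp.G x)" for i by (simp add: s_def q_def)
    then show ?thesis by simp
  next
    case False
    then have zp: "\<zeta> x > 0" using \<zeta>0[of x] by simp
    obtain n where n: "2 / \<zeta> x < real n" using reals_Archimedean2 by blast
    have "s i x = indicator E x * (cut (x \<bullet> x) * hp.G x)" if "i \<ge> n" for i
    proof -
      have "2 / \<zeta> x \<le> k i" using n that by (simp add: k_def)
      then have "k i * \<zeta> x \<ge> 2" using zp by (simp add: field_simps)
      then show ?thesis by (simp add: s_def q_def \<theta>'_def step_eq_1 step'_eq_0)
    qed
    then have "\<forall>\<^sub>F i in sequentially. s i x = indicator E x * (cut (x \<bullet> x) * hp.G x)"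
      unfolding eventually_sequentially by blast
    then show ?thesis by (rule tendsto_eventually)
  qed
  \<comment> \<open>The slope of the step is at most 2, the pairing is at most
    \<open>4 * M\<^sup>2 * \<zeta>\<close>, and the slope is nonzero only for
    \<open>k i * \<zeta> x < 2\<close>; the product is bounded by \<open>16 * M\<^sup>2\<close>
    independently of \<open>i\<close>.\<close>
  define w where "w = (\<lambda>x. indicator K x *\<^sub>R (\<bar>hp.G x\<bar> + 16 * M\<^sup>2))"
  have wi: "integrable lborel w" unfolding w_def
  proof (rule borel_integrable_compact[OF K(1)])
    have "continuous_on K hp.G" by (rule continuous_on_subset[OF hp.cont_G KW])
    then show "continuous_on K (\<lambda>x. \<bar>hp.G x\<bar> + 16 * M\<^sup>2)" by (intro continuous_intros)
  qed
  have sm: "s i \<in> borel_measurable lborel" for i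
    unfolding s_def by (rule borel_measurable_integrable[OF annulus_integrable[OF qc]])
  have dom: "norm (s i x) \<le> w x" for i x
  proof (cases "x \<in> K")
    case True
    then have xE: "x \<in> E" using K(2) by blast
    have 1: "\<bar>step (k i * \<zeta> x) * hp.G x\<bar> \<le> \<bar>hp.G x\<bar>"
      using step_bounds[of "k i * \<zeta> x"] by (simp add: abs_mult mult_left_le_one_le)
    have 2: "\<bar>(\<theta>' i (\<zeta> x) *\<^sub>R g\<zeta> x) \<bullet> hp.Y x\<bar> \<le> 16 * M\<^sup>2"
    proof (cases "k i * \<zeta> x \<ge> 2")
      case True
      then show ?thesis by (simp add: \<theta>'_def step'_eq_0)
    next
      case False
      have "\<bar>(\<theta>' i (\<zeta> x) *\<^sub>R g\<zeta> x) \<bullet> hp.Y x\<bar> = (step' (k i * \<zeta> x) * k i) * \<bar>g\<zeta> x \<bullet> hp.Y x\<bar>"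
        using step'_nonneg[of "k i * \<zeta> x"] k[of i] by (simp add: \<theta>'_def abs_mult)
      also have "\<dots> \<le> (2 * k i) * (4 * M\<^sup>2 * \<zeta> x)"
        by (intro mult_mono bound[OF \<open>x \<in> K\<close>]) (use step'_le[of "k i * \<zeta> x"] step'_nonneg[of "k i * \<zeta> x"] k[of i] in auto)
      also have "\<dots> = 8 * M\<^sup>2 * (k i * \<zeta> x)" by simp
      also have "\<dots> \<le> 8 * M\<^sup>2 * 2" using False by (intro mult_left_mono) auto
      finally show ?thesis by simp
    qed
    have "\<bar>q i x\<bar> \<le> \<bar>hp.G x\<bar> + 16 * M\<^sup>2" unfolding q_def by (rule order_trans[OF abs_triangle_ineq add_mono[OF 1 2]])
    moreover have "\<bar>cut (x \<bullet> x) * q i x\<bar> \<le> \<bar>q i x\<bar>"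
      using cut_nonneg[of "x \<bullet> x"] cut_le_1[of "x \<bullet> x"] by (simp add: abs_mult mult_left_le_one_le)
    ultimately show ?thesis using True xE by (simp add: s_def w_def)
  next
    case False
    then have "x \<notin> E \<or> x \<bullet> x \<le> 1 \<or> x \<bullet> x \<ge> 8" unfolding E_eq K_def by auto
    then show ?thesis using False by (auto simp: s_def w_def cut_eq_0)
  qed
  have "(\<lambda>i. integral\<^sup>L lborel (s i)) \<longlonglongrightarrow> (\<integral>x. indicator E x * (cut (x \<bullet> x) * hp.G x) \<partial>lborel)"
    by (rule integral_dominated_convergence[OF _ sm wi])
      (intro borel_measurable_integrable annulus_integrable hp.cont_G AE_I2 lim dom)+
  then show ?thesis by (rule LIMSEQ_le_const2) (use le in \<open>auto simp: s_def\<close>)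
qed

text \<open>For \<open>n = 2\<close> the coefficient of \<open>|g|^2\<close> in \<open>G\<close> is
  zero, so \<open>g = 0\<close> is not read off from that term. In all dimensions the Hessian
  vanishes, and \<open>H y y = - g y\<close> then gives the gradient.\<close>

lemma g_zero:
  assumes x: "x \<in> Q"
  shows "g x = 0"
proof -
  obtain s where s: "s > 0" "s *\<^sub>R x \<in> Q" "2 < (s *\<^sub>R x) \<bullet> (s *\<^sub>R x)" "(s *\<^sub>R x) \<bullet> (s *\<^sub>R x) < 4"
    by (rule annulus_scale[OF x])
  define y where "y = s *\<^sub>R x"
  have xW: "x \<in> W" and yW: "y \<in> W" using x s(2) Q_sub_E E_sub_W unfolding y_def by blast+
  have y0: "y \<bullet> y > 0" using s(3) by (simp add: y_def)
  have "hp.G y = 0" unfolding y_def by (rule annulus_integral_vanish[OF hp.cont_G G_nonneg integral_G_le_0 s(2,3,4)])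
  moreover have "u (sgn y) > 0" using s(2) Q_sub_int unfolding y_def by (intro u_pos_interior) blast
  ultimately have "(y \<bullet> y) * (\<Sum>j\<in>Basis. H y j \<bullet> H y j) + (real DIM('a) - 3) * (g y \<bullet> g y) = 0"
    by (simp add: hp.G_def)
  moreover have "(y \<bullet> y) * (\<Sum>j\<in>Basis. H y j \<bullet> H y j) \<ge> 0" "(real DIM('a) - 3) * (g y \<bullet> g y) \<ge> 0"
    using dim by (intro mult_nonneg_nonneg sum_nonneg; simp)+
  ultimately have "(y \<bullet> y) * (\<Sum>j\<in>Basis. H y j \<bullet> H y j) = 0" by linarith
  then have "(\<Sum>j\<in>Basis. H y j \<bullet> H y j) = 0" using y0 by simp
  then have "\<forall>j\<in>Basis. H y j \<bullet> H y j = 0" by (subst (asm) sum_nonneg_eq_0_iff) auto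
  then have "H y y = 0" unfolding blinfun_inner_expand[of y "H y", symmetric] by (intro sum.neutral) auto
  then have "g y = 0" using H_euler[OF yW] by simp
  then show ?thesis using g_scale[OF xW s(1)] s(1) by (simp add: y_def)
qed

lemma Q_connected: "connected Q"
proof -
  have "Q = (\<lambda>(t, x). t *\<^sub>R x) ` ({0<..} \<times> \<Omega>)"
  proof (intro set_eqI iffI)
    fix x assume x: "x \<in> Q"
    have "x = (\<lambda>(t, x). t *\<^sub>R x) (norm x, sgn x)" by (simp only: case_prod_conv norm_scaleR_sgn)
    moreover have "(norm x, sgn x) \<in> {0<..} \<times> \<Omega>" using x by (auto simp: hcone_def)
    ultimately show "x \<in> (\<lambda>(t, x). t *\<^sub>R x) ` ({0<..} \<times> \<Omega>)" by (rule image_eqI)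
  next
    fix x assume "x \<in> (\<lambda>(t, x). t *\<^sub>R x) ` ({0<..} \<times> \<Omega>)"
    then obtain t z where tz: "x = t *\<^sub>R z" "t > 0" "z \<in> \<Omega>" by auto
    then have "norm z = 1" using Omega_sphere by auto
    then show "x \<in> Q" using tz hcone_scale[OF tz(2), of z \<Omega>] hcone_sphere[of z \<Omega>] by simp
  qed
  moreover have "connected ((\<lambda>(t, x). t *\<^sub>R x) ` ({0::real<..} \<times> \<Omega>))"
    by (intro connected_continuous_image connected_Times Omega_facts(2) connected_Ioi)
      (auto simp: case_prod_unfold intro!: continuous_intros)
  ultimately show ?thesis by simp
qed

lemma u_affine:
  obtains a where "\<And>x. x \<in> closure \<Omega> \<Longrightarrow> u x = x \<bullet> p - a"
proof -
  obtain x0 where x0: "x0 \<in> \<Omega>" using Omega_facts(3) by blast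
  have QO: "x \<in> Q" "sgn x = x" if "x \<in> \<Omega>" for x
  proof -
    have "norm x = 1" using that Omega_sphere by auto
    then show "x \<in> Q" "sgn x = x" using that hcone_sphere[of x \<Omega>] by (simp_all add: sgn_div_norm)
  qed
  have const: "u x - x \<bullet> p = u x0 - x0 \<bullet> p" if x: "x \<in> \<Omega>" for x
  proof -
    have "u (sgn x) - sgn x \<bullet> p = u (sgn x0) - sgn x0 \<bullet> p"
    proof (rule has_derivative_zero_unique_connected[where f="\<lambda>x. u (sgn x) - sgn x \<bullet> p", OF Q_open Q_connected _ QO(1)[OF x] QO(1)[OF x0]])
      fix y assume y: "y \<in> Q"
      then have "y \<in> W" using Q_sub_E E_sub_W by blast
      from C1g_deriv[OF g(1) this] show "((\<lambda>x. u (sgn x) - sgn x \<bullet> p) has_derivative (\<lambda>h. 0)) (at y)"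
        by (simp add: g_zero[OF y])
    qed
    then show ?thesis by (simp only: QO(2)[OF x] QO(2)[OF x0])
  qed
  show ?thesis
  proof (rule that)
    fix x assume x: "x \<in> closure \<Omega>"
    have "u x - x \<bullet> p \<in> {u x0 - x0 \<bullet> p}"
    proof (rule continuous_on_closure_closed[OF U(1) _ closed_singleton _ _ x])
      show "continuous_on U (\<lambda>x. u x - x \<bullet> p)" by (intro continuous_intros C2_continuous_on[OF U(3)])
      show "x \<in> U" using x U(2) by blast
      show "u y - y \<bullet> p \<in> {u x0 - x0 \<bullet> p}" if "y \<in> \<Omega>" for y using const[OF that] by simp
    qed
    then show "u x = x \<bullet> p - (x0 \<bullet> p - u x0)" by simp
  qed
qed

lemma conclusion:
  "\<Omega> = C \<inter> geoball p (arcsin (- c)) \<and> (\<forall>x\<in>closure \<Omega>. u x = cos (gdist p x) - cos (arcsin (- c)))"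
proof -
  obtain a where a: "\<And>x. x \<in> closure \<Omega> \<Longrightarrow> u x = x \<bullet> p - a" by (rule u_affine) blast
  have \<Gamma>a: "z \<bullet> p = a" if "z \<in> \<Gamma>0" for z
    using a[of z] u_closure_Gamma0[of z] that Gamma0_sub(2) closure_subset[of \<Gamma>0] by force
  obtain z where z: "z \<in> \<Gamma>0" using Omega_facts(7) by blast
  have zr: "z \<in> rbdry \<Omega>" using z Gamma0_sub(1) by blast
  then have zcl: "z \<in> closure \<Omega>" by (simp add: rbdry_def)
  have nz: "norm z = 1" by (rule closure_Omega_norm[OF zcl])
  have zE: "z \<in> E" using hcone_sphere[OF nz] zcl by blast
  have zW: "z \<in> W" and zQ: "z \<in> closure Q" using zE E_eq by blast+
  have a0: "a > 0" using E_height[OF zE] \<Gamma>a[OF z] by simp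
  have "proj p z \<noteq> 0" using rbdry_Int_C[OF zr] z cone_over_iff[OF pole omega_sub, of z] by blast
  then have a1: "a\<^sup>2 < 1" using norm_proj_sq[OF pole, of z] nz \<Gamma>a[OF z] by (smt (verit) norm_eq_zero one_power2 zero_less_power2)
  have pp: "p \<bullet> p = 1" and zz: "z \<bullet> z = 1" using pole nz by (simp_all add: norm_eq_1)
  \<comment> \<open>At a point of \<open>\<Gamma>0\<close> the vanishing of \<open>g\<close> gives
    \<open>gu z = p - a *\<^sub>R z\<close>, of squared length \<open>1 - a\<^sup>2\<close>.
    Comparison with \<open>c\<^sup>2\<close> identifies \<open>a\<close> as
    \<open>cos R\<close>.\<close>
  have "g z \<in> {0}"
    by (rule continuous_on_closure_closed[OF W_open hp.cont_g closed_singleton _ zW zQ]) (simp add: g_zero)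
  then have "gu z = p - a *\<^sub>R z" using gdiff[OF zW] nz \<Gamma>a[OF z] by simp
  then have "c\<^sup>2 = (p - a *\<^sub>R z) \<bullet> (p - a *\<^sub>R z)" using Gamma0_gradient(1)[OF z] by simp
  also have "\<dots> = 1 - a\<^sup>2"
    using \<Gamma>a[OF z] pp zz by (simp add: inner_diff_left inner_diff_right inner_commute[of p z] power2_eq_square)
  finally have ca: "c\<^sup>2 = 1 - a\<^sup>2" .
  have c0: "c \<le> 0" by (rule Gamma0_gradient(2)[OF z])
  have "c\<^sup>2 \<le> 1" using ca by simp
  then have c1: "\<bar>c\<bar> \<le> 1" by (simp add: abs_square_le_1)
  define R where "R = arcsin (- c)"
  have "cos R = sqrt (1 - c\<^sup>2)" using c1 by (simp add: R_def cos_arcsin)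
  then have cosR: "cos R = a" using ca a0 by simp
  have R: "0 \<le> R" "R \<le> pi / 2"
    using arcsin_le_mono[of 0 "- c"] c0 c1 arcsin_bounded[of "- c"] by (auto simp: R_def)
  have Ra: "arccos a = R" using arccos_cos[of R] R cosR by simp
  have abs1: "\<bar>x \<bullet> p\<bar> \<le> 1" if "norm x = 1" for x using Cauchy_Schwarz_ineq2[of x p] that pole by simp
  have a_abs: "\<bar>a\<bar> \<le> 1" using abs1[OF nz] \<Gamma>a[OF z] by simp
  have dist_less: "gdist p x < R \<longleftrightarrow> x \<bullet> p > a" if "norm x = 1" for x
    using arccos_less_mono[OF abs1[OF that] a_abs] by (simp add: gdist_def Ra inner_commute)
  have cosd: "cos (gdist p x) = x \<bullet> p" if "norm x = 1" for x
    using abs1[OF that] by (simp add: gdist_def cos_arccos_abs inner_commute)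
  define T where "T = {x \<in> C. x \<bullet> p > a}"
  have CT: "C \<inter> geoball p R = T"
    using cone_over_iff[OF pole omega_sub] dist_less by (auto simp: T_def geoball_def hemi_def)
  have yp: "y \<bullet> p = 0" if "y \<in> \<omega>" for y using that omega_sub by (auto simp: equator_def)
  have gp: "geod p y t \<bullet> p = cos t" if "y \<in> \<omega>" for y t
    using yp[OF that] pp by (simp add: geod_def inner_add_left)
  \<comment> \<open>In polar coordinates the candidate is a product of \<open>\<omega>\<close> with
    an interval, hence connected.\<close>
  have "T = (\<lambda>(y, t). geod p y t) ` (\<omega> \<times> {0<..<R})"
  proof (intro set_eqI iffI)
    fix x assume "x \<in> T"
    then obtain y t where yt: "x = geod p y t" "y \<in> \<omega>" "0 < t" "t < pi / 2" "x \<bullet> p > a"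
      by (auto simp: T_def cone_over_def)
    have "t < R"
    proof (rule ccontr)
      assume "\<not> t < R"
      then have "cos t \<le> cos R" using R(1) yt(4) by (intro cos_monotone_0_pi_le) auto
      then show False using yt gp[OF yt(2), of t] cosR by simp
    qed
    then show "x \<in> (\<lambda>(y, t). geod p y t) ` (\<omega> \<times> {0<..<R})" using yt by force
  next
    fix x assume "x \<in> (\<lambda>(y, t). geod p y t) ` (\<omega> \<times> {0<..<R})"
    then obtain y t where yt: "x = geod p y t" "y \<in> \<omega>" "0 < t" "t < R" by auto
    have "cos R < cos t" using yt R by (intro cos_monotone_0_pi) auto
    then have "x \<bullet> p > a" using yt gp[OF yt(2), of t] cosR by simp
    moreover have "x \<in> C" using yt R(2) by (force simp: cone_over_def)
    ultimately show "x \<in> T" by (simp add: T_def)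
  qed
  moreover have "connected ((\<lambda>(y, t). geod p y t) ` (\<omega> \<times> {0<..<R}))"
    by (intro connected_continuous_image connected_Times omega_conn connected_Ioo)
      (auto simp: case_prod_unfold geod_def intro!: continuous_intros)
  ultimately have Tc: "connected T" by simp
  \<comment> \<open>On the domain \<open>u\<close> is positive and equals the height minus
    \<open>a\<close>.\<close>
  have OT: "\<Omega> \<subseteq> T"
  proof
    fix x assume x: "x \<in> \<Omega>"
    have nx: "norm x = 1" using x Omega_sphere by auto
    then have "x \<in> Q" "sgn x = x" using x hcone_sphere[OF nx, of \<Omega>] by (simp_all add: sgn_div_norm)
    then have "u x > 0" using u_pos_interior[of x] Q_sub_int by auto
    then show "x \<in> T" using a[of x] x closure_subset[of \<Omega>] Omega_facts(4) by (auto simp: T_def)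
  qed
  \<comment> \<open>A point of the candidate on the boundary of \<open>\<Omega>\<close> would lie in
    the open cone, hence on \<open>\<Gamma>0\<close>, where the height is exactly
    \<open>a\<close>.\<close>
  have TO: "x \<in> \<Omega>" if x: "x \<in> T" "x \<in> closure \<Omega>" for x
  proof (rule ccontr)
    assume "x \<notin> \<Omega>"
    then have "x \<in> rbdry \<Omega>" using x(2) by (simp add: rbdry_def)
    then have "x \<in> \<Gamma>0" using rbdry_Int_C[of x] x(1) by (simp add: T_def)
    then show False using \<Gamma>a[of x] x(1) by (simp add: T_def)
  qed
  obtain S where S: "open S" "\<Omega> = sphere 0 1 \<inter> S" using Omega_facts(1) unfolding openin_open by blast
  have Tn: "norm x = 1" if "x \<in> T" for x using that cone_over_iff[OF pole omega_sub, of x] by (simp add: T_def)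
  \<comment> \<open>\<open>\<Omega>\<close> is relatively open in the connected set
    \<open>T\<close>, and by \<open>TO\<close> also relatively closed.\<close>
  have "S \<inter> T = {} \<or> - closure \<Omega> \<inter> T = {}"
  proof (rule connectedD[OF Tc S(1)])
    show "open (- closure \<Omega>)" by (rule open_Compl[OF closed_closure])
    show "S \<inter> - closure \<Omega> \<inter> T = {}"
    proof -
      have "x \<in> \<Omega>" if "x \<in> S" "x \<in> T" for x using that Tn S(2) by simp
      then show ?thesis using closure_subset[of \<Omega>] by blast
    qed
    show "T \<subseteq> S \<union> - closure \<Omega>" using TO S(2) by blast
  qed
  moreover have "S \<inter> T \<noteq> {}" using OT S(2) Omega_facts(3) by blast
  ultimately have "\<Omega> = T" using OT TO by blast
  moreover have "u x = cos (gdist p x) - cos R" if x: "x \<in> closure \<Omega>" for x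
    using a[OF x] cosd[OF closure_Omega_norm[OF x]] cosR by simp
  ultimately show ?thesis using CT unfolding R_def by blast
qed

end

theorem theorem2p1:
  fixes p :: "'a::euclidean_space" and \<omega> \<Omega> :: "'a set" and u :: "'a \<Rightarrow> real" and c :: real
  assumes dim: "DIM('a) \<ge> 3"
    and pole: "norm p = 1"
    and omega_sub: "\<omega> \<subseteq> equator p"
    and omega_open: "openin (top_of_set (equator p)) \<omega>"
    and omega_conn: "connected \<omega>" and omega_ne: "\<omega> \<noteq> {}"
    and omega_convex: "sph_convex p \<omega>"
    and cone_smooth: "smooth_submanifold (DIM('a) - 2) (cone_bdry p (cone_over p \<omega>) - {p})"
    and adm: "admissible p (cone_over p \<omega>) \<Omega>"
    and u_C2: "\<exists>U. open U \<and> closure \<Omega> \<subseteq> U \<and> Ck 2 u U"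
    and pde: "\<forall>x\<in>\<Omega>. laplace_beltrami u x = - real (DIM('a) - 1) * cos (gdist p x)"
    and dir: "\<forall>x\<in>Gamma0 p (cone_over p \<omega>) \<Omega>. u x = 0"
    and neu0: "\<forall>x\<in>Gamma0 p (cone_over p \<omega>) \<Omega>. \<forall>\<nu>. outward_normal \<Omega> x \<nu> \<longrightarrow>
                 frechet_derivative u (at x) \<nu> = c"
    and neu1: "\<forall>x\<in>Gamma1 p (cone_over p \<omega>) \<Omega> - {p}. \<forall>\<nu>. outward_normal \<Omega> x \<nu> \<longrightarrow>
                 frechet_derivative u (at x) \<nu> = 0"
  shows "\<Omega> = cone_over p \<omega> \<inter> geoball p (arcsin (- c)) \<and>
         (\<forall>x\<in>closure \<Omega>. u x = cos (gdist p x) - cos (arcsin (- c)))"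
proof -
  obtain U where U: "open U" "closure \<Omega> \<subseteq> U" "Ck 2 u U" using u_C2 by blast
  have u2: "C2 u U" by (rule Ck_2_imp_C2[OF U(1,3)])
  have oW: "open (hcone U)" by (rule open_hcone[OF U(1)])
  have s2: "C2 (sgn :: 'a \<Rightarrow> 'a) (hcone U)" by (rule C2_subset[OF C2_sgn]) (auto simp: hcone_def)
  have us: "C2 (\<lambda>x. u (sgn x)) (hcone U)" by (rule C2_compose[OF u2 s2]) (auto simp: hcone_def)
  \<comment> \<open>On the sphere \<open>sgn x \<bullet> p\<close> is \<open>cos r\<close>, so this
    is the extension of \<open>u - cos r\<close>.\<close>
  have ws: "C2 (\<lambda>x. u (sgn x) - sgn x \<bullet> p) (hcone U)"
    using C2_add[OF us C2_inner[OF s2 C2_const[of "- p"]]] by simp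
  obtain gu Hu where gu: "C1g (\<lambda>x. u (sgn x)) gu (hcone U)" "\<And>x. x \<in> hcone U \<Longrightarrow> (gu has_derivative blinfun_apply (Hu x)) (at x)"
    "continuous_on (hcone U) Hu" "\<And>x h k. x \<in> hcone U \<Longrightarrow> blinfun_apply (Hu x) h \<bullet> k = blinfun_apply (Hu x) k \<bullet> h"
    by (rule C2_gradient[OF oW us]) (rule that)
  obtain g H where g: "C1g (\<lambda>x. u (sgn x) - sgn x \<bullet> p) g (hcone U)" "\<And>x. x \<in> hcone U \<Longrightarrow> (g has_derivative blinfun_apply (H x)) (at x)"
    "continuous_on (hcone U) H" "\<And>x h k. x \<in> hcone U \<Longrightarrow> blinfun_apply (H x) h \<bullet> k = blinfun_apply (H x) k \<bullet> h"
    by (rule C2_gradient[OF oW ws]) (rule that)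
  interpret serrin p \<omega> \<Omega> U u c gu g Hu H
    by (rule serrin.intro) (fact assms U u2 | rule gu g; assumption)+
  show ?thesis by (rule conclusion)
qed

end
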